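(* Let $1\le p<2$. The relation $=^{+}$ is Borel reducible to isomorphism, to Lipschitz isomorphism, to biembeddability and to complemented biembeddability between subspaces of $L_p$.
   Context: For an equivalence relation $E$ on a Polish space $X$, $E^+$ is the equivalence relation on $X^\omega$ defined by $(x_n)E^+(y_n)\Leftrightarrow \forall n\ \exists m,q:\ (x_nEy_m)\wedge(y_nEx_q)$. The relation $=^+$ is $(2^\omega,=)^+$, i.e. the relation on $(2^\omega)^\omega$ of two sequences having the same set of terms. A relation $R$ on a standard Borel space $E$ is Borel reducible to a relation $R'$ on a standard Borel space $E'$ if there is a Borel map $f:E\to E'$ with $xRy\Leftrightarrow f(x)R'f(y)$ for all $x,y\in E$. The set of closed linear subspaces of the separable Banach space $L_p=L_p[0,1]$ carries the Effros-Borel structure; "Borel reducible to isomorphism (etc.) between subspaces of $L_p$" means Borel reducible to the corresponding relation on the (closed) subspaces of $L_p$. Isomorphism means linear homeomorphism. Two Banach spaces are Lipschitz isomorphic if there is a bijection between them that is Lipschitz with Lipschitz inverse. $X$ and $Y$ are biembeddable if each is isomorphic to a subspace of the other, and complementably biembeddable if each is isomorphic to a complemented subspace of the other. *)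

theory Defs
  imports "HOL-Analysis.Analysis"
begin

section \<open>Equivalence relations and Borel reducibility\<close>

definition plus_rel :: "('a \<Rightarrow> 'a \<Rightarrow> bool) \<Rightarrow> (nat \<Rightarrow> 'a) \<Rightarrow> (nat \<Rightarrow> 'a) \<Rightarrow> bool"
  where "plus_rel E x y \<longleftrightarrow> (\<forall>n. \<exists>m q. E (x n) (y m) \<and> E (y n) (x q))"

text \<open>The space \<open>2\<^sup>\<omega>\<close> is the type \<^typ>\<open>nat \<Rightarrow> bool\<close>; function types
  carry the product topology and \<^typ>\<open>bool\<close> the discrete one.\<close>

abbreviation eq_plus :: "(nat \<Rightarrow> nat \<Rightarrow> bool) \<Rightarrow> (nat \<Rightarrow> nat \<Rightarrow> bool) \<Rightarrow> bool"
  where "eq_plus \<equiv> plus_rel (=)"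

text \<open>Of the measures below only the underlying measurable space is used.\<close>

definition borel_reducible ::
    "'a measure \<Rightarrow> ('a \<Rightarrow> 'a \<Rightarrow> bool) \<Rightarrow> 'b measure \<Rightarrow> ('b \<Rightarrow> 'b \<Rightarrow> bool) \<Rightarrow> bool"
  where "borel_reducible M R N S \<longleftrightarrow>
    (\<exists>f \<in> M \<rightarrow>\<^sub>M N. \<forall>x \<in> space M. \<forall>y \<in> space M. R x y \<longleftrightarrow> S (f x) (f y))"

definition effros_borel :: "'a topology \<Rightarrow> 'a set measure"
  where "effros_borel X =
    sigma {F. closedin X F} {{F. closedin X F \<and> F \<inter> U \<noteq> {}} |U. openin X U}"


section \<open>The spaces \<open>L\<^sub>p[0,1]\<close>\<close>

abbreviation unit_leb :: "real measure"
  where "unit_leb \<equiv> lebesgue_on {0..1}"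

text \<open>\<open>L0\<close> is the vector space of classes, modulo equality almost everywhere, of
  real-valued Lebesgue measurable functions on \<open>[0,1]\<close>. Functions are total on
  the reals, but their values outside \<open>[0,1]\<close> are immaterial. Each \<open>L\<^sub>p\<close> is a subset of \<open>L0\<close>.\<close>

quotient_type L0 = "real \<Rightarrow> real" / partial: "\<lambda>f g. f \<in> borel_measurable unit_leb \<and>
    g \<in> borel_measurable unit_leb \<and> (AE x in unit_leb. f x = g x)"
proof (rule part_equivpI)
  show "\<exists>f :: real \<Rightarrow> real. f \<in> borel_measurable unit_leb \<and> f \<in> borel_measurable unit_leb \<and>
      (AE x in unit_leb. f x = f x)"
    by (rule exI[of _ "\<lambda>_. 0"]) auto
  show "symp (\<lambda>f g :: real \<Rightarrow> real. f \<in> borel_measurable unit_leb \<and>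
      g \<in> borel_measurable unit_leb \<and> (AE x in unit_leb. f x = g x))"
    by (rule sympI) (auto simp: eq_commute)
  show "transp (\<lambda>f g :: real \<Rightarrow> real. f \<in> borel_measurable unit_leb \<and>
      g \<in> borel_measurable unit_leb \<and> (AE x in unit_leb. f x = g x))"
    by (rule transpI) auto
qed

instantiation L0 :: real_vector
begin

lift_definition zero_L0 :: L0 is "\<lambda>_. 0" by simp
lift_definition plus_L0 :: "L0 \<Rightarrow> L0 \<Rightarrow> L0" is "\<lambda>f g x. f x + g x"
  by auto
lift_definition uminus_L0 :: "L0 \<Rightarrow> L0" is "\<lambda>f x. - f x"
  by auto
lift_definition minus_L0 :: "L0 \<Rightarrow> L0 \<Rightarrow> L0" is "\<lambda>f g x. f x - g x"
  by auto
lift_definition scaleR_L0 :: "real \<Rightarrow> L0 \<Rightarrow> L0" is "\<lambda>c f x. c * f x"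
  by auto

instance
  by standard (transfer; auto simp: algebra_simps)+

end

lift_definition p_integrable :: "real \<Rightarrow> L0 \<Rightarrow> bool"
  is "\<lambda>p f. integrable unit_leb (\<lambda>x. \<bar>f x\<bar> powr p)"
  by (rule integrable_cong_AE) auto

text \<open>The norm is meaningful only on \<^const>\<open>p_integrable\<close> elements.\<close>

lift_definition Lp_norm :: "real \<Rightarrow> L0 \<Rightarrow> real"
  is "\<lambda>p f. (LINT x|unit_leb. \<bar>f x\<bar> powr p) powr (1 / p)"
  by (intro arg_cong[where f = "\<lambda>t. t powr _"] integral_cong_AE) auto

definition Lp_space :: "real \<Rightarrow> L0 set"
  where "Lp_space p = {f. p_integrable p f}"

definition Lp_dist :: "real \<Rightarrow> L0 \<Rightarrow> L0 \<Rightarrow> real"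
  where "Lp_dist p f g = Lp_norm p (f - g)"

text \<open>The abstraction function \<^const>\<open>metric\<close> is meaningful only when its argument is a metric
  space; for \<open>p \<ge> 1\<close> this is lemma \<open>Metric_space_Lp\<close> below.\<close>

definition Lp :: "real \<Rightarrow> L0 metric"
  where "Lp p = metric (Lp_space p, Lp_dist p)"

lemma powr_convex_bound:
  fixes a b l p :: real
  assumes "p \<ge> 1" "a \<ge> 0" "b \<ge> 0" "0 < l" "l < 1"
  shows "(l * a + (1 - l) * b) powr p \<le> l * a powr p + (1 - l) * b powr p"
proof -
  have *: "l * c powr p \<ge> (l * c) powr p" if "0 < l" "l < 1" "c \<ge> 0" for l c :: real
  proof -
    have "l powr p \<le> l powr 1"
      using that assms by (intro powr_mono') auto
    then show ?thesis
      using that by (simp add: powr_mult mult_right_mono)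
  qed
  show ?thesis
  proof (cases "a = 0 \<or> b = 0")
    case True
    then show ?thesis
      using *[of l a] *[of "1 - l" b] assms by auto
  next
    case False
    then have "a > 0" "b > 0" using assms by auto
    then show ?thesis
      using convex_onD[OF powr_convex[OF assms(1)], of "1 - l" a b] assms
      by (simp add: algebra_simps)
  qed
qed

lemma Lp_add_bound:
  fixes p :: real
  assumes p: "p \<ge> 1"
    and fm: "f \<in> borel_measurable M" and gm: "g \<in> borel_measurable M"
    and f: "integrable M (\<lambda>x. \<bar>f x\<bar> powr p)" and g: "integrable M (\<lambda>x. \<bar>g x\<bar> powr p)"
    and u: "u > 0" "(LINT x|M. \<bar>f x\<bar> powr p) \<le> u powr p"
    and v: "v > 0" "(LINT x|M. \<bar>g x\<bar> powr p) \<le> v powr p"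
  shows "integrable M (\<lambda>x. \<bar>f x + g x\<bar> powr p)" (is ?I)
    and "(LINT x|M. \<bar>f x + g x\<bar> powr p) \<le> (u + v) powr p" (is ?B)
proof -
  define l where "l = u / (u + v)"
  have l: "0 < l" "l < 1" "1 - l = v / (u + v)"
    using u v by (auto simp: l_def field_simps)
  define h where "h = (\<lambda>x. (u + v) powr p *
      (l * (\<bar>f x\<bar> powr p / u powr p) + (1 - l) * (\<bar>g x\<bar> powr p / v powr p)))"
  have le: "\<bar>f x + g x\<bar> powr p \<le> h x" for x
  proof -
    have "(u + v) * (l * (\<bar>f x\<bar> / u) + (1 - l) * (\<bar>g x\<bar> / v))
        = (u + v) * l * (\<bar>f x\<bar> / u) + (u + v) * (1 - l) * (\<bar>g x\<bar> / v)"
      by (simp only: distrib_left mult.assoc)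
    also have "(u + v) * l = u" using u v by (simp add: l_def)
    also have "(u + v) * (1 - l) = v" using u v by (simp add: l(3))
    also have "u * (\<bar>f x\<bar> / u) + v * (\<bar>g x\<bar> / v) = \<bar>f x\<bar> + \<bar>g x\<bar>"
      using u v by simp
    finally have "\<bar>f x + g x\<bar> \<le> (u + v) * (l * (\<bar>f x\<bar> / u) + (1 - l) * (\<bar>g x\<bar> / v))"
      by simp
    then have "\<bar>f x + g x\<bar> powr p
        \<le> ((u + v) * (l * (\<bar>f x\<bar> / u) + (1 - l) * (\<bar>g x\<bar> / v))) powr p"
      using p by (intro powr_mono2) auto
    also have "\<dots> = (u + v) powr p * (l * (\<bar>f x\<bar> / u) + (1 - l) * (\<bar>g x\<bar> / v)) powr p"
      by (rule powr_mult)
    also have "\<dots> \<le> (u + v) powr p *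
        (l * (\<bar>f x\<bar> / u) powr p + (1 - l) * (\<bar>g x\<bar> / v) powr p)"
      by (intro mult_left_mono powr_convex_bound) (use u v l p in auto)
    also have "\<dots> = h x"
      using u v by (simp add: h_def powr_divide)
    finally show ?thesis .
  qed
  have hi: "integrable M h"
    unfolding h_def using f g by auto
  show ?I
    by (rule Bochner_Integration.integrable_bound[OF hi])
      (use fm gm le in \<open>auto intro: order_trans[OF le abs_ge_self]\<close>)
  then have "(LINT x|M. \<bar>f x + g x\<bar> powr p) \<le> (LINT x|M. h x)"
    using hi le by (intro integral_mono) auto
  also have "\<dots> = (u + v) powr p * (l * ((LINT x|M. \<bar>f x\<bar> powr p) / u powr p)
      + (1 - l) * ((LINT x|M. \<bar>g x\<bar> powr p) / v powr p))"
    unfolding h_def using f g by simp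
  also have "\<dots> \<le> (u + v) powr p * (l * 1 + (1 - l) * 1)"
    using u v l by (intro mult_left_mono add_mono) (auto simp: field_simps)
  finally show ?B by simp
qed

lemma p_integrable_add:
  assumes "p \<ge> 1" "p_integrable p f" "p_integrable p g"
  shows "p_integrable p (f + g)" "Lp_norm p (f + g) \<le> Lp_norm p f + Lp_norm p g"
proof -
  have powr_cancel: "(a powr (1 / p)) powr p = a" if "a \<ge> 0" for a
    using that assms by (simp add: powr_powr)
  have A: "p_integrable p (f + g) \<and> Lp_norm p (f + g) \<le> u + v"
    if "u > Lp_norm p f" "v > Lp_norm p g" for u v
    using assms(2,3) that
  proof (transfer fixing: p u v)
    fix f g :: "real \<Rightarrow> real"
    let ?I = "\<lambda>f. LINT x|unit_leb. \<bar>f x\<bar> powr p"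
    assume f: "f \<in> borel_measurable unit_leb \<and> f \<in> borel_measurable unit_leb
        \<and> (AE x in unit_leb. f x = f x)"
      and g: "g \<in> borel_measurable unit_leb \<and> g \<in> borel_measurable unit_leb
        \<and> (AE x in unit_leb. g x = g x)"
      and fi: "integrable unit_leb (\<lambda>x. \<bar>f x\<bar> powr p)"
      and gi: "integrable unit_leb (\<lambda>x. \<bar>g x\<bar> powr p)"
      and u: "?I f powr (1 / p) < u" and v: "?I g powr (1 / p) < v"
    have uv: "u > 0" "v > 0"
      using u v by (meson le_less_trans powr_ge_zero)+
    have "?I f \<le> u powr p" "?I g \<le> v powr p"
      using powr_mono2[OF _ _ less_imp_le[OF u], of p] powr_mono2[OF _ _ less_imp_le[OF v], of p]
        assms(1) by (simp_all add: powr_cancel)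
    note * = Lp_add_bound[OF assms(1) _ _ fi gi uv(1) this(1) uv(2) this(2)]
    have "?I (\<lambda>x. f x + g x) powr (1 / p) \<le> ((u + v) powr p) powr (1 / p)"
      using *(2) f g assms(1) by (intro powr_mono2) auto
    also have "\<dots> = u + v"
      using uv assms(1) by (simp add: powr_powr)
    finally show "integrable unit_leb (\<lambda>x. \<bar>f x + g x\<bar> powr p)
        \<and> ?I (\<lambda>x. f x + g x) powr (1 / p) \<le> u + v"
      using *(1) f g by auto
  qed
  show "p_integrable p (f + g)"
    using A[of "Lp_norm p f + 1" "Lp_norm p g + 1"] by simp
  show "Lp_norm p (f + g) \<le> Lp_norm p f + Lp_norm p g"
  proof (rule field_le_epsilon)
    fix e :: real assume "e > 0"
    then show "Lp_norm p (f + g) \<le> Lp_norm p f + Lp_norm p g + e"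
      using A[of "Lp_norm p f + e / 2" "Lp_norm p g + e / 2"] by (simp add: field_simps)
  qed
qed

lemma p_integrable_zero: "p_integrable p 0"
  by transfer simp

lemma p_integrable_uminus: "p_integrable p (- f) \<longleftrightarrow> p_integrable p f"
  by transfer simp

lemma p_integrable_scaleR: "p_integrable p f \<Longrightarrow> p_integrable p (c *\<^sub>R f)"
  by transfer (simp add: abs_mult powr_mult)

lemma p_integrable_diff:
  "p \<ge> 1 \<Longrightarrow> p_integrable p f \<Longrightarrow> p_integrable p g \<Longrightarrow> p_integrable p (f - g)"
  using p_integrable_add(1)[of p f "- g"] by (simp add: p_integrable_uminus)

lemma Lp_norm_uminus: "Lp_norm p (- f) = Lp_norm p f"
  by transfer simp

lemma Lp_norm_nonneg: "Lp_norm p f \<ge> 0"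
  by transfer simp

lemma Lp_norm_eq_0_iff:
  assumes "p \<ge> 1" "p_integrable p f"
  shows "Lp_norm p f = 0 \<longleftrightarrow> f = 0"
  using assms by transfer (simp add: integral_nonneg_eq_0_iff_AE)

lemma Lp_norm_scaleR:
  assumes "p \<ge> 1"
  shows "Lp_norm p (c *\<^sub>R f) = \<bar>c\<bar> * Lp_norm p f"
  using assms by transfer (simp add: abs_mult powr_mult powr_powr)

lemma subspace_Lp_space: "p \<ge> 1 \<Longrightarrow> subspace (Lp_space p)"
  by (auto simp: subspace_def Lp_space_def p_integrable_zero p_integrable_add p_integrable_scaleR)

lemma Metric_space_Lp:
  assumes "p \<ge> 1"
  shows "Metric_space (Lp_space p) (Lp_dist p)"
proof
  show "0 \<le> Lp_dist p f g" for f g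
    by (simp add: Lp_dist_def Lp_norm_nonneg)
  show "Lp_dist p f g = Lp_dist p g f" for f g
    using Lp_norm_uminus[of p "f - g"] by (simp add: Lp_dist_def)
  show "Lp_dist p f g = 0 \<longleftrightarrow> f = g" if "f \<in> Lp_space p" "g \<in> Lp_space p" for f g
    using that assms by (simp add: Lp_dist_def Lp_space_def Lp_norm_eq_0_iff p_integrable_diff)
  show "Lp_dist p f h \<le> Lp_dist p f g + Lp_dist p g h"
    if "f \<in> Lp_space p" "g \<in> Lp_space p" "h \<in> Lp_space p" for f g h
    using that assms p_integrable_add(2)[of p "f - g" "g - h"]
    by (simp add: Lp_dist_def Lp_space_def p_integrable_diff)
qed

lemma mspace_Lp: "p \<ge> 1 \<Longrightarrow> mspace (Lp p) = Lp_space p"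
  by (simp add: Lp_def Metric_space.mspace_metric Metric_space_Lp)

lemma mdist_Lp: "p \<ge> 1 \<Longrightarrow> mdist (Lp p) f g = Lp_norm p (f - g)"
  by (simp add: Lp_def Metric_space.mdist_metric Metric_space_Lp Lp_dist_def)


section \<open>Closed subspaces of \<open>L\<^sub>p\<close> and relations between them\<close>

abbreviation Lp_topology :: "real \<Rightarrow> L0 topology"
  where "Lp_topology p \<equiv> mtopology_of (Lp p)"

definition closed_subspace :: "real \<Rightarrow> L0 set \<Rightarrow> bool"
  where "closed_subspace p V \<longleftrightarrow> subspace V \<and> closedin (Lp_topology p) V"

definition subspaces_Lp :: "real \<Rightarrow> L0 set measure"
  where "subspaces_Lp p = restrict_space (effros_borel (Lp_topology p)) {V. closed_subspace p V}"

text \<open>Only the values of \<open>T\<close> on \<open>V\<close> matter.\<close>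

definition linear_on :: "'a::real_vector set \<Rightarrow> ('a \<Rightarrow> 'b::real_vector) \<Rightarrow> bool"
  where "linear_on V T \<longleftrightarrow>
    (\<forall>x\<in>V. \<forall>y\<in>V. T (x + y) = T x + T y) \<and> (\<forall>c. \<forall>x\<in>V. T (c *\<^sub>R x) = c *\<^sub>R T x)"

definition isomorphic_Lp :: "real \<Rightarrow> L0 set \<Rightarrow> L0 set \<Rightarrow> bool"
  where "isomorphic_Lp p V W \<longleftrightarrow> (\<exists>T. linear_on V T \<and>
    homeomorphic_map (subtopology (Lp_topology p) V) (subtopology (Lp_topology p) W) T)"

definition lipschitz_isomorphic_Lp :: "real \<Rightarrow> L0 set \<Rightarrow> L0 set \<Rightarrow> bool"
  where "lipschitz_isomorphic_Lp p V W \<longleftrightarrow> (\<exists>f. bij_betw f V W \<and>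
    Lipschitz_continuous_map (submetric (Lp p) V) (submetric (Lp p) W) f \<and>
    Lipschitz_continuous_map (submetric (Lp p) W) (submetric (Lp p) V) (inv_into V f))"

text \<open>A complemented subspace of \<open>W\<close> is the range of a continuous linear projection
  on \<open>W\<close>.\<close>

definition complemented_in_Lp :: "real \<Rightarrow> L0 set \<Rightarrow> L0 set \<Rightarrow> bool"
  where "complemented_in_Lp p Z W \<longleftrightarrow> closed_subspace p Z \<and> Z \<subseteq> W \<and>
    (\<exists>P. linear_on W P \<and>
      continuous_map (subtopology (Lp_topology p) W) (subtopology (Lp_topology p) W) P \<and>
      P ` W = Z \<and> (\<forall>z\<in>Z. P z = z))"

definition embeds_Lp :: "real \<Rightarrow> L0 set \<Rightarrow> L0 set \<Rightarrow> bool"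
  where "embeds_Lp p V W \<longleftrightarrow> (\<exists>Z. closed_subspace p Z \<and> Z \<subseteq> W \<and> isomorphic_Lp p V Z)"

definition compl_embeds_Lp :: "real \<Rightarrow> L0 set \<Rightarrow> L0 set \<Rightarrow> bool"
  where "compl_embeds_Lp p V W \<longleftrightarrow> (\<exists>Z. complemented_in_Lp p Z W \<and> isomorphic_Lp p V Z)"

definition biembeddable_Lp :: "real \<Rightarrow> L0 set \<Rightarrow> L0 set \<Rightarrow> bool"
  where "biembeddable_Lp p V W \<longleftrightarrow> embeds_Lp p V W \<and> embeds_Lp p W V"

definition compl_biembeddable_Lp :: "real \<Rightarrow> L0 set \<Rightarrow> L0 set \<Rightarrow> bool"
  where "compl_biembeddable_Lp p V W \<longleftrightarrow> compl_embeds_Lp p V W \<and> compl_embeds_Lp p W V"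

end

theory Submission
  imports Defs "HOL-Probability.Probability" "HOL-Real_Asymp.Real_Asymp"
begin

text \<open>
  Fix \<open>p < r0 < r1 < 2\<close>. For \<open>s\<close> in \<open>[r0, r1]\<close> let \<open>\<xi> s\<close> be a symmetric random variable with
  \<open>P(\<bar>\<xi> s\<bar> \<ge> t)\<close> comparable to \<open>t\<close> to the power \<open>- s\<close> for \<open>t \<ge> 1\<close>. The \<open>L\<^sub>p\<close> norm of a combination of independent
  copies of \<open>\<xi> s\<close> is equivalent to the \<open>\<ell>\<^sub>s\<close> norm of the coefficients (lemma \<open>moment_bounds\<close>), so that
  \<open>\<xi> s\<close> does the work of an \<open>s\<close>-stable variable; in addition \<open>\<xi> s\<close> has an explicit formula that is
  continuous in \<open>s\<close>. Placing such families on disjoint pieces of \<open>[0,1]\<close>, one for each exponent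
  \<open>s n\<close> of a sequence \<open>s\<close>, gives a subspace \<open>V s\<close> of \<open>L\<^sub>p\<close> isomorphic to the \<open>\<ell>\<^sub>p\<close> sum of the spaces
  \<open>\<ell>\<close> with exponents \<open>s n\<close> (theorem \<open>comb_bounds\<close>).

  Points of the Cantor space are coded injectively and continuously by exponents in \<open>[r0, r1]\<close>, and a
  sequence \<open>x\<close> of points is sent to \<open>V (rates x)\<close>, where \<open>rates x\<close> lists the exponent of every term of
  \<open>x\<close> infinitely often. The generators depend continuously on \<open>x\<close> in norm, whence the map is Borel
  (lemma \<open>measurable_V\<close>). If \<open>x\<close> and \<open>y\<close> have the same terms then a permutation of the blocks carries
  \<open>V (rates x)\<close> isomorphically onto \<open>V (rates y)\<close>, and all four relations hold
  (lemma \<open>relations_of_eq_plus\<close>).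

  Each of the four relations yields maps between the two spaces, in both directions, that are
  bi-Lipschitz onto their images. It remains to show that a bi-Lipschitz copy of \<open>V s\<close> inside \<open>V s'\<close>
  forces every \<open>s n\<close> to be one of the exponents \<open>s' m\<close> (theorem \<open>exponent_of_embedded_space\<close>).
  Suppose \<open>r = s n\<close> is not. The map is restricted to a weighted infinite cube inside the block
  \<open>\<ell>\<^sub>r\<close> and is read off in the coordinates of \<open>V s'\<close>. With respect to the product of the uniform measures,
  its coordinatewise difference quotients converge almost everywhere along a subsequence, and the
  limit at a generic point is an additive map on the finitely supported integer vectors that satisfies
  the same two-sided bounds (theorem \<open>linearization\<close>). This gives a linear copy of \<open>\<ell>\<^sub>r\<close> in the \<open>\<ell>\<^sub>p\<close>
  sum of the spaces \<open>\<ell>\<close> with exponents \<open>s' m\<close>. There is none (theorem \<open>no_linear_copy\<close>): after passing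
  to disjointly supported vectors, normalized sums of many of them become small on any finite number
  of blocks because \<open>r\<close> differs from their exponents. Hence one finds successive combinations of
  \<open>\<ell>\<^sub>r\<close> norm one that live essentially on disjoint sets of blocks; they add up as in \<open>\<ell>\<^sub>p\<close>, but also as in
  \<open>\<ell>\<^sub>r\<close>, which contradicts \<open>p < r\<close>.
\<close>

section \<open>The uniform measure on an infinite cube\<close>

definition cube :: "(nat \<Rightarrow> real) measure"
  where "cube = (\<Pi>\<^sub>M i\<in>UNIV. uniform_measure lborel {0..1})"

lemma prob_space_unif: "prob_space (uniform_measure lborel {0..1::real})"
  by (rule prob_space_uniform_measure) auto

lemma sets_cube: "sets cube = sets borel"
  unfolding cube_def by (subst sets_PiM_equal_borel[symmetric]) (intro sets_PiM_cong, auto)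

lemma space_cube [simp]: "space cube = UNIV"
  using sets_eq_imp_space_eq[OF sets_cube] by simp

interpretation cube: prob_space cube
  unfolding cube_def by (intro prob_space_PiM prob_space_unif)

lemma prob_cube_UNIV [simp]: "measure cube UNIV = 1"
  using cube.prob_space by simp

lemma measurable_cube_component [measurable]: "(\<lambda>U. U n) \<in> borel_measurable cube"
  unfolding cube_def by measurable

lemma measurable_to_cube:
  assumes "\<And>n. (\<lambda>x. f x n) \<in> borel_measurable M"
  shows "f \<in> M \<rightarrow>\<^sub>M cube"
proof -
  have "(\<lambda>x. \<lambda>n\<in>UNIV. f x n) \<in> M \<rightarrow>\<^sub>M cube"
    unfolding cube_def by (intro measurable_restrict, subst measurable_cong_sets[OF refl sets_uniform_measure]) (simp add: assms)
  then show ?thesis by (simp add: restrict_def)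
qed

lemma cube_integrable:
  fixes g :: "(nat \<Rightarrow> real) \<Rightarrow> real"
  assumes "g \<in> borel_measurable cube" "\<And>U. \<bar>g U\<bar> \<le> B"
  shows "integrable cube g"
  by (rule cube.integrable_const_bound[of _ B]) (use assms in auto)

text \<open>The unit interval and its translate by \<open>\<delta>\<close> differ by two sets of measure at most \<open>\<bar>\<delta>\<bar>\<close>.\<close>

lemma uniform_shift:
  fixes h :: "real \<Rightarrow> real"
  assumes h[measurable]: "h \<in> borel_measurable borel" and B: "\<And>x. \<bar>h x\<bar> \<le> B"
  shows "\<bar>(\<integral>x. h (x + \<delta>) \<partial>uniform_measure lborel {0..1}) - (\<integral>x. h x \<partial>uniform_measure lborel {0..1})\<bar> \<le> 2 * B * \<bar>\<delta>\<bar>"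
proof -
  have B0: "B \<ge> 0" using B[of 0] by linarith
  have um: "(\<integral>x. g x \<partial>uniform_measure lborel {0..1}) = (\<integral>x. indicator {0..1} x * g x \<partial>lborel)"
    if [measurable]: "g \<in> borel_measurable borel" for g :: "real \<Rightarrow> real"
  proof -
    have "uniform_measure lborel {0..1::real} = density lborel (\<lambda>x. ennreal (indicator {0..1} x))"
      by (simp add: uniform_measure_def ennreal_indicator divide_ennreal_def)
    then show ?thesis by (simp add: integral_density)
  qed
  have i0: "integrable lborel (\<lambda>x. indicator {a..b} x * h x)" for a b :: real
  proof (rule Bochner_Integration.integrable_bound)
    show "integrable lborel (\<lambda>x. B * indicator {a..b} x)"
      by (intro integrable_mult_right integrable_real_indicator) (auto simp: emeasure_lborel_Icc_eq)
    show "AE x in lborel. norm (indicator {a..b} x * h x) \<le> norm (B * indicator {a..b} x)"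
      using B0 B by (intro AE_I2) (simp add: indicator_def)
    show "(\<lambda>x. indicator {a..b} x * h x) \<in> borel_measurable lborel"
      using h by (intro borel_measurable_times borel_measurable_indicator) auto
  qed
  have hd: "(\<lambda>x. h (x + \<delta>)) \<in> borel_measurable borel" by measurable
  have ind: "(\<lambda>x. indicator {\<delta>..1+\<delta>} (\<delta> + 1 * x) * h (\<delta> + 1 * x)) = (\<lambda>x. indicator {0..1} x * h (x + \<delta>))"
    by (auto simp: indicator_def add.commute)
  have "(\<integral>x. indicator {0..1} x * h (x + \<delta>) \<partial>lborel) = (\<integral>x. indicator {\<delta>..1+\<delta>} x * h x \<partial>lborel)"
    using lborel_integral_real_affine[of 1 "\<lambda>x. indicator {\<delta>..1+\<delta>} x * h x" \<delta>] unfolding ind by simp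
  then have eq: "(\<integral>x. h (x + \<delta>) \<partial>uniform_measure lborel {0..1}) - (\<integral>x. h x \<partial>uniform_measure lborel {0..1})
     = (\<integral>x. indicator {\<delta>..1+\<delta>} x * h x - indicator {0..1} x * h x \<partial>lborel)"
    unfolding um[OF h] um[OF hd] Bochner_Integration.integral_diff[OF i0 i0] by simp
  have "\<bar>\<integral>x. indicator {\<delta>..1+\<delta>} x * h x - indicator {0..1} x * h x \<partial>lborel\<bar> \<le> (\<integral>x. B * (indicator {min 0 \<delta>..max 0 \<delta>} x + indicator {min 1 (1+\<delta>)..max 1 (1+\<delta>)} x) \<partial>lborel)"
  proof (rule order_trans[OF integral_abs_bound], rule integral_mono)
    show "integrable lborel (\<lambda>x. \<bar>indicator {\<delta>..1+\<delta>} x * h x - indicator {0..1} x * h x\<bar>)"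
      by (intro integrable_abs Bochner_Integration.integrable_diff i0)
    show "integrable lborel (\<lambda>x. B * (indicator {min 0 \<delta>..max 0 \<delta>} x + indicator {min 1 (1+\<delta>)..max 1 (1+\<delta>)} x))"
      by (intro integrable_mult_right Bochner_Integration.integrable_add integrable_real_indicator)
        (simp_all add: emeasure_lborel_Icc_eq)
    show "\<bar>indicator {\<delta>..1+\<delta>} x * h x - indicator {0..1} x * h x\<bar>
      \<le> B * (indicator {min 0 \<delta>..max 0 \<delta>} x + indicator {min 1 (1+\<delta>)..max 1 (1+\<delta>)} x)" for x
    proof -
      have *: "\<bar>indicator {\<delta>..1+\<delta>} x - indicator {0..1} x\<bar>
        \<le> (indicator {min 0 \<delta>..max 0 \<delta>} x + indicator {min 1 (1+\<delta>)..max 1 (1+\<delta>)} x :: real)"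
        by (cases "\<delta> \<ge> 0") (auto simp: indicator_def min_def max_def)
      have "\<bar>h x\<bar> * \<bar>indicator {\<delta>..1+\<delta>} x - indicator {0..1} x\<bar>
        \<le> B * (indicator {min 0 \<delta>..max 0 \<delta>} x + indicator {min 1 (1+\<delta>)..max 1 (1+\<delta>)} x)"
        by (rule mult_mono[OF B * B0 abs_ge_zero])
      moreover have "\<bar>indicator {\<delta>..1+\<delta>} x * h x - indicator {0..1} x * h x\<bar>
         = \<bar>h x\<bar> * \<bar>indicator {\<delta>..1+\<delta>} x - indicator {0..1} x\<bar>"
        unfolding left_diff_distrib[symmetric] abs_mult by (rule mult.commute)
      ultimately show ?thesis by (simp only:)
    qed
  qed
  also have "\<dots> = 2 * B * \<bar>\<delta>\<bar>"
  proof -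
    let ?i = "\<lambda>a b x. indicator {a..b} x :: real"
    have ii: "integrable lborel (?i a b)" for a b :: real
      by (rule integrable_real_indicator) (simp_all add: emeasure_lborel_Icc_eq)
    have li: "(\<integral>x. ?i a b x \<partial>lborel) = b - a" if "a \<le> b" for a b :: real
      using that by simp
    have "(\<integral>x. B * (?i (min 0 \<delta>) (max 0 \<delta>) x + ?i (min 1 (1+\<delta>)) (max 1 (1+\<delta>)) x) \<partial>lborel)
       = B * ((\<integral>x. ?i (min 0 \<delta>) (max 0 \<delta>) x \<partial>lborel) + (\<integral>x. ?i (min 1 (1+\<delta>)) (max 1 (1+\<delta>)) x \<partial>lborel))"
      by (subst Bochner_Integration.integral_add[OF ii ii, symmetric]) (rule integral_mult_right_zero)
    also have "(\<integral>x. ?i (min 0 \<delta>) (max 0 \<delta>) x \<partial>lborel) = \<bar>\<delta>\<bar>"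
      by (cases "\<delta> \<ge> 0") (simp_all add: min_def max_def)
    also have "(\<integral>x. ?i (min 1 (1+\<delta>)) (max 1 (1+\<delta>)) x \<partial>lborel) = \<bar>\<delta>\<bar>"
      by (cases "\<delta> \<ge> 0") (simp_all add: min_def max_def)
    finally show ?thesis by simp
  qed
  finally show ?thesis unfolding eq .
qed

lemma cube_shift_coord:
  fixes g :: "(nat \<Rightarrow> real) \<Rightarrow> real"
  assumes g[measurable]: "g \<in> borel_measurable cube" and B: "\<And>U. \<bar>g U\<bar> \<le> B"
  shows "\<bar>(\<integral>U. g (U(n := U n + \<delta>)) \<partial>cube) - (\<integral>U. g U \<partial>cube)\<bar> \<le> 2 * B * \<bar>\<delta>\<bar>"
proof -
  let ?Q = "uniform_measure lborel {0..1::real}"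
  let ?R = "\<Pi>\<^sub>M i\<in>UNIV-{n}. ?Q"
  interpret Q: prob_space ?Q by (rule prob_space_unif)
  interpret R: prob_space ?R by (intro prob_space_PiM prob_space_unif)
  interpret QR: pair_prob_space ?Q ?R ..
  have eq: "distr (?Q \<Otimes>\<^sub>M ?R) cube (\<lambda>(x, X). X(n := x)) = cube"
    using distr_pair_PiM_eq_PiM[of "UNIV - {n}" "\<lambda>_. ?Q" n] prob_space_unif
    by (simp add: cube_def insert_absorb)
  have [measurable]: "(\<lambda>(x, X). X(n := x)) \<in> ?Q \<Otimes>\<^sub>M ?R \<rightarrow>\<^sub>M cube"
  proof (rule measurable_to_cube)
    fix i show "(\<lambda>z. (case z of (x, X) \<Rightarrow> X(n := x)) i) \<in> borel_measurable (?Q \<Otimes>\<^sub>M ?R)"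
    proof (cases "i = n")
      case False
      have "(\<lambda>z. snd z i) \<in> ?Q \<Otimes>\<^sub>M ?R \<rightarrow>\<^sub>M ?Q"
        using False by (intro measurable_compose[OF measurable_snd] measurable_component_singleton) auto
      then have "(\<lambda>z. snd z i) \<in> borel_measurable (?Q \<Otimes>\<^sub>M ?R)"
        using measurable_cong_sets[of "?Q \<Otimes>\<^sub>M ?R" "?Q \<Otimes>\<^sub>M ?R" ?Q borel] by simp
      with False show ?thesis by (simp add: case_prod_beta)
    qed (auto simp: case_prod_beta intro!: measurable_compose[OF measurable_fst])
  qed
  have sect: "(\<lambda>x. X(n := x)) \<in> borel \<rightarrow>\<^sub>M cube" for X :: "nat \<Rightarrow> real"
    by (rule measurable_to_cube) auto
  have iter: "(\<integral>U. k U \<partial>cube) = (\<integral>X. (\<integral>x. k (X(n := x)) \<partial>?Q) \<partial>?R)"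
    "integrable ?R (\<lambda>X. (\<integral>x. k (X(n := x)) \<partial>?Q))"
    if k[measurable]: "k \<in> borel_measurable cube" and kB: "\<And>U. \<bar>k U\<bar> \<le> B" for k :: "(nat \<Rightarrow> real) \<Rightarrow> real"
  proof -
    have "integrable (?Q \<Otimes>\<^sub>M ?R) (\<lambda>(x, X). k (X(n := x)))"
      using kB by (intro QR.P.integrable_const_bound[of _ B]) (auto simp: case_prod_beta)
    note * = QR.integral_snd[OF this] QR.integrable_snd[OF this]
    show "integrable ?R (\<lambda>X. (\<integral>x. k (X(n := x)) \<partial>?Q))" using *(2) .
    have "(\<integral>U. k U \<partial>cube) = (\<integral>U. k U \<partial>distr (?Q \<Otimes>\<^sub>M ?R) cube (\<lambda>(x, X). X(n := x)))" by (simp add: eq)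
    also have "\<dots> = (\<integral>(x, X). k (X(n := x)) \<partial>(?Q \<Otimes>\<^sub>M ?R))"
      by (subst integral_distr) (simp_all add: split_def)
    also have "\<dots> = (\<integral>X. (\<integral>x. k (X(n := x)) \<partial>?Q) \<partial>?R)" using *(1) by simp
    finally show "(\<integral>U. k U \<partial>cube) = (\<integral>X. (\<integral>x. k (X(n := x)) \<partial>?Q) \<partial>?R)" .
  qed
  have sh[measurable]: "(\<lambda>U. U(n := U n + \<delta>)) \<in> cube \<rightarrow>\<^sub>M cube"
    by (rule measurable_to_cube) (auto simp: fun_upd_def)
  let ?d = "\<lambda>X. (\<integral>x. g (X(n := x + \<delta>)) \<partial>?Q) - (\<integral>x. g (X(n := x)) \<partial>?Q)"
  have i1: "integrable ?R (\<lambda>X. (\<integral>x. g (X(n := x + \<delta>)) \<partial>?Q))"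
    using iter(2)[of "\<lambda>U. g (U(n := U n + \<delta>))"] B by simp
  have "(\<integral>U. g (U(n := U n + \<delta>)) \<partial>cube) - (\<integral>U. g U \<partial>cube) = (\<integral>X. ?d X \<partial>?R)"
    using iter[of g] iter(1)[of "\<lambda>U. g (U(n := U n + \<delta>))"] i1 B by simp
  also have "\<bar>\<dots>\<bar> \<le> (\<integral>X. 2 * B * \<bar>\<delta>\<bar> \<partial>?R)"
  proof (rule order_trans[OF integral_abs_bound], rule integral_mono)
    show "integrable ?R (\<lambda>X. \<bar>?d X\<bar>)" using i1 iter(2)[of g] B by auto
    show "\<bar>?d X\<bar> \<le> 2 * B * \<bar>\<delta>\<bar>" for X
      by (rule uniform_shift[of "\<lambda>x. g (X(n := x))"]) (use sect B in \<open>auto intro: measurable_compose\<close>)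
  qed auto
  finally show ?thesis by (simp add: R.prob_space)
qed

definition translate :: "(nat \<Rightarrow> real) \<Rightarrow> real \<Rightarrow> (nat \<Rightarrow> real) \<Rightarrow> nat \<Rightarrow> real"
  where "translate w t U = (\<lambda>n. U n + t * w n)"

lemma measurable_translate [measurable]: "translate w t \<in> cube \<rightarrow>\<^sub>M cube"
  by (rule measurable_to_cube) (simp add: translate_def)

lemma translate_translate: "translate w t (translate w s U) = translate w (t + s) U"
  by (auto simp: translate_def algebra_simps)

lemma translate_0 [simp]: "translate w 0 U = U"
  by (simp add: translate_def)

definition mass :: "(nat \<Rightarrow> real) \<Rightarrow> real"
  where "mass w = (\<Sum>n | w n \<noteq> 0. \<bar>w n\<bar>)"

lemma mass_nonneg: "mass w \<ge> 0"
  by (simp add: mass_def sum_nonneg)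

text \<open>The translation is carried out one coordinate at a time. This estimate makes up for the fact that no
  translation invariant probability measure exists on the space of sequences: short translations in finitely
  many directions preserve integrals approximately.\<close>

lemma cube_shift:
  fixes g :: "(nat \<Rightarrow> real) \<Rightarrow> real"
  assumes g[measurable]: "g \<in> borel_measurable cube" and B: "\<And>U. \<bar>g U\<bar> \<le> B"
    and fin: "finite {n. w n \<noteq> 0}"
  shows "\<bar>(\<integral>U. g (translate w t U) \<partial>cube) - (\<integral>U. g U \<partial>cube)\<bar> \<le> 2 * B * \<bar>t\<bar> * mass w"
proof -
  define v where "v S = (\<lambda>n. if n \<in> S then w n else 0)" for S
  have *: "\<bar>(\<integral>U. g (translate (v S) t U) \<partial>cube) - (\<integral>U. g U \<partial>cube)\<bar> \<le> 2 * B * \<bar>t\<bar> * (\<Sum>n\<in>S. \<bar>w n\<bar>)"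
    if "finite S" for S
    using that
  proof (induction S)
    case empty
    then show ?case by (simp add: v_def translate_def)
  next
    case (insert a S)
    let ?k = "\<lambda>U. g (translate (v S) t U)"
    have *: "translate (v (insert a S)) t U = translate (v S) t (U(a := U a + t * w a))" for U
      using insert.hyps by (auto simp: translate_def v_def fun_eq_iff)
    have "\<bar>(\<integral>U. ?k (U(a := U a + t * w a)) \<partial>cube) - (\<integral>U. ?k U \<partial>cube)\<bar> \<le> 2 * B * \<bar>t * w a\<bar>"
      by (rule cube_shift_coord) (auto simp: B)
    with insert.IH have "\<bar>(\<integral>U. g (translate (v (insert a S)) t U) \<partial>cube) - (\<integral>U. g U \<partial>cube)\<bar>
       \<le> 2 * B * \<bar>t * w a\<bar> + 2 * B * \<bar>t\<bar> * (\<Sum>n\<in>S. \<bar>w n\<bar>)"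
      unfolding * by linarith
    then show ?case using insert.hyps by (simp add: abs_mult algebra_simps)
  qed
  have "v {n. w n \<noteq> 0} = w" by (auto simp: v_def)
  with *[OF fin] show ?thesis by (simp add: mass_def)
qed

text \<open>The steps are dyadic so that a difference quotient is the exact mean of the finer ones along its
  segment; see \<open>slope_average\<close>.\<close>

definition slope :: "((nat \<Rightarrow> real) \<Rightarrow> real) \<Rightarrow> (nat \<Rightarrow> real) \<Rightarrow> nat \<Rightarrow> (nat \<Rightarrow> real) \<Rightarrow> real"
  where "slope h w m U = 2 ^ m * (h (translate w (1 / 2 ^ m) U) - h U)"

lemma slope_average:
  "slope h w m U = (\<Sum>j<2^k. slope h w (m + k) (translate w (real j / 2 ^ (m + k)) U)) / 2 ^ k"
proof -
  let ?a = "\<lambda>j. h (translate w (real j / 2 ^ (m + k)) U)"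
  have "(\<Sum>j<2^k. slope h w (m + k) (translate w (real j / 2 ^ (m + k)) U))
    = (\<Sum>j<2^k. 2 ^ (m + k) * (?a (Suc j) - ?a j))"
    by (intro sum.cong) (auto simp: slope_def translate_translate add_divide_distrib add.commute)
  also have "\<dots> = 2 ^ (m + k) * (?a (2 ^ k) - ?a 0)"
    by (subst sum_distrib_left[symmetric], subst sum_lessThan_telescope) simp
  also have "real (2 ^ k) / 2 ^ (m + k) = 1 / 2 ^ m" by (simp add: power_add)
  finally show ?thesis by (simp add: slope_def power_add field_simps)
qed

lemma average_power2_le:
  fixes f :: "nat \<Rightarrow> real"
  assumes "K > 0"
  shows "((\<Sum>j<K. f j) / K)\<^sup>2 \<le> (\<Sum>j<K. (f j)\<^sup>2) / K"
    and "(\<Sum>j<K. (f j - (\<Sum>j<K. f j) / K)\<^sup>2) = (\<Sum>j<K. (f j)\<^sup>2) - K * ((\<Sum>j<K. f j) / K)\<^sup>2"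
proof -
  let ?a = "(\<Sum>j<K. f j) / K"
  have "(\<Sum>j<K. (f j - ?a)\<^sup>2) = (\<Sum>j<K. (f j)\<^sup>2 - 2 * ?a * f j + ?a\<^sup>2)"
    by (simp add: power2_diff algebra_simps)
  also have "\<dots> = (\<Sum>j<K. (f j)\<^sup>2) - 2 * ?a * (\<Sum>j<K. f j) + K * ?a\<^sup>2"
    by (simp add: sum.distrib sum_subtractf sum_distrib_left)
  also have "(\<Sum>j<K. f j) = K * ?a" using assms by simp
  finally show *: "(\<Sum>j<K. (f j - ?a)\<^sup>2) = (\<Sum>j<K. (f j)\<^sup>2) - K * ?a\<^sup>2"
    by (simp add: power2_eq_square)
  have "0 \<le> (\<Sum>j<K. (f j - ?a)\<^sup>2)" by (simp add: sum_nonneg)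
  then show "?a\<^sup>2 \<le> (\<Sum>j<K. (f j)\<^sup>2) / K"
    unfolding * using assms by (simp add: field_simps)
qed

section \<open>Difference quotients in one direction converge in mean square\<close>

locale lipschitz_along =
  fixes h :: "(nat \<Rightarrow> real) \<Rightarrow> real" and w :: "nat \<Rightarrow> real" and M :: real
  assumes meas [measurable]: "h \<in> borel_measurable cube"
    and lip: "\<And>U t. \<bar>h (translate w t U) - h U\<bar> \<le> M * \<bar>t\<bar>"
    and fin: "finite {n. w n \<noteq> 0}"
begin

abbreviation "s \<equiv> slope h w"

lemma M_nonneg: "M \<ge> 0"
  using lip[of 1] abs_ge_zero by (metis abs_one mult.right_neutral order_trans)

lemma slope_measurable [measurable]: "s m \<in> borel_measurable cube"
  unfolding slope_def by measurable

lemma slope_bound: "\<bar>s m U\<bar> \<le> M"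
proof -
  have "\<bar>s m U\<bar> \<le> 2 ^ m * (M * \<bar>1 / 2 ^ m\<bar>)"
    unfolding slope_def abs_mult by (intro mult_mono lip) auto
  then show ?thesis by simp
qed

lemma slope_translate: "\<bar>s m (translate w t U) - s m U\<bar> \<le> 2 ^ m * (2 * M * \<bar>t\<bar>)"
proof -
  have "s m (translate w t U) - s m U
    = 2 ^ m * ((h (translate w t (translate w (1/2^m) U)) - h (translate w (1/2^m) U)) - (h (translate w t U) - h U))"
    by (simp add: slope_def translate_translate algebra_simps)
  also have "\<bar>\<dots>\<bar> \<le> 2 ^ m * (2 * M * \<bar>t\<bar>)"
    unfolding abs_mult using lip[of t "translate w (1/2^m) U"] lip[of t U]
    by (intro mult_mono) auto
  finally show ?thesis .
qed

lemma sq_bound: "\<bar>x\<bar> \<le> c \<Longrightarrow> \<bar>x\<^sup>2\<bar> \<le> (c::real)\<^sup>2"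
  by (metis abs_le_square_iff abs_of_nonneg abs_power2 order_trans abs_ge_zero)

lemma integrable_sq: "integrable cube (\<lambda>U. (s m (translate w t U))\<^sup>2)"
  using sq_bound[OF slope_bound] by (intro cube_integrable[of _ "M\<^sup>2"]) auto

lemma integrable_diff_sq: "integrable cube (\<lambda>U. (s m (translate w t U) - s n (translate w r U))\<^sup>2)"
proof (rule cube_integrable[of _ "(2*M)\<^sup>2"])
  fix U show "\<bar>(s m (translate w t U) - s n (translate w r U))\<^sup>2\<bar> \<le> (2*M)\<^sup>2"
    using slope_bound[of m "translate w t U"] slope_bound[of n "translate w r U"] by (intro sq_bound) linarith
qed auto

text \<open>The mean square of the quotients is almost increasing under refinement and bounded. Its convergence
  is what makes the quotients a Cauchy sequence.\<close>

definition energy :: "nat \<Rightarrow> real" where "energy m = (\<integral>U. (s m U)\<^sup>2 \<partial>cube)"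

lemma energy_le: "energy m \<le> M\<^sup>2"
proof -
  have "energy m \<le> (\<integral>U. M\<^sup>2 \<partial>cube)"
    unfolding energy_def using integrable_sq[of m 0]
    sq_bound[OF slope_bound]
    by (intro integral_mono) auto
  then show ?thesis by simp
qed

lemma energy_shift: "\<bar>(\<integral>U. (s m (translate w t U))\<^sup>2 \<partial>cube) - energy m\<bar> \<le> 2 * M\<^sup>2 * \<bar>t\<bar> * mass w"
  unfolding energy_def
  using sq_bound[OF slope_bound] by (intro cube_shift[where g="\<lambda>U. (s m U)\<^sup>2"]) (auto simp: fin)

text \<open>A coarse quotient is the mean of the finer quotients along its segment, so that the variance of the
  latter is a difference of second moments. Up to the effect of translation this is a gain of energy.\<close>

lemma spread_le:
  assumes "K = 2 ^ k"
  shows "(\<Sum>j<K. (\<integral>U. (s (m + k) (translate w (real j / 2 ^ (m + k)) U) - s m U)\<^sup>2 \<partial>cube))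
    \<le> K * (energy (m + k) - energy m + 2 * M\<^sup>2 / 2 ^ m * mass w)"
proof -
  let ?f = "\<lambda>j U. s (m + k) (translate w (real j / 2 ^ (m + k)) U)"
  have K: "K > 0" using assms by simp
  have av: "s m U = (\<Sum>j<K. ?f j U) / K" for U
    using slope_average[of h w m U k] assms by simp
  have "(\<Sum>j<K. (\<integral>U. (?f j U - s m U)\<^sup>2 \<partial>cube)) = (\<integral>U. (\<Sum>j<K. (?f j U - s m U)\<^sup>2) \<partial>cube)"
    using integrable_diff_sq[of _ _ m 0] by (subst Bochner_Integration.integral_sum) auto
  also have "\<dots> = (\<integral>U. (\<Sum>j<K. (?f j U)\<^sup>2) - K * (s m U)\<^sup>2 \<partial>cube)"
    unfolding av by (subst average_power2_le(2)[OF K]) simp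
  also have "\<dots> = (\<Sum>j<K. (\<integral>U. (?f j U)\<^sup>2 \<partial>cube)) - K * energy m"
    using integrable_sq[of m 0] integrable_sq unfolding energy_def
    by (subst Bochner_Integration.integral_diff) (auto simp: Bochner_Integration.integral_sum)
  also have "(\<Sum>j<K. (\<integral>U. (?f j U)\<^sup>2 \<partial>cube)) \<le> (\<Sum>j<K. energy (m + k) + 2 * M\<^sup>2 / 2 ^ m * mass w)"
  proof (rule sum_mono)
    fix j assume "j \<in> {..<K}"
    then have "real j \<le> 2 ^ k" using assms by (metis lessThan_iff less_imp_le of_nat_le_iff of_nat_numeral of_nat_power)
    then have "\<bar>real j / 2 ^ (m + k)\<bar> \<le> 1 / 2 ^ m" by (simp add: power_add field_simps)
    then have "2 * M\<^sup>2 * \<bar>real j / 2 ^ (m + k)\<bar> * mass w \<le> 2 * M\<^sup>2 * (1 / 2 ^ m) * mass w"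
      by (intro mult_right_mono mult_left_mono mass_nonneg) auto
    then show "(\<integral>U. (?f j U)\<^sup>2 \<partial>cube) \<le> energy (m + k) + 2 * M\<^sup>2 / 2 ^ m * mass w"
      using energy_shift[of "m + k" "real j / 2 ^ (m + k)"] by simp
  qed
  finally show ?thesis by (simp add: algebra_simps)
qed

lemma energy_almost_mono: "energy m \<le> energy (m + k) + 2 * M\<^sup>2 / 2 ^ m * mass w"
proof -
  have "0 \<le> (\<Sum>j<2^k. (\<integral>U. (s (m + k) (translate w (real j / 2 ^ (m + k)) U) - s m U)\<^sup>2 \<partial>cube))"
    by (intro sum_nonneg) auto
  also note spread_le[OF refl, where k=k and m=m]
  finally have "0 \<le> energy (m + k) - energy m + 2 * M\<^sup>2 / 2 ^ m * mass w"
    by (rule mult_left_le_imp_le[of "real (2 ^ k)" 0, simplified mult_zero_right]) simp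
  then show ?thesis by simp
qed

text \<open>In \<open>spread_le\<close> the fine quotient is taken at a translated point. Only the first \<open>2 ^ k\<close> of the
  \<open>2 ^ (k + l)\<close> translates are kept: these are shorter than the scale of \<open>s m\<close> by the factor \<open>2 ^ l\<close>, so that
  the translation can be undone. The price is the factor \<open>2 ^ l\<close> in front of the gain of energy.\<close>

lemma slope_dist:
  "(\<integral>U. (s (m + (k + l)) U - s m U)\<^sup>2 \<partial>cube)
    \<le> 2 * 2 ^ l * (energy (m + (k + l)) - energy m + 2 * M\<^sup>2 / 2 ^ m * mass w) + 8 * M\<^sup>2 / 4 ^ l + 8 * M\<^sup>2 / 2 ^ m * mass w"
proof -
  let ?n = "m + (k + l)"
  let ?X = "(\<integral>U. (s ?n U - s m U)\<^sup>2 \<partial>cube)"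
  let ?t = "\<lambda>j. real j / 2 ^ ?n"
  let ?Y = "\<lambda>j. (\<integral>U. (s ?n (translate w (?t j) U) - s m U)\<^sup>2 \<partial>cube)"
  have Yn: "?Y j \<ge> 0" for j by simp
  have bound: "?X \<le> 2 * ?Y j + (8 * M\<^sup>2 / 4 ^ l + 8 * M\<^sup>2 / 2 ^ m * mass w)" if j: "j < 2 ^ k" for j :: nat
  proof -
    have jk: "real j \<le> 2 ^ k" using j by (metis less_imp_le of_nat_le_iff of_nat_numeral of_nat_power)
    have tj: "?t j \<le> 1 / (2 ^ m * 2 ^ l)" using jk by (simp add: power_add field_simps)
    have "1 / (2 ^ m * 2 ^ l) \<le> 1 / (2 ^ m :: real)" by (simp add: field_simps)
    with tj have tj': "\<bar>?t j\<bar> \<le> 1 / 2 ^ m" by simp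
    let ?g = "\<lambda>U. (s ?n U - s m U)\<^sup>2"
    have "\<bar>(\<integral>U. ?g (translate w (?t j) U) \<partial>cube) - ?X\<bar> \<le> 2 * (2 * M)\<^sup>2 * \<bar>?t j\<bar> * mass w"
    proof (rule cube_shift)
      show "\<bar>(s ?n U - s m U)\<^sup>2\<bar> \<le> (2 * M)\<^sup>2" for U
        using slope_bound[of ?n U] slope_bound[of m U] by (intro sq_bound) linarith
    qed (auto simp: fin)
    also have "\<dots> \<le> 2 * (2 * M)\<^sup>2 * (1 / 2 ^ m) * mass w"
      using tj' by (intro mult_right_mono mult_left_mono mass_nonneg) auto
    finally have 1: "?X \<le> (\<integral>U. ?g (translate w (?t j) U) \<partial>cube) + 8 * M\<^sup>2 / 2 ^ m * mass w"
      by (simp add: power2_eq_square)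
    have "(\<integral>U. ?g (translate w (?t j) U) \<partial>cube)
       \<le> (\<integral>U. 2 * (s ?n (translate w (?t j) U) - s m U)\<^sup>2 + 8 * M\<^sup>2 / 4 ^ l \<partial>cube)"
    proof (rule integral_mono)
      show "integrable cube (\<lambda>U. 2 * (s ?n (translate w (?t j) U) - s m U)\<^sup>2 + 8 * M\<^sup>2 / 4 ^ l)"
        using integrable_diff_sq[of ?n "?t j" m 0] by auto
      fix U
      have "\<bar>s m (translate w (?t j) U) - s m U\<bar> \<le> 2 ^ m * (2 * M * \<bar>?t j\<bar>)" by (rule slope_translate)
      also have "\<dots> \<le> 2 ^ m * (2 * M * (1 / (2 ^ m * 2 ^ l)))"
        using tj M_nonneg by (intro mult_left_mono) auto
      finally have "\<bar>s m (translate w (?t j) U) - s m U\<bar> \<le> 2 * M / 2 ^ l" by simp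
      from sq_bound[OF this] have a: "(s m (translate w (?t j) U) - s m U)\<^sup>2 \<le> 4 * M\<^sup>2 / 4 ^ l"
        by (simp add: power_divide power2_eq_square flip: power_mult_distrib)
      have sq: "(x - y)\<^sup>2 \<le> 2 * (x - z)\<^sup>2 + 2 * (y - z)\<^sup>2" for x y z :: real
        using zero_le_power2[of "(x - z) + (y - z)"] by (simp add: power2_eq_square algebra_simps)
      show "?g (translate w (?t j) U) \<le> 2 * (s ?n (translate w (?t j) U) - s m U)\<^sup>2 + 8 * M\<^sup>2 / 4 ^ l"
        using sq[of "s ?n (translate w (?t j) U)" "s m (translate w (?t j) U)" "s m U"] a by simp
    qed (use integrable_diff_sq in auto)
    also have "\<dots> = 2 * ?Y j + 8 * M\<^sup>2 / 4 ^ l"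
      using integrable_diff_sq[of ?n "?t j" m 0] by (simp add: cube.prob_space)
    finally show ?thesis using 1 by simp
  qed
  define A where "A = energy ?n - energy m + 2 * M\<^sup>2 / 2 ^ m * mass w"
  define B where "B = 8 * M\<^sup>2 / 4 ^ l + 8 * M\<^sup>2 / 2 ^ m * mass w"
  have "(\<Sum>j\<in>{..<2^k::nat}. ?X) \<le> (\<Sum>j<2^k. 2 * ?Y j + B)"
  proof (rule sum_mono)
    fix j :: nat assume "j \<in> {..<2^k}"
    then have "j < 2 ^ k" by simp
    from bound[OF this] show "?X \<le> 2 * ?Y j + B" by (simp only: B_def)
  qed
  then have 1: "2 ^ k * ?X \<le> 2 * (\<Sum>j<2^k. ?Y j) + 2 ^ k * B"
    by (simp add: sum.distrib sum_distrib_left)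
  have "(\<Sum>j<2^k. ?Y j) \<le> (\<Sum>j<2^(k+l). ?Y j)"
  proof (rule sum_mono2)
    have "(2::nat) ^ k \<le> 2 ^ (k + l)" by (rule power_increasing) auto
    then show "{..<(2::nat)^k} \<subseteq> {..<2^(k+l)}" by simp
  qed (auto simp: Yn)
  also have "\<dots> \<le> real (2^(k+l)) * A"
    unfolding A_def by (rule spread_le) simp
  finally have 2: "(\<Sum>j<2^k. ?Y j) \<le> 2 ^ k * (2 ^ l * A)"
    by (simp only: of_nat_power of_nat_numeral power_add mult.assoc of_nat_mult)
  have "2 ^ k * ?X \<le> 2 ^ k * (2 * 2 ^ l * A + B)"
    using 1 2 by (simp only: distrib_left mult.assoc mult.left_commute[of 2 "2 ^ k"])
  then have "?X \<le> 2 * 2 ^ l * A + B" by (rule mult_left_le_imp_le) simp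
  then show ?thesis by (simp only: A_def B_def add.assoc)
qed

lemma energy_convergent: "convergent energy"
proof -
  let ?c = "2 * M\<^sup>2 * mass w"
  have c0: "?c \<ge> 0" by (simp add: mass_nonneg)
  have "incseq (\<lambda>m. energy m - 2 * ?c / 2 ^ m)"
  proof (rule incseq_SucI)
    fix n
    have "2 * ?c / 2 ^ n = ?c / 2 ^ n + 2 * ?c / 2 ^ Suc n" by simp
    moreover have "energy n \<le> energy (Suc n) + ?c / 2 ^ n" using energy_almost_mono[of n 1] by simp
    ultimately show "energy n - 2 * ?c / 2 ^ n \<le> energy (Suc n) - 2 * ?c / 2 ^ Suc n" by smt
  qed
  moreover have "energy m - 2 * ?c / 2 ^ m \<le> M\<^sup>2" for m
  proof (rule order_trans[OF _ energy_le])
    show "energy m - 2 * ?c / 2 ^ m \<le> energy m" using c0 by simp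
  qed
  ultimately have "convergent (\<lambda>m. energy m - 2 * ?c / 2 ^ m)"
    by (meson incseq_convergent convergentI)
  moreover have "convergent (\<lambda>m. 2 * ?c / 2 ^ m)"
  proof (rule convergentI)
    show "(\<lambda>m. c / 2 ^ m) \<longlonglongrightarrow> 0" for c :: real by real_asymp
  qed
  ultimately have "convergent (\<lambda>m. (energy m - 2 * ?c / 2 ^ m) + 2 * ?c / 2 ^ m)"
    by (rule convergent_add)
  then show ?thesis by simp
qed

lemma slope_Cauchy:
  assumes "\<eta> > 0"
  obtains m0 where "\<And>m n. m \<ge> m0 \<Longrightarrow> n \<ge> m0 \<Longrightarrow> (\<integral>U. (s m U - s n U)\<^sup>2 \<partial>cube) \<le> \<eta>"
proof -
  have "(\<lambda>l. 8 * M\<^sup>2 / 4 ^ l) \<longlonglongrightarrow> 0" by real_asymp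
  then have "eventually (\<lambda>l. 8 * M\<^sup>2 / 4 ^ l < \<eta> / 12) sequentially"
    using assms by (auto dest!: order_tendstoD(2)[of _ 0 _ "\<eta> / 12"])
  then obtain l where l: "8 * M\<^sup>2 / 4 ^ l < \<eta> / 12" by (auto simp: eventually_sequentially)
  have "Cauchy energy" using energy_convergent by (rule convergent_Cauchy)
  moreover have "\<eta> / (24 * 2 ^ l) > 0" using assms by simp
  ultimately obtain m1 where m1: "\<And>m n. m \<ge> m1 \<Longrightarrow> n \<ge> m1 \<Longrightarrow> dist (energy m) (energy n) < \<eta> / (24 * 2 ^ l)"
    by (meson metric_CauchyD)
  have "(\<lambda>m. c / 2 ^ m) \<longlonglongrightarrow> 0" for c :: real by real_asymp
  then have "eventually (\<lambda>m. (4 * 2 ^ l * M\<^sup>2 * mass w + 8 * M\<^sup>2 * mass w) / 2 ^ m < \<eta> / 12) sequentially"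
    by (rule order_tendstoD(2)) (use assms in simp)
  then obtain m2 where m2: "\<And>m. m \<ge> m2 \<Longrightarrow> (4 * 2 ^ l * M\<^sup>2 * mass w + 8 * M\<^sup>2 * mass w) / 2 ^ m < \<eta> / 12"
    by (auto simp: eventually_sequentially)
  have far: "(\<integral>U. (s n U - s m U)\<^sup>2 \<partial>cube) \<le> \<eta> / 4" if mn: "m \<ge> max m1 m2" "n \<ge> m + l" for m n
  proof -
    obtain k where k: "n = m + (k + l)" using mn(2) by (metis add.assoc add.commute le_add_diff_inverse2)
    have "energy n - energy m < \<eta> / (24 * 2 ^ l)"
      using m1[of n m] mn by (simp add: dist_real_def)
    then have "2 * 2 ^ l * (energy n - energy m) \<le> 2 * 2 ^ l * (\<eta> / (24 * 2 ^ l))"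
      by (intro mult_left_mono) auto
    then have "2 * 2 ^ l * (energy n - energy m) \<le> \<eta> / 12" by simp
    moreover have "2 * 2 ^ l * (2 * M\<^sup>2 / 2 ^ m * mass w) + 8 * M\<^sup>2 / 2 ^ m * mass w < \<eta> / 12"
      using m2[of m] mn(1) by (simp add: add_divide_distrib mult_ac)
    moreover have "(\<integral>U. (s n U - s m U)\<^sup>2 \<partial>cube) \<le> 2 * 2 ^ l * (energy n - energy m)
        + 2 * 2 ^ l * (2 * M\<^sup>2 / 2 ^ m * mass w) + 8 * M\<^sup>2 / 4 ^ l + 8 * M\<^sup>2 / 2 ^ m * mass w"
      using slope_dist[of m k l] unfolding k distrib_left by simp
    ultimately show ?thesis using l by linarith
  qed
  show ?thesis
  proof (rule that[of "max m1 m2"])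
    fix m n assume mn: "m \<ge> max m1 m2" "n \<ge> max m1 m2"
    define k where "k = max m n + l"
    have i: "integrable cube (\<lambda>U. (s a U - s b U)\<^sup>2)" for a b using integrable_diff_sq[of a 0 b 0] by simp
    have "(\<integral>U. (s m U - s n U)\<^sup>2 \<partial>cube) \<le> (\<integral>U. 2 * (s k U - s m U)\<^sup>2 + 2 * (s k U - s n U)\<^sup>2 \<partial>cube)"
    proof (rule integral_mono)
      show "(s m U - s n U)\<^sup>2 \<le> 2 * (s k U - s m U)\<^sup>2 + 2 * (s k U - s n U)\<^sup>2" for U
        using zero_le_power2[of "2 * s k U - s m U - s n U"] by (simp add: power2_eq_square algebra_simps)
    qed (use i in auto)
    also have "\<dots> = 2 * (\<integral>U. (s k U - s m U)\<^sup>2 \<partial>cube) + 2 * (\<integral>U. (s k U - s n U)\<^sup>2 \<partial>cube)"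
      using i by simp
    also have "\<dots> \<le> 2 * (\<eta> / 4) + 2 * (\<eta> / 4)"
      using mn by (intro add_mono mult_left_mono far) (auto simp: k_def)
    finally show "(\<integral>U. (s m U - s n U)\<^sup>2 \<partial>cube) \<le> \<eta>" by simp
  qed
qed

end

section \<open>Passage to almost everywhere statements\<close>

lemma AE_summable:
  fixes g :: "nat \<Rightarrow> 'a \<Rightarrow> real"
  assumes int: "\<And>i. integrable M (g i)" and nn: "\<And>i x. 0 \<le> g i x" and sm: "summable (\<lambda>i. \<integral>x. g i x \<partial>M)"
  shows "AE x in M. summable (\<lambda>i. g i x)"
proof -
  have [measurable]: "g i \<in> borel_measurable M" for i using int by auto
  have "(\<integral>\<^sup>+x. (\<Sum>i. ennreal (g i x)) \<partial>M) = (\<Sum>i. \<integral>\<^sup>+x. ennreal (g i x) \<partial>M)"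
    by (rule nn_integral_suminf) measurable
  also have "\<dots> = (\<Sum>i. ennreal (\<integral>x. g i x \<partial>M))"
    by (intro suminf_cong nn_integral_eq_integral int AE_I2 nn)
  also have "\<dots> = ennreal (\<Sum>i. \<integral>x. g i x \<partial>M)"
    by (intro suminf_ennreal2 Bochner_Integration.integral_nonneg nn sm)
  finally have "(\<integral>\<^sup>+x. (\<Sum>i. ennreal (g i x)) \<partial>M) \<noteq> \<infinity>" by simp
  then have "AE x in M. (\<Sum>i. ennreal (g i x)) \<noteq> \<infinity>"
    by (intro nn_integral_PInf_AE) auto
  then show ?thesis
    by eventually_elim (simp add: summable_suminf_not_top nn)
qed

lemma (in prob_space) AE_convergent_of_small_increments:
  fixes X :: "nat \<Rightarrow> 'a \<Rightarrow> real"
  assumes [measurable]: "\<And>i. X i \<in> borel_measurable M"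
    and B: "\<And>i x. \<bar>X i x\<bar> \<le> B"
    and small: "\<And>i. i \<ge> k \<Longrightarrow> (\<integral>x. (X (Suc i) x - X i x)\<^sup>2 \<partial>M) \<le> (1/8) ^ i"
  shows "AE x in M. convergent (\<lambda>i. X i x)"
proof -
  let ?d = "\<lambda>i x. X (Suc i) x - X i x"
  have dB: "\<bar>?d i x\<bar> \<le> 2 * B" for i x using B[of "Suc i" x] B[of i x] by linarith
  have i1: "integrable M (?d i)" for i
    by (rule integrable_const_bound[of _ "2 * B"]) (use dB in auto)
  have i2: "integrable M (\<lambda>x. (?d i x)\<^sup>2)" for i
  proof (rule integrable_const_bound[of _ "(2 * B)\<^sup>2"])
    show "AE x in M. norm ((?d i x)\<^sup>2) \<le> (2 * B)\<^sup>2"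
      unfolding real_norm_def abs_power2
      using dB[of i] by (intro AE_I2) (metis abs_ge_zero abs_le_square_iff abs_of_nonneg order_trans)
  qed auto
  have "(\<integral>x. \<bar>?d i x\<bar> \<partial>M) \<le> 2 * (1/2) ^ i" if "i \<ge> k" for i
  proof -
    have "(\<integral>x. \<bar>?d i x\<bar> \<partial>M) \<le> (\<integral>x. (1/2) ^ i + 2 ^ i * (?d i x)\<^sup>2 \<partial>M)"
    proof (rule integral_mono)
      fix x
      have "2 * \<bar>?d i x\<bar> \<le> (1/2) ^ i + 2 ^ i * (?d i x)\<^sup>2"
      proof -
        have "0 \<le> 2 ^ i * (\<bar>?d i x\<bar> - (1/2) ^ i)\<^sup>2" by simp
        also have "\<dots> = 2 ^ i * (?d i x)\<^sup>2 - 2 * (2 ^ i * (1/2) ^ i) * \<bar>?d i x\<bar> + (2 ^ i * (1/2) ^ i) * (1/2) ^ i"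
          by (simp only: power2_diff power2_abs) (simp add: algebra_simps power2_eq_square)
        also have "(2::real) ^ i * (1/2) ^ i = 1" by (simp flip: power_mult_distrib)
        finally show ?thesis by simp
      qed
      then show "\<bar>?d i x\<bar> \<le> (1/2) ^ i + 2 ^ i * (?d i x)\<^sup>2"
        by (rule order_trans[rotated]) simp
    qed (use i1 i2 in auto)
    also have "\<dots> = (1/2) ^ i + 2 ^ i * (\<integral>x. (?d i x)\<^sup>2 \<partial>M)"
      using i2 by (simp add: prob_space)
    finally have le: "(\<integral>x. \<bar>?d i x\<bar> \<partial>M) \<le> (1/2) ^ i + 2 ^ i * (\<integral>x. (?d i x)\<^sup>2 \<partial>M)" .
    have "2 ^ i * (\<integral>x. (?d i x)\<^sup>2 \<partial>M) \<le> 2 ^ i * (1/8) ^ i"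
      by (rule mult_left_mono[OF small[OF that]]) simp
    moreover have "(2::real) ^ i * (1/8) ^ i \<le> (1/2) ^ i"
      unfolding power_mult_distrib[symmetric] by (rule power_mono) auto
    ultimately show ?thesis using le by (simp only: mult_2)
  qed
  then have *: "norm (\<integral>x. \<bar>?d i x\<bar> \<partial>M) \<le> 2 * (1/2) ^ i" if "i \<ge> k" for i
    using that by simp
  have "AE x in M. summable (\<lambda>i. \<bar>?d i x\<bar>)"
  proof (rule AE_summable)
    show "summable (\<lambda>i. \<integral>x. \<bar>?d i x\<bar> \<partial>M)"
      by (rule summable_comparison_test'[OF _ *]) (simp add: summable_mult summable_geometric)
  qed (simp_all add: i1)
  then show ?thesis
  proof eventually_elim
    case (elim x)
    then have "summable (\<lambda>i. X (Suc i) x - X i x)" by (rule summable_rabs_cancel)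
    then obtain l where "(\<lambda>n. \<Sum>i<n. X (Suc i) x - X i x) \<longlonglongrightarrow> l"
      unfolding summable_def sums_def by blast
    then have "(\<lambda>n. X n x - X 0 x) \<longlonglongrightarrow> l" by (simp only: sum_lessThan_telescope[of "\<lambda>i. X i x"])
    from tendsto_add[OF this tendsto_const[of "X 0 x"]] show ?case
      by (auto simp: convergent_def)
  qed
qed

text \<open>The group of directions of differentiation. It is countable, so that statements that hold almost
  everywhere for each direction hold almost everywhere for all directions at once.\<close>

definition int_vectors :: "(nat \<Rightarrow> real) set"
  where "int_vectors = {w. finite {n. w n \<noteq> 0} \<and> range w \<subseteq> \<int>}"

lemma countable_int_vectors: "countable int_vectors"
proof -
  have "int_vectors \<subseteq> (\<lambda>l n. if n < length l then real_of_int (l ! n) else 0) ` UNIV"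
  proof
    fix w assume w: "w \<in> int_vectors"
    then obtain k where k: "\<And>n. w n \<noteq> 0 \<Longrightarrow> n < k"
      unfolding int_vectors_def by (metis (mono_tags, lifting) finite_nat_set_iff_bounded mem_Collect_eq)
    have "w n \<in> \<int>" for n using w by (auto simp: int_vectors_def)
    then have fl: "real_of_int \<lfloor>w n\<rfloor> = w n" for n by (metis Ints_cases floor_of_int)
    have "w = (\<lambda>n. if n < length (map (\<lambda>n. \<lfloor>w n\<rfloor>) [0..<k]) then real_of_int (map (\<lambda>n. \<lfloor>w n\<rfloor>) [0..<k] ! n) else 0)"
    proof
      fix n show "w n = (if n < length (map (\<lambda>n. \<lfloor>w n\<rfloor>) [0..<k]) then real_of_int (map (\<lambda>n. \<lfloor>w n\<rfloor>) [0..<k] ! n) else 0)"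
        using k[of n] by (cases "n < k") (auto simp: fl)
    qed
    then show "w \<in> (\<lambda>l n. if n < length l then real_of_int (l ! n) else 0) ` UNIV" by blast
  qed
  then show ?thesis by (rule countable_subset) auto
qed

lemma int_vectors_add: "w \<in> int_vectors \<Longrightarrow> w' \<in> int_vectors \<Longrightarrow> (\<lambda>n. w n + w' n) \<in> int_vectors"
  unfolding int_vectors_def
  by (auto intro!: Ints_add intro: finite_subset[of _ "{n. w n \<noteq> 0} \<union> {n. w' n \<noteq> 0}"])

lemma zero_int_vectors: "(\<lambda>_. 0) \<in> int_vectors"
  by (simp add: int_vectors_def image_subset_iff)

text \<open>In mean square, \<open>slope h w' m\<close> may be replaced by a fixed coarser quotient \<open>slope h w' k\<close>, which is
  Lipschitz along \<open>w\<close> and therefore insensitive to the translation by \<open>w / 2 ^ m\<close>.\<close>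

lemma slope_translate_vanishes:
  assumes A: "lipschitz_along h w M" and A': "lipschitz_along h w' M'"
  shows "(\<lambda>m. \<integral>U. (slope h w' m (translate w (1 / 2 ^ m) U) - slope h w' m U)\<^sup>2 \<partial>cube) \<longlonglongrightarrow> 0"
proof -
  interpret w: lipschitz_along h w M by (rule A)
  interpret w': lipschitz_along h w' M' by (rule A')
  let ?s = "slope h w'"
  have int2: "integrable cube (\<lambda>U. (?s m (translate w r U) - ?s n (translate w r' U))\<^sup>2)" for m n r r'
  proof (rule cube_integrable[of _ "(2*M')\<^sup>2"])
    fix U show "\<bar>(?s m (translate w r U) - ?s n (translate w r' U))\<^sup>2\<bar> \<le> (2*M')\<^sup>2"
      using w'.slope_bound[of m "translate w r U"] w'.slope_bound[of n "translate w r' U"] by (intro w.sq_bound) linarith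
  qed auto
  have key: "(\<integral>U. (?s m (translate w (1 / 2 ^ m) U) - ?s m U)\<^sup>2 \<partial>cube)
      \<le> 6 * (\<integral>U. (?s m U - ?s k U)\<^sup>2 \<partial>cube) + 24 * M'\<^sup>2 * mass w / 2 ^ m + 12 * (2 ^ k * M / 2 ^ m)\<^sup>2" for m k
  proof -
    let ?t = "1 / 2 ^ m :: real"
    let ?I = "(\<integral>U. (?s m U - ?s k U)\<^sup>2 \<partial>cube)"
    have "\<bar>(\<integral>U. (?s m (translate w ?t U) - ?s k (translate w ?t U))\<^sup>2 \<partial>cube) - ?I\<bar> \<le> 2 * (2 * M')\<^sup>2 * \<bar>?t\<bar> * mass w"
    proof (rule cube_shift[where g="\<lambda>U. (?s m U - ?s k U)\<^sup>2"])
      show "\<bar>(?s m U - ?s k U)\<^sup>2\<bar> \<le> (2 * M')\<^sup>2" for U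
        using w'.slope_bound[of m U] w'.slope_bound[of k U] by (intro w.sq_bound) linarith
    qed (auto simp: w.fin)
    then have 1: "(\<integral>U. (?s m (translate w ?t U) - ?s k (translate w ?t U))\<^sup>2 \<partial>cube) \<le> ?I + 8 * M'\<^sup>2 * mass w / 2 ^ m"
      by (simp add: power2_eq_square)
    have "(\<integral>U. (?s m (translate w ?t U) - ?s m U)\<^sup>2 \<partial>cube)
      \<le> (\<integral>U. 3 * (?s m (translate w ?t U) - ?s k (translate w ?t U))\<^sup>2 + (3 * (?s m U - ?s k U)\<^sup>2 + 12 * (2 ^ k * M / 2 ^ m)\<^sup>2) \<partial>cube)"
    proof (rule integral_mono)
      fix U
      let ?V = "translate w' (1 / 2 ^ k) U"
      have tt: "translate w' a (translate w b X) = translate w b (translate w' a X)" for a b X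
        by (auto simp: translate_def)
      have "?s k (translate w ?t U) - ?s k U = 2 ^ k * ((h (translate w ?t ?V) - h ?V) - (h (translate w ?t U) - h U))"
        unfolding slope_def tt by (simp add: algebra_simps)
      also have "\<bar>\<dots>\<bar> \<le> 2 ^ k * (2 * M * \<bar>?t\<bar>)"
        unfolding abs_mult using w.lip[of ?t ?V] w.lip[of ?t U] by (intro mult_mono) auto
      finally have "\<bar>?s k (translate w ?t U) - ?s k U\<bar> \<le> 2 * (2 ^ k * M / 2 ^ m)" by (simp add: mult_ac)
      from w.sq_bound[OF this] have c: "(?s k (translate w ?t U) - ?s k U)\<^sup>2 \<le> 4 * (2 ^ k * M / 2 ^ m)\<^sup>2"
        by (simp only: power_mult_distrib abs_power2) simp
      have sq: "(x + y + z)\<^sup>2 \<le> 3 * x\<^sup>2 + (3 * z\<^sup>2 + 3 * y\<^sup>2)" for x y z :: real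
        using zero_le_power2[of "x - y"] zero_le_power2[of "y - z"] zero_le_power2[of "x - z"]
        by (simp add: power2_eq_square algebra_simps)
      show "(?s m (translate w ?t U) - ?s m U)\<^sup>2
        \<le> 3 * (?s m (translate w ?t U) - ?s k (translate w ?t U))\<^sup>2 + (3 * (?s m U - ?s k U)\<^sup>2 + 12 * (2 ^ k * M / 2 ^ m)\<^sup>2)"
        using sq[of "?s m (translate w ?t U) - ?s k (translate w ?t U)" "?s k (translate w ?t U) - ?s k U" "?s k U - ?s m U"] c
        by (simp add: power2_commute[of "?s k U" "?s m U"])
    qed (use int2[of m ?t m 0] int2[of m ?t k ?t] int2[of m 0 k 0] in auto)
    also have "\<dots> = 3 * (\<integral>U. (?s m (translate w ?t U) - ?s k (translate w ?t U))\<^sup>2 \<partial>cube) + (3 * ?I + 12 * (2 ^ k * M / 2 ^ m)\<^sup>2)"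
      using int2[of m ?t k ?t] int2[of m 0 k 0] by simp
    finally show ?thesis using 1 by simp
  qed
  show ?thesis
  proof (rule LIMSEQ_I)
    fix r :: real assume "r > 0"
    then obtain k where k: "\<And>m n. m \<ge> k \<Longrightarrow> n \<ge> k \<Longrightarrow> (\<integral>U. (?s m U - ?s n U)\<^sup>2 \<partial>cube) \<le> r / 12"
      using w'.slope_Cauchy[of "r / 12"] by auto
    have p: "(\<lambda>m. a / 2 ^ m) \<longlonglongrightarrow> 0" for a :: real by real_asymp
    have "(\<lambda>m. a / 2 ^ m + 12 * (b / 2 ^ m)\<^sup>2) \<longlonglongrightarrow> 0 + 12 * 0\<^sup>2" for a b :: real
      by (intro tendsto_intros p)
    then have "(\<lambda>m. a / 2 ^ m + 12 * (b / 2 ^ m)\<^sup>2) \<longlonglongrightarrow> 0" for a b :: real by simp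
    then have "eventually (\<lambda>m. 24 * M'\<^sup>2 * mass w / 2 ^ m + 12 * (2 ^ k * M / 2 ^ m)\<^sup>2 < r / 2) sequentially"
      by (rule order_tendstoD(2)) (use \<open>r > 0\<close> in simp)
    then obtain m1 where m1: "\<And>m. m \<ge> m1 \<Longrightarrow> 24 * M'\<^sup>2 * mass w / 2 ^ m + 12 * (2 ^ k * M / 2 ^ m)\<^sup>2 < r / 2"
      by (auto simp: eventually_sequentially)
    show "\<exists>no. \<forall>n\<ge>no. norm ((\<integral>U. (?s n (translate w (1 / 2 ^ n) U) - ?s n U)\<^sup>2 \<partial>cube) - 0) < r"
    proof (intro exI allI impI)
      fix n assume "n \<ge> max m1 k"
      then show "norm ((\<integral>U. (?s n (translate w (1 / 2 ^ n) U) - ?s n U)\<^sup>2 \<partial>cube) - 0) < r"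
        using key[of n k] k[of n k] m1[of n] by simp
    qed
  qed
qed

section \<open>Linearization of bi-Lipschitz maps into sequence spaces\<close>

text \<open>The target is a space of sequences whose norm is the supremum of the increasing seminorms \<open>N J\<close>, each
  of which depends on finitely many coordinates. Norms are never formed: the upper bound is asked of every
  \<open>N J\<close>, the lower bound of some \<open>N J\<close> up to \<open>e\<close>. The map \<open>F\<close> is measurable coordinate by coordinate and
  is bi-Lipschitz in the directions of \<open>int_vectors\<close> with respect to \<open>\<nu>\<close>, at the points of \<open>Bd\<close> as far as the
  lower bound is concerned.\<close>

locale bilipschitz_into_sequences =
  fixes F :: "(nat \<Rightarrow> real) \<Rightarrow> 'b::countable \<Rightarrow> real"
    and N :: "nat \<Rightarrow> ('b \<Rightarrow> real) \<Rightarrow> real"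
    and box :: "nat \<Rightarrow> 'b set"
    and \<nu> :: "(nat \<Rightarrow> real) \<Rightarrow> real"
    and L c :: real
    and Bd :: "(nat \<Rightarrow> real) set"
  assumes N_add: "\<And>J x y. N J (\<lambda>b. x b + y b) \<le> N J x + N J y"
    and N_scale: "\<And>J a x. N J (\<lambda>b. a * x b) = \<bar>a\<bar> * N J x"
    and N_Suc: "\<And>J x. N J x \<le> N (Suc J) x"
    and N_coord: "\<And>J b x. b \<in> box J \<Longrightarrow> \<bar>x b\<bar> \<le> N J x"
    and N_le: "\<And>J x. N J x \<le> (\<Sum>b\<in>box J. \<bar>x b\<bar>)"
    and finite_box: "\<And>J. finite (box J)"
    and cover: "\<And>b. \<exists>J. b \<in> box J"
    and F_meas [measurable]: "\<And>b. (\<lambda>U. F U b) \<in> borel_measurable cube"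
    and upper: "\<And>w t U J. w \<in> int_vectors \<Longrightarrow> N J (\<lambda>b. F (translate w t U) b - F U b) \<le> L * \<bar>t\<bar> * \<nu> w"
    and AE_Bd: "AE U in cube. U \<in> Bd"
    and lower: "\<And>w t U e. w \<in> int_vectors \<Longrightarrow> U \<in> Bd \<Longrightarrow> e > 0 \<Longrightarrow>
      \<exists>J. N J (\<lambda>b. F (translate w t U) b - F U b) \<ge> c * \<bar>t\<bar> * \<nu> w - e"
begin

lemma N_zero: "N J (\<lambda>_. 0) = 0"
  using N_scale[of J 0 "\<lambda>_. 0"] by simp

lemma N_nonneg: "N J x \<ge> 0"
  using N_add[of J x "\<lambda>b. - 1 * x b"] N_scale[of J "-1" x] N_zero[of J] by simp

lemma N_mono: "J \<le> J' \<Longrightarrow> N J x \<le> N J' x"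
  by (rule lift_Suc_mono_le[of "\<lambda>J. N J x"]) (rule N_Suc)

lemma N_sum: "finite S \<Longrightarrow> N J (\<lambda>b. \<Sum>j\<in>S. x j b) \<le> (\<Sum>j\<in>S. N J (x j))"
proof (induction S rule: finite_induct)
  case (insert a S)
  then show ?case using N_add[of J "x a" "\<lambda>b. \<Sum>j\<in>S. x j b"] by simp
qed (simp add: N_zero)

lemma N_diff: "\<bar>N J x - N J y\<bar> \<le> (\<Sum>b\<in>box J. \<bar>x b - y b\<bar>)"
proof -
  have "N J x - N J y \<le> (\<Sum>b\<in>box J. \<bar>x b - y b\<bar>)" for x y
    using N_add[of J y "\<lambda>b. x b - y b"] N_le[of J "\<lambda>b. x b - y b"] by simp
  from this[of x y] this[of y x] show ?thesis by (simp add: abs_minus_commute abs_le_iff)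
qed

lemma N_tendsto:
  assumes "\<And>b. ((\<lambda>i. X i b) \<longlongrightarrow> x b) G"
  shows "((\<lambda>i. N J (X i)) \<longlongrightarrow> N J x) G"
proof (rule LIM_zero_cancel, rule Lim_null_comparison)
  show "\<forall>\<^sub>F i in G. norm (N J (X i) - N J x) \<le> (\<Sum>b\<in>box J. \<bar>X i b - x b\<bar>)"
    by (simp add: N_diff)
  show "((\<lambda>i. \<Sum>b\<in>box J. \<bar>X i b - x b\<bar>) \<longlongrightarrow> 0) G"
    by (intro tendsto_null_sum tendsto_rabs_zero LIM_zero assms)
qed

lemma N_measurable [measurable (raw)]:
  assumes "\<And>b. (\<lambda>z. X z b) \<in> borel_measurable M"
  shows "(\<lambda>z. N J (X z)) \<in> borel_measurable M"
proof -
  have "continuous_on UNIV (N J)"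
    unfolding continuous_on_def
  proof
    fix x
    show "(N J \<longlongrightarrow> N J x) (at x within UNIV)"
    proof (rule N_tendsto[of "\<lambda>y. y"])
      show "((\<lambda>y. y b) \<longlongrightarrow> x b) (at x within UNIV)" for b
        using continuous_on_product_coordinates[of b] unfolding continuous_on_def by blast
    qed
  qed
  then have "N J \<in> borel_measurable borel" by (rule borel_measurable_continuous_onI)
  moreover have "X \<in> M \<rightarrow>\<^sub>M borel" by (rule measurable_coordinatewise_then_product) (rule assms)
  ultimately show ?thesis by (rule measurable_compose[rotated])
qed

definition D :: "(nat \<Rightarrow> real) \<Rightarrow> nat \<Rightarrow> (nat \<Rightarrow> real) \<Rightarrow> 'b \<Rightarrow> real"
  where "D w m U = (\<lambda>b. slope (\<lambda>V. F V b) w m U)"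

lemma lipschitz_coord:
  assumes "w \<in> int_vectors"
  shows "lipschitz_along (\<lambda>V. F V b) w (L * \<nu> w)"
proof
  fix U t
  obtain J where "b \<in> box J" using cover by blast
  then have "\<bar>F (translate w t U) b - F U b\<bar> \<le> N J (\<lambda>b. F (translate w t U) b - F U b)" by (rule N_coord)
  then show "\<bar>F (translate w t U) b - F U b\<bar> \<le> L * \<nu> w * \<bar>t\<bar>"
    using upper[OF assms, of J t U] by (simp add: mult_ac)
qed (use assms in \<open>auto simp: int_vectors_def\<close>)

lemma D_measurable [measurable]: "(\<lambda>U. D w m U b) \<in> borel_measurable cube"
  unfolding D_def slope_def by measurable

lemma N_D: "N J (D w m U) = 2 ^ m * N J (\<lambda>b. F (translate w (1 / 2 ^ m) U) b - F U b)"
  unfolding D_def slope_def by (subst N_scale) simp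

lemma N_D_le: "w \<in> int_vectors \<Longrightarrow> N J (D w m U) \<le> L * \<nu> w"
  using upper[of w J "1 / 2 ^ m" U] unfolding N_D by (simp add: field_simps)

lemma N_D_ge:
  assumes "w \<in> int_vectors" "U \<in> Bd" "e > 0"
  shows "\<exists>J. N J (D w m U) \<ge> c * \<nu> w - e"
proof -
  have "e / 2 ^ m > 0" using assms by simp
  from lower[OF assms(1,2) this, of "1 / 2 ^ m"]
  obtain J where "N J (\<lambda>b. F (translate w (1 / 2 ^ m) U) b - F U b) \<ge> c * \<bar>1 / 2 ^ m\<bar> * \<nu> w - e / 2 ^ m" by blast
  then have "2 ^ m * N J (\<lambda>b. F (translate w (1 / 2 ^ m) U) b - F U b) \<ge> 2 ^ m * (c * \<bar>1 / 2 ^ m\<bar> * \<nu> w - e / 2 ^ m)"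
    by (intro mult_left_mono) auto
  then show ?thesis unfolding N_D by (auto simp: right_diff_distrib)
qed

lemma M_nonneg: "w \<in> int_vectors \<Longrightarrow> L * \<nu> w \<ge> 0"
  using N_D_le[of w 0 0] N_nonneg[of 0] order_trans by blast

text \<open>The quotient with step \<open>2 ^ (- m)\<close> is a mean of finer ones at translated points; \<open>N J\<close> is convex and the
  translations hardly affect the integral.\<close>

lemma N_energy:
  assumes w: "w \<in> int_vectors"
  shows "(\<integral>U. N J (D w m U) \<partial>cube) \<le> (\<integral>U. N J (D w (m + k) U) \<partial>cube) + 2 * (L * \<nu> w) * mass w / 2 ^ m"
proof -
  let ?t = "\<lambda>j. real j / 2 ^ (m + k)"
  let ?n = "\<lambda>U. N J (D w (m + k) U)"
  have B: "\<bar>N J (D w m U)\<bar> \<le> L * \<nu> w" for m U using N_D_le[OF w, of J m U] N_nonneg[of J] by simp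
  have int: "integrable cube (\<lambda>U. N J (D w m (translate w t U)))" for m t
    by (rule cube_integrable[OF _ B]) measurable
  have fin: "finite {n. w n \<noteq> 0}" using w by (simp add: int_vectors_def)
  have le: "N J (D w m U) \<le> (\<Sum>j<2^k. ?n (translate w (?t j) U)) / 2 ^ k" for U
  proof -
    have "D w m U = (\<lambda>b. (1 / 2 ^ k) * (\<Sum>j<2^k. D w (m + k) (translate w (?t j) U) b))"
      unfolding D_def by (subst slope_average[of _ w m U k]) simp
    then have "N J (D w m U) = \<bar>1 / 2 ^ k\<bar> * N J (\<lambda>b. \<Sum>j<2^k. D w (m + k) (translate w (?t j) U) b)"
      by (simp only: N_scale)
    also have "\<dots> \<le> \<bar>1 / 2 ^ k\<bar> * (\<Sum>j<2^k. ?n (translate w (?t j) U))"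
      by (intro mult_left_mono N_sum) auto
    finally show ?thesis by simp
  qed
  have "(\<integral>U. N J (D w m U) \<partial>cube) \<le> (\<integral>U. (\<Sum>j<2^k. ?n (translate w (?t j) U)) / 2 ^ k \<partial>cube)"
    by (intro integral_mono le integrable_divide Bochner_Integration.integrable_sum int) (use int[of m 0] in simp)
  also have "\<dots> = (\<Sum>j<2^k. (\<integral>U. ?n (translate w (?t j) U) \<partial>cube)) / 2 ^ k"
    by (subst integral_divide_zero, subst Bochner_Integration.integral_sum) (use int in auto)
  also have "\<dots> \<le> (\<Sum>j\<in>{..<2^k::nat}. (\<integral>U. ?n U \<partial>cube) + 2 * (L * \<nu> w) * mass w / 2 ^ m) / 2 ^ k"
  proof (intro divide_right_mono sum_mono)
    fix j :: nat assume "j \<in> {..<2^k}"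
    then have "real j \<le> 2 ^ k" by (metis lessThan_iff less_imp_le of_nat_le_iff of_nat_numeral of_nat_power)
    then have "\<bar>?t j\<bar> \<le> 1 / 2 ^ m" by (simp add: power_add field_simps)
    then have *: "2 * (L * \<nu> w) * \<bar>?t j\<bar> * mass w \<le> 2 * (L * \<nu> w) * (1 / 2 ^ m) * mass w"
      using M_nonneg[OF w] by (intro mult_right_mono mult_left_mono mass_nonneg) auto
    have "\<bar>(\<integral>U. ?n (translate w (?t j) U) \<partial>cube) - (\<integral>U. ?n U \<partial>cube)\<bar> \<le> 2 * (L * \<nu> w) * \<bar>?t j\<bar> * mass w"
      by (rule cube_shift[OF _ B fin]) measurable
    with * show "(\<integral>U. ?n (translate w (?t j) U) \<partial>cube) \<le> (\<integral>U. ?n U \<partial>cube) + 2 * (L * \<nu> w) * mass w / 2 ^ m"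
      by simp
  qed simp
  finally show ?thesis by simp
qed

text \<open>A diagonal sequence for the countably many pairs of a direction and a coordinate.\<close>

lemma subsequence_exists:
  obtains mm :: "nat \<Rightarrow> nat" where "\<And>i. i \<le> mm i"
    and "AE U in cube. \<forall>w\<in>int_vectors. \<forall>b. convergent (\<lambda>i. D w (mm i) U b)"
proof -
  define P where "P w b i m0 \<longleftrightarrow> (\<forall>m\<ge>m0. \<forall>n\<ge>m0. (\<integral>U. (D w m U b - D w n U b)\<^sup>2 \<partial>cube) \<le> (1/8) ^ i)" for w b i m0
  define th where "th w b i = (SOME m0. P w b i m0)" for w b i
  have th: "(\<integral>U. (D w m U b - D w n U b)\<^sup>2 \<partial>cube) \<le> (1/8) ^ i"
    if "w \<in> int_vectors" "m \<ge> th w b i" "n \<ge> th w b i" for w b i m n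
  proof -
    interpret lipschitz_along "\<lambda>V. F V b" w "L * \<nu> w" by (rule lipschitz_coord) fact
    obtain m0 where "\<And>m n. m \<ge> m0 \<Longrightarrow> n \<ge> m0 \<Longrightarrow> (\<integral>U. (s m U - s n U)\<^sup>2 \<partial>cube) \<le> (1/8) ^ i"
      using slope_Cauchy[of "(1/8) ^ i"] by auto
    then have "P w b i m0" unfolding D_def P_def by blast
    then have "P w b i (th w b i)" unfolding th_def by (rule someI)
    then show ?thesis using that(2,3) unfolding P_def by blast
  qed
  let ?I = "int_vectors \<times> (UNIV :: 'b set)"
  have cI: "countable ?I" using countable_int_vectors by auto
  have nI: "?I \<noteq> {}" using zero_int_vectors by auto
  define \<rho> where "\<rho> = from_nat_into ?I"
  define T where "T j i = th (fst (\<rho> j)) (snd (\<rho> j)) i" for j i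
  define mm where "mm i = i + (\<Sum>j\<le>i. \<Sum>k\<le>i. T j k)" for i
  have mmS: "mm i \<le> mm (Suc i)" for i
  proof -
    have "(\<Sum>j\<le>i. \<Sum>k\<le>i. T j k) \<le> (\<Sum>j\<le>i. \<Sum>k\<le>Suc i. T j k)" by (rule sum_mono) simp
    also have "\<dots> \<le> (\<Sum>j\<le>Suc i. \<Sum>k\<le>Suc i. T j k)" by simp
    finally show ?thesis unfolding mm_def by simp
  qed
  have mmT: "T j i \<le> mm i" if "j \<le> i" for i j
  proof -
    have "T j i \<le> (\<Sum>k\<le>i. T j k)" by (rule member_le_sum) auto
    also have "\<dots> \<le> (\<Sum>j\<le>i. \<Sum>k\<le>i. T j k)" using that by (intro member_le_sum) auto
    finally show ?thesis by (simp add: mm_def)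
  qed
  have "AE U in cube. \<forall>p\<in>?I. convergent (\<lambda>i. D (fst p) (mm i) U (snd p))"
  proof (subst AE_ball_countable[OF cI], rule)
    fix p assume p: "p \<in> ?I"
    then obtain j where j: "\<rho> j = p" unfolding \<rho>_def using from_nat_into_surj[OF cI] by blast
    have w: "fst p \<in> int_vectors" using p by auto
    interpret lipschitz_along "\<lambda>V. F V (snd p)" "fst p" "L * \<nu> (fst p)" by (rule lipschitz_coord[OF w])
    show "AE U in cube. convergent (\<lambda>i. D (fst p) (mm i) U (snd p))"
    proof (rule cube.AE_convergent_of_small_increments[of _ _ j])
      show "\<bar>D (fst p) (mm i) U (snd p)\<bar> \<le> L * \<nu> (fst p)" for i U
        unfolding D_def by (rule slope_bound)
      show "(\<integral>U. (D (fst p) (mm (Suc i)) U (snd p) - D (fst p) (mm i) U (snd p))\<^sup>2 \<partial>cube) \<le> (1/8) ^ i" if "j \<le> i" for i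
      proof (rule th[OF w])
        show "th (fst p) (snd p) i \<le> mm i" using mmT[OF that] by (simp add: T_def j)
        then show "th (fst p) (snd p) i \<le> mm (Suc i)" using mmS[of i] by simp
      qed
    qed measurable
  qed
  then have "AE U in cube. \<forall>w\<in>int_vectors. \<forall>b. convergent (\<lambda>i. D w (mm i) U b)"
    by eventually_elim auto
  moreover have "i \<le> mm i" for i by (simp add: mm_def)
  ultimately show ?thesis by (rule that[rotated])
qed

lemma D_add:
  "D (\<lambda>n. w n + w' n) m U b = D w m U b + D w' m (translate w (1 / 2 ^ m) U) b"
proof -
  have "translate (\<lambda>n. w n + w' n) t U = translate w' t (translate w t U)" for t
    by (auto simp: translate_def algebra_simps)
  then show ?thesis by (simp add: D_def slope_def algebra_simps)
qed

context
  fixes mm :: "nat \<Rightarrow> nat"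
  assumes mm_ge: "\<And>i. i \<le> mm i"
    and mm_conv: "AE U in cube. \<forall>w\<in>int_vectors. \<forall>b. convergent (\<lambda>i. D w (mm i) U b)"
begin

lemma mm_at_top: "filterlim mm sequentially sequentially"
  by (rule filterlim_at_top_mono[OF filterlim_ident]) (simp add: mm_ge)

definition g :: "(nat \<Rightarrow> real) \<Rightarrow> (nat \<Rightarrow> real) \<Rightarrow> 'b \<Rightarrow> real"
  where "g w U = (\<lambda>b. lim (\<lambda>i. D w (mm i) U b))"

lemma g_measurable [measurable]: "(\<lambda>U. g w U b) \<in> borel_measurable cube"
  unfolding g_def by (rule borel_measurable_lim_metric) measurable

lemma g_limit: "AE U in cube. \<forall>w\<in>int_vectors. \<forall>b. (\<lambda>i. D w (mm i) U b) \<longlonglongrightarrow> g w U b"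
  using mm_conv by eventually_elim (simp add: g_def convergent_LIMSEQ_iff)

text \<open>Quotients are additive up to a translation of the base point (\<open>D_add\<close>), whose effect vanishes in mean
  square.\<close>

lemma g_additive:
  assumes w: "w \<in> int_vectors" and w': "w' \<in> int_vectors"
  shows "AE U in cube. g (\<lambda>n. w n + w' n) U b = g w U b + g w' U b"
proof -
  let ?v = "\<lambda>n. w n + w' n"
  let ?h = "\<lambda>V. F V b"
  interpret A: lipschitz_along ?h w "L * \<nu> w" by (rule lipschitz_coord[OF w])
  interpret A': lipschitz_along ?h w' "L * \<nu> w'" by (rule lipschitz_coord[OF w'])
  define a where "a m U = D w' m (translate w (1 / 2 ^ m) U) b - D w' m U b" for m U
  have a_meas[measurable]: "a m \<in> borel_measurable cube" for m unfolding a_def by measurable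
  have "\<bar>a m U\<bar> \<le> 2 * (L * \<nu> w')" for m U
    using A'.slope_bound[of m "translate w (1 / 2 ^ m) U"] A'.slope_bound[of m U] unfolding a_def D_def by linarith
  then have aB: "norm ((a m U)\<^sup>2) \<le> (2 * (L * \<nu> w'))\<^sup>2" for m U
    unfolding real_norm_def by (rule A.sq_bound)
  have "(\<lambda>m. \<integral>U. (a m U)\<^sup>2 \<partial>cube) \<longlonglongrightarrow> 0"
    unfolding a_def D_def by (rule slope_translate_vanishes) (rule A.lipschitz_along_axioms A'.lipschitz_along_axioms)+
  then have lim0: "(\<lambda>i. \<integral>U. (a (mm i) U)\<^sup>2 \<partial>cube) \<longlonglongrightarrow> 0"
    by (rule filterlim_compose[OF _ mm_at_top])
  have conv: "AE U in cube. (\<lambda>i. (a (mm i) U)\<^sup>2) \<longlonglongrightarrow> (g ?v U b - g w U b - g w' U b)\<^sup>2"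
    using g_limit
  proof eventually_elim
    case (elim U)
    have "a m U = D ?v m U b - D w m U b - D w' m U b" for m
      unfolding a_def D_add by simp
    moreover have "(\<lambda>i. D ?v (mm i) U b - D w (mm i) U b - D w' (mm i) U b) \<longlonglongrightarrow> g ?v U b - g w U b - g w' U b"
      using elim w w' int_vectors_add[OF w w'] by (intro tendsto_diff) auto
    ultimately show ?case by (auto intro: tendsto_power)
  qed
  let ?G = "\<lambda>U. (g ?v U b - g w U b - g w' U b)\<^sup>2"
  have "(\<lambda>i. \<integral>U. (a (mm i) U)\<^sup>2 \<partial>cube) \<longlonglongrightarrow> (\<integral>U. ?G U \<partial>cube)"
    by (rule integral_dominated_convergence[where w="\<lambda>_. (2 * (L * \<nu> w'))\<^sup>2"]) (use conv aB in auto)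
  then have "(\<integral>U. ?G U \<partial>cube) = 0" using lim0 LIMSEQ_unique by blast
  moreover have "integrable cube ?G"
    by (rule integrable_dominated_convergence[where w="\<lambda>_. (2 * (L * \<nu> w'))\<^sup>2" and s="\<lambda>i U. (a (mm i) U)\<^sup>2"]) (use conv aB in auto)
  ultimately have "AE U in cube. ?G U = 0"
    by (simp add: integral_nonneg_eq_0_iff_AE)
  then show ?thesis by eventually_elim (simp add: algebra_simps)
qed

text \<open>Coordinatewise limits may lose norm, so the lower bound does not pass to the limit pointwise. It is
  recovered from integrals. Let \<open>es\<close> be the supremum over \<open>J\<close> of the integrals of \<open>N J (g w U)\<close>. By \<open>N_energy\<close>
  the integrals of \<open>N J (D w m U)\<close> exceed \<open>es\<close> by \<open>O(2 ^ (- m))\<close> at most. As the norm of \<open>D w m U\<close> is at least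
  \<open>c * \<nu> w\<close>, the same bound holds for the integral of \<open>max (N J (D w m U)) (c * \<nu> w)\<close>, and it passes to the limit
  in \<open>m\<close>, then in \<open>J\<close>: replacing the norm of \<open>g w U\<close> by its maximum with \<open>c * \<nu> w\<close> does not increase the integral.\<close>

lemma g_lower:
  assumes w: "w \<in> int_vectors" and cn: "c * \<nu> w \<ge> 0"
  shows "AE U in cube. \<forall>e>0. \<exists>J. N J (g w U) \<ge> c * \<nu> w - e"
proof -
  let ?k = "c * \<nu> w" and ?M = "L * \<nu> w"
  have B: "\<bar>N J (D w m U)\<bar> \<le> ?M" for J m U using N_D_le[OF w, of J m U] N_nonneg[of J] by simp
  have intD: "integrable cube (\<lambda>U. N J (D w m U))" for J m by (rule cube_integrable[OF _ B]) measurable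
  have conv: "AE U in cube. \<forall>J. (\<lambda>i. N J (D w (mm i) U)) \<longlonglongrightarrow> N J (g w U)"
    using g_limit by eventually_elim (use w in \<open>auto intro!: N_tendsto\<close>)
  have gB: "AE U in cube. \<forall>J. N J (g w U) \<le> ?M"
    using conv by eventually_elim (meson LIMSEQ_le_const2 N_D_le[OF w])
  have intg: "integrable cube (\<lambda>U. N J (g w U))" for J
    by (rule cube.integrable_const_bound[of _ ?M]) (use gB N_nonneg in \<open>auto elim: eventually_mono\<close>)
  have lim: "(\<lambda>i. \<integral>U. N J (D w (mm i) U) \<partial>cube) \<longlonglongrightarrow> (\<integral>U. N J (g w U) \<partial>cube)" for J
    by (rule integral_dominated_convergence[where w="\<lambda>_. ?M"]) (use conv B in \<open>auto elim: eventually_mono\<close>)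
  have en: "(\<integral>U. N J (D w m U) \<partial>cube) \<le> (\<integral>U. N J (g w U) \<partial>cube) + 2 * ?M * mass w / 2 ^ m" for J m
  proof (rule LIMSEQ_le_const)
    show "(\<lambda>i. (\<integral>U. N J (D w (mm i) U) \<partial>cube) + 2 * ?M * mass w / 2 ^ m) \<longlonglongrightarrow> (\<integral>U. N J (g w U) \<partial>cube) + 2 * ?M * mass w / 2 ^ m"
      by (intro tendsto_add lim tendsto_const)
    show "\<exists>N0. \<forall>i\<ge>N0. (\<integral>U. N J (D w m U) \<partial>cube) \<le> (\<integral>U. N J (D w (mm i) U) \<partial>cube) + 2 * ?M * mass w / 2 ^ m"
    proof (intro exI allI impI)
      fix i assume "m \<le> i"
      then have "m + (mm i - m) = mm i" using mm_ge[of i] by simp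
      then show "(\<integral>U. N J (D w m U) \<partial>cube) \<le> (\<integral>U. N J (D w (mm i) U) \<partial>cube) + 2 * ?M * mass w / 2 ^ m"
        using N_energy[OF w, of J m "mm i - m"] by simp
    qed
  qed
  define e where "e J = (\<integral>U. N J (g w U) \<partial>cube)" for J
  have "e J \<le> ?M" for J
  proof -
    have "e J \<le> (\<integral>U. ?M \<partial>cube)" unfolding e_def
      by (rule integral_mono_AE[OF intg]) (use gB in \<open>auto elim: eventually_mono\<close>)
    then show ?thesis by simp
  qed
  moreover have "incseq e"
    unfolding e_def by (intro incseq_SucI integral_mono intg N_Suc)
  ultimately obtain es where es: "e \<longlonglongrightarrow> es" and e_le: "\<And>J. e J \<le> es"
    by (meson incseq_convergent)
  have maxD: "(\<integral>U. max (N J (D w m U)) ?k \<partial>cube) \<le> es + 2 * ?M * mass w / 2 ^ m" for J m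
  proof (rule LIMSEQ_le_const2)
    let ?\<phi> = "\<lambda>J' U. max (N J (D w m U)) (min ?k (N J' (D w m U)))"
    show "(\<lambda>J'. \<integral>U. ?\<phi> J' U \<partial>cube) \<longlonglongrightarrow> (\<integral>U. max (N J (D w m U)) ?k \<partial>cube)"
    proof (rule integral_dominated_convergence[where w="\<lambda>_. ?M"])
      show "AE U in cube. norm (?\<phi> J' U) \<le> ?M" for J'
      proof (rule AE_I2)
        fix U show "norm (?\<phi> J' U) \<le> ?M"
          using B[of J m U] B[of J' m U] N_nonneg[of J "D w m U"] N_nonneg[of J' "D w m U"] cn by (simp add: max_def min_def)
      qed
      show "AE U in cube. (\<lambda>J'. ?\<phi> J' U) \<longlonglongrightarrow> max (N J (D w m U)) ?k"
        using AE_Bd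
      proof eventually_elim
        case (elim U)
        have "(\<lambda>J'. min ?k (N J' (D w m U))) \<longlonglongrightarrow> ?k"
        proof (rule LIMSEQ_I)
          fix r :: real assume "r > 0"
          then obtain J0 where J0: "N J0 (D w m U) \<ge> ?k - r / 2"
            using N_D_ge[OF w elim, of "r / 2" m] by auto
          show "\<exists>no. \<forall>n\<ge>no. norm (min ?k (N n (D w m U)) - ?k) < r"
          proof (intro exI allI impI)
            fix n assume "n \<ge> J0"
            then have "N J0 (D w m U) \<le> N n (D w m U)" by (rule N_mono)
            then show "norm (min ?k (N n (D w m U)) - ?k) < r" using J0 \<open>r > 0\<close> by (simp add: min_def)
          qed
        qed
        then show ?case by (intro tendsto_max tendsto_const)
      qed
    qed auto
    show "\<exists>N0. \<forall>J'\<ge>N0. (\<integral>U. ?\<phi> J' U \<partial>cube) \<le> es + 2 * ?M * mass w / 2 ^ m"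
    proof (intro exI allI impI)
      fix J' assume "J \<le> J'"
      have "(\<integral>U. ?\<phi> J' U \<partial>cube) \<le> (\<integral>U. N J' (D w m U) \<partial>cube)"
      proof (rule integral_mono)
        show "integrable cube (?\<phi> J')"
        proof (rule cube_integrable)
          show "\<bar>?\<phi> J' U\<bar> \<le> ?M" for U
            using B[of J m U] B[of J' m U] N_nonneg[of J "D w m U"] N_nonneg[of J' "D w m U"] cn by (simp add: max_def min_def)
        qed measurable
        show "?\<phi> J' U \<le> N J' (D w m U)" for U using N_mono[OF \<open>J \<le> J'\<close>] by simp
      qed (rule intD)
      with en[of J' m] e_le[of J'] show "(\<integral>U. ?\<phi> J' U \<partial>cube) \<le> es + 2 * ?M * mass w / 2 ^ m"
        unfolding e_def by linarith
    qed
  qed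
  have max_norm: "norm (max x ?k) \<le> ?M + ?k" if "0 \<le> x" "x \<le> ?M" for x
    using that cn by (auto simp: max_def)
  have maxg: "(\<integral>U. max (N J (g w U)) ?k \<partial>cube) \<le> es" for J
  proof (rule LIMSEQ_le)
    show "(\<lambda>i. \<integral>U. max (N J (D w (mm i) U)) ?k \<partial>cube) \<longlonglongrightarrow> (\<integral>U. max (N J (g w U)) ?k \<partial>cube)"
    proof (rule integral_dominated_convergence[where w="\<lambda>_. ?M + ?k"])
      show "AE U in cube. (\<lambda>i. max (N J (D w (mm i) U)) ?k) \<longlonglongrightarrow> max (N J (g w U)) ?k"
        using conv by eventually_elim (intro tendsto_max tendsto_const, blast)
      show "AE U in cube. norm (max (N J (D w (mm i) U)) ?k) \<le> ?M + ?k" for i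
        by (intro AE_I2 max_norm N_nonneg N_D_le w)
    qed auto
    have "(\<lambda>m. a / 2 ^ m) \<longlonglongrightarrow> 0" for a :: real by real_asymp
    from tendsto_add[OF tendsto_const filterlim_compose[OF this mm_at_top]]
    show "(\<lambda>i. es + 2 * ?M * mass w / 2 ^ mm i) \<longlonglongrightarrow> es" by simp
  qed (use maxD in blast)
  let ?G = "\<lambda>U. lim (\<lambda>J. N J (g w U))"
  have convG: "AE U in cube. (\<lambda>J. N J (g w U)) \<longlonglongrightarrow> ?G U"
    using gB
  proof eventually_elim
    case (elim U)
    have "incseq (\<lambda>J. N J (g w U))" by (intro incseq_SucI N_Suc)
    then show ?case using elim by (metis incseq_convergent limI)
  qed
  have GB: "AE U in cube. 0 \<le> ?G U \<and> ?G U \<le> ?M"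
    using gB convG by eventually_elim (meson LIMSEQ_le_const LIMSEQ_le_const2 N_nonneg)
  have [measurable]: "?G \<in> borel_measurable cube" by (rule borel_measurable_lim_metric) measurable
  let ?d = "\<lambda>U. max (?G U) ?k - ?G U"
  have d_int: "integrable cube ?d"
  proof (rule cube.integrable_const_bound[of _ "?M + ?k"])
    show "AE U in cube. norm (?d U) \<le> ?M + ?k"
      using GB by eventually_elim (use cn in \<open>auto simp: max_def\<close>)
  qed measurable
  have "(\<integral>U. ?d U \<partial>cube) \<le> es - es"
  proof (rule LIMSEQ_le)
    show "(\<lambda>J. \<integral>U. max (N J (g w U)) ?k - N J (g w U) \<partial>cube) \<longlonglongrightarrow> (\<integral>U. ?d U \<partial>cube)"
    proof (rule integral_dominated_convergence[where w="\<lambda>_. ?M + ?k"])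
      show "AE U in cube. (\<lambda>J. max (N J (g w U)) ?k - N J (g w U)) \<longlonglongrightarrow> ?d U"
        using convG by eventually_elim (intro tendsto_diff tendsto_max tendsto_const)
      show "AE U in cube. norm (max (N J (g w U)) ?k - N J (g w U)) \<le> ?M + ?k" for J
        using gB
      proof eventually_elim
        case (elim U)
        then have "N J (g w U) \<le> ?M" by blast
        then show ?case using cn N_nonneg[of J "g w U"] M_nonneg[OF w] by (simp add: max_def)
      qed
    qed measurable
    show "(\<lambda>J. es - e J) \<longlonglongrightarrow> es - es" by (intro tendsto_diff tendsto_const es)
    show "\<exists>N0. \<forall>J\<ge>N0. (\<integral>U. max (N J (g w U)) ?k - N J (g w U) \<partial>cube) \<le> es - e J"
    proof (intro exI allI impI)
      fix J
      have "integrable cube (\<lambda>U. max (N J (g w U)) ?k)" using intg by auto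
      then show "(\<integral>U. max (N J (g w U)) ?k - N J (g w U) \<partial>cube) \<le> es - e J"
        using maxg[of J] intg[of J] by (simp add: e_def)
    qed
  qed
  moreover have "(\<integral>U. ?d U \<partial>cube) \<ge> 0" by (rule Bochner_Integration.integral_nonneg) simp
  ultimately have "(\<integral>U. ?d U \<partial>cube) = 0" by simp
  then have "AE U in cube. ?d U = 0"
    using integral_nonneg_eq_0_iff_AE[OF d_int] by auto
  with convG show ?thesis
  proof eventually_elim
    case (elim U)
    show ?case
    proof (intro allI impI)
      fix r :: real assume "r > 0"
      have "?k \<le> ?G U" using elim(2) by (simp add: max_def split: if_splits)
      then have "?k - r < ?G U" using \<open>r > 0\<close> by simp
      from order_tendstoD(1)[OF elim(1) this] obtain J where "?k - r < N J (g w U)"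
        by (auto simp: eventually_sequentially)
      then show "\<exists>J. ?k - r \<le> N J (g w U)" by (auto intro: less_imp_le)
    qed
  qed
qed

end

text \<open>All bounds hold simultaneously for almost every base point; \<open>T\<close> is the limit of the quotients at one
  such point.\<close>

theorem linearization:
  assumes cn: "\<And>w. w \<in> int_vectors \<Longrightarrow> c * \<nu> w \<ge> 0"
  obtains T :: "(nat \<Rightarrow> real) \<Rightarrow> 'b \<Rightarrow> real" where
    "\<And>w w'. w \<in> int_vectors \<Longrightarrow> w' \<in> int_vectors \<Longrightarrow> T (\<lambda>n. w n + w' n) = (\<lambda>b. T w b + T w' b)"
    "\<And>w J. w \<in> int_vectors \<Longrightarrow> N J (T w) \<le> L * \<nu> w"
    "\<And>w e. w \<in> int_vectors \<Longrightarrow> e > 0 \<Longrightarrow> \<exists>J. N J (T w) \<ge> c * \<nu> w - e"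
proof -
  obtain mm where mm: "\<And>i. i \<le> mm i"
    "AE U in cube. \<forall>w\<in>int_vectors. \<forall>b. convergent (\<lambda>i. D w (mm i) U b)"
    by (rule subsequence_exists) blast
  note ci = countable_int_vectors
  let ?g = "g mm"
  have "AE U in cube. \<forall>w\<in>int_vectors. \<forall>w'\<in>int_vectors. \<forall>b. ?g (\<lambda>n. w n + w' n) U b = ?g w U b + ?g w' U b"
    unfolding AE_ball_countable[OF ci] AE_all_countable using g_additive[OF mm] by blast
  moreover have "AE U in cube. \<forall>w\<in>int_vectors. \<forall>e>0. \<exists>J. N J (?g w U) \<ge> c * \<nu> w - e"
    unfolding AE_ball_countable[OF ci] using g_lower[OF mm _ cn] by blast
  moreover have "AE U in cube. \<forall>w\<in>int_vectors. \<forall>J. N J (?g w U) \<le> L * \<nu> w"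
    using g_limit[OF mm]
  proof eventually_elim
    case (elim U)
    show ?case
    proof (intro ballI allI)
      fix w J assume w: "w \<in> int_vectors"
      have "(\<lambda>i. N J (D w (mm i) U)) \<longlonglongrightarrow> N J (?g w U)" using elim w by (intro N_tendsto) auto
      then show "N J (?g w U) \<le> L * \<nu> w" using N_D_le[OF w] LIMSEQ_le_const2 by blast
    qed
  qed
  ultimately have "AE U in cube. (\<forall>w\<in>int_vectors. \<forall>w'\<in>int_vectors. \<forall>b. ?g (\<lambda>n. w n + w' n) U b = ?g w U b + ?g w' U b)
     \<and> (\<forall>w\<in>int_vectors. \<forall>e>0. \<exists>J. N J (?g w U) \<ge> c * \<nu> w - e) \<and> (\<forall>w\<in>int_vectors. \<forall>J. N J (?g w U) \<le> L * \<nu> w)"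
    by eventually_elim blast
  from eventually_happens'[OF cube.ae_filter_bot this] obtain U where
    U1: "\<forall>w\<in>int_vectors. \<forall>w'\<in>int_vectors. \<forall>b. ?g (\<lambda>n. w n + w' n) U b = ?g w U b + ?g w' U b"
    and U2: "\<forall>w\<in>int_vectors. \<forall>e>0. \<exists>J. N J (?g w U) \<ge> c * \<nu> w - e"
    and U3: "\<forall>w\<in>int_vectors. \<forall>J. N J (?g w U) \<le> L * \<nu> w"
    by (elim exE conjE)
  show ?thesis
  proof (rule that[of "\<lambda>w. ?g w U"])
    show "?g (\<lambda>n. w n + w' n) U = (\<lambda>b. ?g w U b + ?g w' U b)" if "w \<in> int_vectors" "w' \<in> int_vectors" for w w'
      using bspec[OF bspec[OF U1 that(1)] that(2)] by (intro ext) (rule spec)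
    show "N J (?g w U) \<le> L * \<nu> w" if "w \<in> int_vectors" for w J
      using bspec[OF U3 that] by (rule spec)
    show "\<exists>J. N J (?g w U) \<ge> c * \<nu> w - e" if "w \<in> int_vectors" "e > 0" for w e
      using bspec[OF U2 that(1)] that(2) by (elim allE impE)
  qed
qed

end

section \<open>Mixed sequence norms on finite sets\<close>

definition lp :: "real \<Rightarrow> 'i set \<Rightarrow> ('i \<Rightarrow> real) \<Rightarrow> real"
  where "lp s B a = (\<Sum>i\<in>B. \<bar>a i\<bar> powr s) powr (1 / s)"

lemma lp_nonneg [simp]: "lp s B a \<ge> 0"
  by (simp add: lp_def)

lemma lp_powr: "s \<noteq> 0 \<Longrightarrow> lp s B a powr s = (\<Sum>i\<in>B. \<bar>a i\<bar> powr s)"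
  by (simp add: lp_def powr_powr sum_nonneg)

lemma lp_cong: "B = B' \<Longrightarrow> (\<And>i. i \<in> B' \<Longrightarrow> \<bar>a i\<bar> = \<bar>a' i\<bar>) \<Longrightarrow> lp s B a = lp s B' a'"
  by (simp add: lp_def)

lemma lp_le_iff:
  assumes "s > 0" "u \<ge> 0"
  shows "lp s B a \<le> u \<longleftrightarrow> (\<Sum>i\<in>B. \<bar>a i\<bar> powr s) \<le> u powr s"
proof -
  have "lp s B a \<le> u \<longleftrightarrow> lp s B a powr s \<le> u powr s"
    using assms by (metis linorder_not_less lp_nonneg powr_less_mono2 powr_mono2 less_imp_le)
  then show ?thesis using assms by (simp add: lp_powr)
qed

lemma lp_mono:
  assumes "s > 0" "finite B'" "B \<subseteq> B'" "\<And>i. i \<in> B \<Longrightarrow> \<bar>a i\<bar> \<le> \<bar>a' i\<bar>"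
  shows "lp s B a \<le> lp s B' a'"
  unfolding lp_def
proof (rule powr_mono2)
  have "(\<Sum>i\<in>B. \<bar>a i\<bar> powr s) \<le> (\<Sum>i\<in>B. \<bar>a' i\<bar> powr s)"
    using assms by (intro sum_mono powr_mono2) auto
  then show "(\<Sum>i\<in>B. \<bar>a i\<bar> powr s) \<le> (\<Sum>i\<in>B'. \<bar>a' i\<bar> powr s)"
    using sum_mono2[OF assms(2,3), of "\<lambda>i. \<bar>a' i\<bar> powr s"] by force
qed (use assms in \<open>auto intro: sum_nonneg\<close>)

lemma lp_scale: "s > 0 \<Longrightarrow> lp s B (\<lambda>i. c * a i) = \<bar>c\<bar> * lp s B a"
  by (simp add: lp_def abs_mult powr_mult sum_distrib_left[symmetric] powr_powr)

lemma lp_coord: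
  assumes "s > 0" "finite B" "i \<in> B"
  shows "\<bar>a i\<bar> \<le> lp s B a"
proof -
  have "\<bar>a i\<bar> = lp s {i} a" using assms by (simp add: lp_def powr_powr)
  also have "\<dots> \<le> lp s B a" by (rule lp_mono) (use assms in auto)
  finally show ?thesis .
qed

lemma lp_le_sum:
  assumes "s \<ge> 1" "finite B"
  shows "lp s B a \<le> (\<Sum>i\<in>B. \<bar>a i\<bar>)"
proof -
  define S where "S = (\<Sum>i\<in>B. \<bar>a i\<bar>)"
  have S0: "S \<ge> 0" by (simp add: S_def sum_nonneg)
  have "(\<Sum>i\<in>B. \<bar>a i\<bar> powr s) \<le> (\<Sum>i\<in>B. \<bar>a i\<bar> * S powr (s - 1))"
  proof (rule sum_mono)
    fix i assume i: "i \<in> B"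
    then have "\<bar>a i\<bar> \<le> S" unfolding S_def using assms by (intro member_le_sum) auto
    then have "\<bar>a i\<bar> powr (s - 1) \<le> S powr (s - 1)" using assms by (intro powr_mono2) auto
    then have "\<bar>a i\<bar> * \<bar>a i\<bar> powr (s - 1) \<le> \<bar>a i\<bar> * S powr (s - 1)" by (rule mult_left_mono) simp
    then show "\<bar>a i\<bar> powr s \<le> \<bar>a i\<bar> * S powr (s - 1)"
      by (cases "a i = 0") (simp_all add: powr_diff)
  qed
  then have "(\<Sum>i\<in>B. \<bar>a i\<bar> powr s) \<le> S * S powr (s - 1)" by (simp add: S_def sum_distrib_right)
  then have "(\<Sum>i\<in>B. \<bar>a i\<bar> powr s) \<le> S powr s"
    using S0 assms by (cases "S = 0") (simp_all add: powr_diff)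
  then show ?thesis using lp_le_iff[of s S B a] S0 assms by (simp add: S_def)
qed

lemma lp_add:
  assumes s: "s \<ge> 1" and fin: "finite B"
  shows "lp s B (\<lambda>i. a i + b i) \<le> lp s B a + lp s B b"
proof (rule field_le_epsilon)
  fix e :: real assume e: "e > 0"
  let ?M = "count_space B"
  have int: "(LINT x|?M. f x) = (\<Sum>i\<in>B. f i)" for f :: "'a \<Rightarrow> real"
    using fin by (rule lebesgue_integral_count_space_finite)
  have itg: "integrable ?M f" for f :: "'a \<Rightarrow> real" using fin by (rule integrable_count_space)
  define u v where "u = lp s B a + e / 2" and "v = lp s B b + e / 2"
  have uv: "u > 0" "v > 0" using e by (auto simp: u_def v_def add_nonneg_pos)
  have "(LINT x|?M. \<bar>a x\<bar> powr s) \<le> u powr s"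
    unfolding int using lp_le_iff[of s u B a] uv s e by (simp add: u_def)
  moreover have "(LINT x|?M. \<bar>b x\<bar> powr s) \<le> v powr s"
    unfolding int using lp_le_iff[of s v B b] uv s e by (simp add: v_def)
  ultimately have "(LINT x|?M. \<bar>a x + b x\<bar> powr s) \<le> (u + v) powr s"
    by (intro Lp_add_bound(2)[OF s _ _ itg itg uv(1) _ uv(2)]) auto
  then have "lp s B (\<lambda>i. a i + b i) \<le> u + v"
    unfolding int using lp_le_iff[of s "u + v" B "\<lambda>i. a i + b i"] uv s by simp
  then show "lp s B (\<lambda>i. a i + b i) \<le> lp s B a + lp s B b + e" by (simp add: u_def v_def)
qed

text \<open>The norm of \<open>\<ell>\<^sub>p(\<ell>\<^bsub>s(n)\<^esub>)\<close> over a finite rectangle.\<close>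

definition mix :: "real \<Rightarrow> (nat \<Rightarrow> real) \<Rightarrow> nat set \<Rightarrow> nat set \<Rightarrow> (nat \<times> nat \<Rightarrow> real) \<Rightarrow> real"
  where "mix p s A B y = lp p A (\<lambda>n. lp (s n) B (\<lambda>i. y (n, i)))"

lemma mix_nonneg [simp]: "mix p s A B y \<ge> 0"
  by (simp add: mix_def)

lemma mix_scale: "p > 0 \<Longrightarrow> (\<And>n. s n > 0) \<Longrightarrow> mix p s A B (\<lambda>b. c * y b) = \<bar>c\<bar> * mix p s A B y"
  using lp_scale[of p A "\<bar>c\<bar>"] by (simp add: mix_def lp_scale)

lemma mix_mono:
  assumes "p > 0" "\<And>n. s n > 0" "finite A'" "finite B'" "A \<subseteq> A'" "B \<subseteq> B'"
    "\<And>n i. n \<in> A \<Longrightarrow> i \<in> B \<Longrightarrow> \<bar>y (n, i)\<bar> \<le> \<bar>y' (n, i)\<bar>"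
  shows "mix p s A B y \<le> mix p s A' B' y'"
  unfolding mix_def using assms by (intro lp_mono) (auto intro!: lp_mono)

lemma mix_add:
  assumes "p \<ge> 1" "\<And>n. s n \<ge> 1" "finite A" "finite B"
  shows "mix p s A B (\<lambda>b. y b + z b) \<le> mix p s A B y + mix p s A B z"
proof -
  have "mix p s A B (\<lambda>b. y b + z b) \<le> lp p A (\<lambda>n. lp (s n) B (\<lambda>i. y (n, i)) + lp (s n) B (\<lambda>i. z (n, i)))"
    unfolding mix_def using assms by (intro lp_mono) (auto intro!: lp_add abs_leI order_trans[OF lp_add] simp: abs_le_iff)
  also have "\<dots> \<le> mix p s A B y + mix p s A B z"
    unfolding mix_def by (rule lp_add) (use assms in auto)
  finally show ?thesis .
qed

lemma lp_block_le_mix: "p > 0 \<Longrightarrow> finite A \<Longrightarrow> n \<in> A \<Longrightarrow> lp (s n) B (\<lambda>i. y (n, i)) \<le> mix p s A B y"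
  using lp_coord[of p A n "\<lambda>n. lp (s n) B (\<lambda>i. y (n, i))"] by (simp add: mix_def)

lemma mix_coord:
  assumes "p > 0" "\<And>n. s n > 0" "finite A" "finite B" "n \<in> A" "i \<in> B"
  shows "\<bar>y (n, i)\<bar> \<le> mix p s A B y"
  using lp_coord[of "s n" B i "\<lambda>i. y (n, i)"] lp_block_le_mix[of p A n s B y] assms by fastforce

lemma mix_le_sum_blocks: "p \<ge> 1 \<Longrightarrow> finite A \<Longrightarrow> mix p s A B y \<le> (\<Sum>n\<in>A. lp (s n) B (\<lambda>i. y (n, i)))"
  using lp_le_sum[of p A "\<lambda>n. lp (s n) B (\<lambda>i. y (n, i))"] by (simp add: mix_def)

lemma mix_le_sum:
  assumes "p \<ge> 1" "\<And>n. s n \<ge> 1" "finite A" "finite B"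
  shows "mix p s A B y \<le> (\<Sum>b\<in>A \<times> B. \<bar>y b\<bar>)"
proof -
  have "mix p s A B y \<le> (\<Sum>n\<in>A. lp (s n) B (\<lambda>i. y (n, i)))" by (rule mix_le_sum_blocks) fact+
  also have "\<dots> \<le> (\<Sum>n\<in>A. \<Sum>i\<in>B. \<bar>y (n, i)\<bar>)"
    by (intro sum_mono lp_le_sum assms)
  also have "\<dots> = (\<Sum>b\<in>A \<times> B. \<bar>y b\<bar>)" by (simp add: sum.cartesian_product)
  finally show ?thesis .
qed

lemma mix_powr: "p \<noteq> 0 \<Longrightarrow> mix p s A B y powr p = (\<Sum>n\<in>A. lp (s n) B (\<lambda>i. y (n, i)) powr p)"
  by (simp add: mix_def lp_powr)

section \<open>Linear combinations in a mixed space\<close>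

text \<open>The seminorms \<open>N J\<close> exhaust the norm of the \<open>\<ell>\<^sub>p\<close> sum of the spaces \<open>\<ell>\<^bsub>s(n)\<^esub>\<close>; the space itself is
  represented by families of coefficients on \<open>nat \<times> nat\<close>, block index first.\<close>

locale mixed_space =
  fixes p :: real and s :: "nat \<Rightarrow> real"
  assumes p1: "p \<ge> 1" and s1: "\<And>n. s n \<ge> 1"
begin

definition N :: "nat \<Rightarrow> (nat \<times> nat \<Rightarrow> real) \<Rightarrow> real"
  where "N J = mix p s {..<J} {..<J}"

definition box :: "nat \<Rightarrow> (nat \<times> nat) set"
  where "box J = {..<J} \<times> {..<J}"

lemma p0: "p > 0" and s0: "s n > 0"
  using p1 s1[of n] by auto

lemma N_nonneg [simp]: "N J y \<ge> 0" by (simp add: N_def)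

lemma N_add: "N J (\<lambda>b. y b + z b) \<le> N J y + N J z"
  unfolding N_def by (rule mix_add) (use p1 s1 in auto)

lemma N_scale: "N J (\<lambda>b. c * y b) = \<bar>c\<bar> * N J y"
  unfolding N_def by (rule mix_scale) (use p0 s0 in auto)

lemma N_mono: "J \<le> J' \<Longrightarrow> (\<And>b. b \<in> box J \<Longrightarrow> \<bar>y b\<bar> \<le> \<bar>y' b\<bar>) \<Longrightarrow> N J y \<le> N J' y'"
  unfolding N_def by (rule mix_mono) (use p0 s0 in \<open>auto simp: box_def\<close>)

lemma N_coord: "b \<in> box J \<Longrightarrow> \<bar>y b\<bar> \<le> N J y"
  unfolding N_def box_def using mix_coord[of p s "{..<J}" "{..<J}" "fst b" "snd b" y] p0 s0 by auto

lemma N_le: "N J y \<le> (\<Sum>b\<in>box J. \<bar>y b\<bar>)"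
  unfolding N_def box_def by (rule mix_le_sum) (use p1 s1 in auto)

lemma finite_box [simp]: "finite (box J)" by (simp add: box_def)

lemma box_mono: "J \<le> J' \<Longrightarrow> box J \<subseteq> box J'" by (auto simp: box_def)

lemma box_cover: "\<exists>J. b \<in> box J"
  by (intro exI[of _ "Suc (max (fst b) (snd b))"]) (auto simp: box_def mem_Times_iff)

lemma N_zero [simp]: "N J (\<lambda>_. 0) = 0"
  using N_scale[of J 0 "\<lambda>_. 0"] by simp

lemma N_sum: "finite S \<Longrightarrow> N J (\<lambda>b. \<Sum>j\<in>S. a j * y j b) \<le> (\<Sum>j\<in>S. \<bar>a j\<bar> * N J (y j))"
proof (induction S rule: finite_induct)
  case (insert j S)
  then show ?case using N_add[of J "\<lambda>b. a j * y j b" "\<lambda>b. \<Sum>j\<in>S. a j * y j b"] by (simp add: N_scale)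
qed simp

end

definition unit_vec :: "nat \<Rightarrow> nat \<Rightarrow> real"
  where "unit_vec n = (\<lambda>m. if m = n then 1 else 0)"

lemma int_vectors_scale: "w \<in> int_vectors \<Longrightarrow> (\<lambda>n. of_int k * w n) \<in> int_vectors"
  unfolding int_vectors_def by (auto intro!: Ints_mult intro: finite_subset[of _ "{n. w n \<noteq> 0}"])

lemma unit_vec_int: "unit_vec n \<in> int_vectors"
  unfolding int_vectors_def unit_vec_def by auto

lemma additive_on_int_vectors:
  fixes T :: "(nat \<Rightarrow> real) \<Rightarrow> 'b \<Rightarrow> real"
  assumes add: "\<And>w w'. w \<in> int_vectors \<Longrightarrow> w' \<in> int_vectors \<Longrightarrow> T (\<lambda>n. w n + w' n) = (\<lambda>b. T w b + T w' b)"
    and fin: "finite S" and w: "\<And>n. n \<in> S \<Longrightarrow> w n \<in> \<int>"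
  shows "T (\<lambda>n. if n \<in> S then w n else 0) b = (\<Sum>n\<in>S. w n * T (unit_vec n) b)"
proof -
  have T0: "T (\<lambda>_. 0) b = 0"
    using fun_cong[OF add[OF zero_int_vectors zero_int_vectors], of b] by simp
  have nat: "T (\<lambda>n. real k * v n) b = real k * T v b" if v: "v \<in> int_vectors" for v k
  proof (induction k)
    case (Suc k)
    have "(\<lambda>n. real k * v n) \<in> int_vectors" using int_vectors_scale[OF v, of "int k"] by simp
    from fun_cong[OF add[OF this v], of b] Suc show ?case by (simp add: algebra_simps)
  qed (simp add: T0)
  have int: "T (\<lambda>n. of_int k * v n) b = of_int k * T v b" if v: "v \<in> int_vectors" for v k
  proof (cases "k \<ge> 0")
    case True
    then show ?thesis using nat[OF v, of "nat k"] by simp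
  next
    case False
    have v': "(\<lambda>n. of_int k * v n) \<in> int_vectors" "(\<lambda>n. of_int (-k) * v n) \<in> int_vectors"
      by (rule int_vectors_scale[OF v])+
    have "T (\<lambda>n. of_int (- k) * v n) b = of_int (- k) * T v b"
      using nat[OF v, of "nat (- k)"] False by simp
    with fun_cong[OF add[OF v'], of b] T0 show ?thesis by simp
  qed
  from fin w show ?thesis
  proof (induction S rule: finite_induct)
    case empty
    then show ?case by (simp add: T0)
  next
    case (insert m S)
    obtain k where k: "w m = of_int k" using insert.prems[of m] by (auto elim: Ints_cases)
    have 1: "(\<lambda>n. of_int k * unit_vec m n) \<in> int_vectors" by (rule int_vectors_scale[OF unit_vec_int])
    have 2: "(\<lambda>n. if n \<in> S then w n else 0) \<in> int_vectors"
      using insert by (auto simp: int_vectors_def intro: finite_subset[of _ S])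
    have "(\<lambda>n. if n \<in> insert m S then w n else 0) = (\<lambda>n. of_int k * unit_vec m n + (if n \<in> S then w n else 0))"
      using insert.hyps k by (auto simp: unit_vec_def fun_eq_iff)
    then have "T (\<lambda>n. if n \<in> insert m S then w n else 0) b
       = T (\<lambda>n. of_int k * unit_vec m n) b + T (\<lambda>n. if n \<in> S then w n else 0) b"
      using fun_cong[OF add[OF 1 2], of b] by simp
    then show ?case using insert int[OF unit_vec_int] k by simp
  qed
qed

lemma le_of_le_add_divide:
  fixes x y C :: real
  assumes "\<And>q::nat. q > (0::nat) \<Longrightarrow> x \<le> y + C / q"
  shows "x \<le> y"
proof (rule LIMSEQ_le_const[of "\<lambda>q. y + C / real q"])
  have "(\<lambda>q. y + C / real q) \<longlonglongrightarrow> y + 0" by (intro tendsto_add tendsto_const lim_const_over_n)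
  then show "(\<lambda>q. y + C / real q) \<longlonglongrightarrow> y" by simp
  show "\<exists>N. \<forall>n\<ge>N. x \<le> y + C / real n" using assms by (intro exI[of _ 1]) auto
qed

lemma power_growth:
  fixes \<alpha> \<beta> C1 C2 :: real
  assumes "\<alpha> > \<beta>" "C1 > 0"
  shows "\<exists>K0::nat. \<forall>K\<ge>K0. K \<ge> 1 \<and> C2 * real K powr \<beta> < C1 * real K powr \<alpha>"
proof -
  have "filterlim (\<lambda>K::nat. real K powr (\<alpha> - \<beta>)) at_top sequentially"
    by (rule filterlim_compose[OF real_powr_at_top filterlim_real_sequentially]) (use assms in simp)
  then have "eventually (\<lambda>K::nat. real K powr (\<alpha> - \<beta>) > C2 / C1) sequentially"
    by (simp add: filterlim_at_top_dense)
  then obtain K0 where K0: "\<And>K. K \<ge> K0 \<Longrightarrow> real K powr (\<alpha> - \<beta>) > C2 / C1"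
    by (auto simp: eventually_sequentially)
  show ?thesis
  proof (intro exI[of _ "max K0 1"] allI impI)
    fix K assume K: "K \<ge> max K0 1"
    then have "C2 < C1 * real K powr (\<alpha> - \<beta>)" using K0[of K] assms by (simp add: field_simps)
    then have "C2 * real K powr \<beta> < C1 * real K powr (\<alpha> - \<beta>) * real K powr \<beta>"
      using K by (intro mult_strict_right_mono) auto
    then show "K \<ge> 1 \<and> C2 * real K powr \<beta> < C1 * real K powr \<alpha>"
      using K by (simp add: mult.assoc powr_add[symmetric])
  qed
qed

context mixed_space begin

text \<open>An additive map on integer vectors determines a linear one. For a large integer \<open>q\<close> the numbers
  \<open>q * a n / \<omega> n\<close> are rounded to integers; by additivity the resulting error is \<open>O(1 / q)\<close> after division by \<open>q\<close>.\<close>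

lemma real_combinations:
  fixes T :: "(nat \<Rightarrow> real) \<Rightarrow> nat \<times> nat \<Rightarrow> real" and \<omega> :: "nat \<Rightarrow> real"
  assumes r: "r \<ge> 1" and \<omega>: "\<And>n. \<omega> n > 0" and c: "c > 0"
    and add: "\<And>w w'. w \<in> int_vectors \<Longrightarrow> w' \<in> int_vectors \<Longrightarrow> T (\<lambda>n. w n + w' n) = (\<lambda>b. T w b + T w' b)"
    and up: "\<And>w J. w \<in> int_vectors \<Longrightarrow> N J (T w) \<le> L * lp r {n. w n \<noteq> 0} (\<lambda>n. \<omega> n * w n)"
    and lo: "\<And>w e. w \<in> int_vectors \<Longrightarrow> e > 0 \<Longrightarrow> \<exists>J. N J (T w) \<ge> c * lp r {n. w n \<noteq> 0} (\<lambda>n. \<omega> n * w n) - e"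
  defines "y \<equiv> \<lambda>n b. T (unit_vec n) b / \<omega> n"
  shows "\<And>S a J. finite S \<Longrightarrow> N J (\<lambda>b. \<Sum>n\<in>S. a n * y n b) \<le> L * lp r S a"
    and "\<And>S a e. finite S \<Longrightarrow> e > 0 \<Longrightarrow> \<exists>J. N J (\<lambda>b. \<Sum>n\<in>S. a n * y n b) \<ge> c * lp r S a - e"
proof -
  define V where "V S a = (\<lambda>b. \<Sum>n\<in>S. a n * y n b)" for S a
  have r0: "r > 0" using r by simp
  have L0: "L \<ge> 0"
  proof -
    have "lp r {n. unit_vec 0 n \<noteq> 0} (\<lambda>n. \<omega> n * unit_vec 0 n) = \<omega> 0"
      using \<omega>[of 0] r0 by (simp add: unit_vec_def lp_def powr_powr)
    then have "0 \<le> L * \<omega> 0" using up[OF unit_vec_int[of 0], of 0] N_nonneg order_trans by metis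
    then show ?thesis using \<omega>[of 0] by (simp add: zero_le_mult_iff)
  qed
  define A where "A a q = (\<lambda>n. \<omega> n * of_int \<lfloor>real q * a n / \<omega> n\<rfloor> / real q)" for a and q :: nat
  have A_near: "\<bar>A a q n - a n\<bar> \<le> \<omega> n / q" if "q > 0" for a q n
  proof -
    let ?x = "real q * a n / \<omega> n"
    have "A a q n - a n = (\<omega> n / q) * (of_int \<lfloor>?x\<rfloor> - ?x)"
      using that \<omega>[of n] by (simp add: A_def field_simps)
    moreover have "\<bar>of_int \<lfloor>?x\<rfloor> - ?x\<bar> \<le> 1" by linarith
    then have "\<bar>\<omega> n / q\<bar> * \<bar>of_int \<lfloor>?x\<rfloor> - ?x\<bar> \<le> \<bar>\<omega> n / q\<bar> * 1" by (intro mult_left_mono) auto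
    ultimately show ?thesis using \<omega>[of n] that by (simp only: abs_mult) simp
  qed
  have grid: "N J (V S (A a q)) \<le> L * lp r S (A a q)"
    "e > 0 \<Longrightarrow> \<exists>J. N J (V S (A a q)) \<ge> c * lp r S (A a q) - e"
    if fin: "finite S" and q: "q > 0" for S a J q e
  proof -
    define w where "w = (\<lambda>n. if n \<in> S then real_of_int \<lfloor>real q * a n / \<omega> n\<rfloor> else 0)"
    have w: "w \<in> int_vectors" using fin by (auto simp: w_def int_vectors_def intro: finite_subset[of _ S])
    have Aw: "A a q n = \<omega> n * w n / q" if "n \<in> S" for n using that by (simp add: A_def w_def)
    have Tw: "T w b = q * V S (A a q) b" for b
    proof -
      have "T w b = (\<Sum>n\<in>S. real_of_int \<lfloor>real q * a n / \<omega> n\<rfloor> * T (unit_vec n) b)"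
        unfolding w_def by (rule additive_on_int_vectors[OF add fin]) auto
      also have "\<dots> = (\<Sum>n\<in>S. q * (A a q n * y n b))"
        using q \<omega> by (intro sum.cong) (auto simp: A_def y_def less_imp_neq[symmetric])
      finally show ?thesis by (simp add: V_def sum_distrib_left)
    qed
    have NT: "N J (T w) = q * N J (V S (A a q))" for J
    proof -
      have "T w = (\<lambda>b. q * V S (A a q) b)" by (rule ext) (rule Tw)
      then show ?thesis using N_scale[of J "real q" "V S (A a q)"] by simp
    qed
    have "lp r {n. w n \<noteq> 0} (\<lambda>n. \<omega> n * w n) = lp r S (\<lambda>n. \<omega> n * w n)"
      unfolding lp_def using fin r0
      by (intro arg_cong[where f="\<lambda>x. x powr (1 / r)"] sum.mono_neutral_left) (auto simp: w_def)
    also have "\<dots> = lp r S (\<lambda>n. q * A a q n)" using q by (intro lp_cong) (auto simp: Aw)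
    also have "\<dots> = q * lp r S (A a q)" by (subst lp_scale[OF r0]) simp
    finally have lw: "lp r {n. w n \<noteq> 0} (\<lambda>n. \<omega> n * w n) = q * lp r S (A a q)" .
    show "N J (V S (A a q)) \<le> L * lp r S (A a q)"
      using up[OF w, of J] q unfolding NT lw by (simp add: mult.left_commute)
    assume "e > 0"
    then obtain J where "N J (T w) \<ge> c * lp r {n. w n \<noteq> 0} (\<lambda>n. \<omega> n * w n) - q * e"
      using lo[OF w, of "q * e"] q by auto
    then have "q * N J (V S (A a q)) \<ge> q * (c * lp r S (A a q) - e)"
      unfolding NT lw by (simp add: algebra_simps)
    then show "\<exists>J. N J (V S (A a q)) \<ge> c * lp r S (A a q) - e" using q by auto
  qed
  have Ny: "N J (y n) \<le> L" for J n
  proof -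
    have "lp r {m. unit_vec n m \<noteq> 0} (\<lambda>m. \<omega> m * unit_vec n m) = \<omega> n"
      using \<omega>[of n] r0 by (simp add: unit_vec_def lp_def powr_powr)
    then have "N J (T (unit_vec n)) \<le> L * \<omega> n" using up[OF unit_vec_int[of n], of J] by simp
    moreover have "N J (y n) = N J (T (unit_vec n)) / \<omega> n"
      using N_scale[of J "1 / \<omega> n" "T (unit_vec n)"] \<omega>[of n] by (simp add: y_def)
    ultimately show ?thesis using \<omega>[of n] by (simp add: pos_divide_le_eq)
  qed
  have VL: "N J (V S d) \<le> L * (\<Sum>n\<in>S. \<bar>d n\<bar>)" if "finite S" for J S d
  proof -
    have "N J (V S d) \<le> (\<Sum>n\<in>S. \<bar>d n\<bar> * N J (y n))" unfolding V_def by (rule N_sum[OF that])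
    also have "\<dots> \<le> (\<Sum>n\<in>S. \<bar>d n\<bar> * L)" by (intro sum_mono mult_left_mono Ny) auto
    finally show ?thesis by (simp add: sum_distrib_left mult.commute)
  qed
  have Vdiff: "V S a = (\<lambda>b. V S a' b + V S (\<lambda>n. a n - a' n) b)" for S a a'
    by (simp add: V_def fun_eq_iff sum.distrib[symmetric] algebra_simps)
  have near: "(\<Sum>n\<in>S. \<bar>a n - A a q n\<bar>) \<le> (\<Sum>n\<in>S. \<omega> n) / q" if "q > 0" for S a q
    unfolding sum_divide_distrib using A_near[OF that] by (intro sum_mono) (simp add: abs_minus_commute)
  have lp_near: "\<bar>lp r S a - lp r S (A a q)\<bar> \<le> (\<Sum>n\<in>S. \<omega> n) / q" if "finite S" "q > 0" for S a q
  proof -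
    have "lp r S x \<le> lp r S y + (\<Sum>n\<in>S. \<bar>x n - y n\<bar>)" for x y
      using lp_add[OF r that(1), of y "\<lambda>n. x n - y n"] lp_le_sum[OF r that(1), of "\<lambda>n. x n - y n"] by simp
    from this[of a "A a q"] this[of "A a q" a] near[OF that(2), of a S] show ?thesis
      by (simp add: abs_le_iff abs_minus_commute)
  qed
  show upper: "N J (\<lambda>b. \<Sum>n\<in>S. a n * y n b) \<le> L * lp r S a" if fin: "finite S" for S a J
  proof -
    let ?W = "\<Sum>n\<in>S. \<omega> n"
    have bound: "N J (V S a) \<le> L * lp r S a + 2 * L * ?W / q" if q: "q > (0::nat)" for q :: nat
    proof -
      have "N J (V S a) \<le> N J (V S (A a q)) + N J (V S (\<lambda>n. a n - A a q n))"
        by (subst Vdiff[of S a "A a q"]) (rule N_add)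
      moreover have "N J (V S (A a q)) \<le> L * lp r S (A a q)" by (rule grid(1)[OF fin q])
      moreover have "lp r S (A a q) \<le> lp r S a + ?W / q" using lp_near[OF fin q, of a] by linarith
      then have "L * lp r S (A a q) \<le> L * (lp r S a + ?W / q)" using L0 by (rule mult_left_mono)
      moreover have "N J (V S (\<lambda>n. a n - A a q n)) \<le> L * (?W / q)"
        using VL[OF fin] near[OF q, of a S] L0 by (meson mult_left_mono order_trans)
      moreover have "L * (lp r S a + ?W / q) = L * lp r S a + L * (?W / q)" "2 * L * ?W / q = 2 * (L * (?W / q))"
        by (simp_all add: distrib_left)
      ultimately show ?thesis by linarith
    qed
    have "N J (V S a) \<le> L * lp r S a" by (rule le_of_le_add_divide) (rule bound)
    then show ?thesis by (simp add: V_def)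
  qed
  show "\<exists>J. N J (\<lambda>b. \<Sum>n\<in>S. a n * y n b) \<ge> c * lp r S a - e" if fin: "finite S" and e: "e > 0" for S a e
  proof -
    let ?W = "\<Sum>n\<in>S. \<omega> n"
    have W0: "?W \<ge> 0" by (intro sum_nonneg less_imp_le \<omega>)
    obtain q :: nat where q: "real q > 2 * (L + c) * ?W / e" using reals_Archimedean2 by blast
    have "2 * (L + c) * ?W / e \<ge> 0" using L0 c W0 e by simp
    then have q0: "q > 0" using q by (cases q) auto
    have small: "(L + c) * (?W / q) < e / 2"
    proof -
      have "2 * (L + c) * ?W < e * q" using q e by (simp add: pos_divide_less_eq mult.commute)
      then show ?thesis using q0 by (simp add: field_simps)
    qed
    have "e / 2 > 0" using e by simp
    from grid(2)[OF fin q0 this] obtain J where J: "N J (V S (A a q)) \<ge> c * lp r S (A a q) - e / 2" by blast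
    have "N J (V S (A a q)) \<le> N J (V S a) + N J (V S (\<lambda>n. A a q n - a n))"
      by (subst Vdiff[of S "A a q" a]) (rule N_add)
    moreover have "N J (V S (\<lambda>n. A a q n - a n)) \<le> L * (?W / q)"
      using VL[OF fin, of J "\<lambda>n. A a q n - a n"] mult_left_mono[OF near[OF q0, of a S] L0] by (simp add: abs_minus_commute)
    moreover have "c * (lp r S a - ?W / q) \<le> c * lp r S (A a q)"
      using lp_near[OF fin q0, of a] c by (intro mult_left_mono) auto
    ultimately have "N J (V S a) \<ge> c * lp r S a - e"
      using J small by (simp only: distrib_right right_diff_distrib)
    then show ?thesis by (auto simp: V_def)
  qed
qed

end

section \<open>Disjointly supported copies\<close>

lemma infinite_large:
  assumes "\<And>j0::nat. \<exists>j\<ge>j0. P j"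
  obtains S where "finite S" "card S = K" "\<And>j. j \<in> S \<Longrightarrow> P j"
proof -
  have "infinite {j. P j}" unfolding infinite_nat_iff_unbounded_le using assms by auto
  then obtain S where "finite S" "card S = K" "S \<subseteq> {j. P j}"
    using infinite_arbitrarily_large by blast
  then show ?thesis by (intro that[of S]) auto
qed

lemma lp_const_abs:
  assumes "\<And>i. i \<in> S \<Longrightarrow> \<bar>a i\<bar> = 1" "r > 0"
  shows "lp r S a = real (card S) powr (1 / r)"
  using assms by (simp add: lp_def)

lemma lp_sum:
  assumes "s \<ge> 1" "finite B" "finite S"
  shows "lp s B (\<lambda>i. \<Sum>j\<in>S. x j i) \<le> (\<Sum>j\<in>S. lp s B (x j))"
  using assms(3)
proof (induction S rule: finite_induct)
  case empty
  then show ?case using assms by (simp add: lp_def)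
next
  case (insert j S)
  then show ?case using lp_add[OF assms(1,2), of "x j" "\<lambda>i. \<Sum>j\<in>S. x j i"] by simp
qed

lemma lp_tail:
  assumes s: "s \<ge> 1" and b: "\<And>J. lp s {..<J} u \<le> C" and \<eta>: "\<eta> > 0"
  shows "\<exists>I0::nat. \<forall>J. lp s {..<J} (\<lambda>i. if i < I0 then 0 else u i) \<le> \<eta>"
proof -
  have s0: "s > 0" using s by simp
  have C: "C \<ge> 0" using b[of 0] lp_nonneg order_trans by blast
  have "summable (\<lambda>i. \<bar>u i\<bar> powr s)"
  proof (rule summableI_nonneg_bounded)
    show "(\<Sum>i<J. \<bar>u i\<bar> powr s) \<le> C powr s" for J
      using lp_le_iff[OF s0 C, of "{..<J}" u] b[of J] by simp
  qed simp
  then have "\<forall>e>0. \<exists>M. \<forall>m\<ge>M. \<forall>n. norm (sum (\<lambda>i. \<bar>u i\<bar> powr s) {m..<n}) < e"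
    by (simp only: summable_Cauchy)
  moreover have "\<eta> powr s > 0" using \<eta> by simp
  ultimately obtain I0 where I0: "\<And>m n. m \<ge> I0 \<Longrightarrow> norm (sum (\<lambda>i. \<bar>u i\<bar> powr s) {m..<n}) < \<eta> powr s"
    by blast
  show ?thesis
  proof (intro exI[of _ I0] allI)
    fix J
    have "(\<Sum>i<J. \<bar>if i < I0 then 0 else u i\<bar> powr s) = (\<Sum>i\<in>{I0..<J}. \<bar>u i\<bar> powr s)"
      by (rule sum.mono_neutral_cong_right) auto
    also have "\<dots> \<le> \<eta> powr s" using I0[of I0 J] by simp
    finally show "lp s {..<J} (\<lambda>i. if i < I0 then 0 else u i) \<le> \<eta>"
      using lp_le_iff[OF s0, of \<eta> "{..<J}" "\<lambda>i. if i < I0 then 0 else u i"] \<eta> by simp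
  qed
qed

context mixed_space begin

text \<open>Finitely supported vectors are dense since \<open>p\<close> and all \<open>s n\<close> are finite: first almost all blocks are cut
  off, then the tail of each of the remaining ones.\<close>

lemma N_tail:
  assumes b: "\<And>J. N J y \<le> C" and \<eta>: "\<eta> > 0"
  shows "\<exists>J0. \<forall>J. N J (\<lambda>b. if b \<in> box J0 then 0 else y b) \<le> \<eta>"
proof -
  define q where "q n J = lp (s n) {..<J} (\<lambda>i. y (n, i))" for n J
  have q_mono: "q n J \<le> q n J'" if "J \<le> J'" for n J J'
    unfolding q_def by (rule lp_mono) (use s0 that in auto)
  have q_le: "q n J \<le> C" for n J
  proof -
    have "q n J \<le> q n (max J (Suc n))" by (rule q_mono) simp
    also have "\<dots> \<le> N (max J (Suc n)) y"
      unfolding q_def N_def by (rule lp_block_le_mix) (use p0 in auto)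
    finally show ?thesis using b order_trans by blast
  qed
  define Q where "Q n = (SUP J. q n J)" for n
  have bdd: "bdd_above (range (q n))" for n using q_le by (auto intro: bdd_aboveI[of _ C])
  have qQ: "q n J \<le> Q n" for n J unfolding Q_def by (rule cSUP_upper[OF _ bdd]) simp
  have q_lim: "q n \<longlonglongrightarrow> Q n" for n
    unfolding Q_def by (rule LIMSEQ_incseq_SUP[OF bdd]) (auto simp: incseq_def q_mono)
  have q0: "q n J \<ge> 0" for n J by (simp add: q_def)
  have Q0: "Q n \<ge> 0" for n using qQ[of n 0] q0[of n 0] by simp
  have C0: "C \<ge> 0" using b[of 0] N_nonneg order_trans by blast
  have "lp p {..<A} Q \<le> C" for A
  proof -
    have "(\<Sum>n<A. Q n powr p) \<le> C powr p"
    proof (rule LIMSEQ_le_const2)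
      show "(\<lambda>J. \<Sum>n<A. q n J powr p) \<longlonglongrightarrow> (\<Sum>n<A. Q n powr p)"
        by (intro tendsto_sum tendsto_powr' q_lim tendsto_const) (use p0 q0 in auto)
      show "\<exists>M. \<forall>J\<ge>M. (\<Sum>n<A. q n J powr p) \<le> C powr p"
      proof (intro exI[of _ A] allI impI)
        fix J assume "A \<le> J"
        then have "lp p {..<A} (\<lambda>n. q n J) \<le> N J y"
          unfolding N_def mix_def q_def by (intro lp_mono) (use p0 in auto)
        then have "lp p {..<A} (\<lambda>n. q n J) \<le> C" using b order_trans by blast
        then show "(\<Sum>n<A. q n J powr p) \<le> C powr p"
          using lp_le_iff[OF p0 C0, of "{..<A}" "\<lambda>n. q n J"] q0 by simp
      qed
    qed
    then show ?thesis using lp_le_iff[OF p0 C0, of "{..<A}" Q] Q0 by simp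
  qed
  then obtain N0 where N0: "\<And>J. lp p {..<J} (\<lambda>n. if n < N0 then 0 else Q n) \<le> \<eta> / 2"
    using lp_tail[OF p1, where u=Q and C=C and \<eta>="\<eta> / 2"] \<eta> by auto
  define \<epsilon> where "\<epsilon> = \<eta> / (2 * (real N0 + 1))"
  have \<epsilon>: "\<epsilon> > 0" using \<eta> by (simp add: \<epsilon>_def)
  have "\<exists>I0. \<forall>J. lp (s n) {..<J} (\<lambda>i. if i < I0 then 0 else y (n, i)) \<le> \<epsilon>" for n
    by (rule lp_tail[OF s1 _ \<epsilon>, where C=C]) (use q_le in \<open>simp add: q_def\<close>)
  then obtain I where I: "\<And>n J. lp (s n) {..<J} (\<lambda>i. if i < I n then 0 else y (n, i)) \<le> \<epsilon>"
    by metis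
  define J0 where "J0 = N0 + (\<Sum>n<N0. I n)"
  have IJ: "I n \<le> J0" if "n < N0" for n
    using member_le_sum[of n "{..<N0}" I] that by (simp add: J0_def)
  let ?z = "\<lambda>b. if b \<in> box J0 then 0 else y b"
  let ?A = "\<lambda>n. if n < N0 then 0 else Q n" and ?B = "\<lambda>n. if n < N0 then \<epsilon> else 0"
  have "N J ?z \<le> \<eta>" for J
  proof -
    have "N J ?z \<le> lp p {..<J} (\<lambda>n. ?A n + ?B n)"
      unfolding N_def mix_def
    proof (rule lp_mono)
      fix n
      have "lp (s n) {..<J} (\<lambda>i. ?z (n, i)) \<le> ?A n + ?B n"
      proof (cases "n < N0")
        case True
        then have "n < J0" by (simp add: J0_def)
        then have "lp (s n) {..<J} (\<lambda>i. ?z (n, i)) \<le> lp (s n) {..<J} (\<lambda>i. if i < I n then 0 else y (n, i))"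
          using IJ[OF True] by (intro lp_mono) (auto simp: box_def s0)
        with I[of n J] True show ?thesis by simp
      next
        case False
        have "lp (s n) {..<J} (\<lambda>i. ?z (n, i)) \<le> q n J"
          unfolding q_def by (rule lp_mono) (auto simp: s0)
        with qQ[of n J] False show ?thesis by simp
      qed
      then show "\<bar>lp (s n) {..<J} (\<lambda>i. ?z (n, i))\<bar> \<le> \<bar>?A n + ?B n\<bar>" by simp
    qed (use p0 in auto)
    moreover have "lp p {..<J} (\<lambda>n. ?A n + ?B n) \<le> lp p {..<J} ?A + lp p {..<J} ?B"
      by (rule lp_add[OF p1]) simp
    moreover have "lp p {..<J} ?B \<le> \<eta> / 2"
    proof -
      have "lp p {..<J} ?B \<le> (\<Sum>n<J. \<bar>?B n\<bar>)" by (rule lp_le_sum[OF p1]) simp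
      also have "\<dots> = (\<Sum>n\<in>{..<J} \<inter> {..<N0}. \<epsilon>)"
        using \<epsilon> by (intro sum.mono_neutral_cong_right) auto
      also have "\<dots> \<le> N0 * \<epsilon>" using \<epsilon> card_mono[of "{..<N0}" "{..<J} \<inter> {..<N0}"] by simp
      also have "\<dots> \<le> \<eta> / 2" using \<eta> by (simp add: \<epsilon>_def field_simps)
      finally show ?thesis .
    qed
    ultimately show ?thesis using N0[of J] by linarith
  qed
  then show ?thesis by blast
qed

end

text \<open>The vectors \<open>y j\<close> span a copy of \<open>\<ell>\<^sub>r\<close>.\<close>

locale lr_copy = mixed_space +
  fixes r L c :: real and y :: "nat \<Rightarrow> nat \<times> nat \<Rightarrow> real"
  assumes pr: "p < r" and c0: "c > 0"
    and up: "\<And>S a J. finite S \<Longrightarrow> N J (\<lambda>b. \<Sum>j\<in>S. a j * y j b) \<le> L * lp r S a"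
    and lo: "\<And>S a e. finite S \<Longrightarrow> e > 0 \<Longrightarrow> \<exists>J. N J (\<lambda>b. \<Sum>j\<in>S. a j * y j b) \<ge> c * lp r S a - e"
begin

lemma r1: "r > 1" and r0: "r > 0" using pr p1 by auto

lemma y_le: "N J (y j) \<le> L"
proof -
  have "lp r {j} (\<lambda>_. 1) = 1" using lp_const_abs[of "{j}" "\<lambda>_. 1" r] r0 by simp
  with up[of "{j}" J "\<lambda>_. 1"] show ?thesis by simp
qed

text \<open>If a coordinate stayed away from \<open>0\<close>, signed sums of \<open>K\<close> of the vectors would have norm of order \<open>K\<close>,
  more than the order \<open>K powr (1 / r)\<close> that the upper bound allows.\<close>

lemma coordinate_null: "(\<lambda>j. y j b) \<longlonglongrightarrow> 0"
proof (rule ccontr)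
  assume "\<not> (\<lambda>j. y j b) \<longlonglongrightarrow> 0"
  then obtain \<epsilon> where \<epsilon>: "\<epsilon> > 0" and "\<And>j0. \<exists>j\<ge>j0. \<bar>y j b\<bar> \<ge> \<epsilon>"
    unfolding LIMSEQ_def dist_real_def by (auto simp: not_less)
  note inf = this(2)
  obtain J where J: "b \<in> box J" using box_cover by blast
  obtain K0 where K0: "\<And>K. K \<ge> K0 \<Longrightarrow> K \<ge> 1 \<and> L * real K powr (1 / r) < \<epsilon> * real K powr 1"
    using power_growth[of "1 / r" 1 \<epsilon> L] \<epsilon> r1 by auto
  obtain S where S: "finite S" "card S = K0" "\<And>j. j \<in> S \<Longrightarrow> \<bar>y j b\<bar> \<ge> \<epsilon>"
    using infinite_large[of "\<lambda>j. \<bar>y j b\<bar> \<ge> \<epsilon>" K0] inf by blast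
  let ?a = "\<lambda>j. sgn (y j b)"
  have "\<epsilon> * K0 \<le> (\<Sum>j\<in>S. \<bar>y j b\<bar>)" using sum_bounded_below[of S \<epsilon> "\<lambda>j. \<bar>y j b\<bar>"] S by (simp add: mult.commute)
  also have "\<dots> = \<bar>\<Sum>j\<in>S. ?a j * y j b\<bar>"
  proof -
    have "(\<Sum>j\<in>S. ?a j * y j b) = (\<Sum>j\<in>S. \<bar>y j b\<bar>)"
      by (intro sum.cong) (simp_all add: abs_sgn mult.commute)
    then show ?thesis by (simp add: sum_nonneg)
  qed
  also have "\<dots> \<le> N J (\<lambda>b'. \<Sum>j\<in>S. ?a j * y j b')" using N_coord[OF J, of "\<lambda>b'. \<Sum>j\<in>S. ?a j * y j b'"] by simp
  also have "\<dots> \<le> L * lp r S ?a" by (rule up[OF S(1)])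
  also have "lp r S ?a = real K0 powr (1 / r)"
    using S \<epsilon> by (subst lp_const_abs) (auto simp: r0 sgn_if, force)
  finally show False using K0[of K0] by simp
qed

text \<open>A gliding hump: a vector far out in the sequence is small on the box used so far (\<open>coordinate_null\<close>),
  and the part of it outside a large box is small (\<open>N_tail\<close>).\<close>

lemma disjointification:
  fixes \<delta> :: real
  assumes \<delta>: "\<delta> > 0"
  obtains \<phi> m :: "nat \<Rightarrow> nat" where "strict_mono \<phi>" "strict_mono m"
    "\<And>j J. N J (\<lambda>b. y (\<phi> j) b - (if b \<in> box (m (Suc j)) - box (m j) then y (\<phi> j) b else 0)) \<le> \<delta> / 2 ^ j"
proof -
  define P where "P j x \<longleftrightarrow> (case x of (n, k, k') \<Rightarrow> k < k' \<and>
    (\<forall>J. N J (\<lambda>b. y n b - (if b \<in> box k' - box k then y n b else 0)) \<le> \<delta> / 2 ^ j))" for j and x :: "nat \<times> nat \<times> nat"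
  define R where "R x x' \<longleftrightarrow> (case x of (n, k, k') \<Rightarrow> case x' of (n', l, l') \<Rightarrow> n < n' \<and> l = k')" for x x' :: "nat \<times> nat \<times> nat"
  have step: "\<exists>n k'. n \<ge> n0 \<and> P j (n, k, k')" for j n0 k
  proof -
    define \<epsilon> where "\<epsilon> = \<delta> / 2 ^ j / 2"
    have \<epsilon>: "\<epsilon> > 0" using \<delta> by (simp add: \<epsilon>_def)
    have "(\<lambda>n. \<Sum>b\<in>box k. \<bar>y n b\<bar>) \<longlonglongrightarrow> 0"
      by (intro tendsto_null_sum tendsto_rabs_zero coordinate_null)
    then have "eventually (\<lambda>n. (\<Sum>b\<in>box k. \<bar>y n b\<bar>) < \<epsilon>) sequentially"
      by (rule order_tendstoD(2)) (rule \<epsilon>)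
    then obtain n1 where n1: "\<And>n. n \<ge> n1 \<Longrightarrow> (\<Sum>b\<in>box k. \<bar>y n b\<bar>) < \<epsilon>" by (auto simp: eventually_sequentially)
    define n where "n = max n0 n1"
    have n: "n \<ge> n0" "(\<Sum>b\<in>box k. \<bar>y n b\<bar>) < \<epsilon>" using n1[of n] by (simp_all add: n_def)
    obtain J0 where J0: "\<And>J. N J (\<lambda>b. if b \<in> box J0 then 0 else y n b) \<le> \<epsilon>"
      using N_tail[OF y_le \<epsilon>] by blast
    define k' where "k' = max J0 (Suc k)"
    have "N J (\<lambda>b. y n b - (if b \<in> box k' - box k then y n b else 0)) \<le> \<delta> / 2 ^ j" for J
    proof -
      have sub: "box k \<subseteq> box k'" "box J0 \<subseteq> box k'" by (intro box_mono, simp add: k'_def)+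
      have split: "(\<lambda>b. y n b - (if b \<in> box k' - box k then y n b else 0))
         = (\<lambda>b. (if b \<in> box k then y n b else 0) + (if b \<in> box k' then 0 else y n b))"
        using sub by (auto simp: fun_eq_iff)
      have 1: "N J (\<lambda>b. y n b - (if b \<in> box k' - box k then y n b else 0))
        \<le> N J (\<lambda>b. if b \<in> box k then y n b else 0) + N J (\<lambda>b. if b \<in> box k' then 0 else y n b)"
        unfolding split by (rule N_add)
      have "N J (\<lambda>b. if b \<in> box k then y n b else 0) \<le> (\<Sum>b\<in>box J. \<bar>if b \<in> box k then y n b else 0\<bar>)"
        by (rule N_le)
      also have "\<dots> = (\<Sum>b\<in>box J \<inter> box k. \<bar>y n b\<bar>)"
        by (rule sum.mono_neutral_cong_right) auto
      also have "\<dots> \<le> (\<Sum>b\<in>box k. \<bar>y n b\<bar>)" by (rule sum_mono2) auto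
      finally have 2: "N J (\<lambda>b. if b \<in> box k then y n b else 0) \<le> \<epsilon>" using n(2) by simp
      have "N J (\<lambda>b. if b \<in> box k' then 0 else y n b) \<le> N J (\<lambda>b. if b \<in> box J0 then 0 else y n b)"
        using sub(2) by (intro N_mono) auto
      with J0[of J] have 3: "N J (\<lambda>b. if b \<in> box k' then 0 else y n b) \<le> \<epsilon>" by simp
      show ?thesis using 1 2 3 by (simp add: \<epsilon>_def)
    qed
    moreover have "k < k'" by (simp add: k'_def)
    ultimately show ?thesis using n(1) unfolding P_def by auto
  qed
  have "\<exists>f. \<forall>j. P j (f j) \<and> R (f j) (f (Suc j))"
  proof (rule dependent_nat_choice)
    show "\<exists>x. P 0 x" using step[of 0 0 0] by blast
    fix x j assume "P j x"
    obtain n k k' where x: "x = (n, k, k')" by (cases x) auto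
    obtain n' k'' where "n' \<ge> Suc n" "P (Suc j) (n', k', k'')" using step[of "Suc n" "Suc j" k'] by blast
    then show "\<exists>x'. P (Suc j) x' \<and> R x x'" by (intro exI[of _ "(n', k', k'')"]) (auto simp: R_def x)
  qed
  then obtain f where f: "\<And>j. P j (f j)" "\<And>j. R (f j) (f (Suc j))" by blast
  define \<phi> where "\<phi> j = fst (f j)" for j
  define m where "m j = fst (snd (f j))" for j
  have m': "snd (snd (f j)) = m (Suc j)" for j using f(2)[of j] by (simp add: R_def m_def split: prod.splits)
  have fj: "f j = (\<phi> j, m j, m (Suc j))" for j by (simp add: \<phi>_def m_def[of j] m'[symmetric])
  show ?thesis
  proof (rule that[of \<phi> m])
    show "strict_mono \<phi>" using f(2) by (intro strict_mono_Suc_iff[THEN iffD2]) (auto simp: fj R_def)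
    show "strict_mono m" using f(1) by (intro strict_mono_Suc_iff[THEN iffD2]) (auto simp: fj P_def)
    show "N J (\<lambda>b. y (\<phi> j) b - (if b \<in> box (m (Suc j)) - box (m j) then y (\<phi> j) b else 0)) \<le> \<delta> / 2 ^ j" for j J
      using f(1)[of j] unfolding fj P_def by auto
  qed
qed

end

section \<open>No copy of a foreign sequence space\<close>

locale disjoint_lr_copy = mixed_space +
  fixes r L c :: real and z :: "nat \<Rightarrow> nat \<times> nat \<Rightarrow> real" and m :: "nat \<Rightarrow> nat"
  assumes pr: "p < r" and c0: "c > 0" and m_mono: "strict_mono m"
    and supp: "\<And>j b. z j b \<noteq> 0 \<Longrightarrow> b \<in> box (m (Suc j)) - box (m j)"
    and up: "\<And>S a J. finite S \<Longrightarrow> N J (\<lambda>b. \<Sum>j\<in>S. a j * z j b) \<le> L * lp r S a"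
    and lo: "\<And>S a e. finite S \<Longrightarrow> e > 0 \<Longrightarrow> \<exists>J. N J (\<lambda>b. \<Sum>j\<in>S. a j * z j b) \<ge> c * lp r S a - e"
    and sr: "\<And>n. s n \<noteq> r"
begin

lemma r1: "r > 1" and r0: "r > 0" using pr p1 by auto

definition blk :: "nat \<Rightarrow> nat \<Rightarrow> (nat \<times> nat \<Rightarrow> real) \<Rightarrow> real"
  where "blk n J w = lp (s n) {..<J} (\<lambda>i. w (n, i))"

lemma blk_nonneg [simp]: "blk n J w \<ge> 0" by (simp add: blk_def)

lemma blk_mono: "J \<le> J' \<Longrightarrow> (\<And>i. \<bar>w (n, i)\<bar> \<le> \<bar>w' (n, i)\<bar>) \<Longrightarrow> blk n J w \<le> blk n J' w'"
  unfolding blk_def by (rule lp_mono) (use s0 in auto)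

lemma blk_le_N: "blk n J w \<le> N (max J (Suc n)) w"
proof -
  have "blk n J w \<le> blk n (max J (Suc n)) w" by (rule blk_mono) auto
  also have "\<dots> \<le> N (max J (Suc n)) w" unfolding blk_def N_def by (rule lp_block_le_mix) (use p0 in auto)
  finally show ?thesis .
qed

lemma N_powr: "N J w powr p = (\<Sum>n<J. blk n J w powr p)"
  unfolding N_def blk_def by (rule mix_powr) (use p0 in simp)

lemma disjoint: "z j b \<noteq> 0 \<Longrightarrow> z j' b \<noteq> 0 \<Longrightarrow> j = j'"
proof (induction j j' rule: linorder_wlog)
  case (le j j')
  show ?case
  proof (rule ccontr)
    assume "j \<noteq> j'"
    then have "m (Suc j) \<le> m j'" using le(1) m_mono by (simp add: strict_mono_less_eq)
    then show False using supp[OF le(2)] supp[OF le(3)] box_mono by blast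
  qed
qed auto

lemma abs_sum_disjoint:
  assumes fin: "finite S" and t: "t > 0"
  shows "\<bar>\<Sum>j\<in>S. a j * z j b\<bar> powr t = (\<Sum>j\<in>S. \<bar>a j * z j b\<bar> powr t)"
proof (cases "\<exists>j\<in>S. z j b \<noteq> 0")
  case True
  then obtain j where j: "j \<in> S" "z j b \<noteq> 0" by blast
  have "z k b = 0" if "k \<in> S - {j}" for k using disjoint[of j b k] j that by auto
  then have "(\<Sum>k\<in>S. a k * z k b) = a j * z j b" "(\<Sum>k\<in>S. \<bar>a k * z k b\<bar> powr t) = \<bar>a j * z j b\<bar> powr t"
    using fin j(1) by (simp_all add: sum.remove[of S j])
  then show ?thesis by simp
qed auto

text \<open>On a single block, disjointly supported vectors add up as in \<open>\<ell>\<^bsub>s(n)\<^esub>\<close>.\<close>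

lemma blk_powr:
  assumes "finite S"
  shows "blk n J (\<lambda>b. \<Sum>j\<in>S. a j * z j b) powr s n = (\<Sum>j\<in>S. \<bar>a j\<bar> powr s n * blk n J (z j) powr s n)"
proof -
  have s0': "s n \<noteq> 0" using s0[of n] by simp
  have "blk n J (\<lambda>b. \<Sum>j\<in>S. a j * z j b) powr s n = (\<Sum>i<J. \<Sum>j\<in>S. \<bar>a j * z j (n, i)\<bar> powr s n)"
    unfolding blk_def lp_powr[OF s0'] by (intro sum.cong refl abs_sum_disjoint assms s0)
  also have "\<dots> = (\<Sum>j\<in>S. \<bar>a j\<bar> powr s n * (\<Sum>i<J. \<bar>z j (n, i)\<bar> powr s n))"
    by (subst sum.swap) (simp add: abs_mult powr_mult sum_distrib_left)
  finally show ?thesis unfolding blk_def lp_powr[OF s0'] .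
qed

lemma blk_le: "blk n J (z j) \<le> L"
proof -
  have "lp r {j} (\<lambda>_. 1) = 1" using lp_const_abs[of "{j}" "\<lambda>_. 1" r] r0 by simp
  with up[of "{j}" "max J (Suc n)" "\<lambda>_. 1"] have "N (max J (Suc n)) (z j) \<le> L" by simp
  with blk_le_N[of n J "z j"] show ?thesis by simp
qed

lemma L_nonneg: "L \<ge> 0"
  using blk_le[of 0 0 0] blk_nonneg[of 0 0 "z 0"] by linarith

text \<open>For \<open>s n < r\<close> the sum of \<open>K\<close> vectors that are not small on block \<open>n\<close> would have norm of order
  \<open>K powr (1 / s n)\<close>, which is more than \<open>K powr (1 / r)\<close>.\<close>

lemma blocks_vanish:
  assumes sn: "s n < r" and \<eta>: "\<eta> > 0"
  shows "\<exists>j0. \<forall>j\<ge>j0. \<forall>J. blk n J (z j) \<le> \<eta>"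
proof (rule ccontr)
  assume "\<not> ?thesis"
  then have ex: "\<exists>j\<ge>j0. \<exists>J. blk n J (z j) > \<eta>" for j0 by (simp add: not_le)
  have "1 / s n > 1 / r" using sn s0[of n] by (simp add: field_simps)
  then obtain K where K: "K \<ge> 1" "L * real K powr (1 / r) < \<eta> * real K powr (1 / s n)"
    using power_growth[of "1 / r" "1 / s n" \<eta> L] \<eta> by blast
  obtain S where S: "finite S" "card S = K" "\<And>j. j \<in> S \<Longrightarrow> \<exists>J. blk n J (z j) > \<eta>"
    using infinite_large[of "\<lambda>j. \<exists>J. blk n J (z j) > \<eta>" K] ex by blast
  obtain J where J: "\<And>j. j \<in> S \<Longrightarrow> blk n (J j) (z j) > \<eta>" using S(3) by metis
  define J1 where "J1 = (\<Sum>j\<in>S. J j)"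
  have big: "blk n J1 (z j) \<ge> \<eta>" if "j \<in> S" for j
  proof -
    have "J j \<le> J1" unfolding J1_def using S(1) that by (intro member_le_sum) auto
    then have "blk n (J j) (z j) \<le> blk n J1 (z j)" by (rule blk_mono) simp
    then show ?thesis using J[OF that] by simp
  qed
  let ?w = "\<lambda>b. \<Sum>j\<in>S. 1 * z j b"
  have "real K * \<eta> powr s n \<le> (\<Sum>j\<in>S. \<bar>1\<bar> powr s n * blk n J1 (z j) powr s n)"
    using sum_bounded_below[of S "\<eta> powr s n" "\<lambda>j. blk n J1 (z j) powr s n"] big \<eta> S(2) s0[of n]
    by (simp add: powr_mono2)
  then have "real K * \<eta> powr s n \<le> blk n J1 ?w powr s n" by (simp only: blk_powr[OF S(1)])
  then have "(real K * \<eta> powr s n) powr (1 / s n) \<le> (blk n J1 ?w powr s n) powr (1 / s n)"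
    using s0[of n] by (intro powr_mono2) auto
  then have "real K powr (1 / s n) * \<eta> \<le> blk n J1 ?w"
    using s0[of n] \<eta> by (simp add: powr_mult powr_powr)
  also have "\<dots> \<le> N (max J1 (Suc n)) ?w" by (rule blk_le_N)
  also have "\<dots> \<le> L * lp r S (\<lambda>_. 1)" by (rule up[OF S(1)])
  also have "lp r S (\<lambda>_. 1) = real K powr (1 / r)" using S(2) r0 by (simp add: lp_const_abs)
  finally show False using K(2) by (simp add: mult.commute)
qed

text \<open>Relative to the \<open>\<ell>\<^sub>r\<close> norm \<open>K powr (1 / r)\<close> of their coefficients, sums of \<open>K\<close> vectors are small on a
  given block: for \<open>s n < r\<close> because the single vectors tend to \<open>0\<close> there (\<open>blocks_vanish\<close>), for \<open>s n > r\<close> because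
  the sum grows only like \<open>K powr (1 / s n)\<close>. This is where \<open>s n \<noteq> r\<close> enters.\<close>

lemma block_sums_small:
  assumes \<epsilon>: "\<epsilon> > 0"
  shows "\<exists>K0::nat. \<forall>K\<ge>K0. \<exists>j0::nat. \<forall>I. finite I \<and> I \<subseteq> {j0..} \<and> card I = K \<longrightarrow>
    (\<forall>J. blk n J (\<lambda>b. \<Sum>j\<in>I. 1 * z j b) \<le> \<epsilon> * real K powr (1 / r))"
proof (cases "s n < r")
  case True
  show ?thesis
  proof (rule exI[of _ 1], intro allI impI)
    fix K :: nat assume K: "1 \<le> K"
    obtain j0 where j0: "\<And>j J. j \<ge> j0 \<Longrightarrow> blk n J (z j) \<le> \<epsilon> / K"
      using blocks_vanish[OF True, of "\<epsilon> / K"] \<epsilon> K by auto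
    show "\<exists>j0::nat. \<forall>I. finite I \<and> I \<subseteq> {j0..} \<and> card I = K \<longrightarrow>
      (\<forall>J. blk n J (\<lambda>b. \<Sum>j\<in>I. 1 * z j b) \<le> \<epsilon> * real K powr (1 / r))"
    proof (intro exI[of _ j0] allI impI)
      fix I J assume I: "finite I \<and> I \<subseteq> {j0..} \<and> card I = K"
      have "blk n J (\<lambda>b. \<Sum>j\<in>I. 1 * z j b) \<le> (\<Sum>j\<in>I. blk n J (z j))"
        unfolding blk_def using lp_sum[OF s1, of "{..<J}" I n "\<lambda>j i. z j (n, i)"] I by simp
      also have "\<dots> \<le> (\<Sum>j\<in>I. \<epsilon> / K)" using I j0 by (intro sum_mono) auto
      also have "\<dots> = \<epsilon>" using I K by simp
      also have "\<epsilon> \<le> \<epsilon> * real K powr (1 / r)"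
        using K \<epsilon> r0 by (simp add: ge_one_powr_ge_zero)
      finally show "blk n J (\<lambda>b. \<Sum>j\<in>I. 1 * z j b) \<le> \<epsilon> * real K powr (1 / r)" .
    qed
  qed
next
  case False
  then have sn: "s n > r" using sr[of n] by simp
  have "1 / r > 1 / s n" using sn r0 by (simp add: field_simps)
  then obtain K0 where K0: "\<And>K. K \<ge> K0 \<Longrightarrow> K \<ge> 1 \<and> L * real K powr (1 / s n) < \<epsilon> * real K powr (1 / r)"
    using power_growth[of "1 / s n" "1 / r" \<epsilon> L] \<epsilon> by blast
  show ?thesis
  proof (rule exI[of _ K0], intro allI impI, rule exI[of _ "0::nat"], intro allI impI)
    fix K J :: nat and I :: "nat set" assume K: "K0 \<le> K" and I: "finite I \<and> I \<subseteq> {0..} \<and> card I = K"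
    have fI: "finite I" using I by simp
    let ?b = "blk n J (\<lambda>b. \<Sum>j\<in>I. 1 * z j b)"
    have "?b powr s n = (\<Sum>j\<in>I. \<bar>1\<bar> powr s n * blk n J (z j) powr s n)" by (rule blk_powr[OF fI])
    also have "\<dots> \<le> (\<Sum>j\<in>I. L powr s n)" using s0[of n] blk_le by (intro sum_mono) (simp add: powr_mono2)
    also have "\<dots> = real K * L powr s n" using I by simp
    finally have "(?b powr s n) powr (1 / s n) \<le> (real K * L powr s n) powr (1 / s n)"
      using s0[of n] by (intro powr_mono2) auto
    then have "?b \<le> real K powr (1 / s n) * L"
      using s0[of n] L_nonneg by (simp add: powr_mult powr_powr)
    then show "?b \<le> \<epsilon> * real K powr (1 / r)" using K0[OF K] by (simp add: mult.commute)
  qed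
qed

lemma block_sums_small_simultaneously:
  assumes \<epsilon>: "\<epsilon> > 0"
  shows "\<exists>I. finite I \<and> I \<noteq> {} \<and> I \<subseteq> {j0..} \<and>
    (\<forall>n<A. \<forall>J. blk n J (\<lambda>b. \<Sum>j\<in>I. 1 * z j b) \<le> \<epsilon> * real (card I) powr (1 / r))"
proof -
  define P where "P n K j I \<longleftrightarrow> (finite I \<and> I \<subseteq> {j..} \<and> card I = K \<longrightarrow>
    (\<forall>J. blk n J (\<lambda>b. \<Sum>j\<in>I. 1 * z j b) \<le> \<epsilon> * real K powr (1 / r)))" for n K j and I :: "nat set"
  have "\<forall>n. \<exists>K0::nat. \<forall>K\<ge>K0. \<exists>j. \<forall>I. P n K j I" unfolding P_def using block_sums_small[OF \<epsilon>] by blast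
  then obtain K0 where K0: "\<And>n K. K \<ge> K0 n \<Longrightarrow> \<exists>j. \<forall>I. P n K j I" by metis
  define K where "K = Suc (\<Sum>n<A. K0 n)"
  have "\<forall>n\<in>{..<A}. \<exists>j. \<forall>I. P n K j I"
  proof
    fix n assume "n \<in> {..<A}"
    then have "K0 n \<le> (\<Sum>n<A. K0 n)" by (intro member_le_sum) auto
    then show "\<exists>j. \<forall>I. P n K j I" by (intro K0) (simp add: K_def)
  qed
  then obtain j where j: "\<And>n I. n < A \<Longrightarrow> P n K (j n) I" unfolding bchoice_iff by auto
  define j1 where "j1 = j0 + (\<Sum>n<A. j n)"
  define I where "I = {j1..<j1 + K}"
  have I: "finite I" "card I = K" "I \<noteq> {}" "I \<subseteq> {j0..}" by (auto simp: I_def K_def j1_def)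
  have "\<forall>J. blk n J (\<lambda>b. \<Sum>j\<in>I. 1 * z j b) \<le> \<epsilon> * real (card I) powr (1 / r)" if "n < A" for n
  proof -
    have "j n \<le> j1" using member_le_sum[of n "{..<A}" j] that by (simp add: j1_def)
    then have "I \<subseteq> {j n..}" by (auto simp: I_def)
    then show ?thesis using j[OF that, of I] I unfolding P_def by simp
  qed
  with I show ?thesis by blast
qed

lemma supp_sum:
  assumes "(\<Sum>j\<in>S. a j * z j b) \<noteq> 0"
  obtains j where "j \<in> S" "z j b \<noteq> 0"
  using assms by (metis (mono_tags, lifting) mult_zero_right sum.neutral)

text \<open>Each step adds a normalized sum that is negligible on the first \<open>J0\<close> blocks, hence has norm at least
  \<open>c / 2\<close> on the others. As different blocks add up as in \<open>\<ell>\<^sub>p\<close>, the \<open>p\<close>-th power of the norm grows linearly in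
  the number \<open>l\<close> of steps.\<close>

lemma humps:
  "\<exists>S a J0. finite S \<and> (\<Sum>j\<in>S. \<bar>a j\<bar> powr r) = real l \<and> (\<forall>j\<in>S. m (Suc j) \<le> J0) \<and>
    N J0 (\<lambda>b. \<Sum>j\<in>S. a j * z j b) powr p \<ge> l * (c / 2) powr p"
proof (induction l)
  case 0
  show ?case by (intro exI[of _ "{}"] exI[of _ "\<lambda>_. 0"] exI[of _ 0]) simp
next
  case (Suc l)
  then obtain S a J0 where S: "finite S" "(\<Sum>j\<in>S. \<bar>a j\<bar> powr r) = real l" "\<And>j. j \<in> S \<Longrightarrow> m (Suc j) \<le> J0"
    and NS: "N J0 (\<lambda>b. \<Sum>j\<in>S. a j * z j b) powr p \<ge> l * (c / 2) powr p" by blast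
  define \<epsilon> where "\<epsilon> = c / (4 * (real J0 + 1))"
  have \<epsilon>: "\<epsilon> > 0" using c0 by (simp add: \<epsilon>_def)
  obtain I where I: "finite I" "I \<noteq> {}" "I \<subseteq> {J0..}"
    and Ib: "\<And>n J. n < J0 \<Longrightarrow> blk n J (\<lambda>b. \<Sum>j\<in>I. 1 * z j b) \<le> \<epsilon> * real (card I) powr (1 / r)"
    using block_sums_small_simultaneously[OF \<epsilon>, of J0 J0] by blast
  have m_ge: "m j \<ge> j" for j using m_mono strict_mono_imp_increasing by blast
  have SI: "S \<inter> I = {}"
  proof (rule ccontr)
    assume "S \<inter> I \<noteq> {}"
    then obtain j where "j \<in> S" "j \<in> I" by blast
    then show False using S(3)[of j] m_ge[of "Suc j"] I(3) by auto
  qed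
  define K where "K = card I"
  have K: "K \<ge> 1" using I by (simp add: K_def Suc_leI card_gt_0_iff)
  define \<kappa> where "\<kappa> = real K powr (- (1 / r))"
  have "\<kappa> powr r = real K powr (- 1)" unfolding \<kappa>_def powr_powr using r0 by simp
  then have "real K * \<kappa> powr r = 1" using K by (simp add: powr_minus_divide)
  moreover have "\<kappa> > 0" "\<kappa> * real K powr (1 / r) = 1"
    using K r0 by (simp_all add: \<kappa>_def powr_add[symmetric])
  ultimately have \<kappa>: "\<kappa> > 0" "\<kappa> * real K powr (1 / r) = 1" "real K * \<kappa> powr r = 1" by blast+
  have lpI: "lp r I (\<lambda>_. \<kappa>) = 1" using \<kappa>(1,3) by (simp add: lp_def K_def)
  define v where "v = (\<lambda>b. \<Sum>j\<in>S. a j * z j b)"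
  define w where "w = (\<lambda>b. \<Sum>j\<in>I. \<kappa> * z j b)"
  obtain J where J: "N J w \<ge> c * 1 - c / 4" using lo[OF I(1), of "c / 4" "\<lambda>_. \<kappa>"] c0 lpI by (auto simp: w_def)
  define J1 where "J1 = J0 + J + (\<Sum>j\<in>I. m (Suc j))"
  have J1: "J0 \<le> J1" "J \<le> J1" by (simp_all add: J1_def)
  have NJ1: "N J1 w \<ge> 3 * c / 4"
    using N_mono[OF J1(2), of w w] J by simp
  define b where "b = (\<lambda>n. blk n J1 w)"
  have b_small: "b n \<le> \<epsilon>" if "n < J0" for n
  proof -
    have "b n = \<kappa> * blk n J1 (\<lambda>b. \<Sum>j\<in>I. 1 * z j b)"
      using lp_scale[OF s0[of n], of "{..<J1}" \<kappa> "\<lambda>i. \<Sum>j\<in>I. 1 * z j (n, i)"] \<kappa>(1)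
      by (simp add: b_def blk_def w_def sum_distrib_left)
    also have "\<dots> \<le> \<kappa> * (\<epsilon> * real (card I) powr (1 / r))"
      using Ib[OF that, of J1] \<kappa>(1) by (intro mult_left_mono) auto
    also have "\<dots> = \<epsilon>" using \<kappa>(2) by (simp add: K_def mult.left_commute)
    finally show ?thesis .
  qed
  have b0: "b n \<ge> 0" for n by (simp add: b_def)
  let ?A = "\<lambda>n. if n < J0 then \<epsilon> else 0" and ?B = "\<lambda>n. if n < J0 then 0 else b n"
  have "N J1 w = lp p {..<J1} b" by (simp add: N_def mix_def b_def blk_def)
  also have "\<dots> \<le> lp p {..<J1} (\<lambda>n. ?A n + ?B n)"
    by (rule lp_mono) (use p0 b_small b0 \<epsilon> in auto)
  also have "\<dots> \<le> lp p {..<J1} ?A + lp p {..<J1} ?B" by (rule lp_add[OF p1]) simp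
  finally have split: "N J1 w \<le> lp p {..<J1} ?A + lp p {..<J1} ?B" .
  have "lp p {..<J1} ?A \<le> (\<Sum>n<J1. \<bar>?A n\<bar>)" by (rule lp_le_sum[OF p1]) simp
  also have "\<dots> = (\<Sum>n<J0. \<epsilon>)"
    using J1 \<epsilon> by (intro sum.mono_neutral_cong_right) auto
  also have "\<dots> \<le> c / 4" using c0 by (simp add: \<epsilon>_def field_simps)
  finally have "lp p {..<J1} ?B \<ge> c / 2" using split NJ1 by simp
  then have "(c / 2) powr p \<le> lp p {..<J1} ?B powr p" using c0 p0 by (intro powr_mono2) auto
  also have "\<dots> = (\<Sum>n<J1. \<bar>?B n\<bar> powr p)" using p0 by (simp add: lp_powr)
  also have "\<dots> = (\<Sum>n\<in>{J0..<J1}. b n powr p)"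
    using b0 by (intro sum.mono_neutral_cong_right) auto
  finally have Bsum: "(c / 2) powr p \<le> (\<Sum>n\<in>{J0..<J1}. b n powr p)" .
  define a' where "a' j = (if j \<in> S then a j else \<kappa>)" for j
  have vw: "(\<Sum>j\<in>S \<union> I. a' j * z j x) = v x + w x" for x
  proof -
    have "(\<Sum>j\<in>S \<union> I. a' j * z j x) = (\<Sum>j\<in>S. a' j * z j x) + (\<Sum>j\<in>I. a' j * z j x)"
      by (rule sum.union_disjoint) (use S(1) I(1) SI in auto)
    moreover have "(\<Sum>j\<in>S. a' j * z j x) = v x" by (simp add: a'_def v_def)
    moreover have "(\<Sum>j\<in>I. a' j * z j x) = w x" unfolding w_def using SI by (intro sum.cong) (auto simp: a'_def)
    ultimately show ?thesis by simp
  qed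
  have v_or_w: "v x = 0 \<or> w x = 0" for x
  proof (rule ccontr)
    assume "\<not> ?thesis"
    then have v: "(\<Sum>j\<in>S. a j * z j x) \<noteq> 0" and w: "(\<Sum>j\<in>I. \<kappa> * z j x) \<noteq> 0"
      by (simp_all add: v_def w_def)
    obtain j where j: "j \<in> S" "z j x \<noteq> 0" using v by (rule supp_sum)
    obtain k where k: "k \<in> I" "z k x \<noteq> 0" using w by (rule supp_sum)
    show False using disjoint[OF j(2) k(2)] j(1) k(1) SI by blast
  qed
  have ge: "\<bar>v x\<bar> \<le> \<bar>v x + w x\<bar>" "\<bar>w x\<bar> \<le> \<bar>v x + w x\<bar>" for x using v_or_w[of x] by auto
  let ?u = "\<lambda>x. \<Sum>j\<in>S \<union> I. a' j * z j x"
  have "(l + 1) * (c / 2) powr p \<le> (\<Sum>n<J0. blk n J0 v powr p) + (\<Sum>n\<in>{J0..<J1}. b n powr p)"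
    using NS Bsum unfolding N_powr v_def by (simp add: algebra_simps)
  also have "\<dots> \<le> (\<Sum>n<J0. blk n J1 ?u powr p) + (\<Sum>n\<in>{J0..<J1}. blk n J1 ?u powr p)"
    unfolding vw b_def
    by (intro add_mono sum_mono powr_mono2 blk_mono ge J1 order_refl) (use p0 in auto)
  also have "\<dots> = (\<Sum>n<J1. blk n J1 ?u powr p)"
    using J1 by (subst sum.union_disjoint[symmetric]) (auto intro!: sum.cong)
  also have "\<dots> = N J1 ?u powr p" by (rule N_powr[symmetric])
  finally have 1: "(l + 1) * (c / 2) powr p \<le> N J1 ?u powr p" .
  have "(\<Sum>j\<in>S \<union> I. \<bar>a' j\<bar> powr r) = (\<Sum>j\<in>S. \<bar>a' j\<bar> powr r) + (\<Sum>j\<in>I. \<bar>a' j\<bar> powr r)"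
    by (rule sum.union_disjoint) (use S(1) I(1) SI in auto)
  moreover have "(\<Sum>j\<in>S. \<bar>a' j\<bar> powr r) = l" using S(2) by (simp add: a'_def)
  moreover have "(\<Sum>j\<in>I. \<bar>a' j\<bar> powr r) = (\<Sum>j\<in>I. \<kappa> powr r)"
    using SI \<kappa>(1) by (intro sum.cong) (auto simp: a'_def)
  moreover have "(\<Sum>j\<in>I. \<kappa> powr r) = 1" using \<kappa>(3) by (simp add: K_def)
  ultimately have 2: "(\<Sum>j\<in>S \<union> I. \<bar>a' j\<bar> powr r) = real (Suc l)" by simp
  have 3: "m (Suc j) \<le> J1" if "j \<in> S \<union> I" for j
  proof (cases "j \<in> S")
    case True then show ?thesis using S(3)[of j] J1 by simp
  next
    case False
    then have "m (Suc j) \<le> (\<Sum>j\<in>I. m (Suc j))" using that I(1) by (intro member_le_sum) auto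
    then show ?thesis by (simp add: J1_def)
  qed
  show ?case
    by (intro exI[of _ "S \<union> I"] exI[of _ a'] exI[of _ J1] conjI ballI)
      (use 1 2 3 S(1) I(1) in \<open>auto simp: add.commute\<close>)
qed

text \<open>By \<open>humps\<close> the norm is at least of order \<open>l powr (1 / p)\<close>, by the upper bound it is at most of order
  \<open>l powr (1 / r)\<close>.\<close>

lemma no_disjoint_copy: False
proof -
  have "p / r < 1" using pr r0 by simp
  then obtain l where l: "L powr p * real l powr (p / r) < (c / 2) powr p * real l powr 1" "l \<ge> 1"
    using power_growth[of "p / r" 1 "(c / 2) powr p" "L powr p"] c0 by auto
  obtain S a J0 where S: "finite S" "(\<Sum>j\<in>S. \<bar>a j\<bar> powr r) = real l"
    and N: "N J0 (\<lambda>b. \<Sum>j\<in>S. a j * z j b) powr p \<ge> l * (c / 2) powr p" using humps[of l] by blast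
  have "N J0 (\<lambda>b. \<Sum>j\<in>S. a j * z j b) powr p \<le> (L * lp r S a) powr p"
    using up[OF S(1)] p0 by (intro powr_mono2) auto
  also have "\<dots> = L powr p * real l powr (p / r)"
    using S(2) L_nonneg by (simp add: powr_mult lp_def powr_powr)
  finally show False using N l by (simp add: mult.commute)
qed

end

context mixed_space begin

text \<open>The images of the unit vectors, divided by the weights, span a copy of \<open>\<ell>\<^sub>r\<close> by \<open>real_combinations\<close>.
  By \<open>disjointification\<close> a subsequence is so close to a disjointly supported sequence that half of the lower bound
  survives, and \<open>disjoint_lr_copy.no_disjoint_copy\<close> applies.\<close>

theorem no_linear_copy:
  fixes T :: "(nat \<Rightarrow> real) \<Rightarrow> nat \<times> nat \<Rightarrow> real" and \<omega> :: "nat \<Rightarrow> real"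
  assumes pr: "p < r" and sr: "\<And>n. s n \<noteq> r" and \<omega>: "\<And>n. \<omega> n > 0" and c: "c > 0"
    and add: "\<And>w w'. w \<in> int_vectors \<Longrightarrow> w' \<in> int_vectors \<Longrightarrow> T (\<lambda>n. w n + w' n) = (\<lambda>b. T w b + T w' b)"
    and up: "\<And>w J. w \<in> int_vectors \<Longrightarrow> N J (T w) \<le> L * lp r {n. w n \<noteq> 0} (\<lambda>n. \<omega> n * w n)"
    and lo: "\<And>w e. w \<in> int_vectors \<Longrightarrow> e > 0 \<Longrightarrow> \<exists>J. N J (T w) \<ge> c * lp r {n. w n \<noteq> 0} (\<lambda>n. \<omega> n * w n) - e"
  shows False
proof -
  define y where "y n b = T (unit_vec n) b / \<omega> n" for n b
  have r1: "r \<ge> 1" and r0: "r > 0" using pr p1 by auto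
  have rc1: "N J (\<lambda>b. \<Sum>n\<in>S. a n * y n b) \<le> L * lp r S a" if "finite S" for S a J
    unfolding y_def by (rule real_combinations(1)[where T=T and \<omega>=\<omega> and c=c, OF r1 \<omega> c add up lo that])
  have rc2: "\<exists>J. N J (\<lambda>b. \<Sum>n\<in>S. a n * y n b) \<ge> c * lp r S a - e" if "finite S" "e > 0" for S a e
    unfolding y_def by (rule real_combinations(2)[where T=T and \<omega>=\<omega> and L=L, OF r1 \<omega> c add up lo that])
  interpret A: lr_copy p s r L c y
    by unfold_locales (fact pr c rc1 rc2)+
  (* the errors \<delta> / 2 ^ j sum to 2 * \<delta> = c / 2 *)
  define \<delta> where "\<delta> = c / 4"
  have \<delta>: "\<delta> > 0" using c by (simp add: \<delta>_def)
  obtain \<phi> m where \<phi>: "strict_mono \<phi>" and m: "strict_mono m"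
    and close: "\<And>j J. N J (\<lambda>b. y (\<phi> j) b - (if b \<in> box (m (Suc j)) - box (m j) then y (\<phi> j) b else 0)) \<le> \<delta> / 2 ^ j"
    using A.disjointification[OF \<delta>] by blast
  define z where "z j b = (if b \<in> box (m (Suc j)) - box (m j) then y (\<phi> j) b else 0)" for j b
  have inj: "inj \<phi>" using \<phi> by (rule strict_mono_imp_inj_on)
  have reidx: "(\<lambda>b. \<Sum>j\<in>S. a j * y (\<phi> j) b) = (\<lambda>b. \<Sum>n\<in>\<phi> ` S. (a \<circ> inv \<phi>) n * y n b)"
    "lp r (\<phi> ` S) (a \<circ> inv \<phi>) = lp r S a" for S :: "nat set" and a
    using inj by (simp_all add: lp_def sum.reindex inj_on_subset[OF inj])
  have err: "N J (\<lambda>b. \<Sum>j\<in>S. a j * (y (\<phi> j) b - z j b)) \<le> 2 * \<delta> * lp r S a" if fin: "finite S" for S a J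
  proof -
    have "N J (\<lambda>b. \<Sum>j\<in>S. a j * (y (\<phi> j) b - z j b)) \<le> (\<Sum>j\<in>S. \<bar>a j\<bar> * N J (\<lambda>b. y (\<phi> j) b - z j b))"
      by (rule N_sum[OF fin])
    also have "\<dots> \<le> (\<Sum>j\<in>S. lp r S a * (\<delta> / 2 ^ j))"
      using close unfolding z_def[symmetric] by (intro sum_mono mult_mono lp_coord r0 fin) auto
    also have "\<dots> = lp r S a * \<delta> * (\<Sum>j\<in>S. (1/2) ^ j)"
      by (simp add: sum_distrib_left power_divide)
    finally have 1: "N J (\<lambda>b. \<Sum>j\<in>S. a j * (y (\<phi> j) b - z j b)) \<le> lp r S a * \<delta> * (\<Sum>j\<in>S. (1/2) ^ j)" .
    have "(\<Sum>j\<in>S. (1/2) ^ j) \<le> (\<Sum>j. (1/2::real) ^ j)" by (rule sum_le_suminf) (use fin in auto)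
    then have "(\<Sum>j\<in>S. (1/2) ^ j) \<le> (2::real)" by (simp add: suminf_geometric)
    then have "lp r S a * \<delta> * (\<Sum>j\<in>S. (1/2) ^ j) \<le> lp r S a * \<delta> * 2"
      using \<delta> by (intro mult_left_mono) auto
    with 1 show ?thesis by (simp add: mult_ac)
  qed
  interpret B: disjoint_lr_copy p s r "L + c / 2" "c / 2" z m
  proof
    show "b \<in> box (m (Suc j)) - box (m j)" if "z j b \<noteq> 0" for j b
      using that by (simp add: z_def split: if_splits)
    fix S :: "nat set" and a :: "nat \<Rightarrow> real" assume fin: "finite S"
    let ?y = "\<lambda>b. \<Sum>j\<in>S. a j * y (\<phi> j) b" and ?z = "\<lambda>b. \<Sum>j\<in>S. a j * z j b"
      and ?d = "\<lambda>b. \<Sum>j\<in>S. a j * (y (\<phi> j) b - z j b)"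
    have yzd: "?y = (\<lambda>b. ?z b + ?d b)" "?z = (\<lambda>b. ?y b + (- 1) * ?d b)"
      by (simp_all add: fun_eq_iff algebra_simps sum_subtractf)
    have fin': "finite (\<phi> ` S)" using fin by simp
    { fix J
      have "N J ?z \<le> N J ?y + N J (\<lambda>b. (- 1) * ?d b)" by (subst yzd(2)) (rule N_add)
      moreover have "N J ?y \<le> L * lp r S a" using rc1[OF fin', of J "a \<circ> inv \<phi>"] by (simp only: reidx)
      ultimately show "N J ?z \<le> (L + c / 2) * lp r S a"
        using err[OF fin, of J a] unfolding N_scale by (simp add: \<delta>_def algebra_simps) }
    fix e :: real assume "e > 0"
    from rc2[OF fin' this, of "a \<circ> inv \<phi>"] obtain J where J: "N J ?y \<ge> c * lp r S a - e" unfolding reidx by blast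
    have "N J ?y \<le> N J ?z + N J ?d" by (subst yzd(1)) (rule N_add)
    then have "N J ?z \<ge> c / 2 * lp r S a - e" using J err[OF fin, of J a] by (simp add: \<delta>_def algebra_simps)
    then show "\<exists>J. N J ?z \<ge> c / 2 * lp r S a - e" by blast
  qed (use pr c m sr in auto)
  show False by (rule B.no_disjoint_copy)
qed

end

section \<open>Inequalities\<close>

lemma powr_mean_le:
  fixes u v t :: real
  assumes "u \<ge> 0" "v \<ge> 0" "0 < t" "t \<le> 1"
  shows "(u powr t + v powr t) / 2 \<le> ((u + v) / 2) powr t"
proof -
  have "(1/2 * u powr t + (1 - 1/2) * v powr t) powr (1 / t) \<le> 1/2 * (u powr t) powr (1 / t) + (1 - 1/2) * (v powr t) powr (1 / t)"
    by (rule powr_convex_bound) (use assms in auto)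
  also have "\<dots> = (u + v) / 2" using assms by (simp add: powr_powr)
  finally have "((u powr t + v powr t) / 2) powr (1 / t) \<le> (u + v) / 2" by (simp add: add_divide_distrib)
  then have "(((u powr t + v powr t) / 2) powr (1 / t)) powr t \<le> ((u + v) / 2) powr t"
    using assms by (intro powr_mono2) auto
  then show ?thesis using assms by (simp add: powr_powr)
qed

lemma powr_subadd:
  fixes u v t :: real
  assumes "u \<ge> 0" "v \<ge> 0" "0 < t" "t \<le> 1"
  shows "(u + v) powr t \<le> u powr t + v powr t"
proof (cases "u + v = 0")
  case True
  then show ?thesis using assms by simp
next
  case False
  then have uv: "u + v > 0" using assms by simp
  have *: "x \<le> x powr t" if "0 \<le> x" "x \<le> 1" for x
    using powr_mono'[of t 1 x] that assms by simp
  have "1 = u / (u + v) + v / (u + v)" using uv by (simp add: add_divide_distrib[symmetric])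
  also have "\<dots> \<le> (u / (u + v)) powr t + (v / (u + v)) powr t"
    using uv assms by (intro add_mono *) auto
  also have "\<dots> = (u powr t + v powr t) / (u + v) powr t"
    by (simp add: powr_divide add_divide_distrib)
  finally show ?thesis using uv by (simp add: field_simps)
qed

text \<open>A smooth majorant of \<open>\<bar>x\<bar> powr p\<close>. Under symmetric perturbations it gains at most the square of a small
  perturbation and the \<open>p\<close>-th power of a large one (\<open>bump_mean\<close>); \<open>\<bar>x\<bar> powr p\<close> itself has no such quadratic bound
  at \<open>0\<close>.\<close>

definition bump :: "real \<Rightarrow> real \<Rightarrow> real" where "bump p x = (1 + x\<^sup>2) powr (p / 2)"

lemma bump_nonneg [simp]: "bump p x \<ge> 0" by (simp add: bump_def)

lemma abs_powr_half: "\<bar>x::real\<bar> powr p = (x\<^sup>2) powr (p / 2)"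
proof -
  have "x\<^sup>2 = \<bar>x\<bar> powr 2" by (cases "x = 0") simp_all
  then have "(x\<^sup>2) powr (p / 2) = \<bar>x\<bar> powr (2 * (p / 2))" by (simp only: powr_powr)
  then show ?thesis by simp
qed

lemma powr_le_bump: "p > 0 \<Longrightarrow> \<bar>x\<bar> powr p \<le> bump p x"
  unfolding bump_def abs_powr_half by (intro powr_mono2) auto

lemma bump_mean:
  assumes "1 \<le> p" "p < 2"
  shows "(bump p (s + x) + bump p (s - x)) / 2 \<le> bump p s + min (x\<^sup>2) (\<bar>x\<bar> powr p)"
proof -
  let ?A = "1 + s\<^sup>2" and ?t = "p / 2"
  have t: "0 < ?t" "?t \<le> 1" using assms by auto
  have A: "?A \<ge> 1" by simp
  have "(bump p (s + x) + bump p (s - x)) / 2 \<le> (((1 + (s + x)\<^sup>2) + (1 + (s - x)\<^sup>2)) / 2) powr ?t"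
    unfolding bump_def by (rule powr_mean_le) (use t in auto)
  also have "((1 + (s + x)\<^sup>2) + (1 + (s - x)\<^sup>2)) / 2 = ?A + x\<^sup>2" by (simp add: power2_eq_square algebra_simps)
  finally have 1: "(bump p (s + x) + bump p (s - x)) / 2 \<le> (?A + x\<^sup>2) powr ?t" .
  have 2: "(?A + x\<^sup>2) powr ?t \<le> bump p s + \<bar>x\<bar> powr p"
    unfolding bump_def abs_powr_half by (rule powr_subadd) (use t in auto)
  have "(1 + x\<^sup>2 / ?A) powr ?t \<le> (1 + x\<^sup>2 / ?A) powr 1" using t A by (intro powr_mono) auto
  then have "?A powr ?t * (1 + x\<^sup>2 / ?A) powr ?t \<le> ?A powr ?t * (1 + x\<^sup>2 / ?A)"
    using A by (intro mult_left_mono) auto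
  moreover have "?A * (1 + x\<^sup>2 / ?A) = ?A + x\<^sup>2"
  proof -
    have "?A * (1 + x\<^sup>2 / ?A) = ?A + ?A * (x\<^sup>2 / ?A)" by (simp only: distrib_left mult_1_right)
    also have "?A * (x\<^sup>2 / ?A) = x\<^sup>2" using A by (intro nonzero_mult_div_cancel_left[of ?A, unfolded times_divide_eq_right[symmetric]]) linarith
    finally show ?thesis .
  qed
  then have "?A powr ?t * (1 + x\<^sup>2 / ?A) powr ?t = (?A + x\<^sup>2) powr ?t"
    by (simp only: powr_mult[symmetric])
  moreover have "?A powr ?t * (1 + x\<^sup>2 / ?A) = bump p s + x\<^sup>2 * (?A powr ?t / ?A)"
    by (simp add: bump_def distrib_left)
  ultimately have 3: "(?A + x\<^sup>2) powr ?t \<le> bump p s + x\<^sup>2 * (?A powr ?t / ?A)" by (simp only:)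
  have "?A powr ?t \<le> ?A powr 1" using A t by (intro powr_mono) auto
  moreover have "?A > 0" using A by linarith
  ultimately have "?A powr ?t / ?A \<le> 1" by (simp only: divide_le_eq_1_pos powr_one)
  then have "x\<^sup>2 * (?A powr ?t / ?A) \<le> x\<^sup>2 * 1" by (intro mult_left_mono) auto
  with 3 have "(?A + x\<^sup>2) powr ?t \<le> bump p s + x\<^sup>2" by simp
  with 1 2 show ?thesis by simp
qed

lemma power_mean_max:
  fixes s x p :: real
  assumes "1 \<le> p"
  shows "max (\<bar>s\<bar> powr p) (\<bar>x\<bar> powr p) \<le> (\<bar>s + x\<bar> powr p + \<bar>s - x\<bar> powr p) / 2"
proof -
  have "(1/2 * \<bar>s + x\<bar> + (1 - 1/2) * \<bar>s - x\<bar>) powr p \<le> 1/2 * \<bar>s + x\<bar> powr p + (1 - 1/2) * \<bar>s - x\<bar> powr p"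
    by (rule powr_convex_bound) (use assms in auto)
  moreover have "1/2 * \<bar>s + x\<bar> + (1 - 1/2) * \<bar>s - x\<bar> = max \<bar>s\<bar> \<bar>x\<bar>"
  proof -
    have "\<bar>s + x\<bar> + \<bar>s - x\<bar> = 2 * max \<bar>s\<bar> \<bar>x\<bar>" by linarith
    then show ?thesis by (simp add: field_simps)
  qed
  ultimately have "(max \<bar>s\<bar> \<bar>x\<bar>) powr p \<le> (\<bar>s + x\<bar> powr p + \<bar>s - x\<bar> powr p) / 2" by simp
  moreover have "\<bar>s\<bar> powr p \<le> (max \<bar>s\<bar> \<bar>x\<bar>) powr p" "\<bar>x\<bar> powr p \<le> (max \<bar>s\<bar> \<bar>x\<bar>) powr p"
    using assms by (auto intro!: powr_mono2)
  ultimately show ?thesis by (intro max.boundedI) (erule order_trans, assumption)+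
qed

text \<open>The terms decay geometrically on both sides of the index where \<open>x0 * \<rho> ^ k\<close> crosses \<open>1\<close>, so that the bound
  does not depend on \<open>x0\<close>.\<close>

lemma sum_min_powers_le:
  fixes x0 \<rho> \<alpha> \<beta> :: real
  assumes x0: "x0 > 0" and \<rho>: "\<rho> > 1" and a: "\<alpha> > 0" and b: "\<beta> > 0"
  shows "(\<Sum>k<n. min ((x0 * \<rho> ^ k) powr \<alpha>) ((x0 * \<rho> ^ k) powr (- \<beta>)))
    \<le> 1 / (1 - \<rho> powr (- \<alpha>)) + 1 / (1 - \<rho> powr (- \<beta>))"
proof -
  let ?x = "\<lambda>k. x0 * \<rho> ^ k"
  have geo: "(\<Sum>k<n. (\<rho> powr (- \<gamma>)) ^ k) \<le> 1 / (1 - \<rho> powr (- \<gamma>))" if "\<gamma> > 0" for \<gamma> n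
  proof -
    have g: "\<rho> powr (- \<gamma>) < 1" using \<rho> that by (simp add: powr_less_one)
    have "(\<Sum>k<n. (\<rho> powr (- \<gamma>)) ^ k) \<le> (\<Sum>k. (\<rho> powr (- \<gamma>)) ^ k)"
      by (rule sum_le_suminf) (use g in \<open>auto intro: summable_geometric\<close>)
    then show ?thesis using g by (simp add: suminf_geometric)
  qed
  have "\<exists>k0\<le>n. (\<forall>k<k0. ?x k < 1) \<and> (\<forall>k\<ge>k0. k < n \<longrightarrow> ?x k \<ge> 1)"
  proof (cases "\<exists>k. ?x k \<ge> 1 \<and> k < n")
    case True
    define k0 where "k0 = (LEAST k. ?x k \<ge> 1)"
    obtain k1 where k1: "?x k1 \<ge> 1" "k1 < n" using True by blast
    have k0: "?x k0 \<ge> 1" "k0 \<le> k1" unfolding k0_def using k1 by (auto intro: LeastI Least_le)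
    have "?x k < 1" if "k < k0" for k using not_less_Least[of k "\<lambda>k. ?x k \<ge> 1"] that k0_def by auto
    moreover have "?x k \<ge> 1" if "k \<ge> k0" for k
    proof -
      have "\<rho> ^ k0 \<le> \<rho> ^ k" using \<rho> that by (intro power_increasing) auto
      then have "?x k0 \<le> ?x k" using x0 by (intro mult_left_mono) auto
      with k0 show ?thesis by simp
    qed
    ultimately show ?thesis using k0 k1 by (intro exI[of _ k0]) auto
  next
    case False
    then show ?thesis by (intro exI[of _ n]) (auto simp: not_le)
  qed
  then obtain k0 where k0: "k0 \<le> n" "\<And>k. k < k0 \<Longrightarrow> ?x k < 1" "\<And>k. k \<ge> k0 \<Longrightarrow> k < n \<Longrightarrow> ?x k \<ge> 1" by blast
  let ?f = "\<lambda>k. min (?x k powr \<alpha>) (?x k powr (- \<beta>))"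
  have low: "?f k \<le> (\<rho> powr (- \<alpha>)) ^ (k0 - Suc k)" if "k < k0" for k
  proof -
    have "k0 - 1 < k0" using that by simp
    then have "?x (k0 - 1) < 1" by (rule k0(2))
    moreover have "\<rho> ^ (k0 - 1) = \<rho> ^ k * \<rho> ^ (k0 - Suc k)" using that by (simp flip: power_add)
    ultimately have "?x k * \<rho> ^ (k0 - Suc k) < 1" by (simp add: mult.assoc)
    then have "?x k \<le> 1 / \<rho> ^ (k0 - Suc k)" using \<rho> by (simp add: field_simps)
    then have "?x k powr \<alpha> \<le> (1 / \<rho> ^ (k0 - Suc k)) powr \<alpha>" using x0 \<rho> a by (intro powr_mono2) auto
    also have "\<dots> = (\<rho> powr (- \<alpha>)) ^ (k0 - Suc k)"
      using \<rho> by (simp add: powr_divide powr_minus_divide power_one_over powr_realpow[symmetric] powr_powr mult.commute)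
    finally show ?thesis by simp
  qed
  have high: "?f k \<le> (\<rho> powr (- \<beta>)) ^ (k - k0)" if "k0 \<le> k" "k < n" for k
  proof -
    have "?x k0 \<ge> 1" using that by (intro k0(3)) auto
    then have "1 * \<rho> ^ (k - k0) \<le> ?x k0 * \<rho> ^ (k - k0)" using \<rho> by (intro mult_right_mono) auto
    also have "\<dots> = ?x k" using that by (simp add: mult.assoc flip: power_add)
    finally have "?x k powr (- \<beta>) \<le> (\<rho> ^ (k - k0)) powr (- \<beta>)" using \<rho> b by (intro powr_mono2') auto
    also have "\<dots> = (\<rho> powr (- \<beta>)) ^ (k - k0)"
      using \<rho> by (simp add: powr_realpow[symmetric] powr_powr mult.commute)
    finally show ?thesis by simp
  qed
  have "(\<Sum>k<n. ?f k) = (\<Sum>k<k0. ?f k) + (\<Sum>k\<in>{k0..<n}. ?f k)"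
    using k0(1) by (subst sum.union_disjoint[symmetric]) (auto intro!: sum.cong)
  moreover have "(\<Sum>k<k0. ?f k) \<le> (\<Sum>k<k0. (\<rho> powr (- \<alpha>)) ^ (k0 - Suc k))" by (intro sum_mono low) auto
  moreover have "(\<Sum>k<k0. (\<rho> powr (- \<alpha>)) ^ (k0 - Suc k)) = (\<Sum>k<k0. (\<rho> powr (- \<alpha>)) ^ k)"
    by (rule sum.nat_diff_reindex)
  moreover have "(\<Sum>k\<in>{k0..<n}. ?f k) \<le> (\<Sum>k\<in>{k0..<n}. (\<rho> powr (- \<beta>)) ^ (k - k0))" by (intro sum_mono high) auto
  moreover have "(\<Sum>k\<in>{k0..<n}. (\<rho> powr (- \<beta>)) ^ (k - k0)) = (\<Sum>k<n - k0. (\<rho> powr (- \<beta>)) ^ k)"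
    by (rule sum.reindex_bij_witness[of _ "\<lambda>k. k + k0" "\<lambda>k. k - k0"]) auto
  ultimately show ?thesis using geo[OF a, of k0] geo[OF b, of "n - k0"] by linarith
qed

section \<open>Symmetric variables with power tails\<close>

text \<open>A geometric variable with ratio \<open>1/2\<close> and an independent fair sign.\<close>

definition coin :: "(nat \<times> bool) pmf"
  where "coin = pair_pmf (geometric_pmf (1/2)) (bernoulli_pmf (1/2))"

text \<open>The probability of \<open>\<bar>\<xi> r\<bar> \<ge> 2 powr (k / r)\<close> is \<open>2 powr (- k)\<close>: the tail exponent is \<open>r\<close>.\<close>

definition \<xi> :: "real \<Rightarrow> nat \<times> bool \<Rightarrow> real"
  where "\<xi> r = (\<lambda>(k, b). (if b then 1 else - 1) * 2 powr (real k / r))"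

lemma nn_integral_coin:
  assumes "\<And>k b. f (k, b) \<ge> (0::real)"
  shows "(\<integral>\<^sup>+z. ennreal (f z) \<partial>measure_pmf coin)
    = (\<integral>\<^sup>+k. ennreal ((f (k, True) + f (k, False)) / 2) \<partial>measure_pmf (geometric_pmf (1/2)))"
  unfolding coin_def nn_integral_pair_pmf'
  by (intro nn_integral_cong, subst nn_integral_bernoulli_pmf)
    (use assms in \<open>auto simp: ennreal_divide_numeral add_divide_distrib simp flip: divide_ennreal_def\<close>)

lemma nn_integral_geometric:
  assumes "\<And>k. f k \<ge> (0::real)"
  shows "(\<integral>\<^sup>+k. ennreal (f k) \<partial>measure_pmf (geometric_pmf (1/2))) = (\<Sum>k. ennreal (f k / 2 ^ Suc k))"
  unfolding nn_integral_measure_pmf nn_integral_count_space_nat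
  by (intro suminf_cong) (use assms in \<open>simp add: ennreal_mult[symmetric] power_one_over field_simps\<close>)

lemma geometric_tail: "measure_pmf.prob (geometric_pmf (1/2)) {k0..} = 1 / 2 ^ k0"
proof -
  have "measure_pmf.prob (geometric_pmf (1/2)) {..<k0} = (\<Sum>k<k0. 1 / 2 ^ Suc k)"
    by (subst measure_measure_pmf_finite) (auto simp: power_one_over mult.commute)
  also have "\<dots> = 1 - 1 / 2 ^ k0" by (induction k0) (auto simp: field_simps)
  finally have "measure_pmf.prob (geometric_pmf (1/2)) {..<k0} = 1 - 1 / 2 ^ k0" .
  moreover have "{k0..} = UNIV - {..<k0}" by auto
  ultimately show ?thesis using measure_pmf.prob_compl[of "{..<k0}" "geometric_pmf (1/2)"] by simp
qed

text \<open>Exponents are kept in \<open>[r0, r1]\<close>, away from \<open>p\<close> and from \<open>2\<close>, in order that one constant serves all of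
  them.\<close>

locale tails =
  fixes p r0 r1 :: real
  assumes p: "1 \<le> p" and r: "p < r0" "r0 \<le> r1" "r1 < 2"
begin

text \<open>The two geometric series of \<open>sum_min_powers_le\<close> at the worst exponents, \<open>r1\<close> for small values and \<open>r0\<close> for
  large ones.\<close>

definition C :: real
  where "C = (1 / (1 - 2 powr (- (2 - r1) / 2)) + 1 / (1 - 2 powr (- (r0 - p) / 2))) / 2"

lemma C_nonneg: "C \<ge> 0"
proof -
  have "2 powr (- (2 - r1) / 2) < 1" "2 powr (- (r0 - p) / 2) < 1" using r by (simp_all add: powr_less_one)
  then show ?thesis by (simp add: C_def)
qed

text \<open>The truncation makes the \<open>p\<close>-th power matter where \<open>\<xi>\<close> is large, which is integrable since \<open>p < s\<close>, and the
  square where it is small, which is of the right order since \<open>s < 2\<close>. Both parts scale like \<open>\<bar>a\<bar> powr s\<close>.\<close>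

lemma truncated_moment:
  assumes s: "r0 \<le> s" "s \<le> r1"
  shows "(\<integral>\<^sup>+k. ennreal (min ((a * 2 powr (real k / s))\<^sup>2) (\<bar>a * 2 powr (real k / s)\<bar> powr p)) \<partial>measure_pmf (geometric_pmf (1/2)))
    \<le> ennreal (C * \<bar>a\<bar> powr s)"
proof (cases "a = 0")
  case True
  then show ?thesis by simp
next
  case False
  then have a: "\<bar>a\<bar> > 0" by simp
  have s0: "0 < s" "s < 2" "p < s" using s r p by auto
  define \<rho> where "\<rho> = (2::real) powr (1 / s)"
  have \<rho>: "\<rho> > 1" using s0 by (simp add: \<rho>_def)
  let ?x = "\<lambda>k. \<bar>a\<bar> * \<rho> ^ k"
  have \<rho>_pow: "\<rho> ^ k = 2 powr (real k / s)" for k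
    by (simp add: \<rho>_def powr_power)
  have xk: "\<bar>a * 2 powr (real k / s)\<bar> = ?x k" for k
    by (simp add: \<rho>_pow abs_mult)
  have xpos: "?x k > 0" for k using a \<rho> by simp
  have trm: "min ((a * 2 powr (real k / s))\<^sup>2) (\<bar>a * 2 powr (real k / s)\<bar> powr p) / 2 ^ Suc k
    = \<bar>a\<bar> powr s / 2 * min (?x k powr (2 - s)) (?x k powr (- (s - p)))" for k
  proof -
    have "(\<rho> ^ k) powr s = 2 ^ k"
      unfolding \<rho>_pow powr_powr using s0 by (simp add: powr_realpow)
    then have 2: "?x k powr s = \<bar>a\<bar> powr s * 2 ^ k" by (simp add: powr_mult)
    have "(a * 2 powr (real k / s))\<^sup>2 = \<bar>a * 2 powr (real k / s)\<bar>\<^sup>2" by (rule power2_abs[symmetric])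
    moreover have "(?x k)\<^sup>2 = ?x k powr 2" using less_imp_le[OF xpos[of k]] by (rule powr_numeral[symmetric])
    moreover have "?x k powr 2 = ?x k powr s * ?x k powr (2 - s)" unfolding powr_add[symmetric] by simp
    ultimately have A: "(a * 2 powr (real k / s))\<^sup>2 = ?x k powr s * ?x k powr (2 - s)" by (simp only: xk)
    have B: "\<bar>a * 2 powr (real k / s)\<bar> powr p = ?x k powr s * ?x k powr (- (s - p))"
      unfolding xk powr_add[symmetric] by simp
    have "min (u * v) (u * v') = u * min v v'" if "u \<ge> 0" for u v v' :: real
      using that by (simp add: min_mult_distrib_left)
    from this[of "?x k powr s"] have "min ((a * 2 powr (real k / s))\<^sup>2) (\<bar>a * 2 powr (real k / s)\<bar> powr p)
      = ?x k powr s * min (?x k powr (2 - s)) (?x k powr (- (s - p)))"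
      unfolding A B by (simp only: powr_ge_zero)
    then show ?thesis unfolding 2 by simp
  qed
  have gp: "2 powr (- g / 2) \<ge> \<rho> powr (- g')" if "0 < g" "g \<le> g'" for g g'
  proof -
    have "\<rho> powr (- g') = 2 powr (- g' / s)" by (simp add: \<rho>_def powr_powr)
    moreover have "g / 2 \<le> g' / s" using that s0 by (intro frac_le) auto
    ultimately show ?thesis by simp
  qed
  have inv: "1 / (1 - \<rho> powr (- g')) \<le> 1 / (1 - 2 powr (- g / 2))" if "0 < g" "g \<le> g'" for g g'
  proof -
    have "2 powr (- g / 2) < 1" using that by (simp add: powr_less_one)
    then show ?thesis using gp[OF that] by (intro divide_left_mono) auto
  qed
  have fin: "(\<Sum>k<n. \<bar>a\<bar> powr s / 2 * min (?x k powr (2 - s)) (?x k powr (- (s - p)))) \<le> C * \<bar>a\<bar> powr s" for n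
  proof -
    have "(\<Sum>k<n. min (?x k powr (2 - s)) (?x k powr (- (s - p))))
      \<le> 1 / (1 - \<rho> powr (- (2 - s))) + 1 / (1 - \<rho> powr (- (s - p)))"
      by (rule sum_min_powers_le) (use a \<rho> s0 in auto)
    also have "\<dots> \<le> 2 * C"
      using inv[of "2 - r1" "2 - s"] inv[of "r0 - p" "s - p"] s r by (simp add: C_def)
    finally have "\<bar>a\<bar> powr s / 2 * (\<Sum>k<n. min (?x k powr (2 - s)) (?x k powr (- (s - p)))) \<le> \<bar>a\<bar> powr s / 2 * (2 * C)"
      by (intro mult_left_mono) auto
    then show ?thesis by (simp add: sum_distrib_left mult.commute)
  qed
  show ?thesis
  proof (subst nn_integral_geometric)
    show "(\<Sum>k. ennreal (min ((a * 2 powr (real k / s))\<^sup>2) (\<bar>a * 2 powr (real k / s)\<bar> powr p) / 2 ^ Suc k)) \<le> ennreal (C * \<bar>a\<bar> powr s)"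
      unfolding trm
    proof (rule suminf_le_const[OF summableI])
      fix n
      have "(\<Sum>k<n. ennreal (\<bar>a\<bar> powr s / 2 * min (?x k powr (2 - s)) (?x k powr (- (s - p)))))
        = ennreal (\<Sum>k<n. \<bar>a\<bar> powr s / 2 * min (?x k powr (2 - s)) (?x k powr (- (s - p))))"
        by (rule sum_ennreal) simp
      also have "\<dots> \<le> ennreal (C * \<bar>a\<bar> powr s)" by (rule ennreal_leI[OF fin])
      finally show "(\<Sum>k<n. ennreal (\<bar>a\<bar> powr s / 2 * min (?x k powr (2 - s)) (?x k powr (- (s - p))))) \<le> ennreal (C * \<bar>a\<bar> powr s)" .
    qed
  qed simp
qed

lemma bump_step:
  assumes s: "r0 \<le> s" "s \<le> r1"
  shows "(\<integral>\<^sup>+z. ennreal (bump p (x + a * \<xi> s z)) \<partial>measure_pmf coin) \<le> ennreal (bump p x) + ennreal (C * \<bar>a\<bar> powr s)"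
proof -
  have p2: "p < 2" using r by simp
  let ?y = "\<lambda>k. a * 2 powr (real k / s)"
  have "(\<integral>\<^sup>+z. ennreal (bump p (x + a * \<xi> s z)) \<partial>measure_pmf coin)
    = (\<integral>\<^sup>+k. ennreal ((bump p (x + ?y k) + bump p (x - ?y k)) / 2) \<partial>measure_pmf (geometric_pmf (1/2)))"
    by (subst nn_integral_coin) (auto simp: \<xi>_def)
  also have "\<dots> \<le> (\<integral>\<^sup>+k. ennreal (bump p x) + ennreal (min ((?y k)\<^sup>2) (\<bar>?y k\<bar> powr p)) \<partial>measure_pmf (geometric_pmf (1/2)))"
  proof (intro nn_integral_mono)
    fix k
    have "ennreal ((bump p (x + ?y k) + bump p (x - ?y k)) / 2) \<le> ennreal (bump p x + min ((?y k)\<^sup>2) (\<bar>?y k\<bar> powr p))"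
      by (rule ennreal_leI[OF bump_mean[OF p p2]])
    then show "ennreal ((bump p (x + ?y k) + bump p (x - ?y k)) / 2) \<le> ennreal (bump p x) + ennreal (min ((?y k)\<^sup>2) (\<bar>?y k\<bar> powr p))"
      by (subst ennreal_plus[symmetric]) simp_all
  qed
  also have "\<dots> = ennreal (bump p x) + (\<integral>\<^sup>+k. ennreal (min ((?y k)\<^sup>2) (\<bar>?y k\<bar> powr p)) \<partial>measure_pmf (geometric_pmf (1/2)))"
    by (subst nn_integral_add) (auto simp: measure_pmf.emeasure_space_1)
  also have "\<dots> \<le> ennreal (bump p x) + ennreal (C * \<bar>a\<bar> powr s)"
    by (intro add_left_mono truncated_moment s)
  finally show ?thesis .
qed

text \<open>With probability at least \<open>\<pi>\<close> the summand has absolute value at least \<open>1\<close>, and by symmetry the mean of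
  \<open>\<bar>x + y\<bar> powr p\<close> over the sign of \<open>y\<close> is at least the larger one of \<open>\<bar>x\<bar> powr p\<close> and \<open>\<bar>y\<bar> powr p\<close>.\<close>

lemma power_step:
  assumes s: "r0 \<le> s" "s \<le> r1" and a: "\<bar>a\<bar> \<le> 1"
  defines "\<pi> \<equiv> \<bar>a\<bar> powr s / 2"
  shows "ennreal (1 - \<pi>) * ennreal (\<bar>x\<bar> powr p) + ennreal \<pi> \<le> (\<integral>\<^sup>+z. ennreal (\<bar>x + a * \<xi> s z\<bar> powr p) \<partial>measure_pmf coin)"
proof -
  have s0: "s > 0" using s r p by auto
  have \<pi>: "0 \<le> \<pi>" "\<pi> \<le> 1 / 2" using a s0 by (simp_all add: \<pi>_def powr_le1)
  let ?y = "\<lambda>k. a * 2 powr (real k / s)" and ?G = "measure_pmf (geometric_pmf (1/2))"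
  let ?X = "\<bar>x\<bar> powr p"
  have eq: "(\<integral>\<^sup>+z. ennreal (\<bar>x + a * \<xi> s z\<bar> powr p) \<partial>measure_pmf coin)
    = (\<integral>\<^sup>+k. ennreal ((\<bar>x + ?y k\<bar> powr p + \<bar>x - ?y k\<bar> powr p) / 2) \<partial>?G)"
    by (subst nn_integral_coin) (auto simp: \<xi>_def)
  have ge: "(\<integral>\<^sup>+k. ennreal (max ?X (\<bar>?y k\<bar> powr p)) \<partial>?G) \<le> (\<integral>\<^sup>+z. ennreal (\<bar>x + a * \<xi> s z\<bar> powr p) \<partial>measure_pmf coin)"
    unfolding eq by (intro nn_integral_mono ennreal_leI power_mean_max p)
  have "\<exists>k0. \<pi> \<le> 1 / 2 ^ k0 \<and> (a \<noteq> 0 \<longrightarrow> (\<forall>k\<ge>k0. \<bar>?y k\<bar> \<ge> 1))"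
  proof (cases "a = 0")
    case True
    then show ?thesis by (intro exI[of _ 0]) (simp add: \<pi>_def)
  next
    case False
    then have ap: "\<bar>a\<bar> powr s > 0" by simp
    define k0 where "k0 = (LEAST k. 2 ^ k * \<bar>a\<bar> powr s \<ge> 1)"
    obtain k1 :: nat where "1 / (\<bar>a\<bar> powr s) < 2 ^ k1" using real_arch_pow[of 2] by auto
    then have "2 ^ k1 * \<bar>a\<bar> powr s \<ge> 1" using ap by (simp add: field_simps)
    then have k0: "2 ^ k0 * \<bar>a\<bar> powr s \<ge> 1" unfolding k0_def by (rule LeastI)
    have "\<pi> \<le> 1 / 2 ^ k0"
    proof (cases k0)
      case 0 then show ?thesis using \<pi> by simp
    next
      case (Suc k)
      then have "\<not> 2 ^ k * \<bar>a\<bar> powr s \<ge> 1" using not_less_Least[of k "\<lambda>k. 2 ^ k * \<bar>a\<bar> powr s \<ge> 1"] by (simp add: k0_def)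
      then show ?thesis using Suc by (simp add: \<pi>_def field_simps)
    qed
    moreover have "\<bar>?y k\<bar> \<ge> 1" if "k \<ge> k0" for k
    proof -
      have "\<bar>?y k\<bar> powr s = 2 ^ k * \<bar>a\<bar> powr s"
        using s0 by (simp add: abs_mult powr_mult powr_powr powr_realpow)
      also have "\<dots> \<ge> 2 ^ k0 * \<bar>a\<bar> powr s" using that by (intro mult_right_mono power_increasing) auto
      finally have "1 \<le> \<bar>?y k\<bar> powr s" using k0 by simp
      then have "1 powr (1 / s) \<le> (\<bar>?y k\<bar> powr s) powr (1 / s)" using s0 by (intro powr_mono2) auto
      then show ?thesis using s0 by (simp add: powr_powr)
    qed
    ultimately show ?thesis by blast
  qed
  then obtain k0 where k0: "\<pi> \<le> 1 / 2 ^ k0" "a \<noteq> 0 \<Longrightarrow> k \<ge> k0 \<Longrightarrow> \<bar>?y k\<bar> \<ge> 1" for k by blast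
  show ?thesis
  proof (cases "?X \<ge> 1 \<or> a = 0")
    case True
    have "ennreal (1 - \<pi>) * ennreal ?X + ennreal \<pi> = ennreal ((1 - \<pi>) * ?X + \<pi>)"
      using \<pi> by (simp add: ennreal_mult)
    also have "(1 - \<pi>) * ?X + \<pi> \<le> ?X"
    proof (cases "a = 0")
      case True then show ?thesis by (simp add: \<pi>_def)
    next
      case False
      then have "\<pi> * 1 \<le> \<pi> * ?X" using True \<pi> by (intro mult_left_mono) auto
      then show ?thesis by (simp add: left_diff_distrib)
    qed
    then have "ennreal ((1 - \<pi>) * ?X + \<pi>) \<le> ennreal ?X" by (rule ennreal_leI)
    also have "ennreal ?X = (\<integral>\<^sup>+k. ennreal ?X \<partial>?G)" by (simp add: measure_pmf.emeasure_space_1)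
    also have "\<dots> \<le> (\<integral>\<^sup>+k. ennreal (max ?X (\<bar>?y k\<bar> powr p)) \<partial>?G)" by (intro nn_integral_mono ennreal_leI) simp
    finally show ?thesis using ge by (rule order_trans)
  next
    case False
    then have X: "?X < 1" and a0: "a \<noteq> 0" by auto
    have "(1 - \<pi>) * ?X + \<pi> = ?X + (1 - ?X) * \<pi>" by (simp add: algebra_simps)
    also have "\<dots> \<le> ?X + (1 - ?X) * (1 / 2 ^ k0)" using X k0(1) by (intro add_left_mono mult_left_mono) auto
    finally have "ennreal (1 - \<pi>) * ennreal ?X + ennreal \<pi> \<le> ennreal (?X + (1 - ?X) * (1 / 2 ^ k0))"
      using \<pi> by (simp add: ennreal_mult[symmetric] ennreal_plus[symmetric] ennreal_leI del: ennreal_plus)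
    also have "\<dots> = ennreal ?X + ennreal (1 - ?X) * ennreal (measure_pmf.prob (geometric_pmf (1/2)) {k0..})"
      using X by (simp add: geometric_tail ennreal_mult[symmetric] del: ennreal_plus flip: ennreal_plus)
    also have "\<dots> = (\<integral>\<^sup>+k. ennreal ?X + ennreal (1 - ?X) * indicator {k0..} k \<partial>?G)"
      by (subst nn_integral_add) (auto simp: nn_integral_cmult measure_pmf.emeasure_eq_measure measure_pmf.prob_space)
    also have "\<dots> \<le> (\<integral>\<^sup>+k. ennreal (max ?X (\<bar>?y k\<bar> powr p)) \<partial>?G)"
    proof (intro nn_integral_mono)
      fix k
      show "ennreal ?X + ennreal (1 - ?X) * indicator {k0..} k \<le> ennreal (max ?X (\<bar>?y k\<bar> powr p))"
      proof (cases "k \<ge> k0")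
        case True
        then have "1 \<le> \<bar>?y k\<bar> powr p" using k0(2)[OF a0 True] p by (simp add: ge_one_powr_ge_zero)
        then have "ennreal 1 \<le> ennreal (max ?X (\<bar>?y k\<bar> powr p))" by (intro ennreal_leI) simp
        moreover have "ennreal ?X + ennreal (1 - ?X) = ennreal 1" using X by (simp flip: ennreal_plus)
        ultimately show ?thesis using True by simp
      qed (auto intro: ennreal_leI)
    qed
    finally show ?thesis using ge by (rule order_trans)
  qed
qed

end

definition coins :: "(nat \<Rightarrow> nat \<times> bool) measure"
  where "coins = (\<Pi>\<^sub>M i\<in>UNIV. measure_pmf coin)"

interpretation coins: product_prob_space "\<lambda>_::nat. measure_pmf coin" UNIV
  by unfold_locales

lemma prob_space_coins: "prob_space coins"
  unfolding coins_def by (intro prob_space_PiM prob_space_measure_pmf)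

lemma measurable_coin_component: "i \<in> J \<Longrightarrow> (\<lambda>\<omega>. f (\<omega> i)) \<in> (\<Pi>\<^sub>M i\<in>J. measure_pmf coin) \<rightarrow>\<^sub>M borel"
  by (rule measurable_compose[OF measurable_component_singleton]) auto

lemma measurable_coin_sum:
  fixes f :: "nat \<Rightarrow> nat \<times> bool \<Rightarrow> real"
  shows "S \<subseteq> J \<Longrightarrow> (\<lambda>\<omega>. \<Sum>i\<in>S. f i (\<omega> i)) \<in> borel_measurable (\<Pi>\<^sub>M i\<in>J. measure_pmf coin)"
  by (intro borel_measurable_sum measurable_coin_component) auto

section \<open>Transport to the unit interval\<close>

text \<open>With the digits \<open>0\<close> and \<open>1\<close> only, expansions in base \<open>4\<close> are unique.\<close>

definition quaternary :: "(nat \<Rightarrow> bool) \<Rightarrow> real"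
  where "quaternary b = (\<Sum>k. of_bool (b k) / 4 ^ Suc k)"

lemma summable_quaternary: "summable (\<lambda>k. of_bool (b k) / 4 ^ Suc k :: real)"
proof (rule summable_comparison_test')
  show "summable (\<lambda>k. (1/4) ^ k :: real)" by (simp add: summable_geometric)
  show "norm (of_bool (b k) / 4 ^ Suc k :: real) \<le> (1/4) ^ k" for k
    by (cases "b k") (simp_all add: power_one_over field_simps)
qed

lemma quaternary_bounds: "0 \<le> quaternary b" "quaternary b < 1"
proof -
  show "0 \<le> quaternary b" unfolding quaternary_def by (intro suminf_nonneg summable_quaternary) auto
  have sg: "summable (\<lambda>k. (1/4) * (1/4) ^ k :: real)" by (intro summable_mult summable_geometric) auto
  have "quaternary b \<le> (\<Sum>k. (1/4) * (1/4) ^ k)"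
    unfolding quaternary_def
    by (intro suminf_le summable_quaternary sg) (simp add: power_one_over)
  also have "\<dots> = 1 / 3" by (subst suminf_mult) (simp_all add: suminf_geometric summable_geometric)
  finally show "quaternary b < 1" by simp
qed

lemma quaternary_shift: "4 * quaternary b = of_bool (b 0) + quaternary (\<lambda>k. b (Suc k))"
proof -
  have "quaternary b = of_bool (b 0) / 4 + (\<Sum>k. of_bool (b (Suc k)) / 4 ^ Suc (Suc k))"
    unfolding quaternary_def using suminf_split_head[OF summable_quaternary[of b]] by simp
  also have "(\<Sum>k. of_bool (b (Suc k)) / 4 ^ Suc (Suc k) :: real) = (\<Sum>k. (1/4) * (of_bool (b (Suc k)) / 4 ^ Suc k))"
    by simp
  also have "\<dots> = (1/4) * quaternary (\<lambda>k. b (Suc k))"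
    unfolding quaternary_def by (rule suminf_mult[OF summable_quaternary])
  finally show ?thesis by simp
qed

lemma quaternary_digit: "odd \<lfloor>4 ^ Suc k * quaternary b\<rfloor> \<longleftrightarrow> b k"
proof -
  have "\<exists>n::int. 4 ^ Suc k * quaternary b = of_int n + quaternary (\<lambda>i. b (i + Suc k)) \<and> (odd n \<longleftrightarrow> b k)"
  proof (induction k)
    case 0
    show ?case by (intro exI[of _ "of_bool (b 0)"]) (simp add: quaternary_shift)
  next
    case (Suc k)
    then obtain n :: int where n: "4 ^ Suc k * quaternary b = of_int n + quaternary (\<lambda>i. b (i + Suc k))" by blast
    have "4 ^ Suc (Suc k) * quaternary b = 4 * (4 ^ Suc k * quaternary b)" by simp
    also have "\<dots> = of_int (4 * n + of_bool (b (Suc k))) + quaternary (\<lambda>i. b (i + Suc (Suc k)))"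
      unfolding n distrib_left quaternary_shift by simp
    finally have "4 ^ Suc (Suc k) * quaternary b = of_int (4 * n + of_bool (b (Suc k))) + quaternary (\<lambda>i. b (i + Suc (Suc k)))" .
    then show ?case by (intro exI[of _ "4 * n + of_bool (b (Suc k))"]) simp
  qed
  then obtain n :: int where n: "4 ^ Suc k * quaternary b = of_int n + quaternary (\<lambda>i. b (i + Suc k))" "odd n \<longleftrightarrow> b k" by blast
  have "\<lfloor>4 ^ Suc k * quaternary b\<rfloor> = n"
    unfolding n(1) by (rule floor_unique) (use quaternary_bounds in auto)
  then show ?thesis using n(2) by simp
qed

text \<open>Digit \<open>(i, j)\<close> says whether the \<open>i\<close>-th value has number \<open>j\<close>.\<close>

definition encode :: "(nat \<Rightarrow> nat \<times> bool) \<Rightarrow> real"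
  where "encode \<omega> = quaternary (\<lambda>k. to_nat (\<omega> (fst (prod_decode k))) = snd (prod_decode k))"

definition decode :: "real \<Rightarrow> nat \<Rightarrow> nat \<times> bool"
  where "decode x i = from_nat (LEAST j. odd \<lfloor>4 ^ Suc (prod_encode (i, j)) * x\<rfloor>)"

lemma decode_encode: "decode (encode \<omega>) = \<omega>"
proof
  fix i
  have "odd \<lfloor>4 ^ Suc (prod_encode (i, j)) * encode \<omega>\<rfloor> \<longleftrightarrow> to_nat (\<omega> i) = j" for j
    unfolding encode_def quaternary_digit by simp
  moreover have "(LEAST j. to_nat (\<omega> i) = j) = to_nat (\<omega> i)" by (rule Least_equality) auto
  ultimately show "decode (encode \<omega>) i = \<omega> i" unfolding decode_def by (simp only: from_nat_to_nat)
qed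

lemma measurable_encode: "encode \<in> borel_measurable coins"
  unfolding encode_def quaternary_def
proof (intro borel_measurable_suminf borel_measurable_divide borel_measurable_const)
  fix k
  show "(\<lambda>\<omega>. of_bool (to_nat (\<omega> (fst (prod_decode k))) = snd (prod_decode k)) :: real) \<in> borel_measurable coins"
    unfolding coins_def by (rule measurable_coin_component) simp
qed

lemma measurable_decode: "decode \<in> borel \<rightarrow>\<^sub>M coins"
proof -
  have "(\<lambda>x. \<lambda>i\<in>UNIV. decode x i) \<in> borel \<rightarrow>\<^sub>M (\<Pi>\<^sub>M i\<in>UNIV. measure_pmf coin)"
  proof (rule measurable_restrict)
    fix i :: nat
    have "(\<lambda>x. LEAST j. odd \<lfloor>4 ^ Suc (prod_encode (i, j)) * (x::real)\<rfloor>) \<in> borel \<rightarrow>\<^sub>M count_space UNIV"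
      by (rule measurable_Least) measurable
    then have "(\<lambda>x. decode x i) \<in> borel \<rightarrow>\<^sub>M count_space UNIV"
      unfolding decode_def by (rule measurable_compose) simp
    then show "(\<lambda>x. decode x i) \<in> borel \<rightarrow>\<^sub>M measure_pmf coin"
      using measurable_cong_sets[of borel borel "measure_pmf coin" "count_space UNIV"] by simp
  qed
  then show ?thesis by (simp add: coins_def restrict_def)
qed

text \<open>The sequence of coins is coded by one real number; the quantile function of the distribution of the
  code transports it to \<open>[0,1]\<close>.\<close>

lemma coins_on_unit_interval:
  obtains \<psi> where "\<psi> \<in> unit_leb \<rightarrow>\<^sub>M coins"
    "\<And>f. f \<in> borel_measurable coins \<Longrightarrow> (\<integral>\<^sup>+t. f (\<psi> t) \<partial>unit_leb) = (\<integral>\<^sup>+\<omega>. f \<omega> \<partial>coins)"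
proof -
  interpret P: prob_space coins by (rule prob_space_coins)
  define \<mu> where "\<mu> = distr coins borel encode"
  have rd: "real_distribution \<mu>"
    unfolding \<mu>_def using P.real_distribution_distr[OF measurable_encode] .
  interpret cdf_distribution \<mu> unfolding cdf_distribution_def by (rule rd)
  define \<psi> where "\<psi> t = decode (if t \<in> {0<..<1} then I t else 0)" for t
  have I_meas: "(\<lambda>t. if t \<in> {0<..<1} then I t else 0) \<in> borel_measurable borel"
    using measurable_CI by (subst measurable_restrict_space_iff[symmetric]) auto
  have \<psi>_borel: "\<psi> \<in> borel \<rightarrow>\<^sub>M coins"
    unfolding \<psi>_def by (rule measurable_compose[OF I_meas measurable_decode])
  have \<psi>_leb: "\<psi> \<in> lebesgue \<rightarrow>\<^sub>M coins"
    by (intro measurable_completion) (use \<psi>_borel in simp)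
  show ?thesis
  proof (rule that[of \<psi>])
    show "\<psi> \<in> unit_leb \<rightarrow>\<^sub>M coins" by (rule measurable_restrict_space1[OF \<psi>_leb])
    fix f :: "(nat \<Rightarrow> nat \<times> bool) \<Rightarrow> ennreal" assume f: "f \<in> borel_measurable coins"
    have f\<psi>: "(\<lambda>t. f (\<psi> t)) \<in> borel_measurable borel" by (rule measurable_compose[OF \<psi>_borel f])
    have I_meas': "I \<in> restrict_space lborel {0<..<1} \<rightarrow>\<^sub>M borel"
      using measurable_CI by (simp add: measurable_cong_sets[OF sets_restrict_space_cong[OF sets_lborel] refl])
    have fd: "(\<lambda>x. f (decode x)) \<in> borel_measurable borel" by (rule measurable_compose[OF measurable_decode f])
    have "(\<integral>\<^sup>+t. f (\<psi> t) \<partial>unit_leb) = (\<integral>\<^sup>+t. f (\<psi> t) * indicator {0..1} t \<partial>lebesgue)"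
      by (subst nn_integral_restrict_space) auto
    also have "\<dots> = (\<integral>\<^sup>+t. f (\<psi> t) * indicator {0..1} t \<partial>lborel)" by (rule nn_integral_completion)
    also have "\<dots> = (\<integral>\<^sup>+t. f (\<psi> t) * indicator {0<..<1} t \<partial>lborel)"
    proof (rule nn_integral_cong_AE)
      have "AE t in lborel. t \<notin> {0, 1::real}" by (intro AE_not_in) (simp add: finite_imp_null_set_lborel)
      then show "AE t in lborel. f (\<psi> t) * indicator {0..1} t = f (\<psi> t) * indicator {0<..<1} t"
        by eventually_elim (auto simp: indicator_def)
    qed
    also have "\<dots> = (\<integral>\<^sup>+t. f (\<psi> t) \<partial>restrict_space lborel {0<..<1})"
      by (subst nn_integral_restrict_space) auto
    also have "\<dots> = (\<integral>\<^sup>+t. f (decode (I t)) \<partial>restrict_space lborel {0<..<1})"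
      by (intro nn_integral_cong) (auto simp: \<psi>_def space_restrict_space)
    also have "\<dots> = (\<integral>\<^sup>+x. f (decode x) \<partial>distr (restrict_space lborel {0<..<1}) borel I)"
      by (subst nn_integral_distr[OF I_meas']) (simp_all add: fd)
    also have "\<dots> = (\<integral>\<^sup>+x. f (decode x) \<partial>\<mu>)" by (simp only: distr_I_eq_M)
    also have "\<dots> = (\<integral>\<^sup>+\<omega>. f (decode (encode \<omega>)) \<partial>coins)"
      unfolding \<mu>_def by (subst nn_integral_distr[OF measurable_encode]) (simp_all add: fd)
    finally show "(\<integral>\<^sup>+t. f (\<psi> t) \<partial>unit_leb) = (\<integral>\<^sup>+\<omega>. f \<omega> \<partial>coins)" by (simp only: decode_encode)
  qed
qed

section \<open>Moments of independent sums\<close>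

context tails begin

abbreviation coins_on :: "nat set \<Rightarrow> (nat \<Rightarrow> nat \<times> bool) measure"
  where "coins_on J \<equiv> (\<Pi>\<^sub>M i\<in>J. measure_pmf coin)"

lemma fold_out:
  fixes g :: "real \<Rightarrow> ennreal" and f :: "nat \<Rightarrow> nat \<times> bool \<Rightarrow> real"
  assumes J: "finite J" "j \<notin> J" and g: "g \<in> borel_measurable borel"
  shows "(\<integral>\<^sup>+\<omega>. g (\<Sum>i\<in>insert j J. f i (\<omega> i)) \<partial>coins_on (insert j J))
    = (\<integral>\<^sup>+\<omega>. (\<integral>\<^sup>+z. g ((\<Sum>i\<in>J. f i (\<omega> i)) + f j z) \<partial>measure_pmf coin) \<partial>coins_on J)"
proof -
  have m: "(\<lambda>\<omega>. g (\<Sum>i\<in>insert j J. f i (\<omega> i))) \<in> borel_measurable (coins_on (insert j J))"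
    by (rule measurable_compose[OF measurable_coin_sum[OF order_refl] g])
  have "(\<Sum>i\<in>insert j J. f i (fun_upd \<omega> j z i)) = (\<Sum>i\<in>J. f i (\<omega> i)) + f j z" for \<omega> z
  proof -
    have "(\<Sum>i\<in>J. f i (fun_upd \<omega> j z i)) = (\<Sum>i\<in>J. f i (\<omega> i))" using J by (intro sum.cong) auto
    then show ?thesis using J by (simp add: add.commute)
  qed
  then show ?thesis by (subst coins.product_nn_integral_insert[OF J m]) simp
qed

lemma bump_moment:
  assumes s: "r0 \<le> s" "s \<le> r1" and J: "finite J"
  shows "(\<integral>\<^sup>+\<omega>. ennreal (bump p (\<Sum>i\<in>J. a i * \<xi> s (\<omega> i))) \<partial>coins_on J) \<le> ennreal (1 + C * (\<Sum>i\<in>J. \<bar>a i\<bar> powr s))"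
  using J
proof (induction J rule: finite_induct)
  case empty
  interpret prob_space "coins_on {}" by (intro prob_space_PiM prob_space_measure_pmf)
  show ?case by (simp add: bump_def emeasure_space_1)
next
  case (insert j J)
  interpret J: prob_space "coins_on J" by (intro prob_space_PiM prob_space_measure_pmf)
  let ?f = "\<lambda>i z. a i * \<xi> s z"
  have b: "(\<lambda>x. ennreal (bump p x)) \<in> borel_measurable borel" unfolding bump_def by measurable
  have "(\<integral>\<^sup>+\<omega>. ennreal (bump p (\<Sum>i\<in>insert j J. ?f i (\<omega> i))) \<partial>coins_on (insert j J))
    = (\<integral>\<^sup>+\<omega>. (\<integral>\<^sup>+z. ennreal (bump p ((\<Sum>i\<in>J. ?f i (\<omega> i)) + ?f j z)) \<partial>measure_pmf coin) \<partial>coins_on J)"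
    by (rule fold_out[OF insert.hyps b])
  also have "\<dots> \<le> (\<integral>\<^sup>+\<omega>. ennreal (bump p (\<Sum>i\<in>J. ?f i (\<omega> i))) + ennreal (C * \<bar>a j\<bar> powr s) \<partial>coins_on J)"
    by (intro nn_integral_mono bump_step s)
  also have "\<dots> = (\<integral>\<^sup>+\<omega>. ennreal (bump p (\<Sum>i\<in>J. ?f i (\<omega> i))) \<partial>coins_on J) + ennreal (C * \<bar>a j\<bar> powr s)"
    by (subst nn_integral_add[OF measurable_compose[OF measurable_coin_sum[OF order_refl] b]]) (simp_all add: J.emeasure_space_1)
  also have "\<dots> \<le> ennreal (1 + C * (\<Sum>i\<in>J. \<bar>a i\<bar> powr s)) + ennreal (C * \<bar>a j\<bar> powr s)"
    by (intro add_right_mono insert.IH)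
  also have "\<dots> = ennreal (1 + C * (\<Sum>i\<in>insert j J. \<bar>a i\<bar> powr s))"
    using insert.hyps C_nonneg by (subst ennreal_plus[symmetric]) (auto simp: algebra_simps sum_nonneg)
  finally show ?case .
qed

text \<open>Iterating \<open>power_step\<close> gives a bound by the probability that at least one of independent events of
  probability \<open>\<bar>a i\<bar> powr s / 2\<close> occurs.\<close>

lemma power_moment:
  assumes s: "r0 \<le> s" "s \<le> r1" and J: "finite J" and a: "\<And>i. i \<in> J \<Longrightarrow> \<bar>a i\<bar> \<le> 1"
  shows "ennreal (1 - (\<Prod>i\<in>J. 1 - \<bar>a i\<bar> powr s / 2)) \<le> (\<integral>\<^sup>+\<omega>. ennreal (\<bar>\<Sum>i\<in>J. a i * \<xi> s (\<omega> i)\<bar> powr p) \<partial>coins_on J)"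
  using J a
proof (induction J rule: finite_induct)
  case (insert j J)
  interpret J: prob_space "coins_on J" by (intro prob_space_PiM prob_space_measure_pmf)
  let ?f = "\<lambda>i z. a i * \<xi> s z"
  have s0: "s > 0" using s r p by auto
  define \<pi> where "\<pi> i = \<bar>a i\<bar> powr s / 2" for i
  have \<pi>: "0 \<le> \<pi> i" "\<pi> i \<le> 1" if "i \<in> insert j J" for i
  proof -
    have "\<bar>a i\<bar> powr s \<le> 1" using insert.prems[OF that] s0 by (simp add: powr_le1)
    then show "0 \<le> \<pi> i" "\<pi> i \<le> 1" by (auto simp: \<pi>_def)
  qed
  have prod01: "0 \<le> (\<Prod>i\<in>J. 1 - \<pi> i)" "(\<Prod>i\<in>J. 1 - \<pi> i) \<le> 1"
    using \<pi> by (auto intro!: prod_nonneg prod_le_1)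
  let ?Q = "\<Prod>i\<in>J. 1 - \<pi> i"
  have b: "(\<lambda>x. ennreal (\<bar>x\<bar> powr p)) \<in> borel_measurable borel" by measurable
  have "ennreal (1 - (\<Prod>i\<in>insert j J. 1 - \<pi> i)) = ennreal ((1 - \<pi> j) * (1 - ?Q) + \<pi> j)"
    using insert.hyps by (simp add: algebra_simps)
  also have "\<dots> = ennreal (1 - \<pi> j) * ennreal (1 - ?Q) + ennreal (\<pi> j)"
    using \<pi>[of j] prod01 by (simp add: ennreal_mult)
  also have "\<dots> \<le> ennreal (1 - \<pi> j) * (\<integral>\<^sup>+\<omega>. ennreal (\<bar>\<Sum>i\<in>J. ?f i (\<omega> i)\<bar> powr p) \<partial>coins_on J) + ennreal (\<pi> j)"
    using insert.IH insert.prems unfolding \<pi>_def by (intro add_right_mono mult_left_mono) auto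
  also have "\<dots> = (\<integral>\<^sup>+\<omega>. ennreal (1 - \<pi> j) * ennreal (\<bar>\<Sum>i\<in>J. ?f i (\<omega> i)\<bar> powr p) + ennreal (\<pi> j) \<partial>coins_on J)"
    by (subst nn_integral_add; (subst nn_integral_cmult)?)
      (auto simp: J.emeasure_space_1 intro!: borel_measurable_times_ennreal measurable_compose[OF measurable_coin_sum[OF order_refl] b])
  also have "\<dots> \<le> (\<integral>\<^sup>+\<omega>. (\<integral>\<^sup>+z. ennreal (\<bar>(\<Sum>i\<in>J. ?f i (\<omega> i)) + ?f j z\<bar> powr p) \<partial>measure_pmf coin) \<partial>coins_on J)"
    unfolding \<pi>_def by (intro nn_integral_mono power_step s insert.prems) simp
  also have "\<dots> = (\<integral>\<^sup>+\<omega>. ennreal (\<bar>\<Sum>i\<in>insert j J. ?f i (\<omega> i)\<bar> powr p) \<partial>coins_on (insert j J))"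
    by (rule fold_out[OF insert.hyps b, symmetric])
  finally show ?case by (simp only: \<pi>_def)
qed simp

definition c1 :: real where "c1 = 1 - exp (- (1/2))"
definition c2 :: real where "c2 = 1 + C"

text \<open>By homogeneity the coefficients may be normalized in \<open>\<ell>\<^sub>s\<close>. The upper bound comes from \<open>bump_moment\<close>, the
  lower one from \<open>power_moment\<close> and \<open>1 - t \<le> exp (- t)\<close>.\<close>

lemma moment_bounds:
  assumes s: "r0 \<le> s" "s \<le> r1" and J: "finite J"
  shows "ennreal (c1 * lp s J a powr p) \<le> (\<integral>\<^sup>+\<omega>. ennreal (\<bar>\<Sum>i\<in>J. a i * \<xi> s (\<omega> i)\<bar> powr p) \<partial>coins_on J)"
    and "(\<integral>\<^sup>+\<omega>. ennreal (\<bar>\<Sum>i\<in>J. a i * \<xi> s (\<omega> i)\<bar> powr p) \<partial>coins_on J) \<le> ennreal (c2 * lp s J a powr p)"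
proof -
  interpret prob_space "coins_on J" by (intro prob_space_PiM prob_space_measure_pmf)
  have s0: "s > 0" and p0: "p > 0" using s r p by auto
  let ?A = "lp s J a"
  have c1: "0 \<le> c1" by (simp add: c1_def)
  have "ennreal (c1 * ?A powr p) \<le> (\<integral>\<^sup>+\<omega>. ennreal (\<bar>\<Sum>i\<in>J. a i * \<xi> s (\<omega> i)\<bar> powr p) \<partial>coins_on J) \<and>
    (\<integral>\<^sup>+\<omega>. ennreal (\<bar>\<Sum>i\<in>J. a i * \<xi> s (\<omega> i)\<bar> powr p) \<partial>coins_on J) \<le> ennreal (c2 * ?A powr p)"
  proof (cases "?A = 0")
    case True
    then have "a i = 0" if "i \<in> J" for i using lp_coord[OF s0 J that, of a] by simp
    then show ?thesis using True p0 by simp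
  next
    case False
    then have A: "?A > 0" using lp_nonneg[of s J a] by linarith
    define b where "b = (\<lambda>i. a i / ?A)"
    have "lp s J b = \<bar>1 / ?A\<bar> * ?A" using lp_scale[OF s0, of J "1 / ?A" a] by (simp add: b_def)
    then have lb: "lp s J b = 1" using A by simp
    then have sb: "(\<Sum>i\<in>J. \<bar>b i\<bar> powr s) = 1" using lp_powr[of s J b] s0 by simp
    have b1: "\<bar>b i\<bar> \<le> 1" if "i \<in> J" for i using lp_coord[OF s0 J that, of b] lb by simp
    let ?b = "\<lambda>\<omega>. \<Sum>i\<in>J. b i * \<xi> s (\<omega> i)"
    have m: "(\<lambda>\<omega>. ennreal (\<bar>?b \<omega>\<bar> powr p)) \<in> borel_measurable (coins_on J)"
      by (rule measurable_compose[OF measurable_coin_sum[OF order_refl]]) measurable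
    have "(\<Prod>i\<in>J. 1 - \<bar>b i\<bar> powr s / 2) \<le> (\<Prod>i\<in>J. exp (- (\<bar>b i\<bar> powr s / 2)))"
    proof (intro prod_mono conjI)
      fix i assume i: "i \<in> J"
      have "\<bar>b i\<bar> powr s \<le> 1" using b1[OF i] s0 by (simp add: powr_le1)
      then show "0 \<le> 1 - \<bar>b i\<bar> powr s / 2" by simp
      show "1 - \<bar>b i\<bar> powr s / 2 \<le> exp (- (\<bar>b i\<bar> powr s / 2))" using exp_ge_add_one_self[of "- (\<bar>b i\<bar> powr s / 2)"] by simp
    qed
    also have "\<dots> = exp (\<Sum>i\<in>J. - (\<bar>b i\<bar> powr s / 2))" by (rule exp_sum[OF J, symmetric])
    also have "(\<Sum>i\<in>J. - (\<bar>b i\<bar> powr s / 2)) = - (1/2)" using sb by (simp add: sum_negf sum_divide_distrib[symmetric])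
    finally have "c1 \<le> 1 - (\<Prod>i\<in>J. 1 - \<bar>b i\<bar> powr s / 2)" by (simp add: c1_def)
    from order_trans[OF ennreal_leI[OF this] power_moment[OF s J b1]]
    have lower: "ennreal c1 \<le> (\<integral>\<^sup>+\<omega>. ennreal (\<bar>?b \<omega>\<bar> powr p) \<partial>coins_on J)" .
    have "(\<integral>\<^sup>+\<omega>. ennreal (\<bar>?b \<omega>\<bar> powr p) \<partial>coins_on J) \<le> (\<integral>\<^sup>+\<omega>. ennreal (bump p (?b \<omega>)) \<partial>coins_on J)"
      by (intro nn_integral_mono ennreal_leI powr_le_bump p0)
    also have "\<dots> \<le> ennreal c2" using bump_moment[OF s J, of b] by (simp only: sb c2_def mult_1_right)
    finally have upper: "(\<integral>\<^sup>+\<omega>. ennreal (\<bar>?b \<omega>\<bar> powr p) \<partial>coins_on J) \<le> ennreal c2" .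
    have "(\<Sum>i\<in>J. a i * \<xi> s (\<omega> i)) = ?A * ?b \<omega>" for \<omega>
      using A by (simp add: b_def sum_distrib_left)
    then have "ennreal (\<bar>\<Sum>i\<in>J. a i * \<xi> s (\<omega> i)\<bar> powr p) = ennreal (?A powr p) * ennreal (\<bar>?b \<omega>\<bar> powr p)" for \<omega>
      by (simp add: abs_mult powr_mult ennreal_mult)
    then have eq: "(\<integral>\<^sup>+\<omega>. ennreal (\<bar>\<Sum>i\<in>J. a i * \<xi> s (\<omega> i)\<bar> powr p) \<partial>coins_on J)
      = ennreal (?A powr p) * (\<integral>\<^sup>+\<omega>. ennreal (\<bar>?b \<omega>\<bar> powr p) \<partial>coins_on J)"
      by (simp only: nn_integral_cmult[OF m])
    have c2: "c2 \<ge> 0" using C_nonneg by (simp add: c2_def)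
    have "ennreal (c1 * ?A powr p) = ennreal (?A powr p) * ennreal c1" "ennreal (c2 * ?A powr p) = ennreal (?A powr p) * ennreal c2"
      using c1 c2 by (simp_all add: ennreal_mult mult.commute)
    then show ?thesis unfolding eq using lower upper by (auto intro!: mult_left_mono)
  qed
  then show "ennreal (c1 * lp s J a powr p) \<le> (\<integral>\<^sup>+\<omega>. ennreal (\<bar>\<Sum>i\<in>J. a i * \<xi> s (\<omega> i)\<bar> powr p) \<partial>coins_on J)"
    and "(\<integral>\<^sup>+\<omega>. ennreal (\<bar>\<Sum>i\<in>J. a i * \<xi> s (\<omega> i)\<bar> powr p) \<partial>coins_on J) \<le> ennreal (c2 * lp s J a powr p)"
    by blast+
qed

end

definition \<psi> :: "real \<Rightarrow> nat \<Rightarrow> nat \<times> bool"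
  where "\<psi> = (SOME f. f \<in> unit_leb \<rightarrow>\<^sub>M coins \<and>
    (\<forall>g\<in>borel_measurable coins. (\<integral>\<^sup>+t. g (f t) \<partial>unit_leb) = (\<integral>\<^sup>+\<omega>. g \<omega> \<partial>coins)))"

lemma \<psi>: "\<psi> \<in> unit_leb \<rightarrow>\<^sub>M coins"
  "g \<in> borel_measurable coins \<Longrightarrow> (\<integral>\<^sup>+t. g (\<psi> t) \<partial>unit_leb) = (\<integral>\<^sup>+\<omega>. g \<omega> \<partial>coins)"
proof -
  have "\<exists>f. f \<in> unit_leb \<rightarrow>\<^sub>M coins \<and>
    (\<forall>g\<in>borel_measurable coins. (\<integral>\<^sup>+t. g (f t) \<partial>unit_leb) = (\<integral>\<^sup>+\<omega>. g \<omega> \<partial>coins))"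
    using coins_on_unit_interval by metis
  from someI_ex[OF this] show "\<psi> \<in> unit_leb \<rightarrow>\<^sub>M coins"
    "g \<in> borel_measurable coins \<Longrightarrow> (\<integral>\<^sup>+t. g (\<psi> t) \<partial>unit_leb) = (\<integral>\<^sup>+\<omega>. g \<omega> \<partial>coins)"
    unfolding \<psi>_def by blast+
qed

section \<open>Classes of functions\<close>

lemma p_integrable_abs: "f \<in> borel_measurable unit_leb \<Longrightarrow>
    p_integrable p (abs_L0 f) \<longleftrightarrow> integrable unit_leb (\<lambda>x. \<bar>f x\<bar> powr p)"
  by (simp add: p_integrable.abs_eq)

lemma Lp_norm_abs: "f \<in> borel_measurable unit_leb \<Longrightarrow>
    Lp_norm p (abs_L0 f) = (LINT x|unit_leb. \<bar>f x\<bar> powr p) powr (1 / p)"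
  by (simp add: Lp_norm.abs_eq)

lemma plus_abs: "f \<in> borel_measurable unit_leb \<Longrightarrow> g \<in> borel_measurable unit_leb \<Longrightarrow>
    abs_L0 f + abs_L0 g = abs_L0 (\<lambda>x. f x + g x)"
  by (simp add: plus_L0.abs_eq)

lemma minus_abs: "f \<in> borel_measurable unit_leb \<Longrightarrow> g \<in> borel_measurable unit_leb \<Longrightarrow>
    abs_L0 f - abs_L0 g = abs_L0 (\<lambda>x. f x - g x)"
  by (simp add: minus_L0.abs_eq)

lemma scaleR_abs: "f \<in> borel_measurable unit_leb \<Longrightarrow> c *\<^sub>R abs_L0 f = abs_L0 (\<lambda>x. c * f x)"
  by (simp add: scaleR_L0.abs_eq)

lemma sum_abs:
  assumes "finite S" "\<And>i. i \<in> S \<Longrightarrow> f i \<in> borel_measurable unit_leb"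
  shows "(\<Sum>i\<in>S. abs_L0 (f i)) = abs_L0 (\<lambda>x. \<Sum>i\<in>S. f i x)"
  using assms
proof (induction S rule: finite_induct)
  case empty
  show ?case by (simp add: zero_L0_def)
next
  case (insert i S)
  then show ?case by (simp add: plus_abs borel_measurable_sum)
qed

lemma L0_cases:
  obtains F where "F \<in> borel_measurable unit_leb" "f = abs_L0 F"
proof -
  have "\<exists>F. F \<in> borel_measurable unit_leb \<and> f = abs_L0 F"
    by (rule L0.abs_induct[of _ f]) blast
  then show ?thesis using that by blast
qed

lemma Lp_norm_bounds:
  assumes f: "f \<in> borel_measurable unit_leb" and p: "p > 0"
    and b: "b \<ge> 0" "(\<integral>\<^sup>+x. ennreal (\<bar>f x\<bar> powr p) \<partial>unit_leb) \<le> ennreal (b powr p)"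
  shows "p_integrable p (abs_L0 f)" "Lp_norm p (abs_L0 f) \<le> b"
    "\<And>a. a \<ge> 0 \<Longrightarrow> ennreal (a powr p) \<le> (\<integral>\<^sup>+x. ennreal (\<bar>f x\<bar> powr p) \<partial>unit_leb) \<Longrightarrow> a \<le> Lp_norm p (abs_L0 f)"
proof -
  have m: "(\<lambda>x. \<bar>f x\<bar> powr p) \<in> borel_measurable unit_leb" using f by measurable
  have int: "integrable unit_leb (\<lambda>x. \<bar>f x\<bar> powr p)"
    by (rule integrableI_nonneg[OF m]) (use b(2) in \<open>auto intro: le_less_trans\<close>)
  then show "p_integrable p (abs_L0 f)" by (simp add: p_integrable_abs f)
  let ?I = "LINT x|unit_leb. \<bar>f x\<bar> powr p"
  have eq: "(\<integral>\<^sup>+x. ennreal (\<bar>f x\<bar> powr p) \<partial>unit_leb) = ennreal ?I"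
    by (rule nn_integral_eq_integral[OF int]) simp
  have I0: "?I \<ge> 0" by simp
  have "?I \<le> b powr p" using b(2) unfolding eq by simp
  then have "?I powr (1 / p) \<le> (b powr p) powr (1 / p)" using p I0 by (intro powr_mono2) auto
  then show "Lp_norm p (abs_L0 f) \<le> b" using p b(1) by (simp add: Lp_norm_abs f powr_powr)
  fix a :: real assume a: "a \<ge> 0" "ennreal (a powr p) \<le> (\<integral>\<^sup>+x. ennreal (\<bar>f x\<bar> powr p) \<partial>unit_leb)"
  have "a powr p \<le> ?I" using a(2) I0 unfolding eq by (simp add: ennreal_le_iff)
  then have "(a powr p) powr (1 / p) \<le> ?I powr (1 / p)" using p by (intro powr_mono2) auto
  then show "a \<le> Lp_norm p (abs_L0 f)" using p a(1) by (simp add: Lp_norm_abs f powr_powr)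
qed

lemma p_integrable_sum:
  assumes "p \<ge> 1" "finite S" "\<And>i. i \<in> S \<Longrightarrow> p_integrable p (f i)"
  shows "p_integrable p (\<Sum>i\<in>S. f i)" "Lp_norm p (\<Sum>i\<in>S. f i) \<le> (\<Sum>i\<in>S. Lp_norm p (f i))"
proof -
  have "p_integrable p (\<Sum>i\<in>S. f i) \<and> Lp_norm p (\<Sum>i\<in>S. f i) \<le> (\<Sum>i\<in>S. Lp_norm p (f i))"
    using assms(2,3)
  proof (induction S rule: finite_induct)
    case empty
    then show ?case using Lp_norm_scaleR[OF assms(1), of 0 0] by (simp add: p_integrable_zero)
  next
    case (insert i S)
    then show ?case using p_integrable_add[OF assms(1), of "f i" "\<Sum>i\<in>S. f i"] by auto
  qed
  then show "p_integrable p (\<Sum>i\<in>S. f i)" "Lp_norm p (\<Sum>i\<in>S. f i) \<le> (\<Sum>i\<in>S. Lp_norm p (f i))" by blast+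
qed

context tails begin

section \<open>Generators of the blocks\<close>

text \<open>Coin \<open>0\<close> selects the block; the first factor makes up for the probability of being in block \<open>n\<close>. All
  blocks share the remaining coins, which does no harm because they live on disjoint events.\<close>

definition gfun :: "real \<Rightarrow> nat \<Rightarrow> nat \<Rightarrow> (nat \<Rightarrow> nat \<times> bool) \<Rightarrow> real"
  where "gfun s n i \<omega> = 2 powr (real (Suc n) / p) * of_bool (fst (\<omega> 0) = n) * \<xi> s (\<omega> (Suc i))"

definition G :: "real \<Rightarrow> nat \<Rightarrow> nat \<Rightarrow> L0"
  where "G s n i = abs_L0 (\<lambda>t. gfun s n i (\<psi> t))"

lemma p_pos: "p > 0" and p_less_2: "p < 2" using p r by auto

lemma measurable_coins: "i \<in> UNIV \<Longrightarrow> (\<lambda>\<omega>. h (\<omega> i)) \<in> coins \<rightarrow>\<^sub>M borel"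
  unfolding coins_def by (rule measurable_coin_component)

lemma gfun_measurable: "gfun s n i \<in> borel_measurable coins"
  unfolding gfun_def by (intro borel_measurable_times borel_measurable_const measurable_coins UNIV_I)

lemma gfun_\<psi>: "(\<lambda>t. gfun s n i (\<psi> t)) \<in> borel_measurable unit_leb"
  by (rule measurable_compose[OF \<psi>(1) gfun_measurable])

lemma emeasure_fst_coin: "emeasure (measure_pmf coin) {y. fst y = n} = ennreal (1 / 2 ^ Suc n)"
proof -
  have "measure_pmf.prob (map_pmf fst coin) {n} = measure_pmf.prob coin (fst -` {n})"
    by (rule measure_map_pmf)
  moreover have "fst -` {n} = {y :: nat \<times> bool. fst y = n}" by auto
  moreover have "map_pmf fst coin = geometric_pmf (1/2)" by (simp add: coin_def map_fst_pair_pmf)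
  ultimately have "measure_pmf.prob coin {y. fst y = n} = pmf (geometric_pmf (1/2)) n"
    by (simp only: measure_pmf_single)
  then show ?thesis by (simp add: measure_pmf.emeasure_eq_measure power_one_over mult.commute)
qed

text \<open>At every point only one block is active, so that the \<open>p\<close>-th powers add up over the blocks.\<close>

lemma moment_blocks:
  fixes a :: "nat \<times> nat \<Rightarrow> real"
  assumes A: "finite A" and B: "finite B"
  shows "(\<integral>\<^sup>+\<omega>. ennreal (\<bar>\<Sum>n\<in>A. \<Sum>i\<in>B. a (n, i) * gfun (s n) n i \<omega>\<bar> powr p) \<partial>coins)
    = (\<Sum>n\<in>A. \<integral>\<^sup>+\<omega>. ennreal (\<bar>\<Sum>j\<in>Suc ` B. a (n, j - 1) * \<xi> (s n) (\<omega> j)\<bar> powr p) \<partial>coins_on (Suc ` B))"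
proof -
  define S where "S n \<omega> = (\<Sum>j\<in>Suc ` B. a (n, j - 1) * \<xi> (s n) (\<omega> j))" for n and \<omega> :: "nat \<Rightarrow> nat \<times> bool"
  define h where "h \<omega> = (\<Sum>n\<in>A. ennreal (2 ^ Suc n) * indicator {y. fst y = n} (\<omega> 0) * ennreal (\<bar>S n \<omega>\<bar> powr p))"
    for \<omega> :: "nat \<Rightarrow> nat \<times> bool"
  let ?J = "Suc ` B"
  have J: "finite ?J" "0 \<notin> ?J" using B by auto
  have Sm: "S n \<in> borel_measurable (coins_on K)" if "?J \<subseteq> K" for n K
    unfolding S_def using that by (rule measurable_coin_sum)
  have Sm': "(\<lambda>\<omega>. ennreal (\<bar>S n \<omega>\<bar> powr p)) \<in> borel_measurable (coins_on K)" if "?J \<subseteq> K" for n K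
    by (rule measurable_compose[OF Sm[OF that]]) measurable
  have pw: "ennreal (\<bar>\<Sum>n\<in>A. \<Sum>i\<in>B. a (n, i) * gfun (s n) n i \<omega>\<bar> powr p) = h \<omega>" for \<omega>
  proof -
    let ?n = "fst (\<omega> 0)"
    have inner: "(\<Sum>i\<in>B. a (n, i) * gfun (s n) n i \<omega>) = (if n = ?n then 2 powr (real (Suc n) / p) * S n \<omega> else 0)" for n
      by (auto simp: gfun_def S_def sum.reindex sum_distrib_left mult_ac intro!: sum.cong)
    have h: "h \<omega> = (\<Sum>n\<in>A. if n = ?n then ennreal (2 ^ Suc n) * ennreal (\<bar>S n \<omega>\<bar> powr p) else 0)"
      unfolding h_def by (intro sum.cong) (auto simp: indicator_def)
    show ?thesis
    proof (cases "?n \<in> A")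
      case True
      have "\<bar>2 powr (real (Suc ?n) / p) * S ?n \<omega>\<bar> powr p = 2 ^ Suc ?n * \<bar>S ?n \<omega>\<bar> powr p"
        using p_pos powr_realpow[of 2 "Suc ?n"] by (simp add: abs_mult powr_mult powr_powr del: power_Suc of_nat_Suc)
      then show ?thesis using True A by (simp add: inner h ennreal_mult del: power_Suc)
    next
      case False
      then have "(\<Sum>n\<in>A. \<Sum>i\<in>B. a (n, i) * gfun (s n) n i \<omega>) = 0" unfolding inner by (intro sum.neutral) auto
      moreover have "h \<omega> = 0" unfolding h using False by (intro sum.neutral) auto
      ultimately show ?thesis by simp
    qed
  qed
  have h_restrict: "h (restrict \<omega> (insert 0 ?J)) = h \<omega>" for \<omega> by (simp add: h_def S_def)
  have h_meas: "h \<in> borel_measurable (coins_on K)" if "insert 0 ?J \<subseteq> K" for K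
    unfolding h_def
  proof (intro borel_measurable_sum borel_measurable_times_ennreal borel_measurable_const)
    fix n
    show "(\<lambda>\<omega>. ennreal (\<bar>S n \<omega>\<bar> powr p)) \<in> borel_measurable (coins_on K)" using that by (intro Sm') auto
    show "(\<lambda>\<omega>. indicator {y. fst y = n} (\<omega> 0)) \<in> borel_measurable (coins_on K)" using that by (intro measurable_coin_component) auto
  qed
  have "(\<integral>\<^sup>+\<omega>. h \<omega> \<partial>coins) = (\<integral>\<^sup>+\<omega>. h (restrict \<omega> (insert 0 ?J)) \<partial>coins)" by (simp only: h_restrict)
  also have "\<dots> = (\<integral>\<^sup>+\<omega>. h \<omega> \<partial>distr coins (coins_on (insert 0 ?J)) (\<lambda>\<omega>. restrict \<omega> (insert 0 ?J)))"
  proof (rule nn_integral_distr[symmetric])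
    show "(\<lambda>\<omega>. restrict \<omega> (insert 0 ?J)) \<in> coins \<rightarrow>\<^sub>M coins_on (insert 0 ?J)"
      unfolding coins_def by (rule measurable_restrict_subset) simp
    show "h \<in> borel_measurable (distr coins (coins_on (insert 0 ?J)) (\<lambda>\<omega>. restrict \<omega> (insert 0 ?J)))"
      using h_meas[OF order_refl] by simp
  qed
  also have "\<dots> = (\<integral>\<^sup>+\<omega>. h \<omega> \<partial>coins_on (insert 0 ?J))"
    unfolding coins_def using J by (subst coins.distr_PiM_restrict_finite) auto
  also have "\<dots> = (\<integral>\<^sup>+x. (\<integral>\<^sup>+y. h (x(0 := y)) \<partial>measure_pmf coin) \<partial>coins_on ?J)"
    by (rule coins.product_nn_integral_insert[OF J h_meas[OF order_refl]])
  also have "\<dots> = (\<integral>\<^sup>+x. (\<Sum>n\<in>A. ennreal (\<bar>S n x\<bar> powr p)) \<partial>coins_on ?J)"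
  proof (rule nn_integral_cong)
    fix x
    have S0: "S n (x(0 := y)) = S n x" for n y unfolding S_def by (intro sum.cong) auto
    have "(\<integral>\<^sup>+y. h (x(0 := y)) \<partial>measure_pmf coin)
      = (\<Sum>n\<in>A. \<integral>\<^sup>+y. ennreal (2 ^ Suc n) * indicator {y. fst y = n} y * ennreal (\<bar>S n x\<bar> powr p) \<partial>measure_pmf coin)"
      unfolding h_def S0 by (subst nn_integral_sum) auto
    also have "\<dots> = (\<Sum>n\<in>A. ennreal (\<bar>S n x\<bar> powr p))"
    proof (rule sum.cong[OF refl])
      fix n
      have "(\<integral>\<^sup>+y. ennreal (2 ^ Suc n) * indicator {y. fst y = n} y * ennreal (\<bar>S n x\<bar> powr p) \<partial>measure_pmf coin)
        = ennreal (2 ^ Suc n) * ennreal (1 / 2 ^ Suc n) * ennreal (\<bar>S n x\<bar> powr p)"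
        by (subst nn_integral_multc, simp, subst nn_integral_cmult, simp, subst nn_integral_indicator) (simp_all add: emeasure_fst_coin)
      also have "ennreal (2 ^ Suc n) * ennreal (1 / 2 ^ Suc n) = 1"
        by (subst ennreal_mult[symmetric]) auto
      finally show "(\<integral>\<^sup>+y. ennreal (2 ^ Suc n) * indicator {y. fst y = n} y * ennreal (\<bar>S n x\<bar> powr p) \<partial>measure_pmf coin)
        = ennreal (\<bar>S n x\<bar> powr p)" by simp
    qed
    finally show "(\<integral>\<^sup>+y. h (x(0 := y)) \<partial>measure_pmf coin) = (\<Sum>n\<in>A. ennreal (\<bar>S n x\<bar> powr p))" .
  qed
  also have "\<dots> = (\<Sum>n\<in>A. \<integral>\<^sup>+x. ennreal (\<bar>S n x\<bar> powr p) \<partial>coins_on ?J)"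
    by (rule nn_integral_sum) (rule Sm', simp)
  finally show ?thesis unfolding pw S_def .
qed

definition comb :: "(nat \<Rightarrow> real) \<Rightarrow> nat set \<Rightarrow> nat set \<Rightarrow> (nat \<times> nat \<Rightarrow> real) \<Rightarrow> L0"
  where "comb s A B a = (\<Sum>n\<in>A. \<Sum>i\<in>B. a (n, i) *\<^sub>R G (s n) n i)"

definition K1 :: real where "K1 = c1 powr (1 / p)"
definition K2 :: real where "K2 = c2 powr (1 / p)"

lemma K_pos: "K1 > 0" "K2 > 0"
proof -
  have "c1 > 0" by (simp add: c1_def)
  then show "K1 > 0" by (simp add: K1_def)
  have "c2 > 0" using C_nonneg by (simp add: c2_def)
  then show "K2 > 0" by (simp add: K2_def)
qed

theorem comb_bounds:
  assumes A: "finite A" and B: "finite B" and s: "\<And>n. r0 \<le> s n \<and> s n \<le> r1"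
  shows "p_integrable p (comb s A B a)"
    and "K1 * mix p s A B a \<le> Lp_norm p (comb s A B a)"
    and "Lp_norm p (comb s A B a) \<le> K2 * mix p s A B a"
proof -
  define \<Phi> where "\<Phi> \<omega> = (\<Sum>n\<in>A. \<Sum>i\<in>B. a (n, i) * gfun (s n) n i \<omega>)" for \<omega>
  have m: "\<Phi> \<in> borel_measurable coins"
    unfolding \<Phi>_def by (intro borel_measurable_sum borel_measurable_times borel_measurable_const gfun_measurable)
  have m\<psi>: "(\<lambda>t. \<Phi> (\<psi> t)) \<in> borel_measurable unit_leb" by (rule measurable_compose[OF \<psi>(1) m])
  have comb: "comb s A B a = abs_L0 (\<lambda>t. \<Phi> (\<psi> t))"
  proof -
    have 1: "(\<Sum>i\<in>B. a (n, i) *\<^sub>R G (s n) n i) = abs_L0 (\<lambda>t. \<Sum>i\<in>B. a (n, i) * gfun (s n) n i (\<psi> t))" for n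
      unfolding G_def scaleR_abs[OF gfun_\<psi>]
      by (rule sum_abs[OF B]) (intro borel_measurable_times borel_measurable_const gfun_\<psi>)
    show ?thesis unfolding comb_def 1 \<Phi>_def
      by (rule sum_abs[OF A]) (intro borel_measurable_sum borel_measurable_times borel_measurable_const gfun_\<psi>)
  qed
  have lpB: "lp (s n) (Suc ` B) (\<lambda>j. a (n, j - 1)) = lp (s n) B (\<lambda>i. a (n, i))" for n
    by (simp add: lp_def sum.reindex)
  let ?b = "\<lambda>n. lp (s n) B (\<lambda>i. a (n, i))"
  have mixp: "mix p s A B a powr p = (\<Sum>n\<in>A. ?b n powr p)" using mix_powr[of p s A B a] p_pos by simp
  let ?E = "\<lambda>n. (\<integral>\<^sup>+\<omega>. ennreal (\<bar>\<Sum>j\<in>Suc ` B. a (n, j - 1) * \<xi> (s n) (\<omega> j)\<bar> powr p) \<partial>coins_on (Suc ` B))"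
  have E: "ennreal (c1 * ?b n powr p) \<le> ?E n" "?E n \<le> ennreal (c2 * ?b n powr p)" for n
    using moment_bounds[of "s n" "Suc ` B" "\<lambda>j. a (n, j - 1)"] s[of n] B unfolding lpB by auto
  have c: "c1 \<ge> 0" "c2 \<ge> 0" using C_nonneg by (simp_all add: c1_def c2_def)
  have nn: "(\<integral>\<^sup>+t. ennreal (\<bar>\<Phi> (\<psi> t)\<bar> powr p) \<partial>unit_leb) = (\<Sum>n\<in>A. ?E n)"
  proof -
    have "(\<lambda>\<omega>. ennreal (\<bar>\<Phi> \<omega>\<bar> powr p)) \<in> borel_measurable coins" using m by measurable
    from \<psi>(2)[OF this] show ?thesis unfolding \<Phi>_def moment_blocks[OF A B] .
  qed
  have K: "(K2 * mix p s A B a) powr p = c2 * mix p s A B a powr p" "(K1 * mix p s A B a) powr p = c1 * mix p s A B a powr p"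
    using p_pos c by (simp_all add: K1_def K2_def powr_mult powr_powr)
  have "(\<Sum>n\<in>A. ?E n) \<le> (\<Sum>n\<in>A. ennreal (c2 * ?b n powr p))" by (intro sum_mono E)
  also have "\<dots> = ennreal ((K2 * mix p s A B a) powr p)"
    unfolding K mixp sum_distrib_left by (rule sum_ennreal) (simp add: c)
  finally have up: "(\<integral>\<^sup>+t. ennreal (\<bar>\<Phi> (\<psi> t)\<bar> powr p) \<partial>unit_leb) \<le> ennreal ((K2 * mix p s A B a) powr p)" unfolding nn .
  have "ennreal ((K1 * mix p s A B a) powr p) = (\<Sum>n\<in>A. ennreal (c1 * ?b n powr p))"
    unfolding K mixp sum_distrib_left by (rule sum_ennreal[symmetric]) (simp add: c)
  also have "\<dots> \<le> (\<Sum>n\<in>A. ?E n)" by (intro sum_mono E)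
  finally have lo: "ennreal ((K1 * mix p s A B a) powr p) \<le> (\<integral>\<^sup>+t. ennreal (\<bar>\<Phi> (\<psi> t)\<bar> powr p) \<partial>unit_leb)" unfolding nn .
  have k0: "0 \<le> K2 * mix p s A B a" "0 \<le> K1 * mix p s A B a" using K_pos by simp_all
  note bounds = Lp_norm_bounds[OF m\<psi> p_pos k0(1) up]
  show "p_integrable p (comb s A B a)" unfolding comb by (rule bounds(1))
  show "Lp_norm p (comb s A B a) \<le> K2 * mix p s A B a" unfolding comb by (rule bounds(2))
  show "K1 * mix p s A B a \<le> Lp_norm p (comb s A B a)" unfolding comb by (rule bounds(3)[OF k0(2) lo])
qed

lemma p_integrable_G: "r0 \<le> s \<Longrightarrow> s \<le> r1 \<Longrightarrow> p_integrable p (G s n i)"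
  using comb_bounds(1)[of "{n}" "{i}" "\<lambda>_. s" "\<lambda>_. 1"] by (simp add: comb_def)

text \<open>Dominated convergence: \<open>\<bar>\<xi> s\<bar>\<close> decreases in \<open>s\<close>, so the generators with exponent \<open>r0\<close> dominate.\<close>

lemma G_continuous:
  assumes X: "X \<longlonglongrightarrow> s" "\<And>j. r0 \<le> X j \<and> X j \<le> r1" and s: "r0 \<le> s" "s \<le> r1"
  shows "(\<lambda>j. Lp_norm p (G (X j) n i - G s n i)) \<longlonglongrightarrow> 0"
proof -
  let ?d = "\<lambda>j t. \<bar>gfun (X j) n i (\<psi> t) - gfun s n i (\<psi> t)\<bar> powr p"
  let ?w = "\<lambda>t. 2 powr p * \<bar>gfun r0 n i (\<psi> t)\<bar> powr p"
  have pr0: "0 < r0" using p r by simp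
  have "(\<lambda>j. LINT t|unit_leb. ?d j t) \<longlonglongrightarrow> (LINT t|unit_leb. 0)"
  proof (rule integral_dominated_convergence[where w="?w"])
    show "integrable unit_leb ?w"
      using p_integrable_G[of r0 n i] r p_integrable_abs[OF gfun_\<psi>, of p r0 n i] by (simp add: G_def)
    show "AE t in unit_leb. (\<lambda>j. ?d j t) \<longlonglongrightarrow> 0"
    proof (rule AE_I2)
      fix t
      have "(\<lambda>j. gfun (X j) n i (\<psi> t)) \<longlonglongrightarrow> gfun s n i (\<psi> t)"
        unfolding gfun_def \<xi>_def case_prod_beta using s pr0 by (intro tendsto_intros X) auto
      then have "(\<lambda>j. \<bar>gfun (X j) n i (\<psi> t) - gfun s n i (\<psi> t)\<bar>) \<longlonglongrightarrow> 0"
        by (intro tendsto_rabs_zero LIM_zero)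
      then have "(\<lambda>j. ?d j t) \<longlonglongrightarrow> 0 powr p" using p_pos by (intro tendsto_powr' tendsto_const) auto
      then show "(\<lambda>j. ?d j t) \<longlonglongrightarrow> 0" using p_pos by simp
    qed
    show "AE t in unit_leb. norm (?d j t) \<le> ?w t" for j
    proof (rule AE_I2)
      fix t
      have mono: "\<bar>gfun u n i (\<psi> t)\<bar> \<le> \<bar>gfun r0 n i (\<psi> t)\<bar>" if "r0 \<le> u" for u
      proof -
        have "real (fst (\<psi> t (Suc i))) / u \<le> real (fst (\<psi> t (Suc i))) / r0"
          using that pr0 by (intro divide_left_mono) auto
        then have "\<bar>\<xi> u (\<psi> t (Suc i))\<bar> \<le> \<bar>\<xi> r0 (\<psi> t (Suc i))\<bar>"
          by (auto simp: \<xi>_def case_prod_beta abs_mult)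
        then show ?thesis unfolding gfun_def abs_mult by (intro mult_left_mono) auto
      qed
      have "\<bar>gfun (X j) n i (\<psi> t) - gfun s n i (\<psi> t)\<bar> \<le> 2 * \<bar>gfun r0 n i (\<psi> t)\<bar>"
        using mono[of "X j"] mono[of s] X(2)[of j] s by linarith
      then have "?d j t \<le> (2 * \<bar>gfun r0 n i (\<psi> t)\<bar>) powr p" using p_pos by (intro powr_mono2) auto
      then show "norm (?d j t) \<le> ?w t" by (simp add: powr_mult)
    qed
  qed (use gfun_\<psi> in measurable)
  then have "(\<lambda>j. (LINT t|unit_leb. ?d j t) powr (1 / p)) \<longlonglongrightarrow> 0 powr (1 / p)"
    using p_pos by (intro tendsto_powr' tendsto_const) auto
  moreover have "Lp_norm p (G (X j) n i - G s n i) = (LINT t|unit_leb. ?d j t) powr (1 / p)" for j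
    unfolding G_def minus_abs[OF gfun_\<psi> gfun_\<psi>]
    by (rule Lp_norm_abs) (intro borel_measurable_diff gfun_\<psi>)
  ultimately show ?thesis using p_pos by simp
qed

end

lemma Lp_norm_zero [simp]: "p \<ge> 1 \<Longrightarrow> Lp_norm p 0 = 0"
  using Lp_norm_eq_0_iff p_integrable_zero by blast

lemma Lp_norm_minus_commute: "Lp_norm p (f - g) = Lp_norm p (g - f)"
  using Lp_norm_uminus[of p "f - g"] by simp

lemma Lp_norm_triangle:
  assumes "p \<ge> 1" "p_integrable p f" "p_integrable p g" "p_integrable p h"
  shows "Lp_norm p (f - h) \<le> Lp_norm p (f - g) + Lp_norm p (g - h)"
  using p_integrable_add(2)[OF assms(1), of "f - g" "g - h"] assms by (simp add: p_integrable_diff)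

lemma Lp_norm_diff_abs:
  assumes "p \<ge> 1" "p_integrable p f" "p_integrable p g"
  shows "\<bar>Lp_norm p f - Lp_norm p g\<bar> \<le> Lp_norm p (f - g)"
  using Lp_norm_triangle[OF assms(1,2,3) p_integrable_zero] Lp_norm_triangle[OF assms(1,3,2) p_integrable_zero]
  by (simp add: Lp_norm_minus_commute[of p g f])

section \<open>Completeness\<close>

text \<open>A subsequence with rapidly decreasing increments converges almost everywhere, and Fatou's lemma turns
  this into convergence in norm.\<close>

lemma Lp_complete:
  assumes p: "p \<ge> 1" and f: "\<And>k. p_integrable p (f k)"
    and cauchy: "\<And>e. e > 0 \<Longrightarrow> \<exists>M. \<forall>k\<ge>M. \<forall>l\<ge>M. Lp_norm p (f k - f l) < e"
  shows "\<exists>g. p_integrable p g \<and> (\<lambda>k. Lp_norm p (f k - g)) \<longlonglongrightarrow> 0"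
proof -
  have p0: "p > 0" using p by simp
  have "\<exists>F. F \<in> borel_measurable unit_leb \<and> f k = abs_L0 F" for k by (rule L0_cases[of "f k"]) blast
  then obtain F where F: "\<And>k. F k \<in> borel_measurable unit_leb" "\<And>k. f k = abs_L0 (F k)" by metis
  have "\<exists>M. \<forall>k\<ge>M. \<forall>l\<ge>M. Lp_norm p (f k - f l) < (1/4) ^ i" for i by (rule cauchy) simp
  then obtain M where M: "\<And>i k l. k \<ge> M i \<Longrightarrow> l \<ge> M i \<Longrightarrow> Lp_norm p (f k - f l) < (1/4) ^ i" by metis
  define m where "m i = (\<Sum>j\<le>i. M j)" for i
  have mM: "M i \<le> m j" if "i \<le> j" for i j unfolding m_def using that by (intro member_le_sum) auto
  let ?P = "\<lambda>k l t. \<bar>F k t - F l t\<bar> powr p"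
  have Pm: "?P k l \<in> borel_measurable unit_leb" for k l using F(1)[of k] F(1)[of l] by measurable
  have int: "integrable unit_leb (?P k l)" and norm: "Lp_norm p (f k - f l) = (LINT t|unit_leb. ?P k l t) powr (1/p)" for k l
  proof -
    have mm: "(\<lambda>t. F k t - F l t) \<in> borel_measurable unit_leb" using F(1)[of k] F(1)[of l] by measurable
    have e: "f k - f l = abs_L0 (\<lambda>t. F k t - F l t)" using minus_abs[OF F(1)[of k] F(1)[of l]] by (simp add: F(2))
    show "integrable unit_leb (?P k l)" using p_integrable_diff[OF p f[of k] f[of l]] p_integrable_abs[OF mm] e by simp
    show "Lp_norm p (f k - f l) = (LINT t|unit_leb. ?P k l t) powr (1/p)" using Lp_norm_abs[OF mm] e by simp
  qed
  have small: "(LINT t|unit_leb. ?P k l t) \<le> ((1/4) ^ i) powr p" if "k \<ge> M i" "l \<ge> M i" for i k l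
  proof -
    have "(LINT t|unit_leb. ?P k l t) = Lp_norm p (f k - f l) powr p" unfolding norm using p0 by (simp add: powr_powr)
    also have "\<dots> \<le> ((1/4) ^ i) powr p" using M[OF that] p0 by (intro powr_mono2) (auto simp: Lp_norm_nonneg)
    finally show ?thesis .
  qed
  define d where "d i t = F (m (Suc i)) t - F (m i) t" for i t
  have "AE t in unit_leb. summable (\<lambda>i. (2 ^ i) powr p * \<bar>d i t\<bar> powr p)"
  proof (rule AE_summable)
    show "integrable unit_leb (\<lambda>t. (2 ^ i) powr p * \<bar>d i t\<bar> powr p)" for i
      unfolding d_def by (intro integrable_mult_right int)
    have bd: "norm (LINT t|unit_leb. (2 ^ i) powr p * \<bar>d i t\<bar> powr p) \<le> (1/2) ^ i" for i
    proof -
      have "(LINT t|unit_leb. (2 ^ i) powr p * \<bar>d i t\<bar> powr p) = (2 ^ i) powr p * (LINT t|unit_leb. ?P (m (Suc i)) (m i) t)"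
        unfolding d_def by (rule integral_mult_right_zero)
      also have "\<dots> \<le> (2 ^ i) powr p * ((1/4) ^ i) powr p"
        by (intro mult_left_mono small mM) auto
      also have "\<dots> = ((1/2) ^ i) powr p" by (simp add: powr_mult[symmetric] power_mult_distrib[symmetric])
      also have "\<dots> \<le> ((1/2) ^ i) powr 1" using p by (intro powr_mono') (auto simp: power_le_one)
      finally show ?thesis by simp
    qed
    show "summable (\<lambda>i. LINT t|unit_leb. (2 ^ i) powr p * \<bar>d i t\<bar> powr p)"
      by (rule summable_comparison_test'[OF _ bd]) (simp add: summable_geometric)
  qed simp
  then have conv: "AE t in unit_leb. convergent (\<lambda>i. F (m i) t)"
  proof eventually_elim
    case (elim t)
    then have "(\<lambda>i. (2 ^ i) powr p * \<bar>d i t\<bar> powr p) \<longlonglongrightarrow> 0" by (rule summable_LIMSEQ_zero)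
    then have "eventually (\<lambda>i. (2 ^ i) powr p * \<bar>d i t\<bar> powr p < 1) sequentially" by (rule order_tendstoD(2)) simp
    then obtain i0 where i0: "\<And>i. i \<ge> i0 \<Longrightarrow> (2 ^ i) powr p * \<bar>d i t\<bar> powr p < 1" by (auto simp: eventually_sequentially)
    have "norm (d i t) \<le> (1/2) ^ i" if "i \<ge> i0" for i
    proof (rule ccontr)
      assume "\<not> norm (d i t) \<le> (1/2) ^ i"
      then have "2 ^ i * \<bar>d i t\<bar> \<ge> 1" by (simp add: power_one_over field_simps)
      then have "1 \<le> (2 ^ i * \<bar>d i t\<bar>) powr p" using p0 by (intro ge_one_powr_ge_zero) auto
      with i0[OF that] show False by (simp add: powr_mult)
    qed
    then have "summable (\<lambda>i. d i t)"
      by (rule summable_comparison_test'[where g="\<lambda>i. (1/2) ^ i" and N=i0, rotated]) (assumption, rule summable_geometric, simp)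
    then obtain l where "(\<lambda>n. \<Sum>i<n. d i t) \<longlonglongrightarrow> l" unfolding summable_def sums_def by blast
    then have "(\<lambda>n. F (m n) t - F (m 0) t) \<longlonglongrightarrow> l"
      unfolding d_def by (simp only: sum_lessThan_telescope[of "\<lambda>i. F (m i) t"])
    from tendsto_add[OF this tendsto_const[of "F (m 0) t"]] show ?case by (auto simp: convergent_def)
  qed
  define H where "H t = lim (\<lambda>i. F (m i) t)" for t
  have Hm: "H \<in> borel_measurable unit_leb" unfolding H_def by (rule borel_measurable_lim_metric) (rule F(1))
  have dist: "p_integrable p (f k - abs_L0 H)" "Lp_norm p (f k - abs_L0 H) \<le> (1/4) ^ i" if k: "k \<ge> M i" for i k
  proof -
    have "(\<integral>\<^sup>+t. ennreal (\<bar>F k t - H t\<bar> powr p) \<partial>unit_leb) \<le> (\<integral>\<^sup>+t. liminf (\<lambda>l. ennreal (?P k (m l) t)) \<partial>unit_leb)"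
    proof (rule nn_integral_mono_AE)
      show "AE t in unit_leb. ennreal (\<bar>F k t - H t\<bar> powr p) \<le> liminf (\<lambda>l. ennreal (?P k (m l) t))"
        using conv
      proof eventually_elim
        case (elim t)
        then have "(\<lambda>l. F (m l) t) \<longlonglongrightarrow> H t" by (simp add: H_def convergent_LIMSEQ_iff)
        then have "(\<lambda>l. ennreal (?P k (m l) t)) \<longlonglongrightarrow> ennreal (\<bar>F k t - H t\<bar> powr p)"
          using p0 by (intro tendsto_ennrealI tendsto_powr' tendsto_rabs tendsto_diff tendsto_const) auto
        then have "liminf (\<lambda>l. ennreal (?P k (m l) t)) = ennreal (\<bar>F k t - H t\<bar> powr p)"
          by (rule lim_imp_Liminf[OF sequentially_bot])
        then show ?case by simp
      qed
    qed
    also have "\<dots> \<le> liminf (\<lambda>l. \<integral>\<^sup>+t. ennreal (?P k (m l) t) \<partial>unit_leb)"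
      by (rule nn_integral_liminf) (use Pm in measurable)
    also have "\<dots> \<le> ennreal (((1/4) ^ i) powr p)"
    proof (rule Liminf_le)
      show "\<forall>\<^sub>F l in sequentially. (\<integral>\<^sup>+t. ennreal (?P k (m l) t) \<partial>unit_leb) \<le> ennreal (((1/4) ^ i) powr p)"
      proof (rule eventually_sequentiallyI)
        fix l assume "i \<le> l"
        then have "(LINT t|unit_leb. ?P k (m l) t) \<le> ((1/4) ^ i) powr p" by (intro small k mM)
        then show "(\<integral>\<^sup>+t. ennreal (?P k (m l) t) \<partial>unit_leb) \<le> ennreal (((1/4) ^ i) powr p)"
          by (subst nn_integral_eq_integral[OF int]) (auto intro: ennreal_leI)
      qed
    qed simp
    finally have *: "(\<integral>\<^sup>+t. ennreal (\<bar>F k t - H t\<bar> powr p) \<partial>unit_leb) \<le> ennreal (((1/4) ^ i) powr p)" .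
    have mm: "(\<lambda>t. F k t - H t) \<in> borel_measurable unit_leb" using F(1)[of k] Hm by measurable
    have e: "f k - abs_L0 H = abs_L0 (\<lambda>t. F k t - H t)" using minus_abs[OF F(1)[of k] Hm] by (simp add: F(2))
    show "p_integrable p (f k - abs_L0 H)" "Lp_norm p (f k - abs_L0 H) \<le> (1/4) ^ i"
      using Lp_norm_bounds(1,2)[OF mm p0 _ *] unfolding e by simp_all
  qed
  have "abs_L0 H = f (M 0) - (f (M 0) - abs_L0 H)" by simp
  then have "p_integrable p (abs_L0 H)" using p_integrable_diff[OF p f dist(1)[OF order_refl]] by metis
  moreover have "(\<lambda>k. Lp_norm p (f k - abs_L0 H)) \<longlonglongrightarrow> 0"
  proof (rule LIMSEQ_I)
    fix r :: real assume "r > 0"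
    then obtain i where i: "(1/4) ^ i < r" using real_arch_pow_inv[of r "1/4"] by auto
    show "\<exists>no. \<forall>n\<ge>no. norm (Lp_norm p (f n - abs_L0 H) - 0) < r"
      using dist(2) i by (intro exI[of _ "M i"]) (auto simp: Lp_norm_nonneg intro: le_less_trans)
  qed
  ultimately show ?thesis by blast
qed

section \<open>Closures\<close>

definition cl :: "real \<Rightarrow> L0 set \<Rightarrow> L0 set"
  where "cl p S = {g. p_integrable p g \<and> (\<forall>e>0. \<exists>a\<in>S. Lp_norm p (a - g) < e)}"

lemma mtopology_of_Lp: "p \<ge> 1 \<Longrightarrow> Lp_topology p = Metric_space.mtopology (Lp_space p) (Lp_dist p)"
  using Metric_space.mtopology_of[OF Metric_space_Lp] by (simp add: Lp_def)

lemma cl_eq_closure: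
  assumes "p \<ge> 1" "S \<subseteq> Lp_space p"
  shows "Lp_topology p closure_of S = cl p S"
proof -
  interpret Metric_space "Lp_space p" "Lp_dist p" by (rule Metric_space_Lp) fact
  show ?thesis
  proof -
    have "(\<exists>y\<in>S. y \<in> mball g e) \<longleftrightarrow> (\<exists>a\<in>S. Lp_norm p (a - g) < e)" if "g \<in> Lp_space p" for g e
      using that assms(2) by (auto simp: Lp_dist_def Lp_norm_minus_commute[of p g])
    then show ?thesis
      unfolding mtopology_of_Lp[OF assms(1)] metric_closure_of cl_def by (auto simp: Lp_space_def)
  qed
qed

lemma subset_cl: "p \<ge> 1 \<Longrightarrow> S \<subseteq> Lp_space p \<Longrightarrow> S \<subseteq> cl p S"
  by (auto simp: cl_def Lp_space_def intro!: bexI)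

lemma cl_sequence:
  assumes "g \<in> cl p S"
  obtains a where "\<And>k. a k \<in> S" "\<And>k::nat. Lp_norm p (a k - g) < 1 / Suc k"
proof -
  have "\<exists>a\<in>S. Lp_norm p (a - g) < 1 / Suc k" for k :: nat using assms by (simp add: cl_def)
  then show ?thesis using that by metis
qed

lemma cl_of_limit:
  assumes "p_integrable p g" "\<And>k::nat. a k \<in> S" "(\<lambda>k. Lp_norm p (a k - g)) \<longlonglongrightarrow> 0"
  shows "g \<in> cl p S"
  unfolding cl_def
proof (intro CollectI conjI allI impI)
  fix e :: real assume "e > 0"
  from order_tendstoD(2)[OF assms(3) this] obtain k where "Lp_norm p (a k - g) < e" by (auto simp: eventually_sequentially)
  then show "\<exists>a\<in>S. Lp_norm p (a - g) < e" using assms(2) by blast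
qed (fact assms(1))

definition Lp_lim :: "real \<Rightarrow> (nat \<Rightarrow> L0) \<Rightarrow> L0 \<Rightarrow> bool"
  where "Lp_lim p a g \<longleftrightarrow> (\<forall>k. p_integrable p (a k)) \<and> p_integrable p g \<and> (\<lambda>k. Lp_norm p (a k - g)) \<longlonglongrightarrow> 0"

lemma Lp_lim_add:
  assumes p: "p \<ge> 1" and "Lp_lim p a g" "Lp_lim p b h"
  shows "Lp_lim p (\<lambda>k. a k + b k) (g + h)"
  unfolding Lp_lim_def
proof (intro conjI allI)
  show "p_integrable p (a k + b k)" "p_integrable p (g + h)" for k
    using assms by (auto simp: Lp_lim_def p_integrable_add)
  have "(\<lambda>k. Lp_norm p (a k - g) + Lp_norm p (b k - h)) \<longlonglongrightarrow> 0 + 0"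
    using assms by (intro tendsto_add) (auto simp: Lp_lim_def)
  then have lim0: "(\<lambda>k. Lp_norm p (a k - g) + Lp_norm p (b k - h)) \<longlonglongrightarrow> 0" by simp
  have le: "Lp_norm p (a k + b k - (g + h)) \<le> Lp_norm p (a k - g) + Lp_norm p (b k - h)" for k
  proof -
    have "Lp_norm p ((a k - g) + (b k - h)) \<le> Lp_norm p (a k - g) + Lp_norm p (b k - h)"
      using assms by (intro p_integrable_add(2) p_integrable_diff) (auto simp: Lp_lim_def)
    moreover have "(a k - g) + (b k - h) = a k + b k - (g + h)" by simp
    ultimately show ?thesis by simp
  qed
  show "(\<lambda>k. Lp_norm p (a k + b k - (g + h))) \<longlonglongrightarrow> 0"
    by (rule tendsto_sandwich[OF _ _ tendsto_const lim0]) (auto simp: le Lp_norm_nonneg)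
qed

lemma Lp_lim_scale:
  assumes p: "p \<ge> 1" and "Lp_lim p a g"
  shows "Lp_lim p (\<lambda>k. c *\<^sub>R a k) (c *\<^sub>R g)"
proof -
  have "Lp_norm p (c *\<^sub>R a k - c *\<^sub>R g) = \<bar>c\<bar> * Lp_norm p (a k - g)" for k
    using Lp_norm_scaleR[OF p, of c "a k - g"] by (simp add: scaleR_diff_right)
  then show ?thesis
    using assms by (auto simp: Lp_lim_def p_integrable_scaleR intro: tendsto_mult_right_zero)
qed

lemma Lp_lim_norm:
  assumes p: "p \<ge> 1" and "Lp_lim p a g"
  shows "(\<lambda>k. Lp_norm p (a k)) \<longlonglongrightarrow> Lp_norm p g"
proof (rule LIM_zero_cancel, rule tendsto_rabs_zero_cancel, rule tendsto_sandwich[where f="\<lambda>_. 0"])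
  show "\<forall>\<^sub>F k in sequentially. \<bar>Lp_norm p (a k) - Lp_norm p g\<bar> \<le> Lp_norm p (a k - g)"
    using assms by (intro always_eventually allI Lp_norm_diff_abs) (auto simp: Lp_lim_def)
qed (use assms in \<open>auto simp: Lp_lim_def\<close>)

lemma cl_limitE:
  assumes "S \<subseteq> Lp_space p" "g \<in> cl p S"
  obtains a where "\<And>k. a k \<in> S" "Lp_lim p a g"
proof -
  obtain a where a: "\<And>k. a k \<in> S" "\<And>k::nat. Lp_norm p (a k - g) < 1 / Suc k"
    using cl_sequence[OF assms(2)] by blast
  have "(\<lambda>k. Lp_norm p (a k - g)) \<longlonglongrightarrow> 0"
  proof (rule tendsto_sandwich[where f="\<lambda>_. 0" and h="\<lambda>k. 1 / real (Suc k)"])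
    show "(\<lambda>k. 1 / real (Suc k)) \<longlonglongrightarrow> 0" using LIMSEQ_inverse_real_of_nat by (simp add: inverse_eq_divide)
  qed (use a(2) in \<open>auto simp: Lp_norm_nonneg less_imp_le\<close>)
  then show ?thesis
    using a(1) assms by (intro that[of a]) (auto simp: Lp_lim_def Lp_space_def cl_def)
qed

lemma cl_limitI:
  assumes "\<And>k. a k \<in> S" "Lp_lim p a g"
  shows "g \<in> cl p S"
  by (rule cl_of_limit[where a=a]) (use assms in \<open>auto simp: Lp_lim_def\<close>)

lemma subspace_cl:
  assumes p: "p \<ge> 1" and S: "S \<subseteq> Lp_space p" "subspace S"
  shows "subspace (cl p S)"
  unfolding subspace_def
proof (intro conjI ballI allI)
  show "0 \<in> cl p S" using subset_cl[OF p S(1)] subspace_0[OF S(2)] by blast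
  fix g assume g: "g \<in> cl p S"
  obtain a where a: "\<And>k. a k \<in> S" "Lp_lim p a g" using cl_limitE[OF S(1) g] by blast
  show "c *\<^sub>R g \<in> cl p S" for c
    by (rule cl_limitI[OF _ Lp_lim_scale[OF p a(2)]]) (rule subspace_scale[OF S(2) a(1)])
  fix h assume h: "h \<in> cl p S"
  obtain b where b: "\<And>k. b k \<in> S" "Lp_lim p b h" using cl_limitE[OF S(1) h] by blast
  show "g + h \<in> cl p S"
    by (rule cl_limitI[OF _ Lp_lim_add[OF p a(2) b(2)]]) (rule subspace_add[OF S(2) a(1) b(1)])
qed

lemma closed_subspace_cl:
  assumes "p \<ge> 1" "S \<subseteq> Lp_space p" "subspace S"
  shows "closed_subspace p (cl p S)"
  unfolding closed_subspace_def
  using subspace_cl[OF assms] closedin_closure_of[of "Lp_topology p" S] cl_eq_closure[OF assms(1,2)] by simp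

section \<open>Extension of isomorphisms to closures\<close>

text \<open>The isomorphism is given by its graph \<open>R\<close>, which makes its inverse and the linear structure available
  without choosing representations of vectors.\<close>

lemma extend_to_closure:
  fixes R :: "(L0 \<times> L0) set"
  assumes p: "p \<ge> 1" and R: "subspace R" "R \<subseteq> Lp_space p \<times> Lp_space p" and c: "c > 0"
    and lo: "\<And>g h. (g, h) \<in> R \<Longrightarrow> c * Lp_norm p g \<le> Lp_norm p h"
    and up: "\<And>g h. (g, h) \<in> R \<Longrightarrow> Lp_norm p h \<le> C * Lp_norm p g"
  obtains T where "linear_on (cl p (fst ` R)) T" "T ` cl p (fst ` R) = cl p (snd ` R)"
    "\<And>g. g \<in> cl p (fst ` R) \<Longrightarrow> c * Lp_norm p g \<le> Lp_norm p (T g) \<and> Lp_norm p (T g) \<le> C * Lp_norm p g"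
proof -
  have partner: "\<exists>h b. (\<forall>k. (a k, b k) \<in> R') \<and> Lp_lim p b h"
    if R': "subspace R'" "R' \<subseteq> Lp_space p \<times> Lp_space p" and up': "\<And>g h. (g, h) \<in> R' \<Longrightarrow> Lp_norm p h \<le> C' * Lp_norm p g"
      and a: "\<And>k. a k \<in> fst ` R'" "Lp_lim p a g"
    for R' :: "(L0 \<times> L0) set" and C' a g
  proof -
    have "\<exists>b. (a k, b) \<in> R'" for k using a(1)[of k] by force
    then obtain b where b: "\<And>k. (a k, b k) \<in> R'" by metis
    have bp: "p_integrable p (b k)" "p_integrable p (a k)" for k using b[of k] R'(2) by (auto simp: Lp_space_def)
    have gp: "p_integrable p g" using a(2) by (simp add: Lp_lim_def)
    have "\<exists>h. p_integrable p h \<and> (\<lambda>k. Lp_norm p (b k - h)) \<longlonglongrightarrow> 0"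
    proof (rule Lp_complete[OF p bp(1)])
      fix e :: real assume e: "e > 0"
      define \<eta> where "\<eta> = e / (2 * (\<bar>C'\<bar> + 1))"
      have "\<eta> > 0" using e by (simp add: \<eta>_def add_nonneg_pos)
      from order_tendstoD(2)[of "\<lambda>k. Lp_norm p (a k - g)" 0 sequentially, OF _ this] a(2)
      obtain M where M: "\<And>k. k \<ge> M \<Longrightarrow> Lp_norm p (a k - g) < \<eta>" by (auto simp: Lp_lim_def eventually_sequentially)
      show "\<exists>M. \<forall>k\<ge>M. \<forall>l\<ge>M. Lp_norm p (b k - b l) < e"
      proof (intro exI[of _ M] allI impI)
        fix k l assume kl: "M \<le> k" "M \<le> l"
        have "(a k - a l, b k - b l) \<in> R'" using subspace_diff[OF R'(1) b[of k] b[of l]] by simp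
        then have "Lp_norm p (b k - b l) \<le> C' * Lp_norm p (a k - a l)" by (rule up')
        also have "\<dots> \<le> \<bar>C'\<bar> * Lp_norm p (a k - a l)" by (intro mult_right_mono) (auto simp: Lp_norm_nonneg)
        also have "\<dots> \<le> \<bar>C'\<bar> * (2 * \<eta>)"
        proof (rule mult_left_mono)
          have "Lp_norm p (a k - a l) \<le> Lp_norm p (a k - g) + Lp_norm p (g - a l)" by (rule Lp_norm_triangle[OF p bp(2) gp bp(2)])
          then show "Lp_norm p (a k - a l) \<le> 2 * \<eta>" using M[OF kl(1)] M[OF kl(2)] by (simp add: Lp_norm_minus_commute[of p g])
        qed simp
        also have "\<dots> < (\<bar>C'\<bar> + 1) * (2 * \<eta>)" using \<open>\<eta> > 0\<close> by simp
        also have "(\<bar>C'\<bar> + 1) * (2 * \<eta>) = e"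
        proof -
          have "\<bar>C'\<bar> + 1 \<noteq> 0" by linarith
          then show ?thesis by (simp add: \<eta>_def field_simps)
        qed
        finally show "Lp_norm p (b k - b l) < e" .
      qed
    qed
    then show ?thesis using b bp by (auto simp: Lp_lim_def)
  qed
  define Q where "Q g h \<longleftrightarrow> (\<exists>a b. (\<forall>k. (a k, b k) \<in> R) \<and> Lp_lim p a g \<and> Lp_lim p b h)" for g h
  have QI: "Q g h" if "\<And>k. (a k, b k) \<in> R" "Lp_lim p a g" "Lp_lim p b h" for a b g h
    using that unfolding Q_def by blast
  have sub: "fst ` R \<subseteq> Lp_space p" "snd ` R \<subseteq> Lp_space p" using R(2) by auto
  have Q_dom: "g \<in> cl p (fst ` R)" and Q_ran: "h \<in> cl p (snd ` R)" if Qgh: "Q g h" for g h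
  proof -
    obtain a b where ab: "\<And>k. (a k, b k) \<in> R" "Lp_lim p a g" "Lp_lim p b h" using Qgh by (auto simp: Q_def)
    have "a k \<in> fst ` R" "b k \<in> snd ` R" for k using ab(1)[of k] by force+
    then show "g \<in> cl p (fst ` R)" "h \<in> cl p (snd ` R)" using cl_limitI[OF _ ab(2)] cl_limitI[OF _ ab(3)] by blast+
  qed
  have Q1: "\<exists>h. Q g h" if gm: "g \<in> cl p (fst ` R)" for g
  proof -
    obtain a where a: "\<And>k. a k \<in> fst ` R" "Lp_lim p a g" using cl_limitE[OF sub(1) gm] by blast
    from partner[OF R up a] show ?thesis using a(2) by (auto simp: Q_def)
  qed
  have Q2: "\<exists>g. Q g h" if hm: "h \<in> cl p (snd ` R)" for h
  proof -
    obtain b where b: "\<And>k. b k \<in> snd ` R" "Lp_lim p b h" using cl_limitE[OF sub(2) hm] by blast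
    let ?R = "{(y, x). (x, y) \<in> R}"
    have R': "subspace ?R"
    proof (rule subspaceI)
      show "0 \<in> ?R" using subspace_0[OF R(1)] by (simp add: zero_prod_def)
      show "x + y \<in> ?R" if "x \<in> ?R" "y \<in> ?R" for x y
        using that subspace_add[OF R(1), of "(snd x, fst x)" "(snd y, fst y)"] by (auto simp: case_prod_beta)
      show "r *\<^sub>R x \<in> ?R" if "x \<in> ?R" for r x
        using that subspace_scale[OF R(1), of "(snd x, fst x)" r] by (auto simp: case_prod_beta)
    qed
    have sub': "?R \<subseteq> Lp_space p \<times> Lp_space p" using R(2) by auto
    have up': "Lp_norm p g \<le> (1 / c) * Lp_norm p f" if "(f, g) \<in> ?R" for f g
      using lo[of g f] that c by (simp add: field_simps)
    have b': "b k \<in> fst ` ?R" for k using b(1)[of k] by force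
    obtain g a where "\<And>k. (b k, a k) \<in> ?R" "Lp_lim p a g" using partner[OF R' sub' up' b' b(2)] by blast
    then show ?thesis using b(2) by (auto simp: Q_def)
  qed
  have Q_add: "Q (g + g') (h + h')" if Qs: "Q g h" "Q g' h'" for g h g' h'
  proof -
    obtain a b where ab: "\<And>k. (a k, b k) \<in> R" "Lp_lim p a g" "Lp_lim p b h" using Qs(1) by (auto simp: Q_def)
    obtain a' b' where ab': "\<And>k. (a' k, b' k) \<in> R" "Lp_lim p a' g'" "Lp_lim p b' h'" using Qs(2) by (auto simp: Q_def)
    have "(a k + a' k, b k + b' k) \<in> R" for k using subspace_add[OF R(1) ab(1)[of k] ab'(1)[of k]] by simp
    then show ?thesis by (rule QI[OF _ Lp_lim_add[OF p ab(2) ab'(2)] Lp_lim_add[OF p ab(3) ab'(3)]])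
  qed
  have Q_scale: "Q (r *\<^sub>R g) (r *\<^sub>R h)" if Qs: "Q g h" for r g h
  proof -
    obtain a b where ab: "\<And>k. (a k, b k) \<in> R" "Lp_lim p a g" "Lp_lim p b h" using Qs by (auto simp: Q_def)
    have "(r *\<^sub>R a k, r *\<^sub>R b k) \<in> R" for k using subspace_scale[OF R(1) ab(1)[of k], of r] by simp
    then show ?thesis by (rule QI[OF _ Lp_lim_scale[OF p ab(2)] Lp_lim_scale[OF p ab(3)]])
  qed
  have Q_bd: "c * Lp_norm p g \<le> Lp_norm p h \<and> Lp_norm p h \<le> C * Lp_norm p g" if Qs: "Q g h" for g h
  proof -
    obtain a b where ab: "\<And>k. (a k, b k) \<in> R" "Lp_lim p a g" "Lp_lim p b h" using Qs by (auto simp: Q_def)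
    note l = Lp_lim_norm[OF p ab(2)] Lp_lim_norm[OF p ab(3)]
    show ?thesis
    proof
      show "c * Lp_norm p g \<le> Lp_norm p h"
        by (rule LIMSEQ_le[OF tendsto_mult_left[OF l(1), of c] l(2)]) (use lo[OF ab(1)] in blast)
      show "Lp_norm p h \<le> C * Lp_norm p g"
        by (rule LIMSEQ_le[OF l(2) tendsto_mult_left[OF l(1), of C]]) (use up[OF ab(1)] in blast)
    qed
  qed
  have Q_unique: "h = h'" if Qs: "Q g h" "Q g h'" for g h h'
  proof -
    have hp: "p_integrable p h" "p_integrable p h'" using Qs by (auto simp: Q_def Lp_lim_def)
    have "Q (g + (- 1) *\<^sub>R g) (h + (- 1) *\<^sub>R h')" by (rule Q_add[OF Qs(1) Q_scale[OF Qs(2)]])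
    then have "Q 0 (h - h')" by simp
    from Q_bd[OF this] have "Lp_norm p (h - h') = 0" using p Lp_norm_nonneg[of p "h - h'"] by simp
    then show ?thesis using Lp_norm_eq_0_iff[OF p p_integrable_diff[OF p hp]] by simp
  qed
  define T where "T g = (SOME h. Q g h)" for g
  have T: "Q g (T g)" if "g \<in> cl p (fst ` R)" for g unfolding T_def using Q1[OF that] by (rule someI_ex)
  have T_eq: "T g = h" if "Q g h" for g h using Q_unique[OF T[OF Q_dom[OF that]] that] .
  show ?thesis
  proof (rule that[of T])
    show "linear_on (cl p (fst ` R)) T"
      unfolding linear_on_def using T_eq Q_add Q_scale T by blast
    show "T ` cl p (fst ` R) = cl p (snd ` R)"
    proof
      show "T ` cl p (fst ` R) \<subseteq> cl p (snd ` R)" using Q_ran T by blast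
      show "cl p (snd ` R) \<subseteq> T ` cl p (fst ` R)"
      proof
        fix h assume "h \<in> cl p (snd ` R)"
        then obtain g where "Q g h" using Q2 by blast
        then show "h \<in> T ` cl p (fst ` R)" using T_eq Q_dom by (intro image_eqI[of _ _ g]) auto
      qed
    qed
    show "c * Lp_norm p g \<le> Lp_norm p (T g) \<and> Lp_norm p (T g) \<le> C * Lp_norm p g" if "g \<in> cl p (fst ` R)" for g
      by (rule Q_bd[OF T[OF that]])
  qed
qed

section \<open>Bi-Lipschitz embeddings and the four relations\<close>

text \<open>The common consequence of the four relations; no linearity is assumed because Lipschitz isomorphisms need
  not be linear.\<close>

definition bilip_embeds :: "real \<Rightarrow> L0 set \<Rightarrow> L0 set \<Rightarrow> bool"
  where "bilip_embeds p V W \<longleftrightarrow> (\<exists>f c C. c > 0 \<and> f ` V \<subseteq> W \<and>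
    (\<forall>g\<in>V. \<forall>h\<in>V. c * Lp_norm p (g - h) \<le> Lp_norm p (f g - f h) \<and> Lp_norm p (f g - f h) \<le> C * Lp_norm p (g - h)))"

lemma closed_subspaceD:
  assumes "p \<ge> 1" "closed_subspace p V"
  shows "subspace V" "V \<subseteq> Lp_space p"
proof -
  show "subspace V" using assms by (simp add: closed_subspace_def)
  have "closedin (Lp_topology p) V" using assms by (simp add: closed_subspace_def)
  then show "V \<subseteq> Lp_space p"
    using closedin_subset topspace_mtopology_of mspace_Lp[OF assms(1)] by metis
qed

lemma linear_on_diff:
  assumes "subspace V" "linear_on V T" "g \<in> V" "h \<in> V"
  shows "T (g - h) = T g - T h"
proof -
  have "(- 1) *\<^sub>R h \<in> V" by (rule subspace_scale[OF assms(1,4)])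
  then have "T (g + (- 1) *\<^sub>R h) = T g + T ((- 1) *\<^sub>R h)" using assms unfolding linear_on_def by blast
  also have "T ((- 1) *\<^sub>R h) = (- 1) *\<^sub>R T h" using assms unfolding linear_on_def by blast
  finally show ?thesis by simp
qed

lemma linear_on_zero: "subspace V \<Longrightarrow> linear_on V T \<Longrightarrow> T 0 = 0"
  using linear_on_diff[of V T 0 0] subspace_0 by fastforce

lemma mspace_sub: "p \<ge> 1 \<Longrightarrow> V \<subseteq> Lp_space p \<Longrightarrow> mspace (submetric (Lp p) V) = V"
  by (auto simp: mspace_Lp)

lemma mdist_sub: "p \<ge> 1 \<Longrightarrow> mdist (submetric (Lp p) V) f g = Lp_norm p (f - g)"
  by (simp add: mdist_Lp)

lemma continuous_sub_iff:
  assumes p: "p \<ge> 1" and V: "V \<subseteq> Lp_space p" and W: "W \<subseteq> Lp_space p"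
  shows "continuous_map (subtopology (Lp_topology p) V) (subtopology (Lp_topology p) W) f \<longleftrightarrow>
    f ` V \<subseteq> W \<and> (\<forall>g\<in>V. \<forall>\<epsilon>>0. \<exists>\<delta>>0. \<forall>h. h \<in> V \<and> Lp_norm p (g - h) < \<delta> \<longrightarrow> Lp_norm p (f g - f h) < \<epsilon>)"
proof -
  interpret A: Metric_space "mspace (submetric (Lp p) V)" "mdist (submetric (Lp p) V)"
    by (rule Metric_space_mspace_mdist)
  have "continuous_map (subtopology (Lp_topology p) V) (subtopology (Lp_topology p) W) f \<longleftrightarrow>
    continuous_map (mtopology_of (submetric (Lp p) V)) (mtopology_of (submetric (Lp p) W)) f"
    by (simp only: mtopology_of_submetric)
  also have "\<dots> \<longleftrightarrow> f ` V \<subseteq> W \<and> (\<forall>g\<in>V. \<forall>\<epsilon>>0. \<exists>\<delta>>0. \<forall>h. h \<in> V \<and> Lp_norm p (g - h) < \<delta> \<longrightarrow> Lp_norm p (f g - f h) < \<epsilon>)"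
    unfolding mtopology_of_def A.metric_continuous_map[OF Metric_space_mspace_mdist]
    by (simp only: mspace_sub[OF p V] mspace_sub[OF p W] mdist_sub[OF p])
  finally show ?thesis .
qed

lemma linear_continuous_bounded:
  assumes p: "p \<ge> 1" and V: "subspace V" "V \<subseteq> Lp_space p" and W: "W \<subseteq> Lp_space p"
    and T: "linear_on V T" "continuous_map (subtopology (Lp_topology p) V) (subtopology (Lp_topology p) W) T"
  shows "\<exists>C>0. \<forall>g\<in>V. Lp_norm p (T g) \<le> C * Lp_norm p g"
proof -
  have T0: "T 0 = 0" by (rule linear_on_zero[OF V(1) T(1)])
  have "0 \<in> V" by (rule subspace_0[OF V(1)])
  then obtain \<delta> where \<delta>: "\<delta> > 0" "\<And>h. h \<in> V \<Longrightarrow> Lp_norm p (0 - h) < \<delta> \<Longrightarrow> Lp_norm p (T 0 - T h) < 1"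
    using T(2)[unfolded continuous_sub_iff[OF p V(2) W], THEN conjunct2, rule_format, of 0 1] by auto
  have "Lp_norm p (T g) \<le> (2 / \<delta>) * Lp_norm p g" if g: "g \<in> V" for g
  proof (cases "Lp_norm p g = 0")
    case True
    then have "g = 0" using g V(2) Lp_norm_eq_0_iff[OF p] by (auto simp: Lp_space_def)
    then show ?thesis using T0 p by simp
  next
    case False
    then have n: "Lp_norm p g > 0" using Lp_norm_nonneg[of p g] by simp
    define r where "r = \<delta> / (2 * Lp_norm p g)"
    have r: "r > 0" using n \<delta>(1) by (simp add: r_def)
    have "Lp_norm p (0 - r *\<^sub>R g) = r * Lp_norm p g"
      using Lp_norm_scaleR[OF p, of r g] r by (simp add: Lp_norm_uminus)
    also have "\<dots> < \<delta>" using n \<delta>(1) by (simp add: r_def)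
    finally have "Lp_norm p (T 0 - T (r *\<^sub>R g)) < 1" by (intro \<delta>(2) subspace_scale[OF V(1) g])
    moreover have "T (r *\<^sub>R g) = r *\<^sub>R T g" using T(1) g unfolding linear_on_def by blast
    ultimately have "r * Lp_norm p (T g) < 1"
      using Lp_norm_scaleR[OF p, of r "T g"] r by (simp add: T0 Lp_norm_uminus)
    then show ?thesis using n \<delta>(1) by (simp add: r_def field_simps)
  qed
  then show ?thesis using \<delta>(1) by (intro exI[of _ "2 / \<delta>"]) auto
qed

lemma isomorphic_bilip:
  assumes p: "p \<ge> 1" and V: "closed_subspace p V" and W: "closed_subspace p W" and iso: "isomorphic_Lp p V W"
  shows "bilip_embeds p V W" "bilip_embeds p W V"
proof -
  note V' = closed_subspaceD[OF p V] and W' = closed_subspaceD[OF p W]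
  obtain T S where T: "linear_on V T"
    and TS: "homeomorphic_maps (subtopology (Lp_topology p) V) (subtopology (Lp_topology p) W) T S"
    using iso unfolding isomorphic_Lp_def homeomorphic_map_maps by blast
  have ts: "topspace (subtopology (Lp_topology p) V) = V" "topspace (subtopology (Lp_topology p) W) = W"
    using V'(2) W'(2) by (auto simp: mspace_Lp[OF p])
  have cT: "continuous_map (subtopology (Lp_topology p) V) (subtopology (Lp_topology p) W) T"
    and cS: "continuous_map (subtopology (Lp_topology p) W) (subtopology (Lp_topology p) V) S"
    and inv: "\<And>g. g \<in> V \<Longrightarrow> S (T g) = g" "\<And>h. h \<in> W \<Longrightarrow> T (S h) = h"
    using TS unfolding homeomorphic_maps_def ts by auto
  have im: "T ` V \<subseteq> W" "S ` W \<subseteq> V"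
    using cT cS unfolding continuous_sub_iff[OF p V'(2) W'(2)] continuous_sub_iff[OF p W'(2) V'(2)] by blast+
  have S: "linear_on W S"
    unfolding linear_on_def
  proof (intro conjI ballI allI)
    fix g assume g: "g \<in> W"
    have Sg: "S g \<in> V" using g im by blast
    show "S (c *\<^sub>R g) = c *\<^sub>R S g" for c
    proof -
      have "T (c *\<^sub>R S g) = c *\<^sub>R g" using T Sg g inv(2) unfolding linear_on_def by simp
      then show ?thesis using inv(1)[OF subspace_scale[OF V'(1) Sg]] by metis
    qed
    fix h assume h: "h \<in> W"
    have Sh: "S h \<in> V" using h im by blast
    have "T (S g + S h) = g + h" using T Sg Sh g h inv(2) unfolding linear_on_def by simp
    then show "S (g + h) = S g + S h" using inv(1)[OF subspace_add[OF V'(1) Sg Sh]] by metis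
  qed
  obtain C where C: "C > 0" "\<And>g. g \<in> V \<Longrightarrow> Lp_norm p (T g) \<le> C * Lp_norm p g"
    using linear_continuous_bounded[OF p V' W'(2) T cT] by blast
  obtain C' where C': "C' > 0" "\<And>g. g \<in> W \<Longrightarrow> Lp_norm p (S g) \<le> C' * Lp_norm p g"
    using linear_continuous_bounded[OF p W' V'(2) S cS] by blast
  have "(1 / C') * Lp_norm p (g - h) \<le> Lp_norm p (T g - T h) \<and> Lp_norm p (T g - T h) \<le> C * Lp_norm p (g - h)"
    if g: "g \<in> V" and h: "h \<in> V" for g h
  proof -
    have d: "g - h \<in> V" by (rule subspace_diff[OF V'(1) g h])
    then have "Lp_norm p (S (T (g - h))) \<le> C' * Lp_norm p (T (g - h))" using im by (intro C'(2)) blast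
    then have "Lp_norm p (g - h) \<le> C' * Lp_norm p (T (g - h))" by (simp only: inv(1)[OF d])
    then show ?thesis using C(2)[OF d] C'(1) by (simp add: linear_on_diff[OF V'(1) T g h] field_simps)
  qed
  then show "bilip_embeds p V W"
    unfolding bilip_embeds_def using im(1) C'(1) by (intro exI[of _ T] exI[of _ "1 / C'"] exI[of _ C]) auto
  have "(1 / C) * Lp_norm p (g - h) \<le> Lp_norm p (S g - S h) \<and> Lp_norm p (S g - S h) \<le> C' * Lp_norm p (g - h)"
    if g: "g \<in> W" and h: "h \<in> W" for g h
  proof -
    have d: "g - h \<in> W" by (rule subspace_diff[OF W'(1) g h])
    then have "Lp_norm p (T (S (g - h))) \<le> C * Lp_norm p (S (g - h))" using im by (intro C(2)) blast
    then have "Lp_norm p (g - h) \<le> C * Lp_norm p (S (g - h))" by (simp only: inv(2)[OF d])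
    then show ?thesis using C'(2)[OF d] C(1) by (simp add: linear_on_diff[OF W'(1) S g h] field_simps)
  qed
  then show "bilip_embeds p W V"
    unfolding bilip_embeds_def using im(2) C(1) by (intro exI[of _ S] exI[of _ "1 / C"] exI[of _ C']) auto
qed

lemma bilip_embeds_mono:
  assumes "bilip_embeds p V Z" "Z \<subseteq> W"
  shows "bilip_embeds p V W"
proof -
  obtain f c C where f: "c > 0" "f ` V \<subseteq> Z"
    "\<forall>g\<in>V. \<forall>h\<in>V. c * Lp_norm p (g - h) \<le> Lp_norm p (f g - f h) \<and> Lp_norm p (f g - f h) \<le> C * Lp_norm p (g - h)"
    using assms(1) unfolding bilip_embeds_def by (elim exE conjE) rule
  show ?thesis
    unfolding bilip_embeds_def
    by (rule exI[of _ f], rule exI[of _ c], rule exI[of _ C]) (use f(1,3) order_trans[OF f(2) assms(2)] in simp)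
qed

lemma embeds_bilip:
  assumes "p \<ge> 1" "closed_subspace p V" "embeds_Lp p V W"
  shows "bilip_embeds p V W"
proof -
  obtain Z where Z: "closed_subspace p Z" "Z \<subseteq> W" "isomorphic_Lp p V Z" using assms(3) unfolding embeds_Lp_def by blast
  show ?thesis by (rule bilip_embeds_mono[OF isomorphic_bilip(1)[OF assms(1,2) Z(1,3)] Z(2)])
qed

lemma compl_embeds_embeds: "compl_embeds_Lp p V W \<Longrightarrow> embeds_Lp p V W"
  unfolding compl_embeds_Lp_def complemented_in_Lp_def embeds_Lp_def by blast

lemma lipschitz_isomorphic_bilip:
  assumes p: "p \<ge> 1" and V: "closed_subspace p V" and W: "closed_subspace p W" and iso: "lipschitz_isomorphic_Lp p V W"
  shows "bilip_embeds p V W" "bilip_embeds p W V"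
proof -
  note V' = closed_subspaceD(2)[OF p V] and W' = closed_subspaceD(2)[OF p W]
  obtain f where f: "bij_betw f V W"
    and l: "Lipschitz_continuous_map (submetric (Lp p) V) (submetric (Lp p) W) f"
    and l': "Lipschitz_continuous_map (submetric (Lp p) W) (submetric (Lp p) V) (inv_into V f)"
    using iso unfolding lipschitz_isomorphic_Lp_def by blast
  let ?g = "inv_into V f"
  obtain C0 where C0: "\<And>g h. g \<in> V \<Longrightarrow> h \<in> V \<Longrightarrow> Lp_norm p (f g - f h) \<le> C0 * Lp_norm p (g - h)"
    using l unfolding Lipschitz_continuous_map_def mspace_sub[OF p V'] mdist_sub[OF p] by blast
  obtain C1 where C1: "\<And>g h. g \<in> W \<Longrightarrow> h \<in> W \<Longrightarrow> Lp_norm p (?g g - ?g h) \<le> C1 * Lp_norm p (g - h)"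
    using l' unfolding Lipschitz_continuous_map_def mspace_sub[OF p W'] mdist_sub[OF p] by blast
  define C where "C = \<bar>C0\<bar> + \<bar>C1\<bar> + 1"
  have C: "C > 0" by (simp add: C_def add_nonneg_pos)
  have up: "Lp_norm p (f g - f h) \<le> C * Lp_norm p (g - h)" if "g \<in> V" "h \<in> V" for g h
    using C0[OF that] by (rule order_trans) (auto simp: C_def intro!: mult_right_mono Lp_norm_nonneg)
  have up': "Lp_norm p (?g g - ?g h) \<le> C * Lp_norm p (g - h)" if "g \<in> W" "h \<in> W" for g h
    using C1[OF that] by (rule order_trans) (auto simp: C_def intro!: mult_right_mono Lp_norm_nonneg)
  have im: "f ` V = W" using f by (rule bij_betw_imp_surj_on)
  have im': "?g ` W = V" using bij_betw_inv_into[OF f] by (rule bij_betw_imp_surj_on)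
  have "(1 / C) * Lp_norm p (g - h) \<le> Lp_norm p (f g - f h)" if "g \<in> V" "h \<in> V" for g h
  proof -
    have "?g (f g) = g" "?g (f h) = h" using that f by (auto simp: bij_betw_def)
    then show ?thesis using up'[of "f g" "f h"] that im C by (auto simp: field_simps)
  qed
  then show "bilip_embeds p V W"
    unfolding bilip_embeds_def using im C up by (intro exI[of _ f] exI[of _ "1 / C"] exI[of _ C]) auto
  have "(1 / C) * Lp_norm p (g - h) \<le> Lp_norm p (?g g - ?g h)" if "g \<in> W" "h \<in> W" for g h
  proof -
    have "f (?g g) = g" "f (?g h) = h" using that im by (auto intro: f_inv_into_f)
    moreover have "?g g \<in> V" "?g h \<in> V" using that im' by auto
    ultimately show ?thesis using up[of "?g g" "?g h"] C by (simp add: field_simps)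
  qed
  then show "bilip_embeds p W V"
    unfolding bilip_embeds_def using im' C up' by (intro exI[of _ ?g] exI[of _ "1 / C"] exI[of _ C]) auto
qed

lemma linear_bijection_relations:
  assumes p: "p \<ge> 1" and V: "closed_subspace p V" and W: "closed_subspace p W"
    and T: "linear_on V T" "T ` V = W" and c: "c > 0"
    and bd: "\<And>g. g \<in> V \<Longrightarrow> c * Lp_norm p g \<le> Lp_norm p (T g) \<and> Lp_norm p (T g) \<le> C * Lp_norm p g"
  shows "isomorphic_Lp p V W" "lipschitz_isomorphic_Lp p V W" "embeds_Lp p V W" "compl_embeds_Lp p V W"
proof -
  note V' = closed_subspaceD[OF p V] and W' = closed_subspaceD[OF p W]
  have bd2: "c * Lp_norm p (g - h) \<le> Lp_norm p (T g - T h)" "Lp_norm p (T g - T h) \<le> C * Lp_norm p (g - h)"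
    if "g \<in> V" "h \<in> V" for g h
    using bd[OF subspace_diff[OF V'(1) that]] by (simp_all add: linear_on_diff[OF V'(1) T(1) that])
  have inj: "inj_on T V"
  proof (rule inj_onI)
    fix g h assume gh: "g \<in> V" "h \<in> V" "T g = T h"
    then have "c * Lp_norm p (g - h) \<le> 0" using bd2(1)[OF gh(1,2)] p by simp
    then have "Lp_norm p (g - h) = 0" using c Lp_norm_nonneg[of p "g - h"] by (simp add: mult_le_0_iff)
    then show "g = h" using gh V'(2) Lp_norm_eq_0_iff[OF p p_integrable_diff[OF p]] by (auto simp: Lp_space_def)
  qed
  let ?S = "inv_into V T"
  have bij: "bij_betw T V W" using inj T(2) by (simp add: bij_betw_def)
  have S: "?S g \<in> V" "T (?S g) = g" if "g \<in> W" for g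
    using that T(2) by (auto intro: inv_into_into f_inv_into_f)
  have S_bd: "Lp_norm p (?S g - ?S h) \<le> (1 / c) * Lp_norm p (g - h)" if "g \<in> W" "h \<in> W" for g h
    using bd2(1)[OF S(1)[OF that(1)] S(1)[OF that(2)]] c by (simp add: S(2)[OF that(1)] S(2)[OF that(2)] field_simps)
  have lT: "Lipschitz_continuous_map (submetric (Lp p) V) (submetric (Lp p) W) T"
    unfolding Lipschitz_continuous_map_def mspace_sub[OF p V'(2)] mspace_sub[OF p W'(2)] mdist_sub[OF p]
    using T(2) bd2(2) by blast
  have lS: "Lipschitz_continuous_map (submetric (Lp p) W) (submetric (Lp p) V) ?S"
    unfolding Lipschitz_continuous_map_def mspace_sub[OF p V'(2)] mspace_sub[OF p W'(2)] mdist_sub[OF p]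
    using S(1) S_bd by blast
  show "lipschitz_isomorphic_Lp p V W"
    unfolding lipschitz_isomorphic_Lp_def using bij lT lS by blast
  have ts: "topspace (subtopology (Lp_topology p) V) = V" "topspace (subtopology (Lp_topology p) W) = W"
    using V'(2) W'(2) by (auto simp: mspace_Lp[OF p])
  have "homeomorphic_maps (subtopology (Lp_topology p) V) (subtopology (Lp_topology p) W) T ?S"
    unfolding homeomorphic_maps_def ts
    using Lipschitz_continuous_imp_continuous_map[OF lT] Lipschitz_continuous_imp_continuous_map[OF lS] inj S(2)
    by (auto simp: mtopology_of_submetric)
  then show iso: "isomorphic_Lp p V W"
    unfolding isomorphic_Lp_def using T(1) homeomorphic_maps_map by blast
  show "embeds_Lp p V W" unfolding embeds_Lp_def using iso W by blast
  have "linear_on W (\<lambda>g. g)" by (simp add: linear_on_def)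
  moreover have "continuous_map (subtopology (Lp_topology p) W) (subtopology (Lp_topology p) W) (\<lambda>g. g)" by simp
  ultimately have "complemented_in_Lp p W W"
    unfolding complemented_in_Lp_def using W by (intro conjI exI[of _ "\<lambda>g. g"]) auto
  then show "compl_embeds_Lp p V W" unfolding compl_embeds_Lp_def using iso by blast
qed

section \<open>Finite combinations of a doubly indexed family\<close>

lemma span_doubly_indexed:
  fixes e :: "nat \<Rightarrow> nat \<Rightarrow> 'a::real_vector"
  shows "span (range (case_prod e)) =
    {z. \<exists>A B a. finite A \<and> finite B \<and> z = (\<Sum>n\<in>A. \<Sum>i\<in>B. a (n, i) *\<^sub>R e n i)}" (is "_ = ?S")
proof
  show "?S \<subseteq> span (range (case_prod e))"
  proof
    fix z assume "z \<in> ?S"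
    then obtain A B a where z: "z = (\<Sum>n\<in>A. \<Sum>i\<in>B. a (n, i) *\<^sub>R e n i)" by blast
    have "e n i \<in> span (range (case_prod e))" for n i by (rule span_base) (auto intro: range_eqI[of _ _ "(n, i)"])
    then show "z \<in> span (range (case_prod e))" unfolding z by (intro span_sum span_scale)
  qed
  show "span (range (case_prod e)) \<subseteq> ?S"
  proof
    fix z assume "z \<in> span (range (case_prod e))"
    then show "z \<in> ?S"
    proof (induction rule: span_induct_alt)
      case base
      show ?case by (intro CollectI exI[of _ "{}"]) auto
    next
      case (step c x y)
      obtain n0 i0 where x: "x = e n0 i0" using step(1) by auto
      obtain A B a where AB: "finite A" "finite B" and y: "y = (\<Sum>n\<in>A. \<Sum>i\<in>B. a (n, i) *\<^sub>R e n i)" using step(2) by blast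
      let ?A = "insert n0 A" and ?B = "insert i0 B"
      define a' where "a' b = (if b \<in> A \<times> B then a b else 0) + (if b = (n0, i0) then c else 0)" for b
      have "(\<Sum>n\<in>?A. \<Sum>i\<in>?B. a' (n, i) *\<^sub>R e n i) = (\<Sum>b\<in>?A \<times> ?B. a' b *\<^sub>R case_prod e b)"
        by (simp add: sum.cartesian_product case_prod_beta)
      moreover have "\<dots> = (\<Sum>b\<in>?A \<times> ?B. (if b \<in> A \<times> B then a b *\<^sub>R case_prod e b else 0)) +
          (\<Sum>b\<in>?A \<times> ?B. if b = (n0, i0) then c *\<^sub>R case_prod e b else 0)"
        unfolding a'_def scaleR_add_left sum.distrib by (intro arg_cong2[where f="(+)"] sum.cong) auto
      moreover have "(\<Sum>b\<in>?A \<times> ?B. (if b \<in> A \<times> B then a b *\<^sub>R case_prod e b else 0)) = (\<Sum>b\<in>A \<times> B. a b *\<^sub>R case_prod e b)"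
        by (rule sum.mono_neutral_cong_right) (use AB in auto)
      moreover have "(\<Sum>b\<in>A \<times> B. a b *\<^sub>R case_prod e b) = y"
        unfolding y by (simp add: sum.cartesian_product case_prod_beta)
      moreover have "(\<Sum>b\<in>?A \<times> ?B. if b = (n0, i0) then c *\<^sub>R case_prod e b else 0) = c *\<^sub>R x"
        using AB by (subst sum.delta) (auto simp: x)
      ultimately have "c *\<^sub>R x + y = (\<Sum>n\<in>?A. \<Sum>i\<in>?B. a' (n, i) *\<^sub>R e n i)" by (simp only: add.commute)
      then show ?case using AB by (intro CollectI exI[of _ ?A] exI[of _ ?B] exI[of _ a']) simp
    qed
  qed
qed

section \<open>Dependence of the exponents on the point of the Cantor space\<close>

lemma continuous_quaternary: "continuous_on UNIV quaternary"
proof (rule uniform_limit_theorem)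
  have "uniform_limit UNIV (\<lambda>n (b :: nat \<Rightarrow> bool). \<Sum>k<n. of_bool (b k) / 4 ^ Suc k :: real) (\<lambda>b. \<Sum>k. of_bool (b k) / 4 ^ Suc k) sequentially"
  proof (rule Weierstrass_m_test)
    show "summable (\<lambda>k. (1/4) ^ k :: real)" by (simp add: summable_geometric)
    show "norm (of_bool (b k) / 4 ^ Suc k :: real) \<le> (1/4) ^ k" for k and b :: "nat \<Rightarrow> bool"
      by (cases "b k") (simp_all add: power_one_over field_simps)
  qed
  then show "uniform_limit UNIV (\<lambda>n b. \<Sum>k<n. of_bool (b k) / 4 ^ Suc k) quaternary sequentially"
    by (simp only: quaternary_def[abs_def])
  have "continuous_on UNIV (\<lambda>b :: nat \<Rightarrow> bool. of_bool (b k) :: real)" for k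
    by (rule continuous_on_compose2[OF Topological_Spaces.continuous_on_discrete[of UNIV of_bool]]) auto
  then show "\<forall>\<^sub>F n in sequentially. continuous_on UNIV (\<lambda>b :: nat \<Rightarrow> bool. \<Sum>k<n. of_bool (b k) / 4 ^ Suc k :: real)"
    by (intro always_eventually allI continuous_on_sum continuous_on_divide continuous_on_const) auto
qed simp

lemma quaternary_inject: "quaternary b = quaternary b' \<longleftrightarrow> b = b'"
proof
  assume eq: "quaternary b = quaternary b'"
  have "b k \<longleftrightarrow> b' k" for k using quaternary_digit[of k b] quaternary_digit[of k b'] by (simp only: eq)
  then show "b = b'" by (simp add: fun_eq_iff)
qed simp

context tails begin

definition rate :: "(nat \<Rightarrow> bool) \<Rightarrow> real"
  where "rate b = r0 + (r1 - r0) * quaternary b"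

lemma rate_bounds: "r0 \<le> rate b" "rate b \<le> r1"
proof -
  show "r0 \<le> rate b" using r quaternary_bounds[of b] by (simp add: rate_def)
  have "(r1 - r0) * quaternary b \<le> (r1 - r0) * 1" using r quaternary_bounds[of b] by (intro mult_left_mono) auto
  then show "rate b \<le> r1" by (simp add: rate_def)
qed

text \<open>The pairing function lists every term of \<open>x\<close> infinitely often. So only the set of terms matters, not their
  multiplicities.\<close>

definition rates :: "(nat \<Rightarrow> nat \<Rightarrow> bool) \<Rightarrow> nat \<Rightarrow> real"
  where "rates x n = rate (x (fst (prod_decode n)))"

lemma rates_bounds: "r0 \<le> rates x n \<and> rates x n \<le> r1"
  by (simp add: rates_def rate_bounds)

lemma continuous_rates: "continuous_on UNIV (\<lambda>x. rates x n)"
proof -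
  have "continuous_on UNIV (\<lambda>x :: nat \<Rightarrow> nat \<Rightarrow> bool. quaternary (x (fst (prod_decode n))))"
    by (rule continuous_on_compose2[OF continuous_quaternary]) auto
  then show ?thesis unfolding rates_def rate_def by (intro continuous_intros)
qed

lemma G_rates_tendsto:
  "((\<lambda>x. Lp_norm p (G (rates x n) n i - G (rates x0 n) n i)) \<longlongrightarrow> 0) (at x0)"
proof -
  let ?h = "\<lambda>u. Lp_norm p (G u n i - G (rates x0 n) n i)"
  have "(?h \<longlongrightarrow> 0) (at (rates x0 n) within {r0..r1})"
    unfolding tendsto_at_iff_sequentially comp_def
    using rates_bounds[of x0 n] by (intro allI impI G_continuous) auto
  moreover have "?h (rates x0 n) = 0" using p by simp
  ultimately have c: "continuous (at (rates x0 n) within {r0..r1}) ?h" by (simp add: continuous_within)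
  have l: "((\<lambda>x. rates x n) \<longlongrightarrow> rates x0 n) (at x0)"
    using continuous_rates[of n] by (simp add: continuous_on_def)
  have "((\<lambda>x. ?h (rates x n)) \<longlongrightarrow> ?h (rates x0 n)) (at x0)"
    by (rule continuous_within_tendsto_compose[OF c always_eventually l]) (use rates_bounds in auto)
  then show ?thesis using p by simp
qed

section \<open>The subspace attached to a sequence of points\<close>

definition gens :: "(nat \<Rightarrow> real) \<Rightarrow> L0 set"
  where "gens s = range (\<lambda>(n, i). G (s n) n i)"

definition V :: "(nat \<Rightarrow> real) \<Rightarrow> L0 set"
  where "V s = cl p (span (gens s))"

lemma span_gens: "z \<in> span (gens s) \<longleftrightarrow> (\<exists>A B a. finite A \<and> finite B \<and> z = comb s A B a)"
  unfolding gens_def comb_def using span_doubly_indexed[of "\<lambda>n i. G (s n) n i"] by simp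

lemma span_gens_Lp:
  assumes "\<And>n. r0 \<le> s n \<and> s n \<le> r1"
  shows "span (gens s) \<subseteq> Lp_space p"
  using comb_bounds(1)[OF _ _ assms] by (auto simp: span_gens Lp_space_def)

lemma closed_subspace_V:
  assumes "\<And>n. r0 \<le> s n \<and> s n \<le> r1"
  shows "closed_subspace p (V s)"
  unfolding V_def by (rule closed_subspace_cl[OF p span_gens_Lp[OF assms] subspace_span])

lemma comb_rates_tendsto:
  assumes A: "finite A" and B: "finite B"
  shows "((\<lambda>x. Lp_norm p (comb (rates x) A B a - comb (rates x0) A B a)) \<longlongrightarrow> 0) (at x0)"
proof -
  let ?d = "\<lambda>x n i. Lp_norm p (G (rates x n) n i - G (rates x0 n) n i)"
  have int: "p_integrable p (G (rates x n) n i - G (rates x0 n) n i)" for x n i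
    using p rates_bounds by (intro p_integrable_diff p_integrable_G) auto
  have le: "Lp_norm p (comb (rates x) A B a - comb (rates x0) A B a) \<le> (\<Sum>b\<in>A \<times> B. \<bar>a b\<bar> * ?d x (fst b) (snd b))" for x
  proof -
    let ?v = "\<lambda>b. a b *\<^sub>R (G (rates x (fst b)) (fst b) (snd b) - G (rates x0 (fst b)) (fst b) (snd b))"
    have "comb (rates x) A B a - comb (rates x0) A B a = (\<Sum>b\<in>A \<times> B. ?v b)"
      by (simp add: comb_def sum.cartesian_product case_prod_beta scaleR_diff_right sum_subtractf)
    moreover have "Lp_norm p (\<Sum>b\<in>A \<times> B. ?v b) \<le> (\<Sum>b\<in>A \<times> B. Lp_norm p (?v b))"
      using A B by (intro p_integrable_sum(2)[OF p] p_integrable_scaleR int) auto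
    ultimately show ?thesis by (simp add: Lp_norm_scaleR[OF p])
  qed
  have "((\<lambda>x. \<Sum>b\<in>A \<times> B. \<bar>a b\<bar> * ?d x (fst b) (snd b)) \<longlongrightarrow> 0) (at x0)"
    by (intro tendsto_null_sum tendsto_mult_right_zero G_rates_tendsto)
  then show ?thesis
    by (rule tendsto_sandwich[OF _ _ tendsto_const, rotated -1]) (auto simp: le Lp_norm_nonneg)
qed

lemma open_comb_rates:
  assumes A: "finite A" and B: "finite B" and U: "openin (Lp_topology p) U"
  shows "open {x. comb (rates x) A B a \<in> U}"
proof (subst open_subopen, intro ballI)
  interpret Metric_space "Lp_space p" "Lp_dist p" by (rule Metric_space_Lp[OF p])
  let ?\<Phi> = "\<lambda>x. comb (rates x) A B a"
  have mem: "?\<Phi> x \<in> Lp_space p" for x using comb_bounds(1)[OF A B rates_bounds] by (simp add: Lp_space_def)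
  fix x0 assume "x0 \<in> {x. ?\<Phi> x \<in> U}"
  then obtain e where e: "e > 0" "mball (?\<Phi> x0) e \<subseteq> U"
    using U unfolding mtopology_of_Lp[OF p] openin_mtopology by blast
  have "\<forall>\<^sub>F x in at x0. Lp_norm p (?\<Phi> x - ?\<Phi> x0) < e"
    by (rule order_tendstoD(2)[OF comb_rates_tendsto[OF A B] e(1)])
  then obtain S where S: "open S" "x0 \<in> S" "\<And>x. x \<in> S \<Longrightarrow> x \<noteq> x0 \<Longrightarrow> Lp_norm p (?\<Phi> x - ?\<Phi> x0) < e"
    unfolding eventually_at_topological by blast
  have "?\<Phi> x \<in> U" if "x \<in> S" for x
  proof -
    have "Lp_norm p (?\<Phi> x - ?\<Phi> x0) < e" using S(3)[OF that] e(1) p by (cases "x = x0") auto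
    then have "?\<Phi> x \<in> mball (?\<Phi> x0) e" using mem by (simp add: Lp_dist_def Lp_norm_minus_commute[of p "?\<Phi> x0"])
    then show ?thesis using e(2) by blast
  qed
  then show "\<exists>T. open T \<and> x0 \<in> T \<and> T \<subseteq> {x. ?\<Phi> x \<in> U}" using S(1,2) by blast
qed

text \<open>A closed subspace meets an open set if and only if the span of its generators does, and by
  \<open>open_comb_rates\<close> each finite combination of generators lies in the open set for an open set of \<open>x\<close>.\<close>

lemma measurable_V: "(\<lambda>x. V (rates x)) \<in> borel \<rightarrow>\<^sub>M subspaces_Lp p"
  unfolding subspaces_Lp_def
proof (rule measurable_restrict_space2)
  show "(\<lambda>x. V (rates x)) \<in> space borel \<rightarrow> {V. closed_subspace p V}" using closed_subspace_V[OF rates_bounds] by auto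
  have closed: "closedin (Lp_topology p) (V (rates x))" for x
    using closed_subspace_V[OF rates_bounds] by (simp add: closed_subspace_def)
  show "(\<lambda>x. V (rates x)) \<in> borel \<rightarrow>\<^sub>M effros_borel (Lp_topology p)"
    unfolding effros_borel_def
  proof (rule measurable_measure_of)
    show "(\<lambda>x. V (rates x)) \<in> space borel \<rightarrow> {F. closedin (Lp_topology p) F}" using closed by auto
    fix Y assume "Y \<in> {{F. closedin (Lp_topology p) F \<and> F \<inter> U \<noteq> {}} |U. openin (Lp_topology p) U}"
    then obtain U where U: "openin (Lp_topology p) U" and Y: "Y = {F. closedin (Lp_topology p) F \<and> F \<inter> U \<noteq> {}}" by blast
    have "U \<inter> V (rates x) \<noteq> {} \<longleftrightarrow> U \<inter> span (gens (rates x)) \<noteq> {}" for x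
      unfolding V_def cl_eq_closure[OF p span_gens_Lp[OF rates_bounds], symmetric]
      using openin_Int_closure_of_eq_empty[OF U] by blast
    then have "(\<lambda>x. V (rates x)) -` Y \<inter> space borel = {x. U \<inter> span (gens (rates x)) \<noteq> {}}"
      unfolding Y using closed by auto
    moreover have "{x. U \<inter> span (gens (rates x)) \<noteq> {}} =
        (\<Union>(A, B, a)\<in>{A. finite A} \<times> {B. finite B} \<times> UNIV. {x. comb (rates x) A B a \<in> U})"
    proof (intro set_eqI iffI)
      fix x assume "x \<in> {x. U \<inter> span (gens (rates x)) \<noteq> {}}"
      then obtain z where z: "z \<in> U" "z \<in> span (gens (rates x))" by blast
      then obtain A B a where "finite A" "finite B" "z = comb (rates x) A B a" by (auto simp: span_gens)
      then show "x \<in> (\<Union>(A, B, a)\<in>{A. finite A} \<times> {B. finite B} \<times> UNIV. {x. comb (rates x) A B a \<in> U})"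
        using z(1) by (intro UN_I[of "(A, B, a)"]) auto
    next
      fix x assume "x \<in> (\<Union>(A, B, a)\<in>{A. finite A} \<times> {B. finite B} \<times> UNIV. {x. comb (rates x) A B a \<in> U})"
      then obtain A B a where "finite A" "finite B" and z: "comb (rates x) A B a \<in> U" by auto
      then have "comb (rates x) A B a \<in> span (gens (rates x))" unfolding span_gens by blast
      then show "x \<in> {x. U \<inter> span (gens (rates x)) \<noteq> {}}" using z by blast
    qed
    moreover have "open (\<Union>(A, B, a)\<in>{A. finite A} \<times> {B. finite B} \<times> UNIV. {x. comb (rates x) A B a \<in> U})"
      by (rule open_UN) (use open_comb_rates[OF _ _ U] in auto)
    ultimately show "(\<lambda>x. V (rates x)) -` Y \<inter> space borel \<in> sets borel" by simp
  qed auto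
qed

end

section \<open>Permuting the blocks\<close>

lemma matching_of_infinite_fibres:
  fixes u v :: "nat \<Rightarrow> 'a"
  assumes rng: "range u = range v"
    and u: "\<And>a. a \<in> range u \<Longrightarrow> infinite {n. u n = a}" and v: "\<And>a. a \<in> range v \<Longrightarrow> infinite {n. v n = a}"
  obtains \<sigma> :: "nat \<Rightarrow> nat" where "bij \<sigma>" "\<And>n. v (\<sigma> n) = u n"
proof -
  define eu where "eu a = enumerate {n. u n = a}" for a
  define ev where "ev a = enumerate {n. v n = a}" for a
  have eu: "bij_betw (eu a) UNIV {n. u n = a}" if "a \<in> range u" for a unfolding eu_def by (rule bij_enumerate[OF u[OF that]])
  have ev: "bij_betw (ev a) UNIV {n. v n = a}" if "a \<in> range u" for a unfolding ev_def by (rule bij_enumerate) (use v that rng in auto)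
  define k where "k n = inv (eu (u n)) n" for n
  have k: "eu (u n) (k n) = n" for n
    unfolding k_def using eu[of "u n"] by (intro f_inv_into_f) (auto simp: bij_betw_def)
  define \<sigma> where "\<sigma> n = ev (u n) (k n)" for n
  have v\<sigma>: "v (\<sigma> n) = u n" for n
    unfolding \<sigma>_def using ev[of "u n"] by (auto simp: bij_betw_def)
  have "inj \<sigma>"
  proof (rule injI)
    fix n n' assume eq: "\<sigma> n = \<sigma> n'"
    then have un: "u n = u n'" using v\<sigma>[of n] v\<sigma>[of n'] by simp
    have "inj (ev (u n))" using ev[of "u n"] by (simp add: bij_betw_def)
    moreover have "ev (u n) (k n) = ev (u n) (k n')" using eq un by (simp add: \<sigma>_def)
    ultimately have "k n = k n'" by (rule injD)
    then have "eu (u n) (k n) = eu (u n') (k n')" by (simp only: un)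
    then show "n = n'" by (simp only: k)
  qed
  moreover have "\<exists>n. m = \<sigma> n" for m
  proof -
    have a: "v m \<in> range u" using rng by auto
    have "m \<in> ev (v m) ` UNIV" using ev[OF a] by (auto simp: bij_betw_def)
    then obtain j where j: "m = ev (v m) j" by blast
    define n where "n = eu (v m) j"
    have un: "u n = v m" unfolding n_def using eu[OF a] by (auto simp: bij_betw_def)
    have "inj (eu (v m))" using eu[OF a] by (simp add: bij_betw_def)
    moreover have "eu (v m) (k n) = eu (v m) j" using k[of n] un by (simp add: n_def)
    ultimately have "k n = j" by (rule injD)
    then show ?thesis using j un by (auto simp: \<sigma>_def intro!: exI[of _ n])
  qed
  ultimately have "bij \<sigma>" by (auto simp: bij_def surj_def)
  then show ?thesis using that v\<sigma> by blast
qed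

lemma eq_plus_range: "eq_plus x y \<longleftrightarrow> range x = range y"
proof
  assume "eq_plus x y"
  then have "\<And>n. x n \<in> range y" "\<And>n. y n \<in> range x" unfolding plus_rel_def by (metis rangeI)+
  then show "range x = range y" by blast
next
  assume "range x = range y"
  then have "\<And>n. x n \<in> range y" "\<And>n. y n \<in> range x" by auto
  then show "eq_plus x y" unfolding plus_rel_def by blast
qed

lemma infinitely_many_codes: "infinite {n. f (fst (prod_decode n)) = f j}"
proof -
  have "inj (\<lambda>i. prod_encode (j, i))" by (auto simp: inj_def)
  then have "infinite (range (\<lambda>i. prod_encode (j, i)))" by (simp add: finite_image_iff)
  then show ?thesis by (rule contrapos_nn) (auto elim!: finite_subset[rotated])
qed

context tails begin

lemma mix_reindex:
  assumes "inj \<sigma>" "\<And>n. s' (\<sigma> n) = s n"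
  shows "mix p s' (\<sigma> ` A) B (\<lambda>(m, i). a (inv \<sigma> m, i)) = mix p s A B a"
  using assms by (simp add: mix_def lp_def sum.reindex inj_on_subset[OF assms(1)])

text \<open>Corresponding combinations have the same mixed norm, to which both \<open>L\<^sub>p\<close> norms are equivalent.\<close>

lemma isomorphism_of_permutation:
  assumes s: "\<And>n. r0 \<le> s n \<and> s n \<le> r1" and s': "\<And>n. r0 \<le> s' n \<and> s' n \<le> r1"
    and \<sigma>: "bij \<sigma>" "\<And>n. s' (\<sigma> n) = s n"
  obtains T where "linear_on (V s) T" "T ` V s = V s'"
    "\<And>g. g \<in> V s \<Longrightarrow> (K1 / K2) * Lp_norm p g \<le> Lp_norm p (T g) \<and> Lp_norm p (T g) \<le> (K2 / K1) * Lp_norm p g"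
proof -
  have inj: "inj \<sigma>" and surj: "surj \<sigma>" using \<sigma>(1) by (auto simp: bij_def)
  define e where "e n i = (G (s n) n i, G (s n) (\<sigma> n) i)" for n i
  define R where "R = span (range (case_prod e))"
  have "fst ` range (case_prod e) = gens s"
    unfolding image_image gens_def by (intro image_cong refl) (simp add: e_def case_prod_beta)
  then have fstR: "fst ` R = span (gens s)"
    unfolding R_def span_linear_image[OF linear_fst, symmetric] by simp
  have "(\<lambda>b. G (s (fst b)) (\<sigma> (fst b)) (snd b)) ` UNIV = gens s'"
  proof -
    have "surj (map_prod \<sigma> (id :: nat \<Rightarrow> nat))" using surj by (intro map_prod_surj) auto
    then have "gens s' = (\<lambda>b. G (s' (fst b)) (fst b) (snd b)) ` (map_prod \<sigma> id ` UNIV)"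
      by (simp only: gens_def case_prod_beta')
    moreover have "\<dots> = (\<lambda>b. G (s (fst b)) (\<sigma> (fst b)) (snd b)) ` UNIV"
      unfolding image_image by (intro image_cong refl) (simp add: \<sigma>(2))
    ultimately show ?thesis by (rule trans[symmetric])
  qed
  moreover have "snd ` range (case_prod e) = (\<lambda>b. G (s (fst b)) (\<sigma> (fst b)) (snd b)) ` UNIV"
    unfolding image_image by (intro image_cong refl) (simp add: e_def case_prod_beta)
  ultimately have sndR: "snd ` R = span (gens s')"
    unfolding R_def span_linear_image[OF linear_snd, symmetric] by simp
  have bounds: "(K1 / K2) * Lp_norm p g \<le> Lp_norm p h" "Lp_norm p h \<le> (K2 / K1) * Lp_norm p g" if in_R: "(g, h) \<in> R" for g h
  proof -
    obtain A B a where AB: "finite A" "finite B" and gh: "(g, h) = (\<Sum>n\<in>A. \<Sum>i\<in>B. a (n, i) *\<^sub>R e n i)"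
      using in_R unfolding R_def span_doubly_indexed by blast
    have g: "g = comb s A B a"
      using arg_cong[OF gh, of fst] by (simp add: comb_def fst_sum e_def)
    have "h = (\<Sum>n\<in>A. \<Sum>i\<in>B. a (n, i) *\<^sub>R G (s n) (\<sigma> n) i)"
      using arg_cong[OF gh, of snd] by (simp add: snd_sum e_def)
    moreover have "comb s' (\<sigma> ` A) B (\<lambda>(m, i). a (inv \<sigma> m, i)) = (\<Sum>n\<in>A. \<Sum>i\<in>B. a (n, i) *\<^sub>R G (s n) (\<sigma> n) i)"
      unfolding comb_def using inj by (simp add: sum.reindex inj_on_subset[OF inj] \<sigma>(2))
    ultimately have h: "h = comb s' (\<sigma> ` A) B (\<lambda>(m, i). a (inv \<sigma> m, i))" by simp
    define M where "M = mix p s A B a"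
    have 1: "K1 * M \<le> Lp_norm p g" "Lp_norm p g \<le> K2 * M"
      unfolding g M_def using comb_bounds(2,3)[OF AB s] by auto
    have 2: "K1 * M \<le> Lp_norm p h" "Lp_norm p h \<le> K2 * M"
      using comb_bounds(2,3)[of "\<sigma> ` A" B s' "\<lambda>(m, i). a (inv \<sigma> m, i)"] AB s'
      unfolding h[symmetric] mix_reindex[where s'=s' and s=s, OF inj \<sigma>(2)] M_def[symmetric] by auto
    have "K1 * Lp_norm p g \<le> K1 * (K2 * M)" using 1(2) K_pos by simp
    also have "\<dots> = K2 * (K1 * M)" by simp
    also have "\<dots> \<le> K2 * Lp_norm p h" using 2(1) K_pos by simp
    finally show "(K1 / K2) * Lp_norm p g \<le> Lp_norm p h" using K_pos by (simp add: field_simps)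
    have "K1 * Lp_norm p h \<le> K1 * (K2 * M)" using 2(2) K_pos by simp
    also have "\<dots> = K2 * (K1 * M)" by simp
    also have "\<dots> \<le> K2 * Lp_norm p g" using 1(1) K_pos by simp
    finally show "Lp_norm p h \<le> (K2 / K1) * Lp_norm p g" using K_pos by (simp add: field_simps)
  qed
  have sub: "R \<subseteq> Lp_space p \<times> Lp_space p"
  proof
    fix z assume "z \<in> R"
    then have "fst z \<in> fst ` R" "snd z \<in> snd ` R" by auto
    then show "z \<in> Lp_space p \<times> Lp_space p"
      unfolding fstR sndR using span_gens_Lp[of s] span_gens_Lp[of s'] s s' by (auto simp: mem_Times_iff)
  qed
  have sR: "subspace R" unfolding R_def by (rule subspace_span)
  have c: "K1 / K2 > 0" using K_pos by simp
  show ?thesis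
    by (rule extend_to_closure[OF p sR sub c bounds(1) bounds(2)]) (use that in \<open>simp_all add: fstR sndR V_def\<close>)
qed

lemma relations_of_eq_plus:
  assumes "eq_plus x y"
  shows "isomorphic_Lp p (V (rates x)) (V (rates y))" "lipschitz_isomorphic_Lp p (V (rates x)) (V (rates y))"
    "embeds_Lp p (V (rates x)) (V (rates y))" "compl_embeds_Lp p (V (rates x)) (V (rates y))"
proof -
  let ?u = "\<lambda>z n. z (fst (prod_decode n))"
  have sur: "range (?u z) = range z" for z :: "nat \<Rightarrow> nat \<Rightarrow> bool"
  proof -
    have "z j = ?u z (prod_encode (j, 0))" for j by simp
    then show ?thesis by blast
  qed
  obtain \<sigma> where \<sigma>: "bij \<sigma>" "\<And>n. ?u y (\<sigma> n) = ?u x n"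
  proof (rule matching_of_infinite_fibres[of "?u x" "?u y"])
    have inf: "infinite {n. ?u z n = a}" if "a \<in> range (?u z)" for z :: "nat \<Rightarrow> nat \<Rightarrow> bool" and a
      using that infinitely_many_codes[of z] by auto
    show "range (?u x) = range (?u y)" using assms by (simp only: sur eq_plus_range)
    show "infinite {n. ?u x n = a}" if "a \<in> range (?u x)" for a by (rule inf[OF that])
    show "infinite {n. ?u y n = a}" if "a \<in> range (?u y)" for a by (rule inf[OF that])
  qed blast
  have "rates y (\<sigma> n) = rates x n" for n using \<sigma>(2)[of n] by (simp add: rates_def)
  then obtain T where T: "linear_on (V (rates x)) T" "T ` V (rates x) = V (rates y)"
    "\<And>g. g \<in> V (rates x) \<Longrightarrow> (K1 / K2) * Lp_norm p g \<le> Lp_norm p (T g) \<and> Lp_norm p (T g) \<le> (K2 / K1) * Lp_norm p g"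
    using isomorphism_of_permutation[of "rates x" "rates y" \<sigma>, OF rates_bounds rates_bounds \<sigma>(1)] by blast
  have c: "K1 / K2 > 0" using K_pos by simp
  note R = linear_bijection_relations[OF p closed_subspace_V[of "rates x", OF rates_bounds] closed_subspace_V[of "rates y", OF rates_bounds] T(1,2) c T(3)]
  show "isomorphic_Lp p (V (rates x)) (V (rates y))" "lipschitz_isomorphic_Lp p (V (rates x)) (V (rates y))"
    "embeds_Lp p (V (rates x)) (V (rates y))" "compl_embeds_Lp p (V (rates x)) (V (rates y))"
    by (rule R; assumption)+
qed

end

lemma lp_tendsto:
  assumes "s > 0" "\<And>i. i \<in> B \<Longrightarrow> (\<lambda>k. a k i) \<longlonglongrightarrow> l i"
  shows "(\<lambda>k. lp s B (a k)) \<longlonglongrightarrow> lp s B l"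
  unfolding lp_def using assms
  by (intro tendsto_powr' tendsto_sum tendsto_rabs tendsto_const) (auto intro!: always_eventually sum_nonneg)

lemma mix_tendsto:
  assumes "p > 0" "\<And>n. s n > 0" "\<And>b. (\<lambda>k. a k b) \<longlonglongrightarrow> l b"
  shows "(\<lambda>k. mix p s A B (a k)) \<longlonglongrightarrow> mix p s A B l"
  unfolding mix_def by (intro lp_tendsto assms)

context tails begin

section \<open>Coordinates\<close>

lemma comb_extend:
  assumes "finite A'" "A \<subseteq> A'" "\<And>b. b \<notin> A \<times> A \<Longrightarrow> a b = 0"
  shows "comb s A' A' a = comb s A A a"
proof -
  have fin: "finite A" using assms(1,2) finite_subset by blast
  have "comb s A' A' a = (\<Sum>b\<in>A' \<times> A'. a b *\<^sub>R G (s (fst b)) (fst b) (snd b))"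
    by (simp add: comb_def sum.cartesian_product case_prod_beta)
  moreover have "\<dots> = (\<Sum>b\<in>A \<times> A. a b *\<^sub>R G (s (fst b)) (fst b) (snd b))"
    by (rule sum.mono_neutral_right) (use assms in auto)
  moreover have "\<dots> = comb s A A a"
    by (simp add: comb_def sum.cartesian_product case_prod_beta)
  ultimately show ?thesis by simp
qed

definition represents :: "(nat \<Rightarrow> real) \<Rightarrow> (nat \<times> nat \<Rightarrow> real) \<Rightarrow> L0 \<Rightarrow> bool"
  where "represents s a z \<longleftrightarrow> (\<exists>A. finite A \<and> (\<forall>b. b \<notin> A \<times> A \<longrightarrow> a b = 0) \<and> z = comb s A A a)"

lemma representsE:
  assumes "represents s a z" "finite D"
  obtains A where "finite A" "D \<subseteq> A" "\<And>b. b \<notin> A \<times> A \<Longrightarrow> a b = 0" "z = comb s A A a"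
proof -
  obtain A where A: "finite A" "\<And>b. b \<notin> A \<times> A \<Longrightarrow> a b = 0" "z = comb s A A a"
    using assms(1) unfolding represents_def by blast
  show ?thesis
  proof (rule that[of "A \<union> D"])
    show "z = comb s (A \<union> D) (A \<union> D) a" using comb_extend[of "A \<union> D" A a s] A assms(2) by simp
  qed (use A assms(2) in auto)
qed

lemma ex_represents: "z \<in> span (gens s) \<Longrightarrow> \<exists>a. represents s a z"
proof -
  assume "z \<in> span (gens s)"
  then obtain A B a where AB: "finite A" "finite B" and z: "z = comb s A B a" unfolding span_gens by blast
  define a' where "a' b = (if b \<in> A \<times> B then a b else 0)" for b
  let ?D = "A \<union> B"
  have "comb s ?D ?D a' = (\<Sum>b\<in>?D \<times> ?D. a' b *\<^sub>R G (s (fst b)) (fst b) (snd b))"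
    by (simp add: comb_def sum.cartesian_product case_prod_beta)
  moreover have "\<dots> = (\<Sum>b\<in>A \<times> B. a b *\<^sub>R G (s (fst b)) (fst b) (snd b))"
    by (rule sum.mono_neutral_cong_right) (use AB in \<open>auto simp: a'_def\<close>)
  moreover have "\<dots> = z"
    by (simp add: z comb_def sum.cartesian_product case_prod_beta)
  ultimately have "z = comb s ?D ?D a'" by simp
  then show ?thesis
    unfolding represents_def using AB by (intro exI[of _ a'] exI[of _ ?D]) (auto simp: a'_def)
qed

lemma represents_diff:
  assumes "represents s a z" "represents s a' z'"
  shows "represents s (\<lambda>b. a b - a' b) (z - z')"
proof -
  obtain A where A: "finite A" "\<And>b. b \<notin> A \<times> A \<Longrightarrow> a b = 0" "z = comb s A A a"
    using assms(1) unfolding represents_def by blast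
  obtain D where D: "finite D" "A \<subseteq> D" "\<And>b. b \<notin> D \<times> D \<Longrightarrow> a' b = 0" "z' = comb s D D a'"
    by (rule representsE[OF assms(2) A(1)]) blast
  have "z = comb s D D a" using comb_extend[OF D(1,2) A(2)] A(3) by simp
  then have "z - z' = comb s D D (\<lambda>b. a b - a' b)"
    by (simp add: D(4) comb_def scaleR_diff_left sum_subtractf)
  moreover have "a b - a' b = 0" if "b \<notin> D \<times> D" for b
  proof -
    have "b \<notin> A \<times> A" using that D(2) by auto
    then show ?thesis using A(2) D(3)[OF that] by simp
  qed
  ultimately show ?thesis unfolding represents_def using D(1) by blast
qed

abbreviation box_norm :: "(nat \<Rightarrow> real) \<Rightarrow> nat \<Rightarrow> (nat \<times> nat \<Rightarrow> real) \<Rightarrow> real"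
  where "box_norm s J \<equiv> mix p s {..<J} {..<J}"

lemma p_integrable_represents:
  assumes "\<And>n. r0 \<le> s n \<and> s n \<le> r1" "represents s a z"
  shows "p_integrable p z"
  using assms comb_bounds(1) unfolding represents_def by blast

lemma represents_bounds:
  assumes s: "\<And>n. r0 \<le> s n \<and> s n \<le> r1" and a: "represents s a z"
  shows "K1 * box_norm s J a \<le> Lp_norm p z" and "\<exists>J. Lp_norm p z \<le> K2 * box_norm s J a"
proof -
  have s0: "s n > 0" for n using s[of n] p r by linarith
  obtain A where A: "finite A" "{..<J} \<subseteq> A" "z = comb s A A a"
    by (rule representsE[OF a finite_lessThan[of J]]) blast
  have "box_norm s J a \<le> mix p s A A a" by (rule mix_mono) (use p s0 A in auto)
  then have "K1 * box_norm s J a \<le> K1 * mix p s A A a" using K_pos by simp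
  also have "\<dots> \<le> Lp_norm p z" unfolding A(3) by (rule comb_bounds(2)[OF A(1) A(1) s])
  finally show "K1 * box_norm s J a \<le> Lp_norm p z" .
  obtain k where k: "A \<subseteq> {..<k}" using A(1) finite_nat_iff_bounded by auto
  have "Lp_norm p z \<le> K2 * mix p s A A a" unfolding A(3) by (rule comb_bounds(3)[OF A(1) A(1) s])
  also have "\<dots> \<le> K2 * box_norm s k a" using K_pos by (intro mult_left_mono mix_mono) (use p s0 k in auto)
  finally show "\<exists>J. Lp_norm p z \<le> K2 * box_norm s J a" by blast
qed

text \<open>Coordinates of an element of the closure are limits of the coefficients of approximating finite
  combinations. They determine its norm up to the factors \<open>K1\<close> and \<open>K2\<close> (\<open>coordinates_le\<close>, \<open>coordinates_ge\<close>).\<close>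

definition coordinates :: "(nat \<Rightarrow> real) \<Rightarrow> L0 \<Rightarrow> (nat \<times> nat \<Rightarrow> real) \<Rightarrow> bool"
  where "coordinates s g v \<longleftrightarrow> (\<exists>z a. (\<forall>k. represents s (a k) (z k)) \<and> Lp_lim p z g \<and> (\<forall>b. (\<lambda>k. a k b) \<longlonglongrightarrow> v b))"

lemma coordinates_of_finite:
  assumes "\<And>n. r0 \<le> s n \<and> s n \<le> r1" "represents s a z"
  shows "coordinates s z a"
  unfolding coordinates_def
  by (rule exI[of _ "\<lambda>_. z"], rule exI[of _ "\<lambda>_. a"])
    (use assms p p_integrable_represents[OF assms] in \<open>simp add: Lp_lim_def\<close>)

lemma ex_coordinates:
  assumes s: "\<And>n. r0 \<le> s n \<and> s n \<le> r1" and g: "g \<in> V s"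
  shows "\<exists>v. coordinates s g v"
proof -
  obtain z where z: "\<And>k. z k \<in> span (gens s)" "Lp_lim p z g"
    using cl_limitE[OF span_gens_Lp[OF s] g[unfolded V_def]] by blast
  have "\<forall>k. \<exists>a. represents s a (z k)" using ex_represents z(1) by blast
  then obtain a where a: "\<And>k. represents s (a k) (z k)" by (rule choice[THEN exE]) blast
  have s0: "s n > 0" for n using s[of n] p r by linarith
  have zp: "p_integrable p (z k)" "p_integrable p g" for k using z(2) by (auto simp: Lp_lim_def)
  have "convergent (\<lambda>k. a k b)" for b
  proof -
    define J where "J = Suc (max (fst b) (snd b))"
    have J: "fst b < J" "snd b < J" by (auto simp: J_def)
    have le: "\<bar>a k b - a l b\<bar> \<le> (Lp_norm p (z k - g) + Lp_norm p (z l - g)) / K1" for k l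
    proof -
      have "K1 * \<bar>a k b - a l b\<bar> \<le> K1 * box_norm s J (\<lambda>b. a k b - a l b)"
        using K_pos mix_coord[of p s "{..<J}" "{..<J}" "fst b" "snd b" "\<lambda>b. a k b - a l b"] p s0 J by auto
      moreover have "\<dots> \<le> Lp_norm p (z k - z l)" by (rule represents_bounds(1)[OF s represents_diff[OF a a]])
      moreover have "Lp_norm p (z k - z l) \<le> Lp_norm p (z k - g) + Lp_norm p (z l - g)"
        using Lp_norm_triangle[OF p zp(1) zp(2) zp(1)] by (simp add: Lp_norm_minus_commute[of p g])
      ultimately have "K1 * \<bar>a k b - a l b\<bar> \<le> Lp_norm p (z k - g) + Lp_norm p (z l - g)"
        by linarith
      then show ?thesis using K_pos by (simp add: field_simps)
    qed
    have "Cauchy (\<lambda>k. a k b)"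
    proof (rule CauchyI)
      fix e :: real assume e: "e > 0"
      have "(\<lambda>k. Lp_norm p (z k - g)) \<longlonglongrightarrow> 0" using z(2) by (simp add: Lp_lim_def)
      then have "\<forall>\<^sub>F k in sequentially. Lp_norm p (z k - g) < e * K1 / 2" by (rule order_tendstoD(2)) (use e K_pos in simp)
      then obtain M where M: "\<And>k. k \<ge> M \<Longrightarrow> Lp_norm p (z k - g) < e * K1 / 2" by (auto simp: eventually_sequentially)
      show "\<exists>M. \<forall>m\<ge>M. \<forall>n\<ge>M. norm (a m b - a n b) < e"
      proof (intro exI[of _ M] allI impI)
        fix m n assume "M \<le> m" "M \<le> n"
        then have "Lp_norm p (z m - g) + Lp_norm p (z n - g) < e * K1" using M[of m] M[of n] by simp
        then have "(Lp_norm p (z m - g) + Lp_norm p (z n - g)) / K1 < e" using K_pos by (simp add: field_simps)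
        then show "norm (a m b - a n b) < e" using le[of m n] by simp
      qed
    qed
    then show ?thesis by (rule Cauchy_convergent)
  qed
  then have "\<forall>b. \<exists>v. (\<lambda>k. a k b) \<longlonglongrightarrow> v" by (simp add: convergent_def)
  then obtain v where "\<And>b. (\<lambda>k. a k b) \<longlonglongrightarrow> v b" by (rule choice[THEN exE]) blast
  then show ?thesis unfolding coordinates_def using a z(2) by blast
qed

lemma coordinates_le:
  assumes s: "\<And>n. r0 \<le> s n \<and> s n \<le> r1" and g: "coordinates s g v" and h: "coordinates s h w"
  shows "K1 * box_norm s J (\<lambda>b. v b - w b) \<le> Lp_norm p (g - h)"
proof -
  have s0: "s n > 0" for n using s[of n] p r by linarith
  obtain z a where z: "\<And>k. represents s (a k) (z k)" "Lp_lim p z g" "\<And>b. (\<lambda>k. a k b) \<longlonglongrightarrow> v b"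
    using g unfolding coordinates_def by blast
  obtain z' a' where z': "\<And>k. represents s (a' k) (z' k)" "Lp_lim p z' h" "\<And>b. (\<lambda>k. a' k b) \<longlonglongrightarrow> w b"
    using h unfolding coordinates_def by blast
  have "(\<lambda>k. box_norm s J (\<lambda>b. a k b - a' k b)) \<longlonglongrightarrow> box_norm s J (\<lambda>b. v b - w b)"
    using p by (intro mix_tendsto s0 tendsto_diff z(3) z'(3)) simp
  then have 1: "(\<lambda>k. K1 * box_norm s J (\<lambda>b. a k b - a' k b)) \<longlonglongrightarrow> K1 * box_norm s J (\<lambda>b. v b - w b)"
    by (rule tendsto_mult_left)
  have "Lp_lim p (\<lambda>k. z k + (- 1) *\<^sub>R z' k) (g + (- 1) *\<^sub>R h)"
    by (intro Lp_lim_add Lp_lim_scale p z(2) z'(2))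
  then have 2: "(\<lambda>k. Lp_norm p (z k - z' k)) \<longlonglongrightarrow> Lp_norm p (g - h)"
    using Lp_lim_norm[OF p] by fastforce
  show ?thesis
    by (rule LIMSEQ_le[OF 1 2]) (use represents_bounds(1)[OF s represents_diff[OF z(1) z'(1)]] in blast)
qed

lemma coordinates_ge:
  assumes s: "\<And>n. r0 \<le> s n \<and> s n \<le> r1" and g: "coordinates s g v" and h: "coordinates s h w" and e: "e > 0"
  shows "\<exists>J. box_norm s J (\<lambda>b. v b - w b) \<ge> Lp_norm p (g - h) / K2 - e"
proof -
  have s1: "s n \<ge> 1" for n using s[of n] p r by linarith
  obtain z a where z: "\<And>k. represents s (a k) (z k)" "Lp_lim p z g"
    using g unfolding coordinates_def by blast
  obtain z' a' where z': "\<And>k. represents s (a' k) (z' k)" "Lp_lim p z' h"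
    using h unfolding coordinates_def by blast
  define d where "d = e / (2 / K1 + 2 / K2)"
  have kk: "2 / K1 + 2 / K2 > 0" using K_pos by (simp add: add_pos_pos)
  have d: "d > 0" "2 * d / K1 + 2 * d / K2 = e"
  proof -
    show "d > 0" using e kk by (simp add: d_def)
    have "2 * d / K1 + 2 * d / K2 = d * (2 / K1 + 2 / K2)" by (simp add: distrib_left mult.commute)
    then show "2 * d / K1 + 2 * d / K2 = e" using kk by (simp add: d_def)
  qed
  have "\<forall>\<^sub>F k in sequentially. Lp_norm p (z k - g) < d \<and> Lp_norm p (z' k - h) < d"
    using z(2) z'(2) d(1) by (intro eventually_conj order_tendstoD(2)[of _ 0]) (auto simp: Lp_lim_def)
  then obtain k where k: "Lp_norm p (z k - g) < d" "Lp_norm p (z' k - h) < d" by (auto simp: eventually_sequentially)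
  obtain J where J: "Lp_norm p (z k - z' k) \<le> K2 * box_norm s J (\<lambda>b. a k b - a' k b)"
    using represents_bounds(2)[OF s represents_diff[OF z(1) z'(1)]] by blast
  have "box_norm s J (\<lambda>b. a k b - a' k b) = box_norm s J (\<lambda>b. (v b - w b) + ((a k b - v b) + (w b - a' k b)))"
    by (rule arg_cong[where f="box_norm s J"]) auto
  also have "\<dots> \<le> box_norm s J (\<lambda>b. v b - w b) + box_norm s J (\<lambda>b. (a k b - v b) + (w b - a' k b))"
    by (rule mix_add) (use p s1 in auto)
  finally have "box_norm s J (\<lambda>b. a k b - a' k b) \<le>
      box_norm s J (\<lambda>b. v b - w b) + box_norm s J (\<lambda>b. (a k b - v b) + (w b - a' k b))" .
  moreover have "box_norm s J (\<lambda>b. (a k b - v b) + (w b - a' k b)) \<le>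
      box_norm s J (\<lambda>b. a k b - v b) + box_norm s J (\<lambda>b. w b - a' k b)"
    by (rule mix_add) (use p s1 in auto)
  moreover have "K1 * box_norm s J (\<lambda>b. a k b - v b) \<le> Lp_norm p (z k - g)"
    by (rule coordinates_le[OF s coordinates_of_finite[OF s z(1)] g])
  then have "box_norm s J (\<lambda>b. a k b - v b) \<le> d / K1" using k(1) K_pos by (simp add: field_simps)
  moreover have "K1 * box_norm s J (\<lambda>b. w b - a' k b) \<le> Lp_norm p (h - z' k)"
    by (rule coordinates_le[OF s h coordinates_of_finite[OF s z'(1)]])
  then have "box_norm s J (\<lambda>b. w b - a' k b) \<le> d / K1"
    using k(2) K_pos by (simp add: field_simps Lp_norm_minus_commute[of p h])
  ultimately have 1: "box_norm s J (\<lambda>b. a k b - a' k b) \<le> box_norm s J (\<lambda>b. v b - w b) + 2 * d / K1" by simp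
  have zp: "p_integrable p (z k)" "p_integrable p g" "p_integrable p (z' k)" "p_integrable p h"
    using z(2) z'(2) by (auto simp: Lp_lim_def)
  have "Lp_norm p (g - h) \<le> Lp_norm p (g - z k) + Lp_norm p (z k - h)" by (rule Lp_norm_triangle[OF p zp(2,1,4)])
  moreover have "Lp_norm p (z k - h) \<le> Lp_norm p (z k - z' k) + Lp_norm p (z' k - h)" by (rule Lp_norm_triangle[OF p zp(1,3,4)])
  ultimately have "Lp_norm p (g - h) \<le> K2 * box_norm s J (\<lambda>b. a k b - a' k b) + 2 * d"
    using k J by (simp add: Lp_norm_minus_commute[of p g])
  then have "Lp_norm p (g - h) / K2 \<le> box_norm s J (\<lambda>b. a k b - a' k b) + 2 * d / K2"
    using K_pos by (simp add: field_simps)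
  then have "Lp_norm p (g - h) / K2 - e \<le> box_norm s J (\<lambda>b. v b - w b)" using 1 d(2) by linarith
  then show ?thesis by blast
qed

definition coord :: "(nat \<Rightarrow> real) \<Rightarrow> L0 \<Rightarrow> nat \<times> nat \<Rightarrow> real"
  where "coord s g = (SOME v. coordinates s g v)"

lemma coord:
  assumes "\<And>n. r0 \<le> s n \<and> s n \<le> r1" "g \<in> V s"
  shows "coordinates s g (coord s g)"
  unfolding coord_def by (rule someI_ex[OF ex_coordinates[OF assms]])

end

definition bounded_seqs :: "(nat \<Rightarrow> real) set"
  where "bounded_seqs = {U. \<exists>M::nat. \<forall>i. \<bar>U i\<bar> \<le> real M}"

lemma bounded_seqs_measurable: "bounded_seqs \<in> sets cube"
proof -
  have "{U \<in> space cube. \<exists>M::nat. \<forall>i. \<bar>U i\<bar> \<le> real M} \<in> sets cube" by measurable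
  then show ?thesis by (simp add: bounded_seqs_def)
qed

lemma AE_bounded_seqs: "AE U in cube. U \<in> bounded_seqs"
proof -
  have 1: "AE u in uniform_measure lborel {0..1::real}. \<bar>u\<bar> \<le> 1"
    by (rule AE_uniform_measureI) auto
  have "AE U in cube. \<bar>U i\<bar> \<le> 1" for i
    unfolding cube_def by (rule AE_PiM_component[OF prob_space_unif UNIV_I 1])
  then have "AE U in cube. \<forall>i. \<bar>U i\<bar> \<le> 1" by (simp add: AE_all_countable)
  then show ?thesis by eventually_elim (auto simp: bounded_seqs_def intro!: exI[of _ 1])
qed

lemma int_vectors_bounded:
  assumes "w \<in> int_vectors"
  shows "\<exists>K. \<forall>i. \<bar>w i\<bar> \<le> K"
proof -
  have fin: "finite {n. w n \<noteq> 0}" using assms by (simp add: int_vectors_def)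
  have "\<bar>w i\<bar> \<le> (\<Sum>n\<in>{n. w n \<noteq> 0}. \<bar>w n\<bar>)" for i
  proof (cases "w i = 0")
    case False
    then show ?thesis using fin by (intro member_le_sum) auto
  qed (simp add: sum_nonneg)
  then show ?thesis by blast
qed

lemma translate_bounded_seqs:
  assumes w: "w \<in> int_vectors"
  shows "translate w t U \<in> bounded_seqs \<longleftrightarrow> U \<in> bounded_seqs"
proof -
  have imp: "translate w t U \<in> bounded_seqs" if U: "U \<in> bounded_seqs" for t U
  proof -
    obtain M :: nat where M: "\<And>i. \<bar>U i\<bar> \<le> real M" using U by (auto simp: bounded_seqs_def)
    obtain K where K: "\<And>i. \<bar>w i\<bar> \<le> K" using int_vectors_bounded[OF w] by blast
    obtain M' :: nat where M': "real M + \<bar>t\<bar> * K \<le> real M'" using real_arch_simple by blast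
    have "\<bar>translate w t U i\<bar> \<le> real M'" for i
    proof -
      have "\<bar>translate w t U i\<bar> \<le> \<bar>U i\<bar> + \<bar>t\<bar> * \<bar>w i\<bar>"
        unfolding translate_def by (rule order_trans[OF abs_triangle_ineq]) (simp add: abs_mult)
      also have "\<dots> \<le> real M + \<bar>t\<bar> * K" by (intro add_mono mult_left_mono M K) simp
      finally show ?thesis using M' by simp
    qed
    then show ?thesis by (auto simp: bounded_seqs_def)
  qed
  have "translate w (- t) (translate w t U) = U" by (simp add: translate_def)
  then show ?thesis using imp[of U t] imp[of "translate w t U" "- t"] by auto
qed

context tails begin

section \<open>A cube inside a single block\<close>

text \<open>The weights \<open>1 / 2 ^ i\<close> make the sums converge for bounded \<open>U\<close>, in particular almost everywhere on the
  cube.\<close>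

definition partial_point :: "real \<Rightarrow> nat \<Rightarrow> (nat \<Rightarrow> real) \<Rightarrow> nat \<Rightarrow> L0"
  where "partial_point r n U k = (\<Sum>i<k. (U i / 2 ^ i) *\<^sub>R G r n i)"

definition point :: "real \<Rightarrow> nat \<Rightarrow> (nat \<Rightarrow> real) \<Rightarrow> L0"
  where "point r n U = (SOME g. Lp_lim p (partial_point r n U) g)"

lemma block_bounds:
  assumes r: "r0 \<le> r" "r \<le> r1" and B: "finite B"
  shows "p_integrable p (\<Sum>i\<in>B. a i *\<^sub>R G r n i)"
    and "K1 * lp r B a \<le> Lp_norm p (\<Sum>i\<in>B. a i *\<^sub>R G r n i)"
    and "Lp_norm p (\<Sum>i\<in>B. a i *\<^sub>R G r n i) \<le> K2 * lp r B a"
proof -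
  have "mix p (\<lambda>_. r) {n} B (\<lambda>(_, i). a i) = lp r B a"
    using p by (simp add: mix_def lp_def powr_powr sum_nonneg)
  moreover have "comb (\<lambda>_. r) {n} B (\<lambda>(_, i). a i) = (\<Sum>i\<in>B. a i *\<^sub>R G r n i)" by (simp add: comb_def)
  moreover note comb_bounds[of "{n}" B "\<lambda>_. r" "\<lambda>(_, i). a i"]
  ultimately show "p_integrable p (\<Sum>i\<in>B. a i *\<^sub>R G r n i)"
    and "K1 * lp r B a \<le> Lp_norm p (\<Sum>i\<in>B. a i *\<^sub>R G r n i)"
    and "Lp_norm p (\<Sum>i\<in>B. a i *\<^sub>R G r n i) \<le> K2 * lp r B a"
    using r B by auto
qed

lemma partial_point_diff:
  "partial_point r n U k - partial_point r n U' k = partial_point r n (\<lambda>i. U i - U' i) k"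
  by (simp add: partial_point_def sum_subtractf[symmetric] scaleR_diff_left[symmetric] diff_divide_distrib)

lemma partial_point_converges:
  assumes r: "r0 \<le> r" "r \<le> r1" and U: "U \<in> bounded_seqs"
  shows "Lp_lim p (partial_point r n U) (point r n U)"
proof -
  let ?\<phi> = "partial_point r n U"
  have rr: "r \<ge> 1" using r p tails_axioms by (auto simp: tails_def)
  have int: "p_integrable p (?\<phi> k)" for k unfolding partial_point_def by (rule block_bounds(1)[OF r]) simp
  obtain M :: nat where M: "\<And>i. \<bar>U i\<bar> \<le> real M" using U by (auto simp: bounded_seqs_def)
  have head: "Lp_norm p (?\<phi> k - ?\<phi> k0) \<le> K2 * (2 * real M / 2 ^ k0)" if k: "k0 \<le> k" for k k0
  proof -
    have "?\<phi> k - ?\<phi> k0 = (\<Sum>i\<in>{k0..<k}. (U i / 2 ^ i) *\<^sub>R G r n i)"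
      using sum_diff_nat_ivl[of 0 k0 k "\<lambda>i. (U i / 2 ^ i) *\<^sub>R G r n i"] k
      by (simp add: partial_point_def atLeast0LessThan)
    then have "Lp_norm p (?\<phi> k - ?\<phi> k0) \<le> K2 * lp r {k0..<k} (\<lambda>i. U i / 2 ^ i)"
      using block_bounds(3)[OF r, of "{k0..<k}"] by simp
    also have "\<dots> \<le> K2 * (2 * real M / 2 ^ k0)"
    proof (rule mult_left_mono)
      have "lp r {k0..<k} (\<lambda>i. U i / 2 ^ i) \<le> (\<Sum>i\<in>{k0..<k}. \<bar>U i / 2 ^ i\<bar>)" by (rule lp_le_sum[OF rr]) simp
      also have "\<dots> \<le> (\<Sum>i\<in>{k0..<k}. real M * (1/2) ^ i)"
        using M by (intro sum_mono) (simp add: power_one_over divide_simps)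
      also have "\<dots> = real M * (\<Sum>i\<in>{k0..<k}. (1/2) ^ i)" by (rule sum_distrib_left[symmetric])
      also have "\<dots> \<le> real M * (2 / 2 ^ k0)"
      proof (rule mult_left_mono)
      show "(\<Sum>i\<in>{k0..<k}. (1/2 :: real) ^ i) \<le> 2 / 2 ^ k0"
        using k
      proof (induction k0 rule: inc_induct)
        case (step m)
        have "(\<Sum>i\<in>{m..<k}. (1/2 :: real) ^ i) = (1/2) ^ m + (\<Sum>i\<in>{Suc m..<k}. (1/2) ^ i)"
          using step(2) by (rule sum.atLeast_Suc_lessThan)
        then show ?case using step(3) by (simp add: power_one_over)
      qed simp
      qed simp
      finally show "lp r {k0..<k} (\<lambda>i. U i / 2 ^ i) \<le> 2 * real M / 2 ^ k0" by (simp add: mult.commute)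
    qed (use K_pos in simp)
    finally show ?thesis .
  qed
  have "\<exists>g. p_integrable p g \<and> (\<lambda>k. Lp_norm p (?\<phi> k - g)) \<longlonglongrightarrow> 0"
  proof (rule Lp_complete[OF p int])
    fix e :: real assume e: "e > 0"
    have "(\<lambda>k. K2 * (2 * real M) * (1/2) ^ k) \<longlonglongrightarrow> K2 * (2 * real M) * 0"
      by (intro tendsto_mult_left LIMSEQ_realpow_zero) auto
    then have "\<forall>\<^sub>F k in sequentially. K2 * (2 * real M) * (1/2) ^ k < e / 2" by (rule order_tendstoD(2)) (use e in simp)
    then obtain k0 where k0: "K2 * (2 * real M) * (1/2) ^ k0 < e / 2" by (auto simp: eventually_sequentially)
    have *: "Lp_norm p (?\<phi> k - ?\<phi> k0) < e / 2" if "k0 \<le> k" for k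
      using head[OF that] k0 by (simp add: power_one_over)
    show "\<exists>M. \<forall>k\<ge>M. \<forall>l\<ge>M. Lp_norm p (?\<phi> k - ?\<phi> l) < e"
    proof (intro exI[of _ k0] allI impI)
      fix k l assume "k0 \<le> k" "k0 \<le> l"
      then show "Lp_norm p (?\<phi> k - ?\<phi> l) < e"
        using *[of k] *[of l] Lp_norm_triangle[OF p int[of k] int[of k0] int[of l]]
        by (simp add: Lp_norm_minus_commute[of p "?\<phi> k0"])
    qed
  qed
  then have "\<exists>g. Lp_lim p ?\<phi> g" using int by (simp add: Lp_lim_def)
  then show ?thesis unfolding point_def by (rule someI_ex)
qed

lemma partial_point_in_span: "s n = r \<Longrightarrow> partial_point r n U k \<in> span (gens s)"
  unfolding partial_point_def
proof (intro span_sum span_scale span_base)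
  show "G r n i \<in> gens s" if "s n = r" for i using that by (auto simp: gens_def intro: range_eqI[of _ _ "(n, i)"])
qed

lemma point_in_V:
  assumes "r0 \<le> r" "r \<le> r1" "U \<in> bounded_seqs" "s n = r"
  shows "point r n U \<in> V s"
  unfolding V_def by (rule cl_limitI[OF _ partial_point_converges[OF assms(1-3)]]) (rule partial_point_in_span, rule assms(4))

definition weighted_norm :: "real \<Rightarrow> (nat \<Rightarrow> real) \<Rightarrow> real"
  where "weighted_norm r w = lp r {n. w n \<noteq> 0} (\<lambda>i. (1 / 2 ^ i) * w i)"

lemma translate_point:
  assumes r: "r0 \<le> r" "r \<le> r1" and U: "U \<in> bounded_seqs" and w: "w \<in> int_vectors"
  shows "K1 * (\<bar>t\<bar> * weighted_norm r w) \<le> Lp_norm p (point r n (translate w t U) - point r n U)"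
    and "Lp_norm p (point r n (translate w t U) - point r n U) \<le> K2 * (\<bar>t\<bar> * weighted_norm r w)"
proof -
  let ?U' = "translate w t U"
  let ?d = "\<lambda>k. partial_point r n ?U' k - partial_point r n U k"
  have rr: "r > 0" using r p tails_axioms by (auto simp: tails_def)
  have U': "?U' \<in> bounded_seqs" using U translate_bounded_seqs[OF w] by simp
  have "Lp_lim p (\<lambda>k. partial_point r n ?U' k + (- 1) *\<^sub>R partial_point r n U k) (point r n ?U' + (- 1) *\<^sub>R point r n U)"
    by (intro Lp_lim_add Lp_lim_scale p partial_point_converges[OF r] U U')
  then have lim: "(\<lambda>k. Lp_norm p (?d k)) \<longlonglongrightarrow> Lp_norm p (point r n ?U' - point r n U)"
    using Lp_lim_norm[OF p] by fastforce
  obtain k0 where k0: "{n. w n \<noteq> 0} \<subseteq> {..<k0}"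
    using w finite_nat_iff_bounded by (auto simp: int_vectors_def)
  have eq: "lp r {..<k} (\<lambda>i. (?U' i - U i) / 2 ^ i) = \<bar>t\<bar> * weighted_norm r w" if "k0 \<le> k" for k
  proof -
    have "lp r {..<k} (\<lambda>i. (?U' i - U i) / 2 ^ i) = lp r {n. w n \<noteq> 0} (\<lambda>i. (?U' i - U i) / 2 ^ i)"
      unfolding lp_def using k0 that rr
      by (intro arg_cong[where f="\<lambda>x. x powr _"] sum.mono_neutral_right) (auto simp: translate_def)
    also have "\<dots> = lp r {n. w n \<noteq> 0} (\<lambda>i. t * ((1 / 2 ^ i) * w i))" by (simp add: translate_def)
    also have "\<dots> = \<bar>t\<bar> * weighted_norm r w" unfolding weighted_norm_def by (rule lp_scale[OF rr])
    finally show ?thesis .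
  qed
  have b: "K1 * (\<bar>t\<bar> * weighted_norm r w) \<le> Lp_norm p (?d k) \<and> Lp_norm p (?d k) \<le> K2 * (\<bar>t\<bar> * weighted_norm r w)" if "k0 \<le> k" for k
    unfolding partial_point_diff
    using block_bounds(2,3)[OF r, where B="{..<k}" and a="\<lambda>i. (?U' i - U i) / 2 ^ i" and n=n]
    by (simp add: eq[OF that] partial_point_def)
  show "K1 * (\<bar>t\<bar> * weighted_norm r w) \<le> Lp_norm p (point r n ?U' - point r n U)"
    by (rule LIMSEQ_le_const[OF lim]) (use b in blast)
  show "Lp_norm p (point r n ?U' - point r n U) \<le> K2 * (\<bar>t\<bar> * weighted_norm r w)"
    by (rule LIMSEQ_le_const2[OF lim]) (use b in blast)
qed

lemma continuous_of_partial_point: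
  assumes r: "r0 \<le> r" "r \<le> r1"
    and h: "\<And>U U'. \<bar>h U - h U'\<bar> \<le> D * Lp_norm p (partial_point r n U k - partial_point r n U' k)"
  shows "h \<in> borel_measurable cube"
proof -
  have rr: "r \<ge> 1" using r p tails_axioms by (auto simp: tails_def)
  have le: "\<bar>h U' - h U\<bar> \<le> \<bar>D\<bar> * (K2 * (\<Sum>i<k. \<bar>U' i - U i\<bar> / 2 ^ i))" for U U'
  proof -
    have "Lp_norm p (partial_point r n U' k - partial_point r n U k) \<le> K2 * lp r {..<k} (\<lambda>i. (U' i - U i) / 2 ^ i)"
      unfolding partial_point_diff
      using block_bounds(3)[OF r, where B="{..<k}" and a="\<lambda>i. (U' i - U i) / 2 ^ i" and n=n]
      by (simp add: partial_point_def)
    also have "\<dots> \<le> K2 * (\<Sum>i<k. \<bar>(U' i - U i) / 2 ^ i\<bar>)"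
      using K_pos by (intro mult_left_mono lp_le_sum[OF rr]) auto
    also have "\<dots> = K2 * (\<Sum>i<k. \<bar>U' i - U i\<bar> / 2 ^ i)" by simp
    finally have 1: "Lp_norm p (partial_point r n U' k - partial_point r n U k) \<le> K2 * (\<Sum>i<k. \<bar>U' i - U i\<bar> / 2 ^ i)" .
    have "D * Lp_norm p (partial_point r n U' k - partial_point r n U k) \<le> \<bar>D\<bar> * Lp_norm p (partial_point r n U' k - partial_point r n U k)"
      by (intro mult_right_mono Lp_norm_nonneg) simp
    also have "\<dots> \<le> \<bar>D\<bar> * (K2 * (\<Sum>i<k. \<bar>U' i - U i\<bar> / 2 ^ i))" by (rule mult_left_mono[OF 1]) simp
    finally show ?thesis using h[of U' U] by linarith
  qed
  have "(h \<longlongrightarrow> h U) (at U)" for U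
  proof (rule LIM_zero_cancel, rule tendsto_rabs_zero_cancel, rule tendsto_sandwich[OF _ _ tendsto_const])
    have comp: "((\<lambda>U'. U' i) \<longlongrightarrow> U i) (at U)" for i
      using continuous_on_product_coordinates[of i] unfolding continuous_on_def by blast
    have "((\<lambda>U'. \<bar>D\<bar> * (K2 * (\<Sum>i<k. \<bar>U' i - U i\<bar> / 2 ^ i))) \<longlongrightarrow> \<bar>D\<bar> * (K2 * (\<Sum>i<k. \<bar>U i - U i\<bar> / 2 ^ i))) (at U)"
      by (intro tendsto_intros comp) auto
    then show "((\<lambda>U'. \<bar>D\<bar> * (K2 * (\<Sum>i<k. \<bar>U' i - U i\<bar> / 2 ^ i))) \<longlongrightarrow> 0) (at U)" by simp
  qed (auto simp: le)
  then have "continuous_on UNIV h" by (simp add: continuous_on_def)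
  then have "h \<in> borel_measurable borel" by (rule borel_measurable_continuous_onI)
  then show ?thesis by (simp add: measurable_cong_sets[OF sets_cube refl])
qed

section \<open>Recovering the terms of the sequence\<close>

text \<open>If no \<open>s' m\<close> equals \<open>s n\<close>, the embedding restricted to the points of a cube in block \<open>n\<close>, followed by the
  coordinates of \<open>V s'\<close>, satisfies the hypotheses of \<open>linearization\<close>, and the outcome contradicts \<open>no_linear_copy\<close>.\<close>

theorem exponent_of_embedded_space:
  assumes s: "\<And>n. r0 \<le> s n \<and> s n \<le> r1" and s': "\<And>n. r0 \<le> s' n \<and> s' n \<le> r1"
    and emb: "bilip_embeds p (V s) (V s')"
  shows "\<exists>m. s' m = s n"
proof (rule ccontr)
  assume "\<nexists>m. s' m = s n"
  then have ne: "s' m \<noteq> s n" for m by blast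
  define r where "r = s n"
  have rb: "r0 \<le> r" "r \<le> r1" using s[of n] by (simp_all add: r_def)
  have s1: "s' m \<ge> 1" for m using s'[of m] p r by linarith
  interpret Y: mixed_space p s' by (rule mixed_space.intro[OF p s1])
  obtain f c C0 where c: "c > 0" and f: "f ` V s \<subseteq> V s'"
    and fb: "\<forall>g\<in>V s. \<forall>h\<in>V s. c * Lp_norm p (g - h) \<le> Lp_norm p (f g - f h) \<and>
      Lp_norm p (f g - f h) \<le> C0 * Lp_norm p (g - h)"
    using emb unfolding bilip_embeds_def by (elim exE conjE) rule
  have lo: "c * Lp_norm p (g - h) \<le> Lp_norm p (f g - f h)"
    and up0: "Lp_norm p (f g - f h) \<le> C0 * Lp_norm p (g - h)" if "g \<in> V s" "h \<in> V s" for g h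
    using fb that by auto
  define D where "D = \<bar>C0\<bar> / K1"
  have D: "D \<ge> 0" using K_pos by (simp add: D_def)
  have fV: "f g \<in> V s'" if "g \<in> V s" for g using f that by blast
  define q where "q g = coord s' (f g)" for g
  have q_le: "Y.N J (\<lambda>b. q g b - q h b) \<le> D * Lp_norm p (g - h)" if gh: "g \<in> V s" "h \<in> V s" for J g h
  proof -
    have "K1 * Y.N J (\<lambda>b. q g b - q h b) \<le> Lp_norm p (f g - f h)"
      unfolding Y.N_def q_def by (rule coordinates_le[OF s' coord[OF s' fV] coord[OF s' fV]]) (use gh in auto)
    also have "\<dots> \<le> C0 * Lp_norm p (g - h)" by (rule up0[OF gh])
    also have "\<dots> \<le> \<bar>C0\<bar> * Lp_norm p (g - h)" by (intro mult_right_mono Lp_norm_nonneg) simp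
    finally show ?thesis using K_pos by (simp add: D_def field_simps)
  qed
  have q_ge: "\<exists>J. Y.N J (\<lambda>b. q g b - q h b) \<ge> c / K2 * Lp_norm p (g - h) - e" if gh: "g \<in> V s" "h \<in> V s" and e: "e > 0" for g h e
  proof -
    obtain J where "Y.N J (\<lambda>b. q g b - q h b) \<ge> Lp_norm p (f g - f h) / K2 - e"
      using coordinates_ge[OF s' coord[OF s' fV[OF gh(1)]] coord[OF s' fV[OF gh(2)]] e] unfolding Y.N_def q_def by blast
    moreover have "Lp_norm p (f g - f h) / K2 \<ge> c * Lp_norm p (g - h) / K2"
      using lo[OF gh] K_pos by (intro divide_right_mono) auto
    ultimately have "Y.N J (\<lambda>b. q g b - q h b) \<ge> c / K2 * Lp_norm p (g - h) - e" by simp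
    then show ?thesis by blast
  qed
  have q_coord: "\<bar>q g b - q h b\<bar> \<le> D * Lp_norm p (g - h)" if gh: "g \<in> V s" "h \<in> V s" for g h b
  proof -
    obtain J where "b \<in> Y.box J" using Y.box_cover by blast
    then have "\<bar>q g b - q h b\<bar> \<le> Y.N J (\<lambda>b. q g b - q h b)" by (rule Y.N_coord)
    then show ?thesis using q_le[OF gh, of J] by linarith
  qed
  have pp: "partial_point r n U k \<in> V s" for U k
    using subset_cl[OF p span_gens_Lp[of s, OF s]] partial_point_in_span[of s n r U k] by (auto simp: V_def r_def)
  have pt: "point r n U \<in> V s" if "U \<in> bounded_seqs" for U by (rule point_in_V[OF rb that]) (simp add: r_def)
  (* 0 outside the bounded sequences, a set invariant under the translations; the upper bound holds there trivially *)
  define F where "F U b = (if U \<in> bounded_seqs then q (point r n U) b else 0)" for U b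
  have meas: "(\<lambda>U. F U b) \<in> borel_measurable cube" for b
  proof -
    have h: "(\<lambda>U. q (partial_point r n U k) b) \<in> borel_measurable cube" for k
      by (rule continuous_of_partial_point[OF rb q_coord[OF pp pp]])
    have lim: "F U b = lim (\<lambda>k. q (partial_point r n U k) b)" if U: "U \<in> bounded_seqs" for U
    proof -
      have "(\<lambda>k. Lp_norm p (partial_point r n U k - point r n U)) \<longlonglongrightarrow> 0"
        using partial_point_converges[OF rb U] by (simp add: Lp_lim_def)
      then have 0: "(\<lambda>k. D * Lp_norm p (partial_point r n U k - point r n U)) \<longlonglongrightarrow> 0" by (rule tendsto_mult_right_zero)
      have "(\<lambda>k. \<bar>q (partial_point r n U k) b - q (point r n U) b\<bar>) \<longlonglongrightarrow> 0"
        by (rule tendsto_sandwich[OF _ _ tendsto_const 0]) (use q_coord[OF pp pt[OF U]] in auto)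
      then have "(\<lambda>k. q (partial_point r n U k) b) \<longlonglongrightarrow> q (point r n U) b"
        by (rule LIM_zero_cancel[OF tendsto_rabs_zero_cancel])
      then show ?thesis using U by (simp add: F_def limI)
    qed
    have "(\<lambda>U. if U \<in> bounded_seqs then lim (\<lambda>k. q (partial_point r n U k) b) else 0) \<in> borel_measurable cube"
      by (intro measurable_If_set borel_measurable_lim_metric h) (use bounded_seqs_measurable in auto)
    moreover have "(\<lambda>U. F U b) = (\<lambda>U. if U \<in> bounded_seqs then lim (\<lambda>k. q (partial_point r n U k) b) else 0)"
      using lim by (auto simp: F_def)
    ultimately show ?thesis by simp
  qed
  have N0: "weighted_norm r w \<ge> 0" for w by (simp add: weighted_norm_def)
  have upper: "Y.N J (\<lambda>b. F (translate w t U) b - F U b) \<le> D * K2 * \<bar>t\<bar> * weighted_norm r w" if w: "w \<in> int_vectors" for w t U J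
  proof (cases "U \<in> bounded_seqs")
    case True
    then have U': "translate w t U \<in> bounded_seqs" using translate_bounded_seqs[OF w] by simp
    have "Y.N J (\<lambda>b. F (translate w t U) b - F U b) \<le> D * Lp_norm p (point r n (translate w t U) - point r n U)"
      using q_le[OF pt[OF U'] pt[OF True]] by (simp add: F_def True U')
    also have "\<dots> \<le> D * (K2 * (\<bar>t\<bar> * weighted_norm r w))"
      by (rule mult_left_mono[OF translate_point(2)[OF rb True w] D])
    finally show ?thesis by (simp add: mult.assoc)
  next
    case False
    then have U': "translate w t U \<notin> bounded_seqs" using translate_bounded_seqs[OF w] by simp
    have "Y.N J (\<lambda>b. F (translate w t U) b - F U b) = 0" by (simp add: F_def False U')
    then show ?thesis using D K_pos N0[of w] by simp
  qed
  have lower: "\<exists>J. Y.N J (\<lambda>b. F (translate w t U) b - F U b) \<ge> c / K2 * K1 * \<bar>t\<bar> * weighted_norm r w - e"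
    if w: "w \<in> int_vectors" and U: "U \<in> bounded_seqs" and e: "e > 0" for w t U e
  proof -
    have U': "translate w t U \<in> bounded_seqs" using translate_bounded_seqs[OF w] U by simp
    obtain J where J: "Y.N J (\<lambda>b. q (point r n (translate w t U)) b - q (point r n U) b) \<ge>
        c / K2 * Lp_norm p (point r n (translate w t U) - point r n U) - e"
      using q_ge[OF pt[OF U'] pt[OF U] e] by blast
    moreover have "c / K2 * (K1 * (\<bar>t\<bar> * weighted_norm r w)) \<le> c / K2 * Lp_norm p (point r n (translate w t U) - point r n U)"
      using c K_pos by (intro mult_left_mono translate_point(1)[OF rb U w]) auto
    ultimately have "Y.N J (\<lambda>b. F (translate w t U) b - F U b) \<ge> c / K2 * K1 * \<bar>t\<bar> * weighted_norm r w - e"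
      unfolding F_def by (simp add: U U' mult.assoc)
    then show ?thesis by blast
  qed
  interpret L: bilipschitz_into_sequences F Y.N Y.box "weighted_norm r" "D * K2" "c / K2 * K1" bounded_seqs
    by unfold_locales (fact Y.N_add Y.N_scale Y.N_coord Y.N_le Y.finite_box Y.box_cover meas upper AE_bounded_seqs lower
      Y.N_mono[OF le_SucI[OF order_refl] order_refl])+
  have c': "c / K2 * K1 > 0" using c K_pos by simp
  then have cn: "c / K2 * K1 * weighted_norm r w \<ge> 0" for w by (rule mult_nonneg_nonneg[OF less_imp_le N0])
  obtain T :: "(nat \<Rightarrow> real) \<Rightarrow> nat \<times> nat \<Rightarrow> real" where
    T: "\<And>w w'. w \<in> int_vectors \<Longrightarrow> w' \<in> int_vectors \<Longrightarrow> T (\<lambda>n. w n + w' n) = (\<lambda>b. T w b + T w' b)"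
    "\<And>w J. w \<in> int_vectors \<Longrightarrow> Y.N J (T w) \<le> D * K2 * weighted_norm r w"
    "\<And>w e. w \<in> int_vectors \<Longrightarrow> e > 0 \<Longrightarrow> \<exists>J. Y.N J (T w) \<ge> c / K2 * K1 * weighted_norm r w - e"
    using L.linearization[OF cn] by blast
  have pr: "p < r" using rb(1) tails_axioms by (simp add: tails_def)
  have sr: "s' m \<noteq> r" for m using ne by (simp add: r_def)
  show False
    by (rule Y.no_linear_copy[where r=r and \<omega>="\<lambda>i. 1 / 2 ^ i" and T=T, OF pr sr _ c' T[unfolded weighted_norm_def]]) simp_all
qed

lemma eq_plus_of_embeddings:
  assumes strict: "r0 < r1" and emb: "bilip_embeds p (V (rates x)) (V (rates y))" "bilip_embeds p (V (rates y)) (V (rates x))"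
  shows "eq_plus x y"
proof -
  have sub: "range x \<subseteq> range y" if emb: "bilip_embeds p (V (rates x)) (V (rates y))" for x y
  proof
    fix z assume "z \<in> range x"
    then obtain j where z: "z = x j" by blast
    obtain m where "rates y m = rates x (prod_encode (j, 0))"
      using exponent_of_embedded_space[OF rates_bounds rates_bounds emb] by blast
    then have "quaternary (y (fst (prod_decode m))) = quaternary z" using z strict by (simp add: rates_def rate_def)
    then show "z \<in> range y" by (auto simp: quaternary_inject)
  qed
  show ?thesis unfolding eq_plus_range using sub[OF emb(1)] sub[OF emb(2)] by blast
qed

end

section \<open>The Borel reduction\<close>

theorem theorem4p1:
  fixes p :: real
  assumes "1 \<le> p" and "p < 2"
  shows "borel_reducible borel eq_plus (subspaces_Lp p) (isomorphic_Lp p) \<and>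
    borel_reducible borel eq_plus (subspaces_Lp p) (lipschitz_isomorphic_Lp p) \<and>
    borel_reducible borel eq_plus (subspaces_Lp p) (biembeddable_Lp p) \<and>
    borel_reducible borel eq_plus (subspaces_Lp p) (compl_biembeddable_Lp p)"
proof -
  (* any two numbers with p < r0 < r1 < 2 would do *)
  define r0 r1 where "r0 = p + (2 - p) / 3" and "r1 = p + 2 * (2 - p) / 3"
  have rates_order: "p < r0" "r0 < r1" "r1 < 2" using assms by (auto simp: r0_def r1_def field_simps)
  interpret tails p r0 r1 by (rule tails.intro) (use assms rates_order in auto)
  have closed: "closed_subspace p (V (rates x))" for x by (rule closed_subspace_V[OF rates_bounds])
  have rel: "eq_plus x y \<longleftrightarrow> S (V (rates x)) (V (rates y))"
    if to: "\<And>x y. eq_plus x y \<Longrightarrow> S (V (rates x)) (V (rates y))"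
      and from_S: "\<And>x y. S (V (rates x)) (V (rates y)) \<Longrightarrow>
        bilip_embeds p (V (rates x)) (V (rates y)) \<and> bilip_embeds p (V (rates y)) (V (rates x))"
    for S x y
    using to[of x y] from_S[of x y] eq_plus_of_embeddings[OF rates_order(2), of x y] by blast
  have reducible: "borel_reducible borel eq_plus (subspaces_Lp p) S"
    if "\<And>x y. eq_plus x y \<longleftrightarrow> S (V (rates x)) (V (rates y))" for S
    unfolding borel_reducible_def using that by (intro bexI[OF _ measurable_V]) blast
  have sym: "eq_plus y x" if "eq_plus x y" for x y :: "nat \<Rightarrow> nat \<Rightarrow> bool"
    using that by (simp add: eq_plus_range)
  have emb: "bilip_embeds p (V (rates x)) (V (rates y))" if "embeds_Lp p (V (rates x)) (V (rates y))" for x y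
    by (rule embeds_bilip[OF p closed that])
  show ?thesis
  proof (intro conjI)
    show "borel_reducible borel eq_plus (subspaces_Lp p) (isomorphic_Lp p)"
    proof (rule reducible, rule rel)
      show "isomorphic_Lp p (V (rates x)) (V (rates y))" if "eq_plus x y" for x y
        by (rule relations_of_eq_plus(1)[OF that])
      show "bilip_embeds p (V (rates x)) (V (rates y)) \<and> bilip_embeds p (V (rates y)) (V (rates x))"
        if "isomorphic_Lp p (V (rates x)) (V (rates y))" for x y
        using isomorphic_bilip[OF p closed closed that] by simp
    qed
    show "borel_reducible borel eq_plus (subspaces_Lp p) (lipschitz_isomorphic_Lp p)"
    proof (rule reducible, rule rel)
      show "lipschitz_isomorphic_Lp p (V (rates x)) (V (rates y))" if "eq_plus x y" for x y
        by (rule relations_of_eq_plus(2)[OF that])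
      show "bilip_embeds p (V (rates x)) (V (rates y)) \<and> bilip_embeds p (V (rates y)) (V (rates x))"
        if "lipschitz_isomorphic_Lp p (V (rates x)) (V (rates y))" for x y
        using lipschitz_isomorphic_bilip[OF p closed closed that] by simp
    qed
    show "borel_reducible borel eq_plus (subspaces_Lp p) (biembeddable_Lp p)"
    proof (rule reducible, rule rel)
      show "biembeddable_Lp p (V (rates x)) (V (rates y))" if "eq_plus x y" for x y
        unfolding biembeddable_Lp_def using relations_of_eq_plus(3)[OF that] relations_of_eq_plus(3)[OF sym[OF that]] by simp
      show "bilip_embeds p (V (rates x)) (V (rates y)) \<and> bilip_embeds p (V (rates y)) (V (rates x))"
        if "biembeddable_Lp p (V (rates x)) (V (rates y))" for x y
        using that emb unfolding biembeddable_Lp_def by simp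
    qed
    show "borel_reducible borel eq_plus (subspaces_Lp p) (compl_biembeddable_Lp p)"
    proof (rule reducible, rule rel)
      show "compl_biembeddable_Lp p (V (rates x)) (V (rates y))" if "eq_plus x y" for x y
        unfolding compl_biembeddable_Lp_def using relations_of_eq_plus(4)[OF that] relations_of_eq_plus(4)[OF sym[OF that]] by simp
      show "bilip_embeds p (V (rates x)) (V (rates y)) \<and> bilip_embeds p (V (rates y)) (V (rates x))"
        if "compl_biembeddable_Lp p (V (rates x)) (V (rates y))" for x y
        using that emb compl_embeds_embeds unfolding compl_biembeddable_Lp_def by blast
    qed
  qed
qed

end
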